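(* Let $\Phi_0:\mathbb I\to SO^+(1,n+3)/(SO^+(1,3)\times SO(n))$ be a non-constant real analytic sphere congruence along an open interval $\mathbb I$, with real analytic enveloping curves $[Y_0]$ and $[\hat Y_0]$, where $Y_0,\hat Y_0:\mathbb I\to\mathcal C^{n+3}_+$ satisfy $\langle Y_0,\hat Y_0\rangle=-1$ and $u$ is the arc-length parameter of $Y_0$. Then there exists a unique pair of dual S-Willmore surfaces $y,\hat y:\Sigma\to\mathbb S^{n+2}$, with $\Sigma\subset\mathbb C$ some open set containing $\mathbb I$, such that there are lifts $Y,\hat Y$ of $y,\hat y$ with $Y|_{\mathbb I}=Y_0$, $\hat Y|_{\mathbb I}=\hat Y_0$, and the conformal Gauss map $\Phi$ of $y$ satisfies $\Phi|_{\mathbb I}=\Phi_0$.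
   Context: $\mathbb R^{n+4}_1$ is $\mathbb R^{n+4}$ with $\langle x,y\rangle=-x_0y_0+\sum_{j\ge1}x_jy_j$; $\mathcal C^{n+3}_+$ its forward light cone; $\mathbb S^{n+2}$ the projectivized light cone, $y=[Y]$. $SO^+(1,n+3)/(SO^+(1,3)\times SO(n))$ is the Grassmannian of oriented Lorentzian 4-planes in $\mathbb R^{n+4}_1$ (round 2-spheres in $\mathbb S^{n+2}$); a curve $[Y_0]$ envelopes $\Phi_0$ if $Y_0(u),Y_0'(u)\in\Phi_0(u)$. For a conformal immersion $y$ with coordinate $z$: canonical lift $Y$ with $\langle Y_z,Y_z\rangle=0,\langle Y_z,Y_{\bar z}\rangle=\frac12$; conformal Gauss map $\Phi=V=\mathrm{span}\{Y,Y_u,Y_v,Y_{z\bar z}\}$; $N\in V$ with $\langle N,Y_z\rangle=\langle N,Y_{\bar z}\rangle=\langle N,N\rangle=0$, $\langle N,Y\rangle=-1$; $Y_{zz}=-\frac s2Y+\kappa$, $\kappa\in V^\perp\otimes\mathbb C$; $D$ the normal connection on $V^\perp$. $y$ is Willmore if critical for $W=2i\int\langle\kappa,\bar\kappa\rangle dz\wedge d\bar z$. A Willmore surface is S-Willmore if $D_{\bar z}\kappa\parallel\kappa$, i.e. there is a function $\mu$ with $D_{\bar z}\kappa+\frac{\bar\mu}2\kappa=0$; its dual surface is then $\hat y=[\hat Y]$ with $\hat Y=N+\bar\mu Y_z+\mu Y_{\bar z}+\frac12|\mu|^2Y$ (the second envelope of the mean curvature sphere congruence $\Phi$), which is again Willmore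 where non-degenerate. "A pair of dual S-Willmore surfaces" means $y$ S-Willmore and $\hat y$ its dual. *)

theory Defs
  imports "HOL-Analysis.Analysis"
begin

text \<open>A vector of R^{n+4}_1 is a pair (x0, x') with x' in real^'n, CARD('n) = n+3.\<close>

type_synonym 'n mink = "real \<times> (real ^ 'n)"

definition lor :: "'n::finite mink \<Rightarrow> 'n mink \<Rightarrow> real" where
  "lor x y = - fst x * fst y + snd x \<bullet> snd y"

definition in_cone :: "'n::finite mink \<Rightarrow> bool" where
  "in_cone Y \<longleftrightarrow> lor Y Y = 0 \<and> fst Y > 0"

text \<open>Points of the projectivized light cone S^{n+2} are represented by their unique
  representative with first coordinate 1.\<close>
definition on_sphere :: "'n::finite mink \<Rightarrow> bool" where
  "on_sphere x \<longleftrightarrow> fst x = 1 \<and> lor x x = 0"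

definition is_lift :: "complex set \<Rightarrow> (complex \<Rightarrow> 'n::finite mink) \<Rightarrow> (complex \<Rightarrow> 'n mink) \<Rightarrow> bool" where
  "is_lift S y Y \<longleftrightarrow> (\<forall>z\<in>S. fst (Y z) > 0 \<and> Y z = fst (Y z) *\<^sub>R y z)"

section \<open>Oriented Lorentzian 4-planes (the Grassmannian SO^+(1,n+3)/(SO^+(1,3) x SO(n)))\<close>

definition lorth :: "'n::finite mink set \<Rightarrow> 'n mink set" where
  "lorth W = {x. \<forall>w\<in>W. lor x w = 0}"

definition lorentzian_subspace :: "'n::finite mink set \<Rightarrow> bool" where
  "lorentzian_subspace W \<longleftrightarrow> subspace W \<and> (\<exists>x\<in>W. lor x x < 0)
      \<and> (\<forall>x\<in>W. (\<forall>w\<in>W. lor x w = 0) \<longrightarrow> x = 0)"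

definition is_frame :: "('n::finite mink) ^ 4 \<Rightarrow> bool" where
  "is_frame b \<longleftrightarrow> (\<forall>c::real^4. (\<Sum>i\<in>UNIV. c $ i *\<^sub>R b $ i) = 0 \<longrightarrow> c = 0)"

definition frame_span :: "('n::finite mink) ^ 4 \<Rightarrow> 'n mink set" where
  "frame_span b = span (range (\<lambda>i. b $ i))"

definition same_orientation :: "('n::finite mink) ^ 4 \<Rightarrow> ('n mink) ^ 4 \<Rightarrow> bool" where
  "same_orientation b c \<longleftrightarrow>
     (\<exists>A::real^4^4. det A > 0 \<and> (\<forall>i. c $ i = (\<Sum>j\<in>UNIV. A $ i $ j *\<^sub>R b $ j)))"

text \<open>An oriented 4-plane is the class of all frames positively equivalent to a given frame.\<close>
definition or_class :: "('n::finite mink) ^ 4 \<Rightarrow> ('n mink ^ 4) set" where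
  "or_class b = {c. is_frame c \<and> same_orientation b c}"

definition oriented_lorentzian_4plane :: "('n::finite mink ^ 4) set \<Rightarrow> bool" where
  "oriented_lorentzian_4plane P \<longleftrightarrow>
     (\<exists>b. is_frame b \<and> lorentzian_subspace (frame_span b) \<and> P = or_class b)"

definition plane_of :: "('n::finite mink ^ 4) set \<Rightarrow> 'n mink set" where
  "plane_of P = (\<Union>b\<in>P. frame_span b)"

definition real_analytic_on :: "(real \<Rightarrow> 'a::real_normed_vector) \<Rightarrow> real set \<Rightarrow> bool" where
  "real_analytic_on f S \<longleftrightarrow> (\<forall>x\<in>S. \<exists>r>0. \<exists>c::nat \<Rightarrow> 'a.
      \<forall>t\<in>S. dist t x < r \<longrightarrow> (\<lambda>k. (t - x) ^ k *\<^sub>R c k) sums f t)"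

definition analytic_plane_curve :: "(real \<Rightarrow> ('n::finite mink ^ 4) set) \<Rightarrow> real set \<Rightarrow> bool" where
  "analytic_plane_curve \<Phi> S \<longleftrightarrow> (\<forall>u\<in>S. \<exists>e>0. \<exists>b::real \<Rightarrow> 'n mink ^ 4.
      (\<forall>i. real_analytic_on (\<lambda>t. b t $ i) (S \<inter> ball u e)) \<and>
      (\<forall>t\<in>S \<inter> ball u e. b t \<in> \<Phi> t))"

definition pd :: "('a::real_normed_vector \<Rightarrow> 'b::real_normed_vector) \<Rightarrow> 'a \<Rightarrow> 'a \<Rightarrow> 'b" where
  "pd f v x = frechet_derivative f (at x) v"

fun Ck_on :: "nat \<Rightarrow> 'a::real_normed_vector set \<Rightarrow> ('a \<Rightarrow> 'b::real_normed_vector) \<Rightarrow> bool" where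
  "Ck_on 0 S f = continuous_on S f"
| "Ck_on (Suc k) S f = (f differentiable_on S \<and> (\<forall>v. Ck_on k S (\<lambda>x. pd f v x)))"

definition smooth_on :: "'a::real_normed_vector set \<Rightarrow> ('a \<Rightarrow> 'b::real_normed_vector) \<Rightarrow> bool" where
  "smooth_on S f \<longleftrightarrow> (\<forall>k. Ck_on k S f)"

definition conformal_immersion :: "complex set \<Rightarrow> (complex \<Rightarrow> 'n::finite mink) \<Rightarrow> bool" where
  "conformal_immersion S y \<longleftrightarrow> open S \<and> smooth_on S y \<and> (\<forall>z\<in>S. on_sphere (y z)) \<and>
     (\<forall>z\<in>S. lor (pd y 1 z) (pd y 1 z) = lor (pd y \<i> z) (pd y \<i> z) \<and>
             lor (pd y 1 z) (pd y \<i> z) = 0 \<and> lor (pd y 1 z) (pd y 1 z) > 0)"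

text \<open>Euclidean description of a surface p : S -> S^{n+2} (unit sphere in real^'n), arbitrary
  parametrization: metric g, second fundamental form II in S^{n+2}, trace-free part.\<close>

definition cdir :: "nat \<Rightarrow> complex" where
  "cdir i = (if i = 0 then 1 else \<i>)"

definition gmet :: "(complex \<Rightarrow> real ^ 'n::finite) \<Rightarrow> complex \<Rightarrow> nat \<Rightarrow> nat \<Rightarrow> real" where
  "gmet p z i j = pd p (cdir i) z \<bullet> pd p (cdir j) z"

definition gdet :: "(complex \<Rightarrow> real ^ 'n::finite) \<Rightarrow> complex \<Rightarrow> real" where
  "gdet p z = gmet p z 0 0 * gmet p z 1 1 - gmet p z 0 1 * gmet p z 1 0"

definition ginv :: "(complex \<Rightarrow> real ^ 'n::finite) \<Rightarrow> complex \<Rightarrow> nat \<Rightarrow> nat \<Rightarrow> real" where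
  "ginv p z i j = (if i = j then gmet p z (1 - i) (1 - j) else - gmet p z i j) / gdet p z"

definition eperp :: "(real ^ 'n::finite) set \<Rightarrow> real ^ 'n \<Rightarrow> real ^ 'n" where
  "eperp A x = (THE w. (\<forall>a\<in>A. w \<bullet> a = 0) \<and> x - w \<in> span A)"

definition sff :: "(complex \<Rightarrow> real ^ 'n::finite) \<Rightarrow> complex \<Rightarrow> nat \<Rightarrow> nat \<Rightarrow> real ^ 'n" where
  "sff p z i j = eperp {p z, pd p 1 z, pd p \<i> z} (pd (\<lambda>w. pd p (cdir i) w) (cdir j) z)"

definition sff0 :: "(complex \<Rightarrow> real ^ 'n::finite) \<Rightarrow> complex \<Rightarrow> nat \<Rightarrow> nat \<Rightarrow> real ^ 'n" where
  "sff0 p z i j = sff p z i j -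
     (gmet p z i j / 2) *\<^sub>R (\<Sum>k<2. \<Sum>l<2. ginv p z k l *\<^sub>R sff p z k l)"

definition willmore_density :: "(complex \<Rightarrow> real ^ 'n::finite) \<Rightarrow> complex \<Rightarrow> real" where
  "willmore_density p z = (1/2) *
     (\<Sum>i<2. \<Sum>j<2. \<Sum>k<2. \<Sum>l<2. ginv p z i k * ginv p z j l * (sff0 p z i j \<bullet> sff0 p z k l))
     * sqrt (gdet p z)"

definition willmore_energy :: "complex set \<Rightarrow> (complex \<Rightarrow> real ^ 'n::finite) \<Rightarrow> real" where
  "willmore_energy K p = integral K (willmore_density p)"

definition immersion_on :: "complex set \<Rightarrow> (complex \<Rightarrow> 'n::finite mink) \<Rightarrow> bool" where
  "immersion_on S y \<longleftrightarrow> smooth_on S y \<and> (\<forall>z\<in>S. on_sphere (y z)) \<and>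
     (\<forall>z\<in>S. gdet (\<lambda>w. snd (y w)) z > 0)"

definition willmore :: "complex set \<Rightarrow> (complex \<Rightarrow> 'n::finite mink) \<Rightarrow> bool" where
  "willmore S y \<longleftrightarrow> conformal_immersion S y \<and>
     (\<forall>K e (F :: real \<times> complex \<Rightarrow> 'n mink).
        compact K \<and> K \<subseteq> S \<and> e > 0 \<and> smooth_on ({-e<..<e} \<times> S) F \<and>
        (\<forall>t\<in>{-e<..<e}. immersion_on S (\<lambda>z. F (t, z))) \<and>
        (\<forall>z\<in>S. F (0, z) = y z) \<and>
        (\<forall>t\<in>{-e<..<e}. \<forall>z\<in>S - K. F (t, z) = y z)
      \<longrightarrow> ((\<lambda>t. willmore_energy K (\<lambda>z. snd (F (t, z)))) has_real_derivative 0) (at 0))"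

definition canon_lift :: "(complex \<Rightarrow> 'n::finite mink) \<Rightarrow> complex \<Rightarrow> 'n mink" where
  "canon_lift y z = (1 / sqrt (lor (pd y 1 z) (pd y 1 z))) *\<^sub>R y z"

definition Yu :: "(complex \<Rightarrow> 'n::finite mink) \<Rightarrow> complex \<Rightarrow> 'n mink" where
  "Yu y z = pd (canon_lift y) 1 z"

definition Yv :: "(complex \<Rightarrow> 'n::finite mink) \<Rightarrow> complex \<Rightarrow> 'n mink" where
  "Yv y z = pd (canon_lift y) \<i> z"

definition Yuu :: "(complex \<Rightarrow> 'n::finite mink) \<Rightarrow> complex \<Rightarrow> 'n mink" where
  "Yuu y z = pd (Yu y) 1 z"

definition Yvv :: "(complex \<Rightarrow> 'n::finite mink) \<Rightarrow> complex \<Rightarrow> 'n mink" where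
  "Yvv y z = pd (Yv y) \<i> z"

definition Yuv :: "(complex \<Rightarrow> 'n::finite mink) \<Rightarrow> complex \<Rightarrow> 'n mink" where
  "Yuv y z = pd (Yu y) \<i> z"

definition Yzzb :: "(complex \<Rightarrow> 'n::finite mink) \<Rightarrow> complex \<Rightarrow> 'n mink" where
  "Yzzb y z = (1/4) *\<^sub>R (Yuu y z + Yvv y z)"

text \<open>N = 2 Y_{z zbar} + 2 <Y_{z zbar},Y_{z zbar}> Y, the unique vector of V with
  <N,Y_z> = <N,Y_zbar> = <N,N> = 0, <N,Y> = -1.\<close>
definition frameN :: "(complex \<Rightarrow> 'n::finite mink) \<Rightarrow> complex \<Rightarrow> 'n mink" where
  "frameN y z = 2 *\<^sub>R Yzzb y z + (2 * lor (Yzzb y z) (Yzzb y z)) *\<^sub>R canon_lift y z"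

definition cg_space :: "(complex \<Rightarrow> 'n::finite mink) \<Rightarrow> complex \<Rightarrow> 'n mink set" where
  "cg_space y z = span {canon_lift y z, Yu y z, Yv y z, Yzzb y z}"

definition conformal_gauss_map :: "(complex \<Rightarrow> 'n::finite mink) \<Rightarrow> complex \<Rightarrow> ('n mink ^ 4) set" where
  "conformal_gauss_map y z =
     or_class (vector [canon_lift y z, Yu y z, Yv y z, frameN y z])"

definition lperp :: "'n::finite mink set \<Rightarrow> 'n mink \<Rightarrow> 'n mink" where
  "lperp W x = (THE w. w \<in> lorth W \<and> x - w \<in> W)"

text \<open>kappa = kap_re + i kap_im, the V^perp-part of Y_zz = (Y_uu - Y_vv - 2 i Y_uv)/4\<close>
definition kap_re :: "(complex \<Rightarrow> 'n::finite mink) \<Rightarrow> complex \<Rightarrow> 'n mink" where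
  "kap_re y z = lperp (cg_space y z) ((1/4) *\<^sub>R (Yuu y z - Yvv y z))"

definition kap_im :: "(complex \<Rightarrow> 'n::finite mink) \<Rightarrow> complex \<Rightarrow> 'n mink" where
  "kap_im y z = lperp (cg_space y z) ((- 1/2) *\<^sub>R Yuv y z)"

definition Dzb_kap_re :: "(complex \<Rightarrow> 'n::finite mink) \<Rightarrow> complex \<Rightarrow> 'n mink" where
  "Dzb_kap_re y z = lperp (cg_space y z) ((1/2) *\<^sub>R (pd (kap_re y) 1 z - pd (kap_im y) \<i> z))"

definition Dzb_kap_im :: "(complex \<Rightarrow> 'n::finite mink) \<Rightarrow> complex \<Rightarrow> 'n mink" where
  "Dzb_kap_im y z = lperp (cg_space y z) ((1/2) *\<^sub>R (pd (kap_re y) \<i> z + pd (kap_im y) 1 z))"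

text \<open>the equation D_zbar kappa + (conj mu / 2) kappa = 0\<close>
definition s_willmore_eq :: "complex set \<Rightarrow> (complex \<Rightarrow> 'n::finite mink) \<Rightarrow> (complex \<Rightarrow> complex) \<Rightarrow> bool" where
  "s_willmore_eq S y \<mu> \<longleftrightarrow> (\<forall>z\<in>S.
     Dzb_kap_re y z + (Re (\<mu> z) / 2) *\<^sub>R kap_re y z + (Im (\<mu> z) / 2) *\<^sub>R kap_im y z = 0 \<and>
     Dzb_kap_im y z + (Re (\<mu> z) / 2) *\<^sub>R kap_im y z - (Im (\<mu> z) / 2) *\<^sub>R kap_re y z = 0)"

definition s_willmore_with :: "complex set \<Rightarrow> (complex \<Rightarrow> 'n::finite mink) \<Rightarrow> (complex \<Rightarrow> complex) \<Rightarrow> bool" where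
  "s_willmore_with S y \<mu> \<longleftrightarrow> willmore S y \<and> smooth_on S \<mu> \<and> s_willmore_eq S y \<mu>"

text \<open>hat Y = N + conj mu Y_z + mu Y_zbar + |mu|^2/2 Y = N + Re mu Y_u - Im mu Y_v + |mu|^2/2 Y\<close>
definition dual_lift :: "(complex \<Rightarrow> 'n::finite mink) \<Rightarrow> (complex \<Rightarrow> complex) \<Rightarrow> complex \<Rightarrow> 'n mink" where
  "dual_lift y \<mu> z = frameN y z + Re (\<mu> z) *\<^sub>R Yu y z - Im (\<mu> z) *\<^sub>R Yv y z
                     + ((cmod (\<mu> z))\<^sup>2 / 2) *\<^sub>R canon_lift y z"

definition dual_s_willmore_pair :: "complex set \<Rightarrow> (complex \<Rightarrow> 'n::finite mink) \<Rightarrow> (complex \<Rightarrow> 'n mink) \<Rightarrow> bool" where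
  "dual_s_willmore_pair S y yh \<longleftrightarrow> (\<exists>\<mu>. s_willmore_with S y \<mu> \<and>
      (\<forall>z\<in>S. yh z = (1 / fst (dual_lift y \<mu> z)) *\<^sub>R dual_lift y \<mu> z))"

end

(*
  Along a dual S-Willmore pair the complexified frame (Y, Y^, P, kappa), P = Y_z + mu Y / 2, together
  with mu and rho satisfies a closed polynomial system w_zbar = F(w, cnj w).  Existence: complexify to
  holomorphic functions of two variables, solve by Picard iteration with analytic data on I read off
  from Phi_0, and restrict to the real slice.  The defects of the remaining structure equations and of
  the Gram relations satisfy |w_zbar| <= C |w| and vanish on I, hence vanish by unique continuation from
  a line (a Carleman estimate); the same principle gives uniqueness.
  The first variation of W identifies the Willmore equation as the vanishing of Re(cnj(theta) kappa),
  where theta is the kappa-coefficient of the Codazzi expression.  Since Y^_{z zbar} is real, also its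
  imaginary part vanishes, so theta kappa = 0; as Phi_0 is not constant, kappa is not identically 0, and
  unique continuation forces theta = 0, which closes the system.
*)
theory Submission
 imports Defs "HOL-Complex_Analysis.Complex_Analysis"
begin

text \<open>A solution, with its function mu, is by definition only smooth, so uniqueness has to
  compare smooth functions instead of power series. The structure equations are overdetermined. Only
  their dbar half is integrated: once z and cnj z are independent variables, w_zbar = F(w, cnj w) is
  an ordinary differential equation in the second one. The dz half, reality and the Gram relations
  are propagated from the axis. The frame is adapted to both envelopes at once: P is orthogonal to Y
  and to the dual lift. Hence along the axis it is determined by Y0, Yh0 and the orientation of
  Phi_0, and its derivative along the axis then yields mu, rho and kappa. The equation for rho
  expresses that the dual lift stays null. If kappa vanished identically, every mu would solve the
  S-Willmore equation and theta kappa = 0 would say nothing about theta. The mean curvature sphere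
  would then be one fixed sphere, because the projection onto it is a tensor whose derivative is
  linear in kappa.\<close>

section \<open>Calculus of smooth functions\<close>

lemma has_derivative_pd:
 assumes "f differentiable_on S" "open S" "x \<in> S"
 shows "(f has_derivative (\<lambda>v. pd f v x)) (at x)"
proof -
 have "f differentiable (at x)"
  using assms by (auto simp: differentiable_on_def at_within_open[of x S])
 thus ?thesis by (simp add: pd_def frechet_derivative_works)
qed

lemma pd_eqI:
 assumes "(f has_derivative D) (at x)"
 shows "pd f v x = D v"
 using frechet_derivative_at[OF assms] by (simp add: pd_def)

lemma pd_cong:
 assumes "open S" "x \<in> S" "\<And>z. z \<in> S ==> f z = g z"
 shows "pd f v x = pd g v x"
proof -
 have "(f has_derivative D) (at x) = (g has_derivative D) (at x)" for D
  using has_derivative_transform_within_open[of f D x UNIV S g]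
   has_derivative_transform_within_open[of g D x UNIV S f] assms by auto
 thus ?thesis by (simp add: pd_def frechet_derivative_def)
qed

lemma Ck_cong:
 assumes "open S" "\<And>z. z \<in> S ==> f z = g z"
 shows "Ck_on k S f \<longleftrightarrow> Ck_on k S g"
 using assms(2)
proof (induction k arbitrary: f g)
 case 0
 thus ?case by simp
next
 case (Suc k)
 have "f differentiable_on S \<longleftrightarrow> g differentiable_on S"
  using Suc.prems unfolding differentiable_on_def differentiable_def
  by (metis has_derivative_transform)
 moreover have "Ck_on k S (pd f v) \<longleftrightarrow> Ck_on k S (pd g v)" for v
  using pd_cong[OF assms(1)] Suc.prems by (intro Suc.IH) blast
 ultimately show ?case by simp
qed

lemma Ck_congD:
 assumes "open S" "Ck_on k S g" "\<And>z. z \<in> S ==> f z = g z"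
 shows "Ck_on k S f"
 using Ck_cong[of S f g, OF assms(1,3)] assms(2) by blast

lemma smooth_on_cong:
 assumes "open S" "\<And>z. z \<in> S ==> f z = g z"
 shows "smooth_on S f \<longleftrightarrow> smooth_on S g"
 using Ck_cong[OF assms] by (auto simp: smooth_on_def)

lemma Ck_mono: "Ck_on (Suc k) S f ==> Ck_on k S f"
proof (induction k arbitrary: f)
 case 0
 thus ?case by (auto intro: differentiable_imp_continuous_on)
next
 case (Suc k)
 thus ?case by simp
qed

lemma Ck_subset: "Ck_on k S f ==> T \<subseteq> S ==> Ck_on k T f"
 by (induction k arbitrary: f) (auto intro: continuous_on_subset differentiable_on_subset)

lemma smooth_on_subset: "smooth_on S f ==> T \<subseteq> S ==> smooth_on T f"
 by (auto simp: smooth_on_def intro: Ck_subset)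

lemma smooth_on_differentiable: "smooth_on S f ==> f differentiable_on S"
 unfolding smooth_on_def by (metis Ck_on.simps(2))

lemma smooth_on_continuous: "smooth_on S f ==> continuous_on S f"
 by (metis smooth_on_def Ck_on.simps(1))

lemma smooth_on_pd: "smooth_on S f ==> smooth_on S (pd f v)"
 unfolding smooth_on_def by (metis Ck_on.simps(2))

lemma smooth_on_has_derivative:
 "smooth_on S f ==> open S ==> x \<in> S ==> (f has_derivative (\<lambda>v. pd f v x)) (at x)"
 by (intro has_derivative_pd smooth_on_differentiable)

lemma Ck_local:
 assumes "\<And>x. x \<in> S ==> \<exists>T. open T \<and> x \<in> T \<and> T \<subseteq> S \<and> Ck_on k T f"
 shows "Ck_on k S f"
 using assms
proof (induction k arbitrary: f)
 case 0
 hence "isCont f x" if "x \<in> S" for x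
  using that by (metis Ck_on.simps(1) continuous_on_eq_continuous_at)
 thus ?case by (auto simp: continuous_at_imp_continuous_on)
next
 case (Suc k)
 have "f differentiable (at x)" if "x \<in> S" for x
  using Suc.prems[OF that] by (auto simp: differentiable_on_def) (metis at_within_open)
 moreover have "Ck_on k S (pd f v)" for v
  using Suc.prems by (intro Suc.IH) (metis Ck_on.simps(2))
 ultimately show ?case
  by (auto simp: differentiable_on_def intro: differentiable_at_withinI)
qed

lemma smooth_on_local:
 assumes "\<And>x. x \<in> S ==> \<exists>T. open T \<and> x \<in> T \<and> T \<subseteq> S \<and> smooth_on T f"
 shows "smooth_on S f"
 using assms unfolding smooth_on_def by (meson Ck_local)

lemma pd_linear:
 assumes "bounded_linear L"
 shows "pd L v x = L v"
 by (rule pd_eqI) (rule bounded_linear.has_derivative[OF assms has_derivative_ident])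

lemma pd_const [simp]: "pd (\<lambda>_. c) v x = 0"
 by (rule pd_eqI) simp

lemma Ck_const: "Ck_on k S (\<lambda>_. c)"
proof (induction k arbitrary: c)
 case (Suc k)
 have "pd (\<lambda>_. c) v = (\<lambda>_. 0)" for v :: 'a by auto
 with Suc show ?case by simp
qed simp

lemma smooth_on_const [simp, intro!]: "smooth_on S (\<lambda>_. c)"
 by (simp add: smooth_on_def Ck_const)

lemma Ck_linear: "bounded_linear L ==> Ck_on k S L"
proof (cases k)
 case (Suc n)
 assume L: "bounded_linear L"
 have "(\<lambda>x. pd L v x) = (\<lambda>_. L v)" for v using pd_linear[OF L] by auto
 thus ?thesis using Suc bounded_linear_imp_differentiable_on[OF L] by (simp add: Ck_const)
qed (auto simp: linear_continuous_on)

lemma smooth_on_linear: "bounded_linear L ==> smooth_on S L"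
 by (simp add: smooth_on_def Ck_linear)

lemma smooth_on_id [simp, intro!]: "smooth_on S (\<lambda>x. x)"
 by (rule smooth_on_linear) (rule bounded_linear_ident)

lemma pd_linear_compose:
 assumes "bounded_linear L" "f differentiable_on S" "open S" "x \<in> S"
 shows "pd (\<lambda>z. L (f z)) v x = L (pd f v x)"
 by (rule pd_eqI) (rule bounded_linear.has_derivative[OF assms(1) has_derivative_pd[OF assms(2-)]])

lemma Ck_linear_compose:
 assumes L: "bounded_linear L" and S: "open S"
 shows "Ck_on k S f ==> Ck_on k S (\<lambda>x. L (f x))"
proof (induction k arbitrary: f)
 case 0
 thus ?case by (auto intro: bounded_linear.continuous_on[OF L])
next
 case (Suc k)
 have "(\<lambda>x. L (f x)) differentiable_on S"
  using Suc.prems unfolding differentiable_on_def differentiable_def Ck_on.simps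
  by (metis bounded_linear.has_derivative[OF L])
 moreover have "Ck_on k S (pd (\<lambda>x. L (f x)) v)" for v
  using Suc Ck_cong[OF S, of "pd (\<lambda>x. L (f x)) v" "\<lambda>x. L (pd f v x)"]
   pd_linear_compose[OF L _ S] by simp
 ultimately show ?case by simp
qed

lemma smooth_on_linear_compose:
 "bounded_linear L ==> open S ==> smooth_on S f ==> smooth_on S (\<lambda>x. L (f x))"
 by (auto simp: smooth_on_def intro: Ck_linear_compose)

lemma pd_add:
 assumes "f differentiable_on S" "g differentiable_on S" "open S" "x \<in> S"
 shows "pd (\<lambda>z. f z + g z) v x = pd f v x + pd g v x"
 by (rule pd_eqI) (intro has_derivative_add has_derivative_pd[OF _ assms(3,4)] assms)

lemma pd_diff:
 assumes "f differentiable_on S" "g differentiable_on S" "open S" "x \<in> S"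
 shows "pd (\<lambda>z. f z - g z) v x = pd f v x - pd g v x"
 by (rule pd_eqI) (intro has_derivative_diff has_derivative_pd[OF _ assms(3,4)] assms)

lemma Ck_add:
 assumes S: "open S"
 shows "Ck_on k S f ==> Ck_on k S g ==> Ck_on k S (\<lambda>x. f x + g x)"
proof (induction k arbitrary: f g)
 case 0
 thus ?case by (auto intro: continuous_intros)
next
 case (Suc k)
 have "Ck_on k S (pd (\<lambda>x. f x + g x) v)" for v
 proof -
  have "Ck_on k S (\<lambda>x. pd f v x + pd g v x)" using Suc by auto
  moreover have "pd (\<lambda>x. f x + g x) v x = pd f v x + pd g v x" if "x \<in> S" for x
   using Suc.prems pd_add[OF _ _ S that] by auto
  ultimately show ?thesis by (rule Ck_congD[OF S])
 qed
 with Suc.prems show ?case by simp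
qed

lemma smooth_on_add: "open S ==> smooth_on S f ==> smooth_on S g ==> smooth_on S (\<lambda>x. f x + g x)"
 by (auto simp: smooth_on_def intro: Ck_add)

lemma pd_bilinear:
 assumes "bounded_bilinear b" "f differentiable_on S" "g differentiable_on S" "open S" "x \<in> S"
 shows "pd (\<lambda>z. b (f z) (g z)) v x = b (f x) (pd g v x) + b (pd f v x) (g x)"
 by (rule pd_eqI) (intro bounded_bilinear.FDERIV[OF assms(1)] has_derivative_pd[OF _ assms(4,5)] assms)

lemma Ck_bilinear:
 assumes b: "bounded_bilinear b" and S: "open S"
 shows "Ck_on k S f ==> Ck_on k S g ==> Ck_on k S (\<lambda>x. b (f x) (g x))"
proof (induction k arbitrary: f g)
 case 0
 thus ?case by (auto intro: bounded_bilinear.continuous_on[OF b])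
next
 case (Suc k)
 have d: "(\<lambda>x. b (f x) (g x)) differentiable_on S"
  using Suc.prems bounded_bilinear.FDERIV[OF b] unfolding differentiable_on_def differentiable_def Ck_on.simps
  by blast
 have "Ck_on k S (pd (\<lambda>x. b (f x) (g x)) v)" for v
 proof -
  have "Ck_on k S (\<lambda>x. b (f x) (pd g v x) + b (pd f v x) (g x))"
   using Suc.prems Ck_mono[OF Suc.prems(1)] Ck_mono[OF Suc.prems(2)]
   by (intro Ck_add[OF S] Suc.IH) auto
  thus ?thesis
   using Ck_cong[OF S, of "pd (\<lambda>x. b (f x) (g x)) v"] pd_bilinear[OF b _ _ S] Suc.prems
   by (metis (no_types, lifting) Ck_on.simps(2))
 qed
 with d show ?case by simp
qed

lemma smooth_on_bilinear:
 "bounded_bilinear b ==> open S ==> smooth_on S f ==> smooth_on S g ==> smooth_on S (\<lambda>x. b (f x) (g x))"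
 by (auto simp: smooth_on_def intro: Ck_bilinear)

lemmas smooth_on_scaleR = smooth_on_bilinear[OF bounded_bilinear_scaleR]
lemmas smooth_on_inner = smooth_on_bilinear[OF bounded_bilinear_inner]

lemmas smooth_on_mult = smooth_on_bilinear[OF bounded_bilinear_mult]

lemmas smooth_on_uminus = smooth_on_linear_compose[OF bounded_linear_minus[OF bounded_linear_ident]]

lemma smooth_on_diff: "open S ==> smooth_on S f ==> smooth_on S g ==> smooth_on S (\<lambda>x. f x - g x)"
 using smooth_on_add[of S f "\<lambda>x. - g x"] smooth_on_uminus[of S g] by simp

lemma smooth_on_sum:
 assumes "open S" "\<And>i. i \<in> I ==> smooth_on S (f i)"
 shows "smooth_on S (\<lambda>x. \<Sum>i\<in>I. f i x)"
 using assms(2)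
 by (induction I rule: infinite_finite_induct) (auto intro!: smooth_on_add[OF assms(1)])

lemmas smooth_on_cnj = smooth_on_linear_compose[OF bounded_linear_cnj]
lemma smooth_on_of_real:
 "open S ==> smooth_on S f ==> smooth_on S (\<lambda>x. of_real (f x) :: 'b::{real_normed_algebra_1,real_inner})"
 by (rule smooth_on_linear_compose[OF bounded_linear_of_real])

lemmas smooth_on_Re = smooth_on_linear_compose[OF bounded_linear_Re]
lemmas smooth_on_Im = smooth_on_linear_compose[OF bounded_linear_Im]
lemmas smooth_on_fst = smooth_on_linear_compose[OF bounded_linear_fst]
lemmas smooth_on_snd = smooth_on_linear_compose[OF bounded_linear_snd]

lemma smooth_on_Pair:
 assumes "open S" "smooth_on S f" "smooth_on S g"
 shows "smooth_on S (\<lambda>x. (f x, g x))"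
proof -
 have "smooth_on S (\<lambda>x. (f x, 0) + (0, g x))"
  by (intro smooth_on_add assms smooth_on_linear_compose[of "\<lambda>a. (a, 0)"]
    smooth_on_linear_compose[of "\<lambda>a. (0, a)"] bounded_linear_Pair bounded_linear_ident bounded_linear_zero)
 thus ?thesis by simp
qed

lemma smooth_on_power:
 fixes f :: "'a::real_normed_vector => 'b::real_normed_field"
 shows "open S ==> smooth_on S f ==> smooth_on S (\<lambda>x. f x ^ n)"
 by (induction n) (auto intro!: smooth_on_mult)

section \<open>Composition with functions of one real variable and with affine maps\<close>

lemma pd_compose_real:
 fixes g :: "real => real"
 assumes "g differentiable_on T" "open T" "f differentiable_on S" "open S" "x \<in> S" "f x \<in> T"
 shows "pd (\<lambda>z. g (f z)) v x = pd g 1 (f x) * pd f v x"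
proof -
 have g: "(g has_derivative (\<lambda>h. pd g h (f x))) (at (f x))"
  using has_derivative_pd assms by blast
 have "pd g h (f x) = h * pd g 1 (f x)" for h
  using linear_cmul[OF has_derivative_linear[OF g], of h 1] by simp
 moreover have "pd (\<lambda>z. g (f z)) v x = pd g (pd f v x) (f x)"
  by (rule pd_eqI) (rule has_derivative_compose[OF has_derivative_pd[OF assms(3-5)] g])
 ultimately show ?thesis by (metis mult.commute)
qed

lemma Ck_compose_real:
 fixes g :: "real => real"
 assumes T: "open T" and S: "open S" and f: "Ck_on k S f" and fT: "\<And>x. x \<in> S ==> f x \<in> T"
 shows "Ck_on k T g ==> Ck_on k S (\<lambda>x. g (f x))"
 using f
proof (induction k arbitrary: g)
 case 0
 thus ?case
  by (auto intro!: continuous_on_compose2[of T g S f] fT)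
next
 case (Suc k)
 have d: "(\<lambda>x. g (f x)) differentiable_on S"
  unfolding differentiable_on_eq_differentiable_at[OF S]
 proof
  fix x assume "x \<in> S"
  hence "f differentiable (at x)" "g differentiable (at (f x))"
   using Suc.prems fT by (auto simp: differentiable_on_eq_differentiable_at S T)
  thus "(\<lambda>x. g (f x)) differentiable (at x)"
   using differentiable_chain_at[of f x g] by (simp add: o_def)
 qed
 have "Ck_on k S (pd (\<lambda>x. g (f x)) v)" for v
 proof -
  have "Ck_on k S (\<lambda>x. pd g 1 (f x) * pd f v x)"
  proof (rule Ck_bilinear[OF bounded_bilinear_mult S])
   show "Ck_on k S (\<lambda>x. pd g 1 (f x))"
    using Suc.prems Ck_mono[OF Suc.prems(2)] by (intro Suc.IH[of "pd g 1"]) auto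
   show "Ck_on k S (\<lambda>x. pd f v x)" using Suc.prems by simp
  qed
  moreover have "pd (\<lambda>x. g (f x)) v x = pd g 1 (f x) * pd f v x" if "x \<in> S" for x
   using Suc.prems fT[OF that] that by (intro pd_compose_real[OF _ T _ S]) auto
  ultimately show ?thesis by (rule Ck_congD[OF S])
 qed
 with d show ?case by simp
qed

lemma smooth_on_compose_real:
 fixes g :: "real => real"
 assumes "smooth_on T g" "open T" "open S" "smooth_on S f" "\<And>x. x \<in> S ==> f x \<in> T"
 shows "smooth_on S (\<lambda>x. g (f x))"
 using assms unfolding smooth_on_def by (auto intro: Ck_compose_real)

lemma pd_affine_compose:
 assumes "bounded_linear L" "f differentiable_on T" "open T" "a + L x \<in> T"
 shows "pd (\<lambda>x. f (a + L x)) v x = pd f (L v) (a + L x)"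
proof -
 have "((\<lambda>x. a + L x) has_derivative L) (at x)"
  using bounded_linear_imp_has_derivative[OF assms(1)] by (auto intro!: derivative_eq_intros)
 thus ?thesis
  by (intro pd_eqI has_derivative_compose[of "\<lambda>x. a + L x" L x UNIV f "\<lambda>h. pd f h (a + L x)"] has_derivative_pd[OF assms(2-)])
qed

lemma Ck_affine_compose:
 assumes L: "bounded_linear L" and T: "open T" and S: "open S" and ST: "\<And>x. x \<in> S ==> a + L x \<in> T"
 shows "Ck_on k T f ==> Ck_on k S (\<lambda>x. f (a + L x))"
proof (induction k arbitrary: f)
 case 0
 have "continuous_on S (\<lambda>x. a + L x)"
  using linear_continuous_on[OF L] by (intro continuous_intros)
 with 0 ST show ?case by (auto intro!: continuous_on_compose2[of T f S])
next
 case (Suc k)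
 have d: "(\<lambda>x. a + L x) differentiable (at x)" for x
  using bounded_linear_imp_differentiable[OF L] by (rule differentiable_add[OF differentiable_const])
 have "(\<lambda>x. f (a + L x)) differentiable_on S"
  unfolding differentiable_on_eq_differentiable_at[OF S]
 proof
  fix x assume "x \<in> S"
  hence "f differentiable (at (a + L x))"
   using Suc.prems ST by (auto simp: differentiable_on_eq_differentiable_at T)
  thus "(\<lambda>x. f (a + L x)) differentiable (at x)"
   using differentiable_chain_at[OF d[of x], of f] by (simp add: o_def)
 qed
 moreover have "Ck_on k S (pd (\<lambda>x. f (a + L x)) v)" for v
 proof (rule Ck_congD[OF S])
  show "Ck_on k S (\<lambda>x. pd f (L v) (a + L x))" using Suc by auto
  show "pd (\<lambda>x. f (a + L x)) v x = pd f (L v) (a + L x)" if "x \<in> S" for x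
   using pd_affine_compose[OF L _ T ST[OF that]] Suc.prems by auto
 qed
 ultimately show ?case by simp
qed

lemma smooth_on_affine_compose:
 assumes "bounded_linear L" "open T" "open S" "\<And>x. x \<in> S ==> a + L x \<in> T" "smooth_on T f"
 shows "smooth_on S (\<lambda>x. f (a + L x))"
 using assms unfolding smooth_on_def by (auto intro: Ck_affine_compose)

text \<open>The derivative of \<open>inverse\<close> is a polynomial in \<open>inverse\<close>, so
  the induction on the order of differentiability reproduces its own hypothesis.\<close>

lemma Ck_inverse: "Ck_on k (- {0::real}) inverse"
proof (induction k)
 case 0
 thus ?case by (auto intro!: continuous_intros)
next
 case (Suc k)
 have "pd inverse v x = - (inverse x * v * inverse x)" if "x \<in> - {0}" for v x :: real
  using that by (intro pd_eqI) (auto intro!: derivative_eq_intros)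
 moreover have "Ck_on k (- {0}) (\<lambda>x. - (inverse x * v * inverse x))" for v :: real
  by (intro Ck_linear_compose[OF bounded_linear_minus[OF bounded_linear_ident]]
    Ck_bilinear[OF bounded_bilinear_mult] Ck_const Suc) auto
 ultimately have "Ck_on k (- {0::real}) (pd inverse v)" for v :: real
  by (intro Ck_congD[of "- {0::real}" k "\<lambda>x. - (inverse x * v * inverse x)" "pd inverse v"]) auto
 moreover have "(inverse :: real => real) differentiable_on (- {0})"
  by (auto intro!: differentiable_on_inverse)
 ultimately show ?case by simp
qed

lemma smooth_on_inverse:
 assumes "open S" "smooth_on S f" "\<And>x. x \<in> S ==> f x \<noteq> 0"
 shows "smooth_on S (\<lambda>x. inverse (f x) :: real)"
 using assms smooth_on_compose_real[of "- {0}" inverse S f] Ck_inverse by (auto simp: smooth_on_def)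

lemma smooth_on_divide:
 assumes "open S" "smooth_on S f" "smooth_on S g" "\<And>x. x \<in> S ==> g x \<noteq> 0"
 shows "smooth_on S (\<lambda>x. f x / g x :: real)"
 unfolding divide_inverse using assms by (intro smooth_on_mult smooth_on_inverse)

lemma Ck_sqrt: "Ck_on k {0<..} sqrt"
proof (induction k)
 case 0
 thus ?case by (auto intro!: continuous_intros)
next
 case (Suc k)
 have *: "(sqrt has_derivative (\<lambda>v. v * (inverse (sqrt x) * (1/2)))) (at x)" if "x > 0" for x
  using that by (auto intro!: derivative_eq_intros)
 have "Ck_on k {0<..} (\<lambda>x. v * (inverse (sqrt x) * (1/2)))" for v :: real
  by (intro Ck_bilinear[OF bounded_bilinear_mult] Ck_const
    Ck_compose_real[OF _ _ _ _ Ck_inverse] Suc) auto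
 hence "Ck_on k {0<..} (pd sqrt v)" for v :: real
  using Ck_cong[of "{0::real<..}" "pd sqrt v" "\<lambda>x. v * (inverse (sqrt x) * (1/2))"] pd_eqI[OF *] by auto
 moreover have "sqrt differentiable_on {0<..}"
  using * by (auto simp: differentiable_on_def differentiable_def intro: has_derivative_at_withinI)
 ultimately show ?case by simp
qed

lemma smooth_on_sqrt:
 assumes "open S" "smooth_on S f" "\<And>x. x \<in> S ==> f x > 0"
 shows "smooth_on S (\<lambda>x. sqrt (f x))"
 using assms smooth_on_compose_real[of "{0<..}" sqrt S f] Ck_sqrt by (auto simp: smooth_on_def)

section \<open>Symmetry of second derivatives\<close>

lemma has_real_derivative_line:
 fixes g :: "'a::real_normed_vector => real"
 assumes "g differentiable_on S" "open S" "p + s *\<^sub>R u \<in> S"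
 shows "((\<lambda>s. g (p + s *\<^sub>R u)) has_real_derivative pd g u (p + s *\<^sub>R u)) (at s)"
proof -
 note g = has_derivative_pd[OF assms]
 have "((\<lambda>s. p + s *\<^sub>R u) has_derivative (\<lambda>h. h *\<^sub>R u)) (at s)" by (auto intro!: derivative_eq_intros)
 from has_derivative_compose[OF this g] linear_cmul[OF has_derivative_linear[OF g], of _ u]
 show ?thesis by (simp add: has_field_derivative_def mult.commute[of _ "pd g u _"])
qed

text \<open>The second difference of f over the parallelogram with sides h v and h w is symmetric in
  v and w. Two applications of the mean value theorem write it as h^2 times a mixed derivative at a
  nearby point, in either order; continuity gives equality as h tends to 0.\<close>

lemma pd_commute_C2:
 fixes f :: "'a::real_normed_vector => real"
 assumes S: "open S" and f: "Ck_on 2 S f" and x: "x \<in> S"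
 shows "pd (pd f v) w x = pd (pd f w) v x"
proof (rule ccontr)
 have fd: "f differentiable_on S" "pd f a differentiable_on S" "continuous_on S (pd (pd f a) b)" for a b
  using f by (simp_all add: numeral_2_eq_2 eta_contract_eq)
 have lim: "\<exists>d>0. \<forall>h. 0 < h \<and> h < d \<longrightarrow> (\<exists>y. \<bar>pd (pd f a) b y - pd (pd f a) b x\<bar> < e \<and>
   f (x + h *\<^sub>R a + h *\<^sub>R b) - f (x + h *\<^sub>R a) - f (x + h *\<^sub>R b) + f x = h^2 * pd (pd f a) b y)"
  if e: "e > 0" for e a b
 proof -
  have "isCont (pd (pd f a) b) x" using fd(3) S x continuous_on_eq_continuous_at by blast
  then obtain d where d: "d > 0" "\<And>z. norm (z - x) < d ==> \<bar>pd (pd f a) b z - pd (pd f a) b x\<bar> < e"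
   using e unfolding continuous_at_eps_delta dist_norm real_norm_def by metis
  obtain r where r: "r > 0" "ball x r \<subseteq> S" using S x open_contains_ball by blast
  \<comment> \<open>Keeps x + s a + t b within min d r of x for s and t up to h < \<delta>; the
    added 1 keeps the denominator positive when a = b = 0.\<close>
  define \<delta> where "\<delta> = min d r / (norm a + norm b + 1)"
  have p: "norm a + norm b + 1 > 0" by (simp add: add_nonneg_pos)
  have near: "x + s *\<^sub>R a + t *\<^sub>R b \<in> S" (is ?h1) "norm (s *\<^sub>R a + t *\<^sub>R b) < d"
   if "0 \<le> s" "s \<le> h" "0 \<le> t" "t \<le> h" "h < \<delta>" for h s t
  proof -
   have "norm (s *\<^sub>R a + t *\<^sub>R b) \<le> s * norm a + t * norm b"
    using norm_triangle_ineq[of "s *\<^sub>R a" "t *\<^sub>R b"] that by simp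
   also have "\<dots> \<le> h * norm a + h * norm b" using that by (intro add_mono mult_right_mono) auto
   also have "\<dots> \<le> h * (norm a + norm b + 1)" using that by (simp add: algebra_simps)
   also have "\<dots> < min d r" using that(5) p by (simp add: \<delta>_def pos_less_divide_eq)
   finally have "norm (s *\<^sub>R a + t *\<^sub>R b) < d" "dist (x + s *\<^sub>R a + t *\<^sub>R b) x < r" by (simp_all add: dist_norm add.assoc)
   thus ?h1 "norm (s *\<^sub>R a + t *\<^sub>R b) < d" using r(2) by (auto simp: dist_commute)
  qed
  have "\<exists>y. \<bar>pd (pd f a) b y - pd (pd f a) b x\<bar> < e \<and>
   f (x + h *\<^sub>R a + h *\<^sub>R b) - f (x + h *\<^sub>R a) - f (x + h *\<^sub>R b) + f x = h^2 * pd (pd f a) b y"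
   if h: "0 < h" "h < \<delta>" for h
  proof -
   let ?G = "\<lambda>s. f (x + h *\<^sub>R b + s *\<^sub>R a) - f (x + s *\<^sub>R a)"
   have "\<exists>s. 0 < s \<and> s < h \<and> ?G h - ?G 0 = (h - 0) * (pd f a (x + h *\<^sub>R b + s *\<^sub>R a) - pd f a (x + s *\<^sub>R a))"
    using h near(1)[of _ h h] near(1)[of _ h 0]
    by (intro MVT2 DERIV_diff has_real_derivative_line[OF fd(1) S]) (auto simp: add.commute add.left_commute)
   then obtain s where s: "0 < s" "s < h" "?G h - ?G 0 = h * (pd f a (x + h *\<^sub>R b + s *\<^sub>R a) - pd f a (x + s *\<^sub>R a))" by auto
   have "\<exists>t. 0 < t \<and> t < h \<and> pd f a (x + s *\<^sub>R a + h *\<^sub>R b) - pd f a (x + s *\<^sub>R a + 0 *\<^sub>R b)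
     = (h - 0) * pd (pd f a) b (x + s *\<^sub>R a + t *\<^sub>R b)"
    using h s near(1)[of s h] by (intro MVT2 has_real_derivative_line[OF fd(2) S]) auto
   then obtain t where t: "0 < t" "t < h" "pd f a (x + s *\<^sub>R a + h *\<^sub>R b) - pd f a (x + s *\<^sub>R a)
     = h * pd (pd f a) b (x + s *\<^sub>R a + t *\<^sub>R b)" by auto
   show ?thesis
    using s t h near(2)[of s h t] d(2)[of "x + s *\<^sub>R a + t *\<^sub>R b"]
    by (intro exI[of _ "x + s *\<^sub>R a + t *\<^sub>R b"]) (simp add: power2_eq_square algebra_simps)
  qed
  thus ?thesis using d(1) r(1) p by (intro exI[of _ \<delta>]) (auto simp: \<delta>_def)
 qed
 assume ne: "pd (pd f v) w x \<noteq> pd (pd f w) v x"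
 \<comment> \<open>Half the gap: one number cannot be within e of both mixed derivatives.\<close>
 define e where "e = \<bar>pd (pd f v) w x - pd (pd f w) v x\<bar> / 2"
 have e: "e > 0" using ne by (simp add: e_def)
 obtain d1 d2 where d: "d1 > 0" "d2 > 0" and q: "\<And>h. 0 < h ==> h < d1 ==> \<exists>y. \<bar>pd (pd f v) w y - pd (pd f v) w x\<bar> < e \<and>
   f (x + h *\<^sub>R v + h *\<^sub>R w) - f (x + h *\<^sub>R v) - f (x + h *\<^sub>R w) + f x = h^2 * pd (pd f v) w y"
  "\<And>h. 0 < h ==> h < d2 ==> \<exists>y. \<bar>pd (pd f w) v y - pd (pd f w) v x\<bar> < e \<and>
   f (x + h *\<^sub>R w + h *\<^sub>R v) - f (x + h *\<^sub>R w) - f (x + h *\<^sub>R v) + f x = h^2 * pd (pd f w) v y"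
  using lim[OF e, of v w] lim[OF e, of w v] by metis
 define h where "h = min d1 d2 / 2"
 have h: "0 < h" "h < d1" "h < d2" using d by (auto simp: h_def)
 obtain y y' where y: "\<bar>pd (pd f v) w y - pd (pd f v) w x\<bar> < e" "\<bar>pd (pd f w) v y' - pd (pd f w) v x\<bar> < e"
  and "h^2 * pd (pd f v) w y = f (x + h *\<^sub>R v + h *\<^sub>R w) - f (x + h *\<^sub>R v) - f (x + h *\<^sub>R w) + f x"
   "f (x + h *\<^sub>R w + h *\<^sub>R v) - f (x + h *\<^sub>R w) - f (x + h *\<^sub>R v) + f x = h^2 * pd (pd f w) v y'"
  using q(1)[OF h(1,2)] q(2)[OF h(1,3)] by metis
 hence "h^2 * pd (pd f v) w y = h^2 * pd (pd f w) v y'" by (simp add: algebra_simps)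
 with y show False using h unfolding e_def by (simp add: abs_if split: if_splits)
qed

lemma pd_commute:
 fixes f :: "'a::real_normed_vector => 'b::euclidean_space"
 assumes S: "open S" and f: "smooth_on S f" and x: "x \<in> S"
 shows "pd (pd f v) w x = pd (pd f w) v x"
proof (rule euclidean_eqI)
 fix b :: 'b assume "b \<in> Basis"
 have l: "bounded_linear (\<lambda>y. y \<bullet> b)" by auto
 have "pd (pd f v) w x \<bullet> b = pd (pd (\<lambda>x. f x \<bullet> b) v) w x" for v w
 proof -
  have "pd (pd (\<lambda>x. f x \<bullet> b) v) w x = pd (\<lambda>x. pd f v x \<bullet> b) w x"
   by (rule pd_cong[OF S x]) (rule pd_linear_compose[OF l smooth_on_differentiable[OF f] S])
  thus ?thesis
   using pd_linear_compose[OF l smooth_on_differentiable[OF smooth_on_pd[OF f]] S x] by simp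
 qed
 thus "pd (pd f v) w x \<bullet> b = pd (pd f w) v x \<bullet> b"
  using pd_commute_C2[OF S _ x, of "\<lambda>x. f x \<bullet> b" v w] smooth_on_linear_compose[OF l S f] by (simp add: smooth_on_def)
qed

lemmas smooth_intros = smooth_on_add smooth_on_diff smooth_on_mult smooth_on_scaleR smooth_on_uminus
 smooth_on_cnj smooth_on_of_real smooth_on_Re smooth_on_Im smooth_on_fst smooth_on_snd smooth_on_Pair
 smooth_on_inner smooth_on_power smooth_on_sum smooth_on_const smooth_on_id smooth_on_pd

section \<open>Wirtinger derivatives\<close>

definition dz :: "(complex => complex) => complex => complex" where
 "dz f z = (pd f 1 z - \<i> * pd f \<i> z) / 2"

definition dzb :: "(complex => complex) => complex => complex" where
 "dzb f z = (pd f 1 z + \<i> * pd f \<i> z) / 2"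

lemma pd_complex_dir:
 assumes "f differentiable_on S" "open S" "z \<in> S"
 shows "pd f v z = Re v *\<^sub>R pd f 1 z + Im v *\<^sub>R pd f \<i> z"
proof -
 have l: "linear (\<lambda>v. pd f v z)" using has_derivative_linear[OF has_derivative_pd[OF assms]] .
 have "v = Re v *\<^sub>R 1 + Im v *\<^sub>R \<i>" by (simp add: complex_eq_iff)
 hence "pd f v z = pd f (Re v *\<^sub>R 1 + Im v *\<^sub>R \<i>) z" by simp
 also have "\<dots> = Re v *\<^sub>R pd f 1 z + Im v *\<^sub>R pd f \<i> z"
  using linear_add[OF l] linear_cmul[OF l] by metis
 finally show ?thesis .
qed

lemma pd_1_dz: "pd f 1 z = dz f z + dzb f z"
 by (simp add: dz_def dzb_def field_simps)

lemma pd_ii_dz: "pd f \<i> z = \<i> * (dz f z - dzb f z)"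
 by (simp add: dz_def dzb_def field_simps)

lemma dz_cong: "open S ==> z \<in> S ==> (\<And>w. w \<in> S ==> f w = g w) ==> dz f z = dz g z"
 unfolding dz_def using pd_cong[of S z f g] by simp

lemma dzb_cong: "open S ==> z \<in> S ==> (\<And>w. w \<in> S ==> f w = g w) ==> dzb f z = dzb g z"
 unfolding dzb_def using pd_cong[of S z f g] by simp

lemma smooth_on_dz: "open S ==> smooth_on S f ==> smooth_on S (dz f)"
 and smooth_on_dzb: "open S ==> smooth_on S f ==> smooth_on S (dzb f)"
 unfolding dz_def[abs_def] dzb_def[abs_def] divide_inverse
 by (intro smooth_on_mult smooth_on_diff smooth_on_add smooth_on_pd smooth_on_const; assumption)+

context
 fixes S :: "complex set" and z :: complex
 assumes S: "open S" and z: "z \<in> S"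
begin

lemma dz_add: "smooth_on S f ==> smooth_on S g ==> dz (\<lambda>z. f z + g z) z = dz f z + dz g z"
 and dzb_add: "smooth_on S f ==> smooth_on S g ==> dzb (\<lambda>z. f z + g z) z = dzb f z + dzb g z"
 unfolding dz_def dzb_def
 by (simp_all add: pd_add[OF _ _ S z] smooth_on_differentiable field_simps)

lemma dz_mult: "smooth_on S f ==> smooth_on S g ==> dz (\<lambda>z. f z * g z) z = f z * dz g z + dz f z * g z"
 and dzb_mult: "smooth_on S f ==> smooth_on S g ==> dzb (\<lambda>z. f z * g z) z = f z * dzb g z + dzb f z * g z"
 unfolding dz_def dzb_def
 by (simp_all add: pd_bilinear[OF bounded_bilinear_mult _ _ S z] smooth_on_differentiable field_simps)

lemma dz_const [simp]: "dz (\<lambda>_. c) z = 0"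
 and dzb_const [simp]: "dzb (\<lambda>_. c) z = 0"
 by (simp_all add: dz_def dzb_def)

lemma dz_cmult: "smooth_on S f ==> dz (\<lambda>z. c * f z) z = c * dz f z"
 and dzb_cmult: "smooth_on S f ==> dzb (\<lambda>z. c * f z) z = c * dzb f z"
 by (simp_all add: dz_mult dzb_mult)

lemma dz_uminus: "smooth_on S f ==> dz (\<lambda>z. - f z) z = - dz f z"
 and dzb_uminus: "smooth_on S f ==> dzb (\<lambda>z. - f z) z = - dzb f z"
 using dz_cmult[of f "-1"] dzb_cmult[of f "-1"] by simp_all

lemma dz_diff: "smooth_on S f ==> smooth_on S g ==> dz (\<lambda>z. f z - g z) z = dz f z - dz g z"
 and dzb_diff: "smooth_on S f ==> smooth_on S g ==> dzb (\<lambda>z. f z - g z) z = dzb f z - dzb g z"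
 using dz_add[of f "\<lambda>z. - g z"] dzb_add[of f "\<lambda>z. - g z"] smooth_on_uminus[OF S, of g]
 by (simp_all add: dz_uminus dzb_uminus)

lemma dz_divide: "smooth_on S f ==> dz (\<lambda>z. f z / c) z = dz f z / c"
 and dzb_divide: "smooth_on S f ==> dzb (\<lambda>z. f z / c) z = dzb f z / c"
 using dz_cmult[of f "inverse c"] dzb_cmult[of f "inverse c"] by (simp_all add: divide_inverse mult.commute)

lemma dz_cnj: "smooth_on S f ==> dz (\<lambda>z. cnj (f z)) z = cnj (dzb f z)"
 and dzb_cnj: "smooth_on S f ==> dzb (\<lambda>z. cnj (f z)) z = cnj (dz f z)"
 unfolding dz_def dzb_def
 by (simp_all add: pd_linear_compose[OF bounded_linear_cnj _ S z] smooth_on_differentiable)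

lemma dz_sum: "(\<And>i. i \<in> A ==> smooth_on S (f i)) ==> dz (\<lambda>z. \<Sum>i\<in>A. f i z) z = (\<Sum>i\<in>A. dz (f i) z)"
 by (induction A rule: infinite_finite_induct) (auto simp: dz_add smooth_on_sum[OF S])

lemma dzb_sum: "(\<And>i. i \<in> A ==> smooth_on S (f i)) ==> dzb (\<lambda>z. \<Sum>i\<in>A. f i z) z = (\<Sum>i\<in>A. dzb (f i) z)"
 by (induction A rule: infinite_finite_induct) (auto simp: dzb_add smooth_on_sum[OF S])

lemma dz_dzb_commute:
 assumes f: "smooth_on S f"
 shows "dz (dzb f) z = dzb (dz f) z"
proof -
 have s: "smooth_on S (pd f v)" "smooth_on S (\<lambda>z. \<i> * pd f v z)" for v
  by (intro smooth_on_pd smooth_on_mult S f smooth_on_const)+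
 have "dz (\<lambda>z. (pd f 1 z + \<i> * pd f \<i> z) / 2) z = dzb (\<lambda>z. (pd f 1 z - \<i> * pd f \<i> z) / 2) z"
  by (simp add: dz_divide dzb_divide dz_add dzb_diff dz_cmult dzb_cmult smooth_on_add smooth_on_diff S s)
   (use pd_commute[OF S f z, of 1 \<i>] in \<open>simp add: dz_def dzb_def field_simps\<close>)
 thus ?thesis by (simp add: dz_def[of f, abs_def] dzb_def[of f, abs_def])
qed

end

lemmas wirtinger = dz_add dz_diff dz_mult dz_uminus dz_cnj dz_const dz_divide dzb_add dzb_diff dzb_mult dzb_uminus dzb_cnj dzb_const dzb_divide

section \<open>Integrals of compactly supported functions\<close>

lemma integrable_on_compact:
 fixes f :: "'a::euclidean_space => 'b::euclidean_space"
 assumes "compact K" "continuous_on K f"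
 shows "f integrable_on K"
 using borel_integrable_compact[OF assms] set_borel_integral_eq_integral(1)[of K f]
 by (simp add: set_integrable_def)

lemma integral_compact_support:
 fixes f :: "'a::euclidean_space => 'b::euclidean_space"
 assumes "compact K" "continuous_on K f" "\<And>x. x \<notin> K ==> f x = 0"
 shows "f integrable_on UNIV" (is ?g1) "integral K f = integral UNIV f" (is ?g2)
proof -
 show ?g1
  using integrable_on_superset[OF integrable_on_compact[OF assms(1,2)]] assms(3) by auto
 have "(\<lambda>x. if x \<in> K then f x else 0) = f" using assms(3) by auto
 thus ?g2 using integral_restrict_UNIV[of K f] by simp
qed

text \<open>Dominated convergence for the difference quotients along sequences. Joint continuity
  bounds \<open>h'\<close> on the compact set [-e/2, e/2] x K, and the mean value estimate carries
  that bound over to the quotients.\<close>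

lemma has_real_derivative_integral_compact:
 fixes h h' :: "real => 'a::euclidean_space => real"
 assumes K: "compact K" and e: "e > 0"
  and der: "\<And>t z. \<bar>t\<bar> < e ==> z \<in> K ==> ((\<lambda>t. h t z) has_real_derivative h' t z) (at t)"
  and cont: "\<And>t. \<bar>t\<bar> < e ==> continuous_on K (h t)"
  and cont': "continuous_on ({-e<..<e} \<times> K) (\<lambda>(t, z). h' t z)"
 shows "((\<lambda>t. integral K (h t)) has_real_derivative integral K (h' 0)) (at 0)"
proof -
 have "bounded ((\<lambda>(t, z). h' t z) ` ({-e/2..e/2} \<times> K))"
  using e by (intro compact_imp_bounded compact_continuous_image continuous_on_subset[OF cont'] compact_Times K) auto
 then obtain M where M: "\<And>t z. \<bar>t\<bar> \<le> e / 2 ==> z \<in> K ==> norm (h' t z) \<le> M" unfolding bounded_iff by fastforce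
 let ?U = "{-e/2<..<e/2}"
 have "((\<lambda>t. (integral K (h t) - integral K (h 0)) / t) \<longlongrightarrow> integral K (h' 0)) (at 0 within ?U)"
  unfolding tendsto_at_iff_sequentially o_def
 proof (intro allI impI)
  fix X :: "nat => real" assume "\<forall>i. X i \<in> ?U - {0}" and X0: "X \<longlonglongrightarrow> 0"
  hence X: "\<bar>X i\<bar> \<le> e / 2" "\<bar>X i\<bar> < e" "X i \<noteq> 0" for i by (auto simp: abs_if dest: spec[of _ i])
  let ?q = "\<lambda>i z. (h (X i) z - h 0 z) / X i"
  have "(\<lambda>i. integral K (?q i)) \<longlonglongrightarrow> integral K (h' 0)"
  proof (rule dominated_convergence(2))
   show "?q i integrable_on K" for i using e X by (intro integrable_on_compact K continuous_intros cont) auto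
   show "(\<lambda>_. M) integrable_on K" by (rule integrable_on_compact[OF K]) simp
   show "norm (?q i z) \<le> M" if z: "z \<in> K" for i z
   proof -
    have "norm (h (X i) z - h 0 z) \<le> M * norm (X i - 0)"
     using X(1)[of i] e z by (intro field_differentiable_bound[of "{-e/2..e/2}" "\<lambda>t. h t z" "\<lambda>t. h' t z"]
       DERIV_subset[OF der] M) (auto simp: abs_le_iff)
    thus ?thesis using X(3)[of i] by (simp add: field_simps)
   qed
   show "(\<lambda>i. ?q i z) \<longlonglongrightarrow> h' 0 z" if "z \<in> K" for z
    using filterlim_compose[of "\<lambda>t. (h t z - h 0 z) / t" "nhds (h' 0 z)" "at 0" X] der[of 0 z] that e X0 X(3)
    by (simp add: DERIV_def filterlim_at)
  qed
  moreover have "integral K (?q i) = (integral K (h (X i)) - integral K (h 0)) / X i" for i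
   using e X(2)[of i] by (subst integral_divide) (simp add: Henstock_Kurzweil_Integration.integral_diff integrable_on_compact K cont)
  ultimately show "(\<lambda>i. (integral K (h (X i)) - integral K (h 0)) / X i) \<longlonglongrightarrow> integral K (h' 0)" by (simp only:)
 qed
 thus ?thesis using at_within_open[of 0 ?U] e by (simp add: DERIV_def)
qed

text \<open>By translation invariance the integral of z \<mapsto> f (z + t v) does not depend on t;
  its derivative at t = 0 is the integral of the directional derivative.\<close>

lemma integral_pd_eq_0_real:
 fixes f :: "complex => real"
 assumes f: "Ck_on 1 UNIV f" and K: "compact K" and f0: "\<And>z. z \<notin> K ==> f z = 0"
 shows "integral K (pd f v) = 0"
proof -
 have diff: "f differentiable_on UNIV" and c1: "continuous_on UNIV (pd f v)"
  using f by simp_all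
 have c0: "continuous_on UNIV f" using diff differentiable_imp_continuous_on by blast
 obtain a b where ab: "K \<subseteq> cbox a b" using bounded_subset_cbox_symmetric compact_imp_bounded[OF K] by metis
 obtain B where B: "B > 0" "K \<subseteq> ball 0 B" using compact_imp_bounded[OF K] bounded_subset_ballD by blast
 \<comment> \<open>A ball containing the supports of all translates with |t| < 1, so that the domain
   of integration does not move with t.\<close>
 define L where "L = cball (0::complex) (B + norm v)"
 have L: "compact L" by (simp add: L_def)
 have sh: "f (z + t *\<^sub>R v) = 0" if "\<bar>t\<bar> < 1" "z \<notin> L" for z t
 proof (rule f0, rule notI)
  assume "z + t *\<^sub>R v \<in> K"
  hence "norm (z + t *\<^sub>R v) < B" using B by auto
  moreover have "norm z \<le> norm (z + t *\<^sub>R v) + norm (t *\<^sub>R v)"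
   using norm_triangle_ineq4[of "z + t *\<^sub>R v" "t *\<^sub>R v"] by simp
  moreover have "norm (t *\<^sub>R v) \<le> norm v" using that by (simp add: mult_left_le_one_le)
  ultimately show False using that(2) by (simp add: L_def)
 qed
 have der: "((\<lambda>t. f (z + t *\<^sub>R v)) has_real_derivative pd f v (z + t *\<^sub>R v)) (at t)" for t z
  by (rule has_real_derivative_line[OF diff]) auto
 have ct: "continuous_on X (\<lambda>z. f (z + t *\<^sub>R v))" for t X
  by (intro continuous_on_compose2[OF c0]) (auto intro!: continuous_intros)
 have "((\<lambda>t. integral L (\<lambda>z. f (z + t *\<^sub>R v))) has_real_derivative integral L (\<lambda>z. pd f v (z + 0 *\<^sub>R v))) (at 0)"
 proof (rule has_real_derivative_integral_compact[OF L zero_less_one])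
  show "continuous_on ({- 1<..<1} \<times> L) (\<lambda>(t, z). pd f v (z + t *\<^sub>R v))"
   unfolding split_def by (intro continuous_on_compose2[OF c1]) (auto intro!: continuous_intros)
 qed (use der ct in auto)
 moreover have "integral L (\<lambda>z. f (z + t *\<^sub>R v)) = integral UNIV f" if t: "\<bar>t\<bar> < 1" for t
 proof -
  have "integral L (\<lambda>z. f (z + t *\<^sub>R v)) = integral UNIV (\<lambda>z. f (z + t *\<^sub>R v))"
   using sh[OF t] by (intro integral_compact_support(2) L ct) auto
  also have "\<dots> = integral (cbox (a - t *\<^sub>R v) (b - t *\<^sub>R v)) (\<lambda>z. f (z + t *\<^sub>R v))"
  proof (rule integral_compact_support(2)[symmetric, OF compact_cbox ct])
   show "f (z + t *\<^sub>R v) = 0" if "z \<notin> cbox (a - t *\<^sub>R v) (b - t *\<^sub>R v)" for z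
   proof (rule f0, rule notI)
    assume "z + t *\<^sub>R v \<in> K"
    hence "z + t *\<^sub>R v \<in> cbox a b" using ab by auto
    thus False using that by (auto simp: mem_box inner_simps)
   qed
  qed
  also have "\<dots> = integral (cbox a b) f" by (rule integral_shift_cbox)
  also have "\<dots> = integral UNIV f"
   using ab f0 by (intro integral_compact_support(2) compact_cbox continuous_on_subset[OF c0]) auto
  finally show ?thesis .
 qed
 ultimately have "((\<lambda>t::real. integral UNIV f) has_real_derivative integral L (pd f v)) (at 0)"
  by (intro has_field_derivative_transform_within_open[where S="{-1<..<1}" and
     f="\<lambda>t. integral L (\<lambda>z. f (z + t *\<^sub>R v))" and g="\<lambda>t. integral UNIV f"]) auto
 hence z: "integral L (pd f v) = 0" using DERIV_unique DERIV_const by blast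
 have pd0: "pd f v z = 0" if "z \<notin> K" for z
  using pd_cong[of "- K" z f "\<lambda>_. 0" v] that f0 compact_imp_closed[OF K] by auto
 note cs = integral_compact_support[OF _ continuous_on_subset[OF c1 subset_UNIV]]
 have "K \<subseteq> L" using B(2) by (force simp: L_def intro: add_increasing2)
 hence "pd f v z = 0" if "z \<notin> L" for z using pd0 that by blast
 thus ?thesis using cs(2)[OF L] cs(2)[OF K pd0] z by simp
qed

section \<open>Smooth cutoff functions\<close>

text \<open>The powers of 1/t make the family closed under differentiation: the derivative of member
  n is a combination of members n + 1 and n + 2. Smoothness at 0 is then an induction over the whole
  family.\<close>

definition flat_exp :: "nat => real => real" where
 "flat_exp n t = (if t > 0 then (1 / t) ^ n * exp (- (1 / t)) else 0)"

lemma flat_exp_tendsto_0: "(flat_exp n \<longlongrightarrow> 0) (at 0)"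
proof -
 have "((\<lambda>t::real. (1 / t) ^ n * exp (- (1 / t))) \<longlongrightarrow> 0) (at_right 0)"
 proof -
  have "((\<lambda>x::real. x ^ n / exp x) \<longlongrightarrow> 0) at_top" by (rule tendsto_power_div_exp_0)
  moreover have "filterlim (\<lambda>t::real. 1 / t) at_top (at_right 0)"
   using filterlim_inverse_at_top_right by (simp add: inverse_eq_divide)
  ultimately have "((\<lambda>t::real. (1 / t) ^ n / exp (1 / t)) \<longlongrightarrow> 0) (at_right 0)"
   by (rule filterlim_compose)
  thus ?thesis by (simp add: exp_minus divide_inverse)
 qed
 hence "(flat_exp n \<longlongrightarrow> 0) (at_right 0)"
  by (rule Lim_transform_eventually) (auto simp: flat_exp_def eventually_at_filter)
 moreover have "(flat_exp n \<longlongrightarrow> 0) (at_left 0)"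
  by (rule Lim_transform_eventually[of "\<lambda>_. 0"]) (auto simp: flat_exp_def eventually_at_filter)
 ultimately show ?thesis by (simp add: filterlim_at_split)
qed

lemma flat_exp_deriv:
 "(flat_exp n has_real_derivative flat_exp (n + 2) t - real n * flat_exp (n + 1) t) (at t)"
proof -
 consider "t > 0" | "t < 0" | "t = 0" by linarith
 thus ?thesis
 proof cases
  case 1
  have n: "real n * (1 / t) ^ (n - 1) * (1 / t) ^ 2 = real n * (1 / t) ^ (n + 1)"
   by (cases n) (auto simp: power2_eq_square)
  have "((\<lambda>t. (1 / t) ^ n * exp (- (1 / t))) has_real_derivative
    real n * (1 / t) ^ (n - 1) * (- ((1 / t) ^ 2)) * exp (- (1 / t)) + (1 / t) ^ n * (exp (- (1 / t)) * (1 / t) ^ 2)) (at t)"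
   using 1 by (auto intro!: derivative_eq_intros simp: power2_eq_square)
  moreover have "real n * (1 / t) ^ (n - 1) * (- ((1 / t) ^ 2)) * exp (- (1 / t)) + (1 / t) ^ n * (exp (- (1 / t)) * (1 / t) ^ 2)
    = flat_exp (n + 2) t - real n * flat_exp (n + 1) t"
  proof -
   have "real n * (1 / t) ^ (n - 1) * (- ((1 / t) ^ 2)) = - (real n * (1 / t) ^ (n + 1))"
    using n by (simp only: mult_minus_right)
   thus ?thesis using 1 by (simp add: flat_exp_def power2_eq_square)
  qed
  ultimately have "((\<lambda>t. (1 / t) ^ n * exp (- (1 / t))) has_real_derivative flat_exp (n + 2) t - real n * flat_exp (n + 1) t) (at t)"
   by simp
  thus ?thesis
   by (rule has_field_derivative_transform_within_open[where S="{0<..}"]) (use 1 in \<open>auto simp: flat_exp_def\<close>)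
 next
  case 2
  have "((\<lambda>_. 0) has_real_derivative flat_exp (n + 2) t - real n * flat_exp (n + 1) t) (at t)"
   using 2 by (auto simp: flat_exp_def)
  thus ?thesis
   by (rule has_field_derivative_transform_within_open[where S="{..<0}"]) (use 2 in \<open>auto simp: flat_exp_def\<close>)
 next
  case 3
  have "((\<lambda>h. (flat_exp n (0 + h) - flat_exp n 0) / h) \<longlongrightarrow> 0) (at 0)"
   by (rule Lim_transform_eventually[OF flat_exp_tendsto_0[of "Suc n"]])
    (auto simp: flat_exp_def)
  thus ?thesis using 3 by (simp add: DERIV_def flat_exp_def)
 qed
qed

lemma Ck_flat_exp: "Ck_on k UNIV (flat_exp n)"
proof (induction k arbitrary: n)
 case 0
 have "isCont (flat_exp n) x" for x using DERIV_isCont flat_exp_deriv by blast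
 thus ?case by (auto intro: continuous_at_imp_continuous_on)
next
 case (Suc k)
 have D: "(flat_exp n has_derivative (\<lambda>v. (flat_exp (n + 2) t - real n * flat_exp (n + 1) t) * v)) (at t)" for t
  using flat_exp_deriv by (simp add: has_field_derivative_def)
 have "pd (flat_exp n) v = (\<lambda>t. (flat_exp (n + 2) t + (- real n) * flat_exp (n + 1) t) * v)" for v
  using pd_eqI[OF D] by auto
 moreover have "Ck_on k UNIV (\<lambda>t. (flat_exp (n + 2) t + (- real n) * flat_exp (n + 1) t) * v)" for v
  by (intro Ck_bilinear[OF bounded_bilinear_mult] Ck_add Ck_const Suc open_UNIV)
 ultimately show ?case using D by (auto simp: differentiable_on_def differentiable_def)
qed

text \<open>The parameter t equals 1 at distance d and 0 at distance 2 d from p. It is affine in the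
  squared distance, hence smooth also at p.\<close>

definition bump :: "complex => real => complex => real" where
 "bump p d z = (let t = (4 * d^2 - (cmod (z - p))^2) / (3 * d^2) in
   flat_exp 0 t / (flat_exp 0 t + flat_exp 0 (1 - t)))"

lemma flat_exp_pos: "t > 0 ==> flat_exp 0 t > 0"
 and flat_exp_nonneg: "flat_exp 0 t \<ge> 0"
 and flat_exp_0: "t \<le> 0 ==> flat_exp 0 t = 0"
 by (simp_all add: flat_exp_def)

lemma flat_exp_denom: "flat_exp 0 t + flat_exp 0 (1 - t) > 0"
 using flat_exp_pos[of t] flat_exp_pos[of "1 - t"] flat_exp_nonneg[of t] flat_exp_nonneg[of "1 - t"]
 by (cases "t > 0") auto

lemma bump_nonneg: "bump p d z \<ge> 0"
 unfolding bump_def Let_def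
 by (intro divide_nonneg_pos flat_exp_nonneg flat_exp_denom)

lemma bump_1:
 assumes "d > 0" "cmod (z - p) \<le> d"
 shows "bump p d z = 1"
proof -
 let ?t = "(4 * d^2 - (cmod (z - p))^2) / (3 * d^2)"
 have "(cmod (z - p))^2 \<le> d^2" using assms by (intro power_mono) auto
 hence "?t \<ge> 1" using assms by simp
 thus ?thesis
  using flat_exp_0[of "1 - ?t"] flat_exp_pos[of ?t] by (simp add: bump_def)
qed

lemma bump_0:
 assumes "d > 0" "cmod (z - p) \<ge> 2 * d"
 shows "bump p d z = 0"
proof -
 have "(2 * d)^2 \<le> (cmod (z - p))^2" using assms by (intro power_mono) auto
 thus ?thesis using assms by (simp add: bump_def flat_exp_0 field_simps)
qed

lemma smooth_on_bump:
 assumes d: "d > 0"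
 shows "smooth_on UNIV (bump p d)"
proof -
 let ?t = "\<lambda>z. (4 * d^2 - (cmod (z - p))^2) / (3 * d^2)"
 have s: "smooth_on UNIV ?t"
  unfolding power2_norm_eq_inner
  by (intro smooth_on_divide smooth_intros open_UNIV) (use d in auto)
 have f: "smooth_on UNIV (\<lambda>z. flat_exp 0 (g z))" if "smooth_on UNIV g" for g :: "complex => real"
  by (rule smooth_on_compose_real[OF _ open_UNIV open_UNIV that]) (auto simp: smooth_on_def Ck_flat_exp)
 show ?thesis
 proof -
  have nz: "flat_exp 0 t + flat_exp 0 (1 - t) \<noteq> 0" for t using flat_exp_denom[of t] by simp
  show ?thesis unfolding bump_def[abs_def] Let_def
   by (rule smooth_on_divide[OF open_UNIV f[OF s] smooth_on_add[OF open_UNIV f[OF s] f[OF smooth_on_diff[OF open_UNIV smooth_on_const s]]] nz])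
 qed
qed

section \<open>A Carleman estimate for the Cauchy--Riemann operator\<close>

lemma Ck_1: "Ck_on 1 S f \<longleftrightarrow> f differentiable_on S \<and> (\<forall>v. continuous_on S (pd f v))"
 by simp

lemma Ck_2: "Ck_on 2 S f \<longleftrightarrow> f differentiable_on S \<and> (\<forall>v. Ck_on 1 S (pd f v))"
 by (simp add: numeral_2_eq_2)

lemma Ck_2_1: "Ck_on 2 S f ==> Ck_on 1 S f"
 using Ck_mono[of 1 S f] by (simp add: numeral_2_eq_2)

text \<open>For v = a + i b the first two squares are twice the real and imaginary part of v_zbar -
  t phi_zbar v, the last two those of v_z + t phi_z v, which is up to sign its formal adjoint. The
  difference of squared norms is a Jacobian plus a multiple of grad phi . grad |v|^2, both of which
  are handled by integration by parts.\<close>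

lemma carleman_identity:
 fixes ax ay bx "by" a b px py t :: real
 shows "(ax - by - t * (px * a - py * b))^2 + (bx + ay - t * (px * b + py * a))^2
  - ((ax + by + t * (px * a + py * b))^2 + (bx - ay + t * (px * b - py * a))^2)
  = 4 * (bx * ay - ax * by) - 4 * t * (px * (a * ax + b * bx) + py * (a * ay + b * by))"
 by (simp add: power2_eq_square algebra_simps)

lemma cmod_dzb:
 assumes "f differentiable_on UNIV"
 shows "4 * (cmod (dzb f z))^2 = (pd (\<lambda>z. Re (f z)) 1 z - pd (\<lambda>z. Im (f z)) \<i> z)^2
   + (pd (\<lambda>z. Im (f z)) 1 z + pd (\<lambda>z. Re (f z)) \<i> z)^2"
proof -
 have "pd (\<lambda>z. Re (f z)) v z = Re (pd f v z)" "pd (\<lambda>z. Im (f z)) v z = Im (pd f v z)" for v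
  by (rule pd_linear_compose[OF _ assms]; simp add: bounded_linear_Re bounded_linear_Im)+
 thus ?thesis unfolding dzb_def cmod_power2 by (simp add: field_simps)
qed

text \<open>Conjugating dbar with the weight exp (t phi) and discarding the squared adjoint leaves
  the commutator, which is the Laplacian of phi: a strictly subharmonic weight therefore gains a
  factor t. Two derivatives of g suffice, which later admits functions extended by zero.\<close>

lemma carleman:
 fixes g :: "complex => complex" and \<phi> :: "complex => real"
 assumes g: "Ck_on 2 UNIV g" and \<phi>: "smooth_on UNIV \<phi>" and K: "compact K" and g0: "\<And>z. z \<notin> K ==> g z = 0"
  and c: "\<And>z. z \<in> K ==> c \<le> pd (pd \<phi> 1) 1 z + pd (pd \<phi> \<i>) \<i> z" and t: "t \<ge> 0"
 shows "2 * t * c * integral K (\<lambda>z. (cmod (g z))^2 * exp (2 * t * \<phi> z))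
  \<le> integral K (\<lambda>z. 4 * (cmod (dzb g z))^2 * exp (2 * t * \<phi> z))"
proof -
 define a where "a z = Re (g z)" for z
 define b where "b z = Im (g z)" for z
 have a: "Ck_on 2 UNIV a" and b: "Ck_on 2 UNIV b"
  unfolding a_def[abs_def] b_def[abs_def] by (rule Ck_linear_compose[OF bounded_linear_Re open_UNIV g] Ck_linear_compose[OF bounded_linear_Im open_UNIV g])+
 define E where "E z = exp (t * \<phi> z)" for z
 have E: "smooth_on UNIV E"
 proof -
  have "Ck_on k UNIV (exp :: real => real)" for k
  proof (induction k)
   case (Suc k)
   have *: "(exp has_derivative (\<lambda>v. exp x * v)) (at x)" for x :: real
    using DERIV_exp by (simp add: has_field_derivative_def)
   have "pd exp v = (\<lambda>x. exp x * v)" for v :: real using pd_eqI[OF *] by auto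
   moreover have "Ck_on k UNIV (\<lambda>x. exp x * v)" for v :: real
    by (intro Ck_bilinear[OF bounded_bilinear_mult] Ck_const Suc open_UNIV)
   ultimately show ?case using * by (auto simp: differentiable_on_def differentiable_def)
  qed (auto intro!: continuous_intros)
  hence "smooth_on UNIV (exp :: real => real)" by (simp add: smooth_on_def)
  from smooth_on_compose_real[OF this open_UNIV open_UNIV, of "\<lambda>z. t * \<phi> z"]
  show ?thesis unfolding E_def by (simp add: smooth_on_mult \<phi>)
 qed
 have dE: "pd E v z = t * pd \<phi> v z * E z" for v z
 proof -
  have "(E has_derivative (\<lambda>h. E z * (t * pd \<phi> h z))) (at z)"
   unfolding E_def by (auto intro!: derivative_eq_intros smooth_on_has_derivative[OF \<phi>])
  thus ?thesis by (simp add: pd_eqI)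
 qed
 define A where "A z = E z * a z" for z
 define B where "B z = E z * b z" for z
 have E2: "Ck_on 2 UNIV E" using E by (simp add: smooth_on_def)
 have AB2: "Ck_on 2 UNIV A" "Ck_on 2 UNIV B"
  unfolding A_def B_def by (intro Ck_bilinear[OF bounded_bilinear_mult] E2 a b open_UNIV)+
 have AB: "Ck_on 1 UNIV A" "Ck_on 1 UNIV B" "\<And>v. Ck_on 1 UNIV (pd A v)" "\<And>v. Ck_on 1 UNIV (pd B v)"
  using AB2 Ck_2_1 by (auto simp: Ck_2)
 have AB0: "A z = 0" "B z = 0" if "z \<notin> K" for z using g0[OF that] by (auto simp: A_def B_def a_def b_def)
 have dA: "pd A v z = E z * pd a v z + t * pd \<phi> v z * A z"
  and dB: "pd B v z = E z * pd b v z + t * pd \<phi> v z * B z" for v z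
  using pd_bilinear[OF bounded_bilinear_mult, of E UNIV a z v] pd_bilinear[OF bounded_bilinear_mult, of E UNIV b z v]
   smooth_on_differentiable[OF E] a b by (simp_all add: A_def[abs_def] B_def[abs_def] Ck_2 dE)
 define Q where "Q z = A z * A z + B z * B z" for z
 have Q: "Ck_on 1 UNIV Q" unfolding Q_def by (intro Ck_add Ck_bilinear[OF bounded_bilinear_mult] AB open_UNIV)
 have dphi: "Ck_on 1 UNIV (pd \<phi> v)" for v using smooth_on_pd[OF \<phi>] by (simp add: smooth_on_def)
 define F1 where "F1 z = A z * pd B 1 z" for z
 define F2 where "F2 z = A z * pd B \<i> z" for z
 define G1 where "G1 z = pd \<phi> 1 z * Q z" for z
 define G2 where "G2 z = pd \<phi> \<i> z * Q z" for z
 have F: "Ck_on 1 UNIV F1" "Ck_on 1 UNIV F2" and G: "Ck_on 1 UNIV G1" "Ck_on 1 UNIV G2"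
  unfolding F1_def F2_def G1_def G2_def
  by (intro Ck_bilinear[OF bounded_bilinear_mult] AB Q dphi open_UNIV)+
 have F0: "F1 z = 0" "F2 z = 0" "G1 z = 0" "G2 z = 0" "Q z = 0" if "z \<notin> K" for z
  using AB0[OF that] by (auto simp: F1_def F2_def G1_def G2_def Q_def)
 have mult: "pd (\<lambda>z. f z * g z) v z = f z * pd g v z + pd f v z * g z"
  if "Ck_on 1 UNIV f" "Ck_on 1 UNIV g" for f g :: "complex => real" and v z
  using pd_bilinear[OF bounded_bilinear_mult, of f UNIV g z v] that by simp
 have dQ: "pd Q v z = 2 * (A z * pd A v z + B z * pd B v z)" for v z
  unfolding Q_def[abs_def]
  by (subst pd_add[of _ UNIV]) (use AB in \<open>auto simp: mult intro!: differentiable_on_mult simp: Ck_1\<close>)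
 have comm: "pd (pd B 1) \<i> z = pd (pd B \<i>) 1 z" for z by (rule pd_commute_C2[OF open_UNIV AB2(2)]) auto
 \<comment> \<open>The divergence terms: derivatives of functions supported in K, so R integrates to
   zero.\<close>
 define R where "R z = 4 * pd F1 \<i> z - 4 * pd F2 1 z - 2 * t * pd G1 1 z - 2 * t * pd G2 \<i> z" for z
 define lap where "lap z = pd (pd \<phi> 1) 1 z + pd (pd \<phi> \<i>) \<i> z" for z
 define L where "L z = ((pd a 1 z - pd b \<i> z)^2 + (pd b 1 z + pd a \<i> z)^2) * exp (2 * t * \<phi> z)" for z
 have EE: "exp (2 * t * \<phi> z) = E z * E z" for z by (simp add: E_def exp_add[symmetric])
 have pw: "2 * t * lap z * Q z + R z \<le> L z" for z
 proof -
  let ?X = "pd A 1 z" and ?Y = "pd A \<i> z" and ?U = "pd B 1 z" and ?V = "pd B \<i> z"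
  let ?px = "pd \<phi> 1 z" and ?py = "pd \<phi> \<i> z"
  have 1: "E z * (pd a 1 z - pd b \<i> z) = ?X - ?V - t * (?px * A z - ?py * B z)"
   "E z * (pd b 1 z + pd a \<i> z) = ?U + ?Y - t * (?px * B z + ?py * A z)"
   by (simp_all add: dA dB algebra_simps)
  have "L z = (E z * (pd a 1 z - pd b \<i> z))^2 + (E z * (pd b 1 z + pd a \<i> z))^2"
   unfolding L_def EE by (simp add: power2_eq_square algebra_simps)
  also have "\<dots> \<ge> 4 * (?U * ?Y - ?X * ?V) - 4 * t * (?px * (A z * ?X + B z * ?U) + ?py * (A z * ?Y + B z * ?V))"
   unfolding 1 using carleman_identity[of ?X ?V t ?px "A z" ?py "B z" ?U ?Y]
    sum_power2_ge_zero[of "?X + ?V + t * (?px * A z + ?py * B z)" "?U - ?Y + t * (?px * B z - ?py * A z)"]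
   by linarith
  finally have "L z \<ge> 4 * (?U * ?Y - ?X * ?V) - 2 * t * (?px * pd Q 1 z + ?py * pd Q \<i> z)"
   by (simp add: dQ algebra_simps)
  moreover have "pd F1 \<i> z - pd F2 1 z = ?U * ?Y - ?X * ?V"
   unfolding F1_def[abs_def] F2_def[abs_def] by (simp add: mult[OF AB(1) AB(4)] comm)
  moreover have "pd G1 1 z + pd G2 \<i> z = lap z * Q z + (?px * pd Q 1 z + ?py * pd Q \<i> z)"
   unfolding G1_def[abs_def] G2_def[abs_def] lap_def by (simp add: mult[OF dphi Q]) (simp add: algebra_simps)
  moreover have "R z = 4 * (pd F1 \<i> z - pd F2 1 z) - 2 * t * (pd G1 1 z + pd G2 \<i> z)"
   by (simp add: R_def algebra_simps)
  ultimately show ?thesis by (simp add: algebra_simps)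
 qed
 have int: "f integrable_on K" if "continuous_on UNIV f" for f :: "complex => real"
  by (rule integrable_on_compact[OF K continuous_on_subset[OF that]]) simp
 have I: "pd F1 v integrable_on K" "pd F2 v integrable_on K" "pd G1 v integrable_on K" "pd G2 v integrable_on K"
  and I0: "integral K (pd F1 v) = 0" "integral K (pd F2 v) = 0" "integral K (pd G1 v) = 0" "integral K (pd G2 v) = 0" for v
  using F G by (auto intro!: int integral_pd_eq_0_real K F0)
 have R: "R integrable_on K" "integral K R = 0"
  unfolding R_def using I I0 by (simp_all add: Henstock_Kurzweil_Integration.integral_diff integrable_diff integrable_on_mult_right)
 have Qc: "continuous_on UNIV Q" using Q by (simp add: differentiable_imp_continuous_on)
 have Qi: "(\<lambda>z. 2 * t * c * Q z) integrable_on K" by (intro int continuous_intros Qc)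
 have Li: "L integrable_on K"
  unfolding L_def using Ck_2_1[OF a] Ck_2_1[OF b] smooth_on_continuous[OF \<phi>] by (intro int continuous_intros) auto
 have "integral K (\<lambda>z. 2 * t * c * Q z + R z) \<le> integral K L"
 proof (rule integral_le)
  fix z assume z: "z \<in> K"
  have "2 * t * (c * Q z) \<le> 2 * t * (lap z * Q z)"
   using c[OF z] t by (intro mult_left_mono mult_right_mono) (auto simp: lap_def Q_def)
  with pw[of z] show "2 * t * c * Q z + R z \<le> L z" by simp
 qed (use Qi R Li in \<open>auto intro: integrable_add\<close>)
 moreover have "integral K (\<lambda>z. 2 * t * c * Q z + R z) = 2 * t * c * integral K Q"
  by (subst Henstock_Kurzweil_Integration.integral_add) (use Qi R in auto)
 moreover have "Q = (\<lambda>z. (cmod (g z))^2 * exp (2 * t * \<phi> z))"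
  unfolding EE cmod_power2 by (rule ext) (simp add: Q_def A_def B_def a_def b_def power2_eq_square algebra_simps)
 moreover have "L = (\<lambda>z. 4 * (cmod (dzb g z))^2 * exp (2 * t * \<phi> z))"
  using g by (simp add: fun_eq_iff L_def cmod_dzb Ck_2 a_def[abs_def] b_def[abs_def])
 ultimately show ?thesis by simp
qed

section \<open>Unique continuation\<close>

text \<open>The median formula. The circle about the midpoint of p and q through p touches the ball
  about q from inside at p, and outside that ball the squared distance from the midpoint exceeds its
  value at p by at least |z - p|^2 / 2.\<close>

lemma tangent_ball_dist:
 fixes p q z :: complex
 shows "(cmod (z - (p + q) / 2))^2 = (cmod (z - q))^2 / 2 + (cmod (z - p))^2 / 2 - (cmod (p - q))^2 / 4"
 unfolding cmod_power2 by (simp add: power2_eq_square field_simps)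

text \<open>If G were positive at p, a box around p on which G and phi - phi1 exceed some \<eta> > 0
  would contribute at least a constant times exp (2 t (phi1 + \<eta>)), which outgrows the upper
  bound as t tends to infinity.\<close>

lemma exp_weight_eq_0:
 fixes G \<phi> :: "'a::euclidean_space => real"
 assumes K: "compact K" and c: "continuous_on K G" "continuous_on K \<phi>" and nn: "\<And>z. z \<in> K ==> G z \<ge> 0"
  and bd: "\<And>t. t \<ge> t0 ==> integral K (\<lambda>z. G z * exp (2 * t * \<phi> z)) \<le> b * exp (2 * t * \<phi>1)"
  and p: "p \<in> interior K" "\<phi>1 < \<phi> p"
 shows "G p = 0"
proof (rule ccontr)
 assume "G p \<noteq> 0"
 hence Gp: "G p > 0" using nn[of p] p interior_subset by fastforce
 define \<eta> where "\<eta> = min (G p) (\<phi> p - \<phi>1) / 2"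
 have \<eta>: "\<eta> > 0" "\<eta> < G p" "\<phi>1 + \<eta> < \<phi> p" using Gp p(2) by (simp_all add: \<eta>_def min_def field_simps)
 have "open (interior K \<inter> G -` {\<eta><..} \<inter> (interior K \<inter> \<phi> -` {\<phi>1 + \<eta><..}))"
  by (intro open_Int continuous_open_preimage continuous_on_subset[OF c(1)] continuous_on_subset[OF c(2)] interior_subset open_interior open_greaterThan)
 then obtain a b' where ab: "cbox a b' \<subseteq> interior K \<inter> G -` {\<eta><..} \<inter> (interior K \<inter> \<phi> -` {\<phi>1 + \<eta><..})" "p \<in> box a b'"
  using \<eta> p(1) by (elim open_contains_cbox[where x=p]) auto
 define V where "V = measure lborel (cbox a b')"
 have V: "V > 0" using ab(2) unfolding V_def by (auto simp: content_pos_lt_eq mem_box)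
 have QK: "cbox a b' \<subseteq> K" using ab(1) interior_subset by blast
 have "\<eta> * V * exp (2 * t * \<eta>) \<le> b" if t: "t \<ge> t0" "t \<ge> 0" for t
 proof -
  have i: "(\<lambda>z. G z * exp (2 * t * \<phi> z)) integrable_on X" if "compact X" "X \<subseteq> K" for X
   by (intro integrable_on_compact continuous_intros that continuous_on_subset[OF c(1)] continuous_on_subset[OF c(2)])
  have "V * (\<eta> * exp (2 * t * (\<phi>1 + \<eta>))) = integral (cbox a b') (\<lambda>_. \<eta> * exp (2 * t * (\<phi>1 + \<eta>)))" by (simp add: V_def)
  also have "\<dots> \<le> integral (cbox a b') (\<lambda>z. G z * exp (2 * t * \<phi> z))"
   using ab(1) t \<eta>(1) by (intro integral_le i QK mult_mono) (auto intro!: mult_left_mono)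
  also have "\<dots> \<le> integral K (\<lambda>z. G z * exp (2 * t * \<phi> z))"
   by (intro integral_subset_le QK i K) (auto simp: nn)
  also have "\<dots> \<le> b * exp (2 * t * \<phi>1)" by (rule bd[OF t(1)])
  finally show ?thesis by (simp add: exp_add algebra_simps)
 qed
 \<comment> \<open>So large that the bound exp x >= x already gives a contradiction: \<eta> V (2 t
   \<eta>) >= |b| + 1.\<close>
 moreover define t where "t = max t0 ((\<bar>b\<bar> + 1) / (2 * \<eta> * (\<eta> * V)))"
 moreover have t: "t \<ge> t0" "(\<bar>b\<bar> + 1) / (2 * \<eta> * (\<eta> * V)) \<le> t" by (auto simp: t_def)
 moreover have "0 \<le> (\<bar>b\<bar> + 1) / (2 * \<eta> * (\<eta> * V))" using \<eta> V by simp
 ultimately have "\<eta> * V * exp (2 * t * \<eta>) \<le> b" by force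
 moreover have "\<bar>b\<bar> + 1 \<le> \<eta> * V * (2 * t * \<eta>)" using t(2) \<eta> V by (simp add: field_simps)
 moreover have "\<eta> * V * (2 * t * \<eta>) \<le> \<eta> * V * exp (2 * t * \<eta>)"
  using exp_ge_add_one_self[of "2 * t * \<eta>"] \<eta> V by (intro mult_left_mono) (linarith, simp)
 ultimately show False by linarith
qed

lemma Ck_zero_extension:
 assumes S: "open S" and K: "compact K" "K \<subseteq> S" and f: "Ck_on k S f" and f0: "\<And>z. z \<in> S - K ==> f z = 0"
 shows "Ck_on k UNIV (\<lambda>z. if z \<in> S then f z else 0)"
proof (rule Ck_local)
 fix z
 have o: "open (- K)" using K compact_imp_closed by blast
 have "Ck_on k (- K) (\<lambda>z. if z \<in> S then f z else 0)" by (rule Ck_congD[OF o Ck_const[of k _ 0]]) (use f0 in auto)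
 moreover have "Ck_on k S (\<lambda>z. if z \<in> S then f z else 0)" by (rule Ck_congD[OF S f]) simp
 ultimately show "\<exists>T. open T \<and> z \<in> T \<and> T \<subseteq> UNIV \<and> Ck_on k T (\<lambda>z. if z \<in> S then f z else 0)"
  using K o S by (cases "z \<in> K") blast+
qed

abbreviation "tot W z \<equiv> \<Sum>w\<in>W. cmod (w z :: complex)"

text \<open>The functions vanish on a ball with p on its boundary. A weight whose level sets touch
  that ball only at p makes the error caused by the cutoff exponentially smaller than the
  contribution near p, while for large t the term C \<open>tot\<close> is absorbed by the left side
  of the Carleman estimate.\<close>

lemma unique_continuation_local:
 fixes W :: "(complex => complex) set"
 assumes W: "finite W" and S: "open S" "p \<in> S" and C2: "\<And>w. w \<in> W ==> Ck_on 2 S w"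
  and bd: "\<And>w z. w \<in> W ==> z \<in> S ==> cmod (dzb w z) \<le> C * tot W z"
  and R: "R > 0" "cmod (p - q) = R" and zero: "\<And>w z. w \<in> W ==> z \<in> S ==> cmod (z - q) < R ==> w z = 0"
 shows "\<exists>r>0. ball p r \<subseteq> S \<and> (\<forall>w\<in>W. \<forall>z\<in>ball p r. w z = 0)"
proof -
 obtain r0 where r0: "r0 > 0" "cball p r0 \<subseteq> S" using S open_contains_cball by blast
 \<comment> \<open>With 2 d <= R / 32 the value of \<open>s\<close> stays within s0 / 7 of s0 on the
   support of the cutoff.\<close>
 define d where "d = min (r0 / 2) (R / 64)"
 have d: "d > 0" "2 * d \<le> r0" "64 * d \<le> R" using r0 R by (auto simp: d_def)
 define q' where "q' = (p + q) / 2"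
 define s where "s z = (cmod (z - q'))^2" for z
 define s0 where "s0 = R^2 / 4"
 \<comment> \<open>M lies between s0 and 2 s0. Near p this gives s < M, so that phi decreases away
   from q', and M < 2 s, so that the Laplacian 16 s - 8 M of phi is positive.\<close>
 define M where "M = 3 / 2 * s0"
 define \<phi> where "\<phi> z = (M - s z) * (M - s z)" for z
 have s0: "s0 > 0" using R by (simp add: s0_def)
 have pq': "cmod (p - q') = R / 2"
 proof -
  have "p - q' = (p - q) / 2" by (simp add: q'_def field_simps)
  hence "cmod (p - q') = cmod (p - q) / 2" by (simp only: norm_divide) simp
  thus ?thesis using R by simp
 qed
 have sp: "s p = s0" by (simp add: s_def pq' s0_def power2_eq_square)
 have s_near: "\<bar>s z - s0\<bar> \<le> s0 / 7" if "cmod (z - p) \<le> 2 * d" for z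
 proof -
  have 1: "cmod (z - q') \<le> R / 2 + R / 32"
   using norm_triangle_ineq[of "z - p" "p - q'"] that d pq' by simp
  have 2: "R / 2 - R / 32 \<le> cmod (z - q')"
   using norm_triangle_ineq4[of "z - q'" "z - p"] that d pq' by simp
  have "s z \<le> (R / 2 + R / 32)^2" unfolding s_def using 1 by (intro power_mono) auto
  moreover have "(R / 2 - R / 32)^2 \<le> s z" unfolding s_def using 2 R by (intro power_mono) auto
  moreover have "(R / 2 + R / 32)^2 = 289 / 1024 * R^2" "(R / 2 - R / 32)^2 = 225 / 1024 * R^2"
   by (simp_all add: field_simps)
  moreover have "R^2 \<ge> 0" by simp
  ultimately show ?thesis unfolding s0_def by linarith
 qed
 have s_out: "s z \<ge> s0 + (cmod (z - p))^2 / 2" if "cmod (z - q) \<ge> R" for z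
 proof -
  have "R^2 \<le> (cmod (z - q))^2" using that R by (intro power_mono) auto
  thus ?thesis unfolding s_def q'_def tangent_ball_dist s0_def R(2) by simp
 qed
 have s_smooth: "smooth_on UNIV s"
  unfolding s_def power2_norm_eq_inner by (intro smooth_intros open_UNIV)
 have \<phi>: "smooth_on UNIV \<phi>" unfolding \<phi>_def by (intro smooth_intros s_smooth open_UNIV)
 have ds: "pd s v z = 2 * ((z - q') \<bullet> v)" for v z
  unfolding s_def power2_norm_eq_inner
  by (rule pd_eqI) (auto intro!: derivative_eq_intros simp: inner_commute)
 have d\<phi>: "pd \<phi> v z = -4 * (M - s z) * ((z - q') \<bullet> v)" for v z
  unfolding \<phi>_def
  by (rule pd_eqI) (auto intro!: derivative_eq_intros smooth_on_has_derivative[OF s_smooth] simp: ds algebra_simps)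
 have dd\<phi>: "pd (pd \<phi> v) v z = 8 * ((z - q') \<bullet> v) * ((z - q') \<bullet> v) - 4 * (M - s z) * (v \<bullet> v)" for v z
  unfolding d\<phi>[abs_def]
  by (rule pd_eqI) (auto intro!: derivative_eq_intros smooth_on_has_derivative[OF s_smooth] simp: ds algebra_simps)
 have lap: "pd (pd \<phi> 1) 1 z + pd (pd \<phi> \<i>) \<i> z = 16 * s z - 8 * M" for z
  unfolding dd\<phi> s_def cmod_power2 by (simp add: power2_eq_square algebra_simps)
 define K where "K = cball p (2 * d)"
 have K: "compact K" "K \<subseteq> S" using r0 d by (auto simp: K_def)
 have lapK: "s0 \<le> pd (pd \<phi> 1) 1 z + pd (pd \<phi> \<i>) \<i> z" if "z \<in> K" for z
 proof -
  have "cmod (z - p) \<le> 2 * d" using that by (simp add: K_def dist_norm norm_minus_commute)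
  from s_near[OF this] have "13 * s0 \<le> 16 * s z"  by linarith
  thus ?thesis by (simp add: lap M_def)
 qed
 define g where "g w z = (if z \<in> S then of_real (bump p d z) * w z else 0)" for w :: "complex => complex" and z
 have g0: "g w z = 0" if "z \<notin> K" for w z
  using bump_0[of d z p] d that by (simp add: g_def K_def dist_norm norm_minus_commute)
 have g2: "Ck_on 2 UNIV (g w)" if w: "w \<in> W" for w
  unfolding g_def
 proof (rule Ck_zero_extension[OF S(1) K])
  have "smooth_on S (\<lambda>z. complex_of_real (bump p d z))"
   using smooth_on_of_real[OF S(1) smooth_on_subset[OF smooth_on_bump[OF d(1)]]] by simp
  thus "Ck_on 2 S (\<lambda>z. of_real (bump p d z) * w z)"
   by (intro Ck_bilinear[OF bounded_bilinear_mult S(1) _ C2[OF w]]) (simp add: smooth_on_def)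
 qed (use bump_0[of d _ p] d in \<open>auto simp: K_def dist_norm norm_minus_commute\<close>)
 have gc: "continuous_on UNIV (g w)" "continuous_on UNIV (dzb (g w))" (is ?h1) if w: "w \<in> W" for w
 proof -
  have "continuous_on UNIV (pd (g w) v)" for v using Ck_2_1[OF g2[OF w]] by simp
  thus ?h1 unfolding dzb_def[abs_def] by (intro continuous_intros) auto
  show "continuous_on UNIV (g w)" using g2[OF w] by (auto simp: Ck_2 intro: differentiable_imp_continuous_on)
 qed
 have \<phi>c: "continuous_on X \<phi>" for X using smooth_on_continuous[OF \<phi>] continuous_on_subset by blast
 define G where "G z = (\<Sum>w\<in>W. (cmod (g w z))^2)" for z
 define H where "H z = (\<Sum>w\<in>W. 4 * (cmod (dzb (g w) z))^2)" for z
 define E where "E t z = exp (2 * t * \<phi> z)" for t z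
 note cg = continuous_on_subset[OF gc(1)] continuous_on_subset[OF gc(2)]
 have cont: "continuous_on X G" "continuous_on X H" "continuous_on X (E t)" for X t
  unfolding G_def[abs_def] H_def[abs_def] E_def[abs_def] by (intro continuous_intros \<phi>c cg; simp)+
 have int: "f integrable_on K" if "continuous_on K f" for f :: "complex => real"
  by (rule integrable_on_compact[OF K(1) that])
 have carl: "2 * t * s0 * integral K (\<lambda>z. G z * E t z) \<le> integral K (\<lambda>z. H z * E t z)" if t: "t \<ge> 0" for t
 proof -
  have "integral K (\<lambda>z. G z * E t z) = (\<Sum>w\<in>W. integral K (\<lambda>z. (cmod (g w z))^2 * E t z))"
   "integral K (\<lambda>z. H z * E t z) = (\<Sum>w\<in>W. integral K (\<lambda>z. 4 * (cmod (dzb (g w) z))^2 * E t z))"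
   unfolding G_def H_def sum_distrib_right
   by (intro Henstock_Kurzweil_Integration.integral_sum W int continuous_intros cont cg; simp)+
  thus ?thesis
   using sum_mono[of W "\<lambda>w. 2 * t * s0 * integral K (\<lambda>z. (cmod (g w z))^2 * E t z)" "\<lambda>w. integral K (\<lambda>z. 4 * (cmod (dzb (g w) z))^2 * E t z)"]
    carleman[OF g2 \<phi> K(1) g0 lapK t] by (simp add: sum_distrib_left E_def)
 qed
 \<comment> \<open>The largest value of phi on the part of the cutoff region, at distance at least d
   from p, that lies outside the ball of zeros; it is smaller than phi at p.\<close>
 define \<phi>1 where "\<phi>1 = (M - s0 - d^2 / 2)^2"
 define n where "n = real (card W)"
 \<comment> \<open>One factor n from Cauchy-Schwarz for the square of a sum, the other from summing
   over W.\<close>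
 define m where "m = 4 * C^2 * n * n"
 have G0: "G z \<ge> 0" for z unfolding G_def by (intro sum_nonneg) auto
 have m0: "m * G z \<ge> 0" for z using G0 by (simp add: m_def n_def)
 \<comment> \<open>Near p the cutoff is 1 and the differential inequality applies; inside the ball
   of zeros everything vanishes; in the remaining transition region only the smallness of the weight
   is used.\<close>
 have pw: "H z \<le> m * G z \<or> \<phi> z \<le> \<phi>1" if z: "z \<in> K" for z
 proof -
  consider "cmod (z - p) < d" | "cmod (z - q) < R" | "cmod (z - p) \<ge> d" "cmod (z - q) \<ge> R" by linarith
  thus ?thesis
  proof cases
   case 1
   have gw: "g w z' = w z'" if "z' \<in> ball p d" for z' w
    using bump_1[of d z' p] d that K by (auto simp: g_def K_def dist_norm norm_minus_commute subset_iff)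
   have zb: "z \<in> ball p d" using 1 by (simp add: dist_norm norm_minus_commute)
   have "4 * (cmod (dzb (g w) z))^2 \<le> 4 * C^2 * n * G z" if w: "w \<in> W" for w
   proof -
    have "dzb (g w) z = dzb w z" by (rule dzb_cong[OF open_ball zb gw])
    hence "cmod (dzb (g w) z) \<le> C * (\<Sum>w\<in>W. cmod (g w z))"
     using bd[OF w] K z gw[OF zb] by auto
    hence "(cmod (dzb (g w) z))^2 \<le> (C * (\<Sum>w\<in>W. cmod (g w z)))^2" by (intro power_mono) auto
    also have "\<dots> \<le> C^2 * (G z * n)"
     unfolding power_mult_distrib n_def G_def by (intro mult_left_mono sum_squared_le_sum_of_squares W) auto
    finally show ?thesis by (simp add: mult_ac)
   qed
   hence "H z \<le> n * (4 * C^2 * n * G z)" unfolding H_def n_def by (intro sum_bounded_above)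
   thus ?thesis by (simp add: m_def algebra_simps)
  next
   case 2
   have "dzb (g w) z = 0" if w: "w \<in> W" for w
    using dzb_cong[of "ball q R" z "g w" "\<lambda>_. 0"] 2 zero[OF w] by (auto simp: g_def dzb_def dist_norm norm_minus_commute)
   hence "H z = 0" by (simp add: H_def)
   thus ?thesis using m0 by simp
  next
   case 3
   have zK: "cmod (z - p) \<le> 2 * d" using z by (simp add: K_def dist_norm norm_minus_commute)
   have "d^2 \<le> (cmod (z - p))^2" using 3 d by (intro power_mono) auto
   hence "s z \<ge> s0 + d^2 / 2" using s_out[OF 3(2)] by linarith
   moreover have "s z \<le> M" using s_near[OF zK] s0 unfolding M_def by linarith
   ultimately have "(M - s z)^2 \<le> (M - s0 - d^2 / 2)^2" by (intro power_mono) auto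
   thus ?thesis by (simp add: \<phi>_def \<phi>1_def power2_eq_square)
  qed
 qed
 obtain B where B: "\<And>z. z \<in> K ==> norm (H z) \<le> B"
  using compact_imp_bounded[OF compact_continuous_image[OF cont(2) K(1)]] unfolding bounded_iff by auto
 \<comment> \<open>For such t the gain 2 t s0 exceeds the loss m by at least 1, so the term with G
   can be moved to the left.\<close>
 have bound: "integral K (\<lambda>z. G z * exp (2 * t * \<phi> z)) \<le> B * integral K (\<lambda>_. 1) * exp (2 * t * \<phi>1)"
  if t: "t \<ge> (m + 1) / (2 * s0)" for t
 proof -
  have "m \<ge> 0" by (simp add: m_def n_def)
  hence t0: "t \<ge> 0" "m + 1 \<le> 2 * t * s0" using t s0 by (auto simp: field_simps intro: order_trans[OF _ t])
  have "integral K (\<lambda>z. G z * E t z) \<ge> 0" by (intro integral_nonneg int continuous_intros cont) (simp add: G0 E_def)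
  hence "(m + 1) * integral K (\<lambda>z. G z * E t z) \<le> 2 * t * s0 * integral K (\<lambda>z. G z * E t z)"
   by (rule mult_right_mono[OF t0(2)])
  also have "\<dots> \<le> integral K (\<lambda>z. H z * E t z)" by (rule carl[OF t0(1)])
  also have "\<dots> \<le> integral K (\<lambda>z. m * (G z * E t z) + B * exp (2 * t * \<phi>1) * 1)"
  proof (intro integral_le int continuous_intros cont)
   fix z assume z: "z \<in> K"
   have B': "H z \<le> B" "0 \<le> B" using B[OF z] by (auto intro: order_trans[OF norm_ge_zero])
   have mE: "0 \<le> m * G z * E t z" using m0 by (simp add: E_def)
   show "H z * E t z \<le> m * (G z * E t z) + B * exp (2 * t * \<phi>1) * 1"
   proof (cases "H z \<le> m * G z")
    case True
    hence "H z * E t z \<le> m * G z * E t z" by (intro mult_right_mono) (simp_all add: E_def)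
    thus ?thesis using B' by (simp add: add_increasing2)
   next
    case False
    hence "E t z \<le> exp (2 * t * \<phi>1)" using pw[OF z] t0 by (simp add: E_def mult_left_mono)
    hence "H z * E t z \<le> B * exp (2 * t * \<phi>1)" using B' by (intro mult_mono) (auto simp: E_def)
    thus ?thesis using mE by simp
   qed
  qed
  also have "\<dots> = m * integral K (\<lambda>z. G z * E t z) + B * exp (2 * t * \<phi>1) * integral K (\<lambda>_. 1)"
   unfolding integral_mult_right[symmetric]
   by (intro Henstock_Kurzweil_Integration.integral_add int continuous_intros cont)
  finally show ?thesis by (simp add: algebra_simps E_def)
 qed
 have "\<phi>1 < \<phi> p"
 proof -
  have "(2 * d)^2 \<le> (R / 32)^2" using d by (intro power_mono) auto
  hence "d^2 / 2 < M - s0" using s0 by (simp add: M_def s0_def power2_eq_square)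
  hence "(M - s0 - d^2 / 2)^2 < (M - s0)^2" using d by (intro power_strict_mono) auto
  thus ?thesis by (simp add: \<phi>_def sp \<phi>1_def power2_eq_square)
 qed
 moreover have "open (\<phi> -` {\<phi>1<..})" by (intro open_vimage open_greaterThan \<phi>c)
 ultimately obtain r1 where r1: "r1 > 0" "ball p r1 \<subseteq> \<phi> -` {\<phi>1<..}" using open_contains_ball by (metis greaterThan_iff vimageI)
 have sub: "ball p (min d r1) \<subseteq> interior K" unfolding K_def interior_cball using d by (auto simp: ball_def)
 have "w z = 0" if w: "w \<in> W" and z: "z \<in> ball p (min d r1)" for w z
 proof -
  have "G z = 0" by (rule exp_weight_eq_0[OF K(1) cont(1) \<phi>c G0 bound]) (use sub z r1 in auto)
  hence "g w z = 0" using w W by (simp add: G_def sum_nonneg_eq_0_iff)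
  thus ?thesis
   using bump_1[of d z p] d z K sub interior_subset[of K] by (auto simp: g_def dist_norm norm_minus_commute subset_iff)
 qed
 thus ?thesis using r1 d sub interior_subset[of K] K(2) by (intro exI[of _ "min d r1"]) auto
qed

text \<open>The constant may depend on the point, so the notion is stable under multiplication by
  continuous functions. An expression that is linear in members of W and their conjugates satisfies
  it by mere syntax.\<close>

definition lbd :: "complex set => (complex => complex) set => (complex => complex) => bool" where
 "lbd S W f \<longleftrightarrow> (\<forall>p\<in>S. \<exists>r>0. \<exists>C. \<forall>z\<in>S \<inter> ball p r. cmod (f z) \<le> C * tot W z)"

lemma lbdE:
 assumes "lbd S W f" "p \<in> S"
 obtains r C where "r > 0" "C \<ge> 0" "\<And>z. z \<in> S ==> dist p z < r ==> cmod (f z) \<le> C * tot W z"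
proof -
 obtain r C where rC: "r > 0" "\<And>z. z \<in> S \<inter> ball p r ==> cmod (f z) \<le> C * tot W z"
  using assms unfolding lbd_def by meson
 have "cmod (f z) \<le> max C 0 * tot W z" if "z \<in> S" "dist p z < r" for z
  using order_trans[OF rC(2)[of z] mult_right_mono[of C "max C 0"]] that by (simp add: sum_nonneg)
 thus ?thesis using rC(1) that[of r "max C 0"] by simp
qed

lemma lbd_base: "finite W ==> w \<in> W ==> lbd S W w"
 unfolding lbd_def by (intro ballI exI[of _ 1] conjI) (auto intro!: member_le_sum)

lemma lbd_0: "lbd S W (\<lambda>_. 0)"
 unfolding lbd_def by (intro ballI exI[of _ 1] conjI) (auto intro: sum_nonneg)

lemma lbd_cong: "lbd S W f ==> (\<And>z. z \<in> S ==> g z = f z) ==> lbd S W g"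
 unfolding lbd_def by simp

lemma lbd_add: "lbd S W f ==> lbd S W g ==> lbd S W (\<lambda>z. f z + g z)"
proof (unfold lbd_def[of S W "\<lambda>z. f z + g z"], intro ballI)
 fix p assume f: "lbd S W f" and g: "lbd S W g" and p: "p \<in> S"
 obtain r C where 1: "r > 0" "\<And>z. z \<in> S ==> dist p z < r ==> cmod (f z) \<le> C * tot W z"
  using lbdE[OF f p] by metis
 obtain r' C' where 2: "r' > 0" "\<And>z. z \<in> S ==> dist p z < r' ==> cmod (g z) \<le> C' * tot W z"
  using lbdE[OF g p] by metis
 have "cmod (f z + g z) \<le> (C + C') * tot W z" if "z \<in> S \<inter> ball p (min r r')" for z
  using norm_triangle_ineq[of "f z" "g z"] 1(2)[of z] 2(2)[of z] that by (simp add: distrib_right)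
 thus "\<exists>r>0. \<exists>C. \<forall>z\<in>S \<inter> ball p r. cmod (f z + g z) \<le> C * tot W z"
  using 1(1) 2(1) by (intro exI[of _ "min r r'"] conjI exI[of _ "C + C'"] ballI) auto
qed

lemma lbd_mult_left:
 assumes "lbd S W f" "continuous_on S g"
 shows "lbd S W (\<lambda>z. g z * f z)"
 unfolding lbd_def
proof
 fix p assume p: "p \<in> S"
 obtain r C where 1: "r > 0" "C \<ge> 0" "\<And>z. z \<in> S ==> dist p z < r ==> cmod (f z) \<le> C * tot W z"
  using lbdE[OF assms(1) p] by metis
 obtain d where d: "d > 0" "\<And>z. z \<in> S ==> dist z p < d ==> dist (g z) (g p) < 1"
  using assms(2) p unfolding continuous_on_iff by (metis zero_less_one)
 have "cmod (g z * f z) \<le> ((cmod (g p) + 1) * C) * tot W z" if "z \<in> S \<inter> ball p (min r d)" for z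
 proof -
  have "cmod (g z) \<le> cmod (g p) + 1"
   using d(2)[of z] that norm_triangle_ineq2[of "g z" "g p"] by (simp add: dist_norm norm_minus_commute)
  hence "cmod (g z) * cmod (f z) \<le> (cmod (g p) + 1) * (C * tot W z)"
   using 1(3)[of z] that by (intro mult_mono) auto
  thus ?thesis by (simp add: norm_mult)
 qed
 thus "\<exists>r>0. \<exists>C. \<forall>z\<in>S \<inter> ball p r. cmod (g z * f z) \<le> C * tot W z"
  using 1(1) d(1) by (intro exI[of _ "min r d"] conjI exI[of _ "(cmod (g p) + 1) * C"] ballI) auto
qed

lemma lbd_mult_right: "lbd S W f ==> continuous_on S g ==> lbd S W (\<lambda>z. f z * g z)"
 using lbd_mult_left[of S W f g] by (simp add: mult.commute)

lemma lbd_cmult: "lbd S W f ==> lbd S W (\<lambda>z. c * f z)"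
 by (rule lbd_mult_left) auto

lemma lbd_uminus: "lbd S W f ==> lbd S W (\<lambda>z. - f z)"
 by (simp add: lbd_def)

lemma lbd_diff: "lbd S W f ==> lbd S W g ==> lbd S W (\<lambda>z. f z - g z)"
 using lbd_add[of S W f "\<lambda>z. - g z"] lbd_uminus[of S W g] by simp

lemma lbd_cnj: "lbd S W f ==> lbd S W (\<lambda>z. cnj (f z))"
 by (simp add: lbd_def)

lemma lbd_sum: "(\<And>i. i \<in> A ==> lbd S W (f i)) ==> lbd S W (\<lambda>z. \<Sum>i\<in>A. f i z)"
 by (induction A rule: infinite_finite_induct) (auto intro: lbd_0 lbd_add)

lemma lbd_uniform:
 assumes "finite F" "\<And>f. f \<in> F ==> lbd S W (g f)" "p \<in> S"
 shows "\<exists>r>0. \<exists>C. \<forall>f\<in>F. \<forall>z\<in>S. dist p z < r \<longrightarrow> cmod (g f z) \<le> C * tot W z"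
 using assms(1,2)
proof (induction F)
 case empty
 thus ?case by (intro exI[of _ 1]) auto
next
 case (insert f F)
 obtain r C where 1: "r > 0" "\<And>f z. f \<in> F ==> z \<in> S ==> dist p z < r ==> cmod (g f z) \<le> C * tot W z"
  using insert by (metis insertCI)
 obtain r' C' where 2: "r' > 0" "\<And>z. z \<in> S ==> dist p z < r' ==> cmod (g f z) \<le> C' * tot W z"
  using lbdE[OF insert.prems[OF insertI1] assms(3)] by metis
 have 3: "c * tot W z \<le> max C C' * tot W z" if "c = C \<or> c = C'" for c z
  using that by (intro mult_right_mono sum_nonneg) auto
 have "cmod (g f' z) \<le> max C C' * tot W z"
  if "f' \<in> insert f F" "z \<in> S" "dist p z < min r r'" for f' z
  using that 1(2)[of f' z] 2(2)[of z] 3[of C z] 3[of C' z] by auto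
 thus ?case using 1(1) 2(1) by (intro exI[of _ "min r r'"] conjI exI[of _ "max C C'"]) auto
qed

text \<open>Let Z be the interior of the common zero set. If Z had a boundary point in S, the
  largest ball in Z about a point q of Z close to it would touch the complement at a point p' of S,
  and the local theorem at p' would enlarge Z.\<close>

theorem unique_continuation_open:
 fixes W :: "(complex => complex) set"
 assumes W: "finite W" and S: "open S" "connected S" and sm: "\<And>w. w \<in> W ==> smooth_on S w"
  and bd: "\<And>w. w \<in> W ==> lbd S W (dzb w)"
  and U: "open U" "U \<noteq> {}" "U \<subseteq> S" and zero: "\<And>w z. w \<in> W ==> z \<in> U ==> w z = 0"
  and w: "w \<in> W" and z: "z \<in> S"
 shows "w z = 0"
proof -
 define Z where "Z = interior {z\<in>S. \<forall>w\<in>W. w z = 0}"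
 have Zo: "open Z" by (simp add: Z_def)
 have ZS: "Z \<subseteq> S" "\<And>w z. w \<in> W ==> z \<in> Z ==> w z = 0" using interior_subset by (auto simp: Z_def)
 have "U \<subseteq> Z" unfolding Z_def using U zero by (intro interior_maximal) auto
 hence ne: "Z \<noteq> {}" using U by auto
 have "closedin (top_of_set S) Z"
 proof -
  have "p \<in> Z" if p: "p \<in> S" "p \<in> closure Z" for p
  proof (rule ccontr)
   assume pZ: "p \<notin> Z"
   obtain e where e: "e > 0" "ball p e \<subseteq> S" using S p open_contains_ball by blast
   obtain q where q: "q \<in> Z" "dist q p < e / 2" using p(2) e(1) closure_approachable[of p Z] by (meson half_gt_zero)
   have cl: "closed (- Z)" "- Z \<noteq> {}" using Zo pZ by auto
   obtain p' where p': "p' \<in> - Z" "\<And>y. y \<in> - Z ==> dist q p' \<le> dist q y"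
    using distance_attains_inf[OF cl, of q] by blast
   define R where "R = dist q p'"
   have R: "R > 0" using p'(1) q(1) by (auto simp: R_def)
   have inZ: "y \<in> Z" if "dist q y < R" for y using p'(2)[of y] that unfolding R_def by fastforce
   have "dist q p' \<le> dist q p" using p'(2) pZ by simp
   hence p'S: "p' \<in> S" using e q dist_triangle[of p p' q] by (auto simp: dist_commute)
   obtain r C where r: "r > 0" "\<forall>w\<in>W. \<forall>z\<in>S. dist p' z < r \<longrightarrow> cmod (dzb w z) \<le> C * tot W z"
    using lbd_uniform[of W S W dzb, OF W bd p'S] by auto
   have "\<exists>r'>0. ball p' r' \<subseteq> S \<inter> ball p' r \<and> (\<forall>w\<in>W. \<forall>z\<in>ball p' r'. w z = 0)"
   proof (rule unique_continuation_local[OF W, where q=q and R=R and C=C])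
    show "w z = 0" if "w \<in> W" "z \<in> S \<inter> ball p' r" "cmod (z - q) < R" for w z
     using ZS(2)[OF that(1) inZ] that(3) by (simp add: dist_norm norm_minus_commute)
    show "Ck_on 2 (S \<inter> ball p' r) w" if "w \<in> W" for w
     using sm[OF that] by (auto simp: smooth_on_def intro: Ck_subset)
   qed (use S p'S r R R_def in \<open>auto simp: dist_norm norm_minus_commute\<close>)
   then obtain r' where "r' > 0" "ball p' r' \<subseteq> S" "\<forall>w\<in>W. \<forall>z\<in>ball p' r'. w z = 0" by auto
   hence "p' \<in> Z" unfolding Z_def by (intro interiorI[of "ball p' r'"]) auto
   thus False using p'(1) by simp
  qed
  thus ?thesis using ZS(1) closure_subset by (auto simp: closedin_closed intro!: exI[of _ "closure Z"])
 qed
 moreover have "openin (top_of_set S) Z" using Zo ZS(1) by (simp add: openin_open_eq S)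
 ultimately have "Z = S" using S(2) ne connected_clopen by blast
 thus ?thesis using ZS(2) w z by blast
qed

section \<open>Continuation from the real axis\<close>

lemma pd_1_real_axis:
 assumes S: "open S" and f: "smooth_on S f" and 0: "\<And>x. complex_of_real x \<in> S ==> f (of_real x) = 0"
  and x: "complex_of_real x \<in> S"
 shows "pd f 1 (of_real x) = 0"
proof -
 have g: "(f has_derivative (\<lambda>v. pd f v (of_real x))) (at (of_real x))"
  by (rule smooth_on_has_derivative[OF f S x])
 have "((\<lambda>t. f (of_real t)) has_derivative (\<lambda>h. pd f (of_real h) (of_real x))) (at x)"
  by (rule has_derivative_compose[of complex_of_real complex_of_real x UNIV f "\<lambda>v. pd f v (of_real x)", OF _ g])
   auto
 moreover have "((\<lambda>t. f (of_real t)) has_derivative (\<lambda>_. 0)) (at x)"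
 proof (rule has_derivative_transform_within_open[of "\<lambda>_. 0" _ _ _ "complex_of_real -` S"])
  show "open (complex_of_real -` S)" by (intro open_vimage S continuous_intros)
 qed (use x 0 in auto)
 ultimately have "(\<lambda>h. pd f (of_real h) (of_real x)) = (\<lambda>_. 0)" by (rule has_derivative_unique)
 thus ?thesis by (metis of_real_1)
qed

text \<open>At a point of the axis f and its derivative vanish, so f (z + h) is o(|h|), and this
  survives replacing f by 0 on one side.\<close>

lemma half_plane_extension:
 fixes s :: real
 assumes S: "open S" and f: "f differentiable_on S" and s: "s \<noteq> 0"
  and 0: "\<And>x. complex_of_real x \<in> S ==> f (of_real x) = 0"
  and 1: "\<And>x v. complex_of_real x \<in> S ==> pd f v (of_real x) = 0"
 shows "(\<lambda>z. if s * Im z > 0 then f z else 0) differentiable_on S"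
  and "z \<in> S ==> pd (\<lambda>z. if s * Im z > 0 then f z else 0) v z = (if s * Im z > 0 then pd f v z else 0)"
proof -
 let ?g = "\<lambda>z. if s * Im z > 0 then f z else 0"
 have D: "(?g has_derivative (\<lambda>v. if s * Im z > 0 then pd f v z else 0)) (at z)" if z: "z \<in> S" for z
 proof -
  consider "s * Im z > 0" | "s * Im z < 0" | "Im z = 0" using s linorder_less_linear[of "s * Im z" 0] by auto
  thus ?thesis
  proof cases
   case 1
   have "(?g has_derivative (\<lambda>v. pd f v z)) (at z)"
    by (rule has_derivative_transform_within_open[OF has_derivative_pd[OF f S z], of "{z. s * Im z > 0}"])
     (use 1 in \<open>auto intro!: open_Collect_less continuous_intros\<close>)
   thus ?thesis using 1 by simp
  next
   case 2
   have "(?g has_derivative (\<lambda>v. 0)) (at z)"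
    by (rule has_derivative_transform_within_open[OF has_derivative_const, of "{z. s * Im z < 0}"])
     (use 2 in \<open>auto intro!: open_Collect_less continuous_intros\<close>)
   thus ?thesis using 2 by simp
  next
   case 3
   hence zr: "z = of_real (Re z)" by (simp add: complex_eq_iff)
   have f0: "f z = 0" "\<And>v. pd f v z = 0" using 0[of "Re z"] 1[of "Re z"] zr z by auto
   have "(f has_derivative (\<lambda>v. 0)) (at z)" using has_derivative_pd[OF f S z] f0 by simp
   hence "((\<lambda>h. norm (f (z + h)) / norm h) \<longlongrightarrow> 0) (at 0)" by (simp add: has_derivative_at f0)
   hence "((\<lambda>h. norm (?g (z + h)) / norm h) \<longlongrightarrow> 0) (at 0)"
    by (rule tendsto_sandwich[OF _ _ tendsto_const, rotated 2]) auto
   thus ?thesis using f0 by (simp add: has_derivative_at)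
  qed
 qed
 show "?g differentiable_on S" using D by (auto simp: differentiable_on_def differentiable_def intro: has_derivative_at_withinI)
 show "pd ?g v z = (if s * Im z > 0 then pd f v z else 0)" if "z \<in> S" using pd_eqI[OF D[OF that]] .
qed

lemma half_plane_extension_C2:
 fixes s :: real
 assumes S: "open S" and f: "Ck_on 2 S f" and s: "s \<noteq> 0"
  and 0: "\<And>x. complex_of_real x \<in> S ==> f (of_real x) = 0"
  and 1: "\<And>x v. complex_of_real x \<in> S ==> pd f v (of_real x) = 0"
  and 2: "\<And>x u v. complex_of_real x \<in> S ==> pd (pd f v) u (of_real x) = 0"
 shows "Ck_on 2 S (\<lambda>z. if s * Im z > 0 then f z else 0)"
proof -
 let ?e = "\<lambda>f z. if s * Im z > 0 then f z else 0"
 have fd: "f differentiable_on S" "pd f v differentiable_on S" "continuous_on S (pd (pd f v) u)" for u v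
  using f by (simp_all add: Ck_2)
 note e1 = half_plane_extension[OF S fd(1) s 0 1] and e2 = half_plane_extension[OF S fd(2) s 1 2]
 have c: "continuous_on S (?e g)" if g: "continuous_on S g" and g0: "\<And>x. complex_of_real x \<in> S ==> g (of_real x) = 0"
  for g :: "complex => 'a"
 proof -
  have "g z = 0" if "z \<in> S" "s * Im z = 0" for z using g0[of "Re z"] that s complex_is_Real_iff[of z] by (auto simp: of_real_Re)
  hence "continuous_on S (\<lambda>z. if s * Im z \<le> 0 then 0 else g z)"
   by (intro continuous_on_cases_le continuous_intros continuous_on_subset[OF g]) auto
  thus ?thesis by (rule continuous_on_eq) auto
 qed
 have "Ck_on 1 S (pd (?e f) v)" for v
 proof (rule Ck_congD[OF S _ e1(2)])
  have "continuous_on S (pd (?e (pd f v)) u)" for u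
   by (rule continuous_on_eq[OF c[of "pd (pd f v) u", OF fd(3) 2]]) (simp_all add: e2(2))
  thus "Ck_on 1 S (?e (pd f v))" using e2(1) by simp
 qed
 thus ?thesis using e1(1) by (simp add: Ck_2)
qed

text \<open>If \<^term>\<open>w\<close> vanishes on the real axis, then \<open>w\<^sup>3\<close> vanishes there to order three, so that its
  extension by zero across the axis is twice differentiable; moreover the cubes satisfy a differential
  inequality of the same kind.\<close>

theorem unique_continuation_line:
 fixes W :: "(complex => complex) set"
 assumes W: "finite W" and S: "open S" "connected S" and sm: "\<And>w. w \<in> W ==> smooth_on S w"
  and bd: "\<And>w. w \<in> W ==> lbd S W (dzb w)"
  and x: "complex_of_real x \<in> S" and zero: "\<And>w x. w \<in> W ==> complex_of_real x \<in> S ==> w (of_real x) = 0"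
  and w: "w \<in> W" and z: "z \<in> S"
 shows "w z = 0"
proof -
 define e where "e s w z = (if s * Im z > 0 then w z ^ 3 else 0)" for s :: real and w :: "complex => complex" and z
 obtain r C where r: "r > 0" "\<And>w z. w \<in> W ==> z \<in> S ==> dist (of_real x) z < r ==> cmod (dzb w z) \<le> C * tot W z"
  using lbd_uniform[of W S W dzb, OF W bd x] by auto
 have d1: "pd (\<lambda>z. w z ^ 3) v z = 3 * (w z)^2 * pd w v z" if "w \<in> W" "z \<in> S" for w v z
  by (rule pd_eqI) (auto intro!: derivative_eq_intros smooth_on_has_derivative[OF sm S(1)] that simp: algebra_simps)
 have d2: "pd (pd (\<lambda>z. w z ^ 3) v) u (of_real t) = 0" if w: "w \<in> W" and t: "complex_of_real t \<in> S" for w u v t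
 proof -
  have "pd (pd (\<lambda>z. w z ^ 3) v) u (of_real t) = pd (\<lambda>z. 3 * (w z)^2 * pd w v z) u (of_real t)"
   by (rule pd_cong[OF S(1) t d1[OF w]])
  also have "\<dots> = 0"
   by (rule pd_eqI) (auto intro!: derivative_eq_intros smooth_on_has_derivative[OF sm[OF w] S(1) t]
    smooth_on_has_derivative[OF smooth_on_pd[OF sm[OF w]] S(1) t] simp: zero[OF w t])
  finally show ?thesis .
 qed
 have one_side: "\<exists>r'>0. ball (of_real x) r' \<subseteq> S \<and> (\<forall>w\<in>W. \<forall>z\<in>ball (of_real x) r'. e s w z = 0)" if s: "s = 1 \<or> s = -1" for s
 proof -
  have s0: "s \<noteq> 0" using s by auto
  have C2: "Ck_on 2 S (\<lambda>z. w z ^ 3)" if "w \<in> W" for w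
   using smooth_on_power[OF S(1) sm[OF that], of 3] by (simp add: smooth_on_def)
  have dzb_e: "dzb (e s w) z = (if s * Im z > 0 then 3 * (w z)^2 * dzb w z else 0)" if w: "w \<in> W" and z: "z \<in> S" for w z
   unfolding dzb_def e_def[abs_def]
   using half_plane_extension(2)[of S "\<lambda>z. w z ^ 3", OF S(1) _ s0 _ _ z] C2[OF w] zero[OF w] d1[OF w] z
   by (simp add: Ck_2 distrib_left)
  have "\<exists>r'>0. ball (of_real x) r' \<subseteq> S \<inter> ball (of_real x) r \<and> (\<forall>w'\<in>e s ` W. \<forall>z\<in>ball (of_real x) r'. w' z = 0)"
  \<comment> \<open>The truncated cubes vanish on the half plane s Im z <= 0, which contains the
    unit ball about x - s i; that ball touches the axis at x. The factor 3 is from differentiating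
    the cube.\<close>
  proof (rule unique_continuation_local[where q="of_real x - s *\<^sub>R \<i>" and R=1 and C="3 * \<bar>C\<bar> * real (card W)"])
   show "finite (e s ` W)" using W by simp
   show "open (S \<inter> ball (of_real x) r)" "complex_of_real x \<in> S \<inter> ball (of_real x) r" using S x r by auto
   show "Ck_on 2 (S \<inter> ball (complex_of_real x) r) w'" if w': "w' \<in> e s ` W" for w'
   proof -
    obtain w where w: "w \<in> W" "w' = e s w" using w' by auto
    have "Ck_on 2 S w'" unfolding w(2) e_def[abs_def]
     using zero[OF w(1)] d1[OF w(1)] d2[OF w(1)] by (intro half_plane_extension_C2[OF S(1) C2[OF w(1)] s0]) auto
    thus ?thesis by (rule Ck_subset) auto
   qed
   show "cmod (dzb w' z) \<le> 3 * \<bar>C\<bar> * real (card W) * (\<Sum>w'\<in>e s ` W. cmod (w' z))" (is "_ \<le> _ * ?T")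
    if w': "w' \<in> e s ` W" and z: "z \<in> S \<inter> ball (of_real x) r" for w' z
   proof -
    obtain w where w: "w \<in> W" "w' = e s w" using w' by auto
    have nn: "0 \<le> 3 * \<bar>C\<bar> * real (card W) * ?T" by (intro mult_nonneg_nonneg sum_nonneg) auto
    show ?thesis
    proof (cases "s * Im z > 0")
     case True
     have T: "cmod (v z) ^ 3 \<le> ?T" if "v \<in> W" for v
      using member_le_sum[of "e s v" "e s ` W" "\<lambda>w'. cmod (w' z)"] that W True by (simp add: e_def norm_power)
     \<comment> \<open>Differentiating the cube of w produces w^2 times the bound for dzb w, hence
       products a^2 b, which are at most the cube of max a b. This is why the cubes satisfy an
       inequality among themselves.\<close>
     have m: "(cmod (w z))^2 * cmod (v z) \<le> ?T" if v: "v \<in> W" for v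
     proof -
      have "(cmod (w z))^2 * cmod (v z) \<le> (max (cmod (w z)) (cmod (v z)))^2 * max (cmod (w z)) (cmod (v z))"
       by (intro mult_mono power_mono) auto
      thus ?thesis using T[OF w(1)] T[OF v] by (auto simp: max_def power3_eq_cube power2_eq_square split: if_splits)
     qed
     have "cmod (dzb w z) \<le> \<bar>C\<bar> * tot W z"
      using r(2)[of w z] z w(1) mult_right_mono[of C "\<bar>C\<bar>" "tot W z"] by (fastforce intro: sum_nonneg)
     hence "3 * (cmod (w z))^2 * cmod (dzb w z) \<le> 3 * (cmod (w z))^2 * (\<bar>C\<bar> * tot W z)"
      by (intro mult_left_mono) auto
     also have "\<dots> = 3 * \<bar>C\<bar> * (\<Sum>v\<in>W. (cmod (w z))^2 * cmod (v z))" by (simp add: sum_distrib_left mult_ac)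
     also have "\<dots> \<le> 3 * \<bar>C\<bar> * (real (card W) * ?T)" by (intro mult_left_mono sum_bounded_above m) auto
     finally show ?thesis using dzb_e[OF w(1), of z] z True by (simp add: w(2) norm_mult norm_power)
    next
     case False
     thus ?thesis using dzb_e[OF w(1), of z] z w nn by auto
    qed
   qed
   show "w' z = 0" if w': "w' \<in> e s ` W" and z: "z \<in> S \<inter> ball (of_real x) r" and q: "cmod (z - (of_real x - s *\<^sub>R \<i>)) < 1" for w' z
   proof -
    have "\<bar>Im z + s\<bar> < 1" using abs_Im_le_cmod[of "z - (of_real x - s *\<^sub>R \<i>)"] q by simp
    hence "\<not> s * Im z > 0" using s by auto
    thus ?thesis using w' by (auto simp: e_def)
   qed
  qed (use s in auto)
  thus ?thesis by auto
 qed
 obtain r1 where r1: "r1 > 0" "ball (of_real x) r1 \<subseteq> S" "\<And>w z. w \<in> W ==> z \<in> ball (of_real x) r1 ==> e 1 w z = 0"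
  using one_side[of 1] by auto
 obtain r2 where r2: "r2 > 0" "\<And>w z. w \<in> W ==> z \<in> ball (of_real x) r2 ==> e (-1) w z = 0"
  using one_side[of "-1"] by auto
 show ?thesis
 proof (rule unique_continuation_open[where w=w and z=z and W=W and S=S and U="ball (of_real x) (min r1 r2)"])
  show "w z = 0" if w: "w \<in> W" and z: "z \<in> ball (of_real x) (min r1 r2)" for w z
  proof (cases "Im z = 0")
   case True
   hence "z = of_real (Re z)" by (simp add: complex_eq_iff)
   thus ?thesis using zero[OF w, of "Re z"] r1(2) z by auto
  next
   case False
   thus ?thesis using r1(3)[OF w, of z] r2(2)[OF w, of z] z by (auto simp: e_def split: if_splits)
  qed
 qed (use r1 r2 w z W S sm bd in auto)
qed

section \<open>Separately holomorphic functions of two variables\<close>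

text \<open>Joint continuity lets Cauchy integrals in one variable depend continuously and
  holomorphically on the other, which is how all regularity below is obtained.\<close>

definition sholo :: "complex set => (complex => complex => complex) => bool" where
 "sholo D h \<longleftrightarrow> continuous_on (D \<times> D) (\<lambda>x. h (fst x) (snd x)) \<and>
   (\<forall>w\<in>D. (\<lambda>z. h z w) holomorphic_on D) \<and> (\<forall>z\<in>D. h z holomorphic_on D)"

lemma continuous_on_compose_pair:
 assumes "continuous_on (D \<times> D) (\<lambda>x. h (fst x) (snd x))" "continuous_on X f" "continuous_on X g"
  "\<And>x. x \<in> X ==> f x \<in> D" "\<And>x. x \<in> X ==> g x \<in> D"
 shows "continuous_on X (\<lambda>x. h (f x) (g x))"
 using continuous_on_compose2[OF assms(1), of X "\<lambda>x. (f x, g x)"] assms(2-) by (auto intro: continuous_on_Pair)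

lemma sholo_swap: "sholo D h ==> sholo D (\<lambda>z w. h w z)"
 by (auto simp: sholo_def intro!: continuous_on_compose_pair[of D h] continuous_intros)

text \<open>Cauchy's formula for the derivative, written over a fixed real interval so that the
  theorems on integrals with parameters apply.\<close>

lemma sholo_deriv_formula:
 assumes h: "sholo D h" and \<rho>: "cball a \<rho> \<subseteq> D" and z: "z \<in> ball a \<rho>" and w: "w \<in> D"
 shows "deriv (\<lambda>z. h z w) z = integral (cbox 0 1) (\<lambda>t. h (circlepath a \<rho> t) w / (circlepath a \<rho> t - z)^2 * (circlepath a \<rho> t - a))"
proof -
 have hol: "(\<lambda>z. h z w) holomorphic_on D" using h w by (simp add: sholo_def)
 have "((\<lambda>z. h z w) has_field_derivative (1 / (2 * of_real pi * \<i>) * contour_integral (circlepath a \<rho>) (\<lambda>u. h u w / (u - z)^2))) (at z)"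
  using \<rho> by (intro Cauchy_derivative_integral_circlepath(2) z holomorphic_on_imp_continuous_on[OF holomorphic_on_subset[OF hol]]
    holomorphic_on_subset[OF hol]) auto
 hence "deriv (\<lambda>z. h z w) z = 1 / (2 * of_real pi * \<i>) * contour_integral (circlepath a \<rho>) (\<lambda>u. h u w / (u - z)^2)"
  by (rule DERIV_imp_deriv)
 also have "contour_integral (circlepath a \<rho>) (\<lambda>u. h u w / (u - z)^2)
   = integral {0..1} (\<lambda>t. (2 * of_real pi * \<i>) * (h (circlepath a \<rho> t) w / (circlepath a \<rho> t - z)^2 * (circlepath a \<rho> t - a)))"
  unfolding contour_integral_integral vector_derivative_circlepath
  by (intro integral_cong) (simp add: circlepath)
 also have "\<dots> = (2 * of_real pi * \<i>) * integral {0..1} (\<lambda>t. h (circlepath a \<rho> t) w / (circlepath a \<rho> t - z)^2 * (circlepath a \<rho> t - a))"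
  by (rule integral_mult_right)
 finally show ?thesis by simp
qed

lemma circlepath_in:
 assumes "\<rho> > 0" "cball a \<rho> \<subseteq> D"
 shows "circlepath a \<rho> t \<in> D" "z \<in> ball a \<rho> ==> circlepath a \<rho> t \<noteq> z"
proof -
 have "dist a (circlepath a \<rho> t) = \<rho>" using assms by (simp add: circlepath dist_norm norm_mult)
 thus "circlepath a \<rho> t \<in> D" "z \<in> ball a \<rho> ==> circlepath a \<rho> t \<noteq> z" using assms(2) by auto
qed

lemma continuous_on_circlepath [continuous_intros]:
 "continuous_on X f ==> continuous_on X (\<lambda>x. circlepath a \<rho> (f x))"
 unfolding circlepath by (intro continuous_intros)

lemma sholo_deriv_continuous:
 assumes D: "open D" and h: "sholo D h"
 shows "continuous_on (D \<times> D) (\<lambda>x. deriv (\<lambda>z. h z (snd x)) (fst x))"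
proof -
 have "isCont (\<lambda>x. deriv (\<lambda>z. h z (snd x)) (fst x)) (a, b)" if "a \<in> D" "b \<in> D" for a b
 proof -
  obtain \<rho> where \<rho>: "\<rho> > 0" "cball a \<rho> \<subseteq> D" using D \<open>a \<in> D\<close> open_contains_cball by blast
  have ch: "continuous_on (D \<times> D) (\<lambda>x. h (fst x) (snd x))" using h by (simp add: sholo_def)
  have "continuous_on ((ball a \<rho> \<times> D) \<times> cbox 0 1)
    (\<lambda>y. h (circlepath a \<rho> (snd y)) (snd (fst y)) / (circlepath a \<rho> (snd y) - fst (fst y))^2 * (circlepath a \<rho> (snd y) - a))"
   by (intro continuous_intros continuous_on_compose_pair[OF ch]) (use circlepath_in[OF \<rho>] in auto)
  hence "continuous_on (ball a \<rho> \<times> D) (\<lambda>x. integral (cbox 0 1)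
    (\<lambda>t. h (circlepath a \<rho> t) (snd x) / (circlepath a \<rho> t - fst x)^2 * (circlepath a \<rho> t - a)))"
   by (intro integral_continuous_on_param) (simp add: split_def)
  hence "continuous_on (ball a \<rho> \<times> D) (\<lambda>x. deriv (\<lambda>z. h z (snd x)) (fst x))"
   by (rule continuous_on_eq) (use sholo_deriv_formula[OF h \<rho>(2)] in auto)
  thus ?thesis using that \<rho> D by (simp add: continuous_on_eq_continuous_at open_Times)
 qed
 thus ?thesis by (intro continuous_at_imp_continuous_on) auto
qed

lemma sholo_deriv2_continuous:
 assumes D: "open D" and h: "sholo D h"
 shows "continuous_on (D \<times> D) (\<lambda>x. deriv (h (fst x)) (snd x))"
 by (rule continuous_on_compose_pair[OF sholo_deriv_continuous[OF D sholo_swap[OF h]], of "D \<times> D" snd fst])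
  (auto intro!: continuous_intros)

text \<open>In the second variable the derivative is an integral of holomorphic functions over a
  circle, so Leibniz' rule applies. Closure under both partial derivatives is what turns
  \<open>sholo\<close> into infinite differentiability.\<close>

lemma sholo_deriv:
 assumes D: "open D" and h: "sholo D h"
 shows "sholo D (\<lambda>z w. deriv (\<lambda>z. h z w) z)"
 unfolding sholo_def
proof (intro conjI ballI)
 show "continuous_on (D \<times> D) (\<lambda>x. deriv (\<lambda>z. h z (snd x)) (fst x))" by (rule sholo_deriv_continuous[OF D h])
 show "(\<lambda>z. deriv (\<lambda>z. h z w) z) holomorphic_on D" if "w \<in> D" for w
  using h that D by (auto simp: sholo_def intro: holomorphic_deriv)
 show "(\<lambda>w. deriv (\<lambda>z. h z w) z) holomorphic_on D" if z: "z \<in> D" for z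
 proof -
  have "(\<lambda>w. deriv (\<lambda>z. h z w) z) field_differentiable (at b)" if b: "b \<in> D" for b
  proof -
   obtain \<rho> where \<rho>: "\<rho> > 0" "cball z \<rho> \<subseteq> D" using D z open_contains_cball by blast
   obtain \<sigma> where \<sigma>: "\<sigma> > 0" "ball b \<sigma> \<subseteq> D" using D b open_contains_ball by blast
   note circ = circlepath_in[OF \<rho>]
   have ch: "continuous_on (D \<times> D) (\<lambda>x. h (fst x) (snd x))" using h by (simp add: sholo_def)
   have "(\<lambda>w. integral (cbox 0 1) (\<lambda>t. h (circlepath z \<rho> t) w / (circlepath z \<rho> t - z)^2 * (circlepath z \<rho> t - z))) holomorphic_on ball b \<sigma>"
   proof (rule leibniz_rule_holomorphic)
    show "((\<lambda>w. h (circlepath z \<rho> t) w / (circlepath z \<rho> t - z)^2 * (circlepath z \<rho> t - z)) has_field_derivative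
      deriv (h (circlepath z \<rho> t)) w / (circlepath z \<rho> t - z)^2 * (circlepath z \<rho> t - z)) (at w within ball b \<sigma>)"
     if "w \<in> ball b \<sigma>" "t \<in> cbox 0 1" for w t
    proof -
     have "(h (circlepath z \<rho> t) has_field_derivative deriv (h (circlepath z \<rho> t)) w) (at w)"
      using h circ(1)[of t] D \<sigma> that by (intro holomorphic_derivI[of _ D]) (auto simp: sholo_def)
     from DERIV_cmult_right[OF DERIV_cdivide[OF has_field_derivative_at_within[OF this]]] show ?thesis .
    qed
    show "(\<lambda>t. h (circlepath z \<rho> t) w / (circlepath z \<rho> t - z)^2 * (circlepath z \<rho> t - z)) integrable_on cbox 0 1"
     if "w \<in> ball b \<sigma>" for w
     by (intro integrable_continuous continuous_intros continuous_on_compose_pair[OF ch]) (use circ \<rho> \<sigma> that in auto)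
    show "continuous_on (ball b \<sigma> \<times> cbox 0 1) (\<lambda>(w, t). deriv (h (circlepath z \<rho> t)) w / (circlepath z \<rho> t - z)^2 * (circlepath z \<rho> t - z))"
     unfolding split_def
     by (intro continuous_intros continuous_on_compose_pair[OF sholo_deriv2_continuous[OF D h]])
      (use circ \<rho> \<sigma> in auto)
   qed simp
   hence "(\<lambda>w. deriv (\<lambda>z. h z w) z) holomorphic_on ball b \<sigma>"
    by (rule holomorphic_transform) (use sholo_deriv_formula[OF h \<rho>(2)] \<rho> \<sigma> in auto)
   thus ?thesis using \<sigma> by (auto intro: holomorphic_on_imp_differentiable_at)
  qed
  thus ?thesis by (auto simp: holomorphic_on_def intro: field_differentiable_at_within)
 qed
qed

lemma sholo_deriv2: "open D ==> sholo D h ==> sholo D (\<lambda>z w. deriv (h z) w)"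
 using sholo_swap[OF sholo_deriv[OF _ sholo_swap]] by simp

lemma sholo_has_derivative:
 assumes D: "open D" "convex D" and h: "sholo D h" and zw: "z \<in> D" "w \<in> D"
 shows "((\<lambda>x. h (fst x) (snd x)) has_derivative
   (\<lambda>v. deriv (\<lambda>z. h z w) z * fst v + deriv (h z) w * snd v)) (at (z, w))"
proof -
 have "((\<lambda>(x, y). h x y) has_derivative (\<lambda>(tx, ty). deriv (\<lambda>z. h z w) z * tx + blinfun_apply (blinfun_mult_right (deriv (h z) w)) ty)) (at (z, w) within D \<times> D)"
 proof (rule has_derivative_partialsI)
  show "((\<lambda>x. h x w) has_derivative (*) (deriv (\<lambda>z. h z w) z)) (at z within D)"
      using holomorphic_derivI[of "\<lambda>z. h z w" D z] h D zw
      by (auto simp: sholo_def has_field_derivative_def)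
    show "((\<lambda>y. h x y) has_derivative blinfun_apply (blinfun_mult_right (deriv (h x) y))) (at y within D)"
      if "x \<in> D" "y \<in> D" for x y
      using holomorphic_derivI[of "h x" D y] h D that
      by (auto simp: sholo_def has_field_derivative_def)
    have "continuous_on (D \<times> D) (\<lambda>x. blinfun_mult_right (deriv (h (fst x)) (snd x)))"
      by (intro bounded_linear.continuous_on[OF bounded_linear_blinfun_mult_right] sholo_deriv2_continuous D h)
    then show "continuous (at (z, w) within D \<times> D) (\<lambda>(x, y). blinfun_mult_right (deriv (h x) y))"
      using zw by (simp add: continuous_on_eq_continuous_within split_def)
  qed (use zw D in auto)
  then show ?thesis
    using zw at_within_open[of "(z, w)" "D \<times> D"] open_Times[OF D(1) D(1)] by (simp add: split_def)
qed

lemma sholo_compose_deriv: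
  assumes D: "open D" "convex D" and h: "sholo D h"
    and a: "(a has_field_derivative a') (at x)" and b: "(b has_field_derivative b') (at x)"
    and zw: "a x \<in> D" "b x \<in> D"
  shows "((\<lambda>x. h (a x) (b x)) has_field_derivative (deriv (\<lambda>z. h z (b x)) (a x) * a' + deriv (h (a x)) (b x) * b')) (at x)"
proof -
  have "((\<lambda>x. (a x, b x)) has_derivative (\<lambda>v. (a' * v, b' * v))) (at x)"
    using a b by (auto simp: has_field_derivative_def intro: has_derivative_Pair)
  from has_derivative_compose[OF this sholo_has_derivative[OF D h zw]]
  have "((\<lambda>x. h (a x) (b x)) has_derivative
      (\<lambda>v. deriv (\<lambda>z. h z (b x)) (a x) * (a' * v) + deriv (h (a x)) (b x) * (b' * v))) (at x)" by simp
  moreover have "(\<lambda>v. deriv (\<lambda>z. h z (b x)) (a x) * (a' * v) + deriv (h (a x)) (b x) * (b' * v))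
      = (*) (deriv (\<lambda>z. h z (b x)) (a x) * a' + deriv (h (a x)) (b x) * b')"
  by (rule ext) (simp add: algebra_simps)
 ultimately show ?thesis by (simp add: has_field_derivative_def)
qed

text \<open>On w = cnj z the two partial derivatives become dz and dzb. They are again functions of
  the same kind on the diagonal, so smoothness follows by induction over all h.\<close>

lemma sholo_diagonal:
 assumes D: "open D" "convex D" "\<And>z. z \<in> D ==> cnj z \<in> D" and h: "sholo D h"
 shows "smooth_on D (\<lambda>z. h z (cnj z))" (is ?g1) and "z \<in> D ==> dzb (\<lambda>z. h z (cnj z)) z = deriv (h z) (cnj z)"
proof -
 have der: "((\<lambda>z. h z (cnj z)) has_derivative (\<lambda>v. deriv (\<lambda>x. h x (cnj z)) z * v + deriv (h z) (cnj z) * cnj v)) (at z)"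
  if "sholo D h" "z \<in> D" for h z
 proof -
  have "((\<lambda>x. (x, cnj x)) has_derivative (\<lambda>v. (v, cnj v))) (at z)"
   by (auto intro!: derivative_eq_intros)
  from has_derivative_compose[OF this sholo_has_derivative[OF D(1,2) that D(3)[OF that(2)]]]
  show ?thesis by simp
 qed
 have "Ck_on k D (\<lambda>z. h z (cnj z))" if "sholo D h" for k h
  using that
 proof (induction k arbitrary: h)
  case 0
  have "continuous (at z) (\<lambda>z. h z (cnj z))" if "z \<in> D" for z
   using has_derivative_continuous[OF der[OF 0 that]] .
  thus ?case by (auto intro: continuous_at_imp_continuous_on)
 next
  case (Suc k)
  have "Ck_on k D (pd (\<lambda>z. h z (cnj z)) v)" for v
  proof (rule Ck_congD[OF D(1)])
   show "Ck_on k D (\<lambda>z. deriv (\<lambda>x. h x (cnj z)) z * v + deriv (h z) (cnj z) * cnj v)"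
    by (intro Ck_add Ck_bilinear[OF bounded_bilinear_mult] Ck_const D(1) Suc.IH[OF sholo_deriv[OF D(1) Suc.prems]]
      Suc.IH[OF sholo_deriv2[OF D(1) Suc.prems]])
   show "pd (\<lambda>z. h z (cnj z)) v z = deriv (\<lambda>x. h x (cnj z)) z * v + deriv (h z) (cnj z) * cnj v" if "z \<in> D" for z
    by (rule pd_eqI[OF der[OF Suc.prems that]])
  qed
  thus ?case using der[OF Suc.prems]
   by (auto simp: differentiable_on_def differentiable_def intro: has_derivative_at_withinI)
 qed
 thus ?g1 using h by (simp add: smooth_on_def)
 show "dzb (\<lambda>z. h z (cnj z)) z = deriv (h z) (cnj z)" if "z \<in> D"
  unfolding dzb_def pd_eqI[OF der[OF h that]] by (simp add: field_simps)
qed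

lemma sholo_const: "sholo D (\<lambda>_ _. c)"
 by (simp add: sholo_def)

lemma sholo_add: "sholo D f ==> sholo D g ==> sholo D (\<lambda>z w. f z w + g z w)"
 and sholo_mult: "sholo D f ==> sholo D g ==> sholo D (\<lambda>z w. f z w * g z w)"
 by (auto simp: sholo_def intro!: continuous_intros holomorphic_intros)

lemma sholo_fst: "f holomorphic_on D ==> sholo D (\<lambda>z _. f z)"
 using continuous_on_compose2[OF holomorphic_on_imp_continuous_on, of f D "D \<times> D" fst]
 by (auto simp: sholo_def continuous_on_fst)

text \<open>On w = cnj z this function is the conjugate of h z (cnj z): it is the complexification
  of the conjugate, and it is again holomorphic in both variables.\<close>

lemma sholo_cnj:
 assumes D: "open D" "\<And>z. z \<in> D ==> cnj z \<in> D" and h: "sholo D h"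
 shows "sholo D (\<lambda>z w. cnj (h (cnj w) (cnj z)))"
 unfolding sholo_def
proof (intro conjI ballI)
 have c: "cnj ` D = D" using D(2) by (metis complex_cnj_cnj image_eqI subsetI subset_antisym image_subsetI)
 have ch: "continuous_on (D \<times> D) (\<lambda>x. h (fst x) (snd x))" using h by (simp add: sholo_def)
 show "continuous_on (D \<times> D) (\<lambda>x. cnj (h (cnj (snd x)) (cnj (fst x))))"
  by (intro continuous_on_cnj continuous_on_compose_pair[OF ch] continuous_intros) (auto simp: D(2))
 show "(\<lambda>z. cnj (h (cnj w) (cnj z))) holomorphic_on D" if "w \<in> D" for w
  using holomorphic_on_compose_cnj_cnj[of "h (cnj w)" D] h D that c by (simp add: sholo_def o_def)
 show "(\<lambda>w. cnj (h (cnj w) (cnj z))) holomorphic_on D" if "z \<in> D" for z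
  using holomorphic_on_compose_cnj_cnj[of "\<lambda>w. h w (cnj z)" D] h D that c by (simp add: sholo_def o_def)
qed

section \<open>Integrals along segments with variable end points\<close>

definition segint :: "complex => complex => (complex => complex) => complex" where
 "segint z w f = (w - z) * integral (cbox 0 1) (\<lambda>t::real. f (z + of_real t * (w - z)))"

lemma segment_in_convex:
 assumes "convex D" "z \<in> D" "w \<in> D" "t \<in> cbox (0::real) 1"
 shows "z + of_real t * (w - z) \<in> D"
 using convexD_alt[OF assms(1-3), of t] assms(4) by (simp add: scaleR_conv_of_real algebra_simps)

lemma segint_primitive:
 assumes D: "open D" "convex D" and f: "f holomorphic_on D"
 obtains F where "\<And>z w. z \<in> D ==> w \<in> D ==> segint z w f = F w - F z"
  "\<And>z. z \<in> D ==> (F has_field_derivative f z) (at z)"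
proof -
 obtain F where F: "\<And>x. x \<in> D ==> (F has_field_derivative f x) (at x within D)"
  using holomorphic_convex_primitive'[OF D(2,1) f] by blast
 have F': "(F has_field_derivative f x) (at x)" if "x \<in> D" for x
  using F[OF that] at_within_open[OF that D(1)] by simp
 have "segint z w f = F w - F z" if zw: "z \<in> D" "w \<in> D" for z w
 proof -
  have "((\<lambda>t. f (z + of_real t * (w - z)) * (w - z)) has_integral (F (z + of_real 1 * (w - z)) - F (z + of_real 0 * (w - z)))) {0..1::real}"
  proof (rule fundamental_theorem_of_calculus)
   fix t :: real assume t: "t \<in> {0..1}"
   have "((\<lambda>t. z + of_real t * (w - z)) has_vector_derivative (w - z)) (at t within {0..1})"
    by (auto intro!: derivative_eq_intros)
   from field_vector_diff_chain_within[OF this has_field_derivative_at_within[OF F'[OF segment_in_convex[OF D(2) zw]]]]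
   show "((\<lambda>t. F (z + of_real t * (w - z))) has_vector_derivative f (z + of_real t * (w - z)) * (w - z)) (at t within {0..1})"
    using t by (simp add: o_def mult.commute)
  qed simp
  hence "integral {0..1::real} (\<lambda>t. f (z + of_real t * (w - z)) * (w - z)) = F w - F z"
   by (simp add: has_integral_iff)
  thus ?thesis unfolding segint_def by (simp add: mult.commute[of _ "w - z"])
 qed
 thus ?thesis using that F' by blast
qed

lemma segint_norm_le:
 assumes D: "convex D" "z \<in> D" "w \<in> D" and f: "continuous_on D f" and B: "\<And>x. x \<in> D ==> cmod (f x) \<le> B"
 shows "cmod (segint z w f) \<le> cmod (w - z) * B"
proof -
 have c: "continuous_on (cbox 0 1) (\<lambda>t::real. f (z + of_real t * (w - z)))"
  by (rule continuous_on_compose2[OF f]) (auto intro!: continuous_intros segment_in_convex[OF D])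
 have "cmod (integral (cbox 0 1) (\<lambda>t::real. f (z + of_real t * (w - z)))) \<le> integral (cbox 0 1) (\<lambda>_::real. B)"
  using segment_in_convex[OF D] by (intro integral_norm_bound_integral integrable_continuous c B) auto
 thus ?thesis unfolding segint_def norm_mult by (intro mult_left_mono) auto
qed

lemma segint_diff:
 assumes D: "convex D" "z \<in> D" "w \<in> D" and f: "continuous_on D f" "continuous_on D g"
 shows "segint z w f - segint z w g = segint z w (\<lambda>x. f x - g x)"
proof -
 have c: "(\<lambda>t::real. f (z + of_real t * (w - z))) integrable_on cbox 0 1" if "continuous_on D f" for f :: "complex => complex"
 proof (rule integrable_continuous)
  show "continuous_on (cbox 0 1) (\<lambda>t::real. f (z + of_real t * (w - z)))"
   by (rule continuous_on_compose2[OF that]) (auto intro!: continuous_intros segment_in_convex[OF D])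
 qed
 show ?thesis unfolding segint_def right_diff_distrib[symmetric]
  by (simp only: Henstock_Kurzweil_Integration.integral_diff[OF c[OF f(1)] c[OF f(2)]])
qed

text \<open>In the end point w the integral is a primitive. The starting point z also enters the
  integrand, so there Leibniz' rule with the total derivative of g is used.\<close>

lemma sholo_segint:
 assumes D: "open D" "convex D" and g: "sholo D g"
 shows "sholo D (\<lambda>z w. segint z w (g z))"
 unfolding sholo_def
proof (intro conjI ballI)
 note seg = segment_in_convex[OF D(2)]
 have ch: "continuous_on (D \<times> D) (\<lambda>x. g (fst x) (snd x))" using g by (simp add: sholo_def)
 show "continuous_on (D \<times> D) (\<lambda>x. segint (fst x) (snd x) (g (fst x)))"
  unfolding segint_def
  by (intro continuous_intros integral_continuous_on_param[unfolded split_def] continuous_on_compose_pair[OF ch])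
   (auto intro!: seg)
 show "(\<lambda>w. segint z w (g z)) holomorphic_on D" if z: "z \<in> D" for z
 proof -
  have "g z holomorphic_on D" using g z by (simp add: sholo_def)
  then obtain F where F: "\<And>a w. a \<in> D ==> w \<in> D ==> segint a w (g z) = F w - F a"
   "\<And>a. a \<in> D ==> (F has_field_derivative g z a) (at a)"
   using segint_primitive[OF D] by metis
  have "(\<lambda>w. F w - F z) holomorphic_on D"
   using F(2) by (intro holomorphic_intros) (auto simp: holomorphic_on_def field_differentiable_def intro: has_field_derivative_at_within)
  thus ?thesis by (rule holomorphic_transform) (use F(1) z in auto)
 qed
 show "(\<lambda>z. segint z w (g z)) holomorphic_on D" if w: "w \<in> D" for w
  unfolding segint_def
 proof (intro holomorphic_intros leibniz_rule_holomorphic)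
  let ?p = "\<lambda>z t. z + complex_of_real t * (w - z)"
  show "((\<lambda>z. g z (?p z t)) has_field_derivative
    deriv (\<lambda>x. g x (?p z t)) z * 1 + deriv (g z) (?p z t) * (1 - of_real t)) (at z within D)"
   if "z \<in> D" "t \<in> cbox 0 1" for z t
  proof (rule has_field_derivative_at_within, rule sholo_compose_deriv[OF D g, where a="\<lambda>z. z" and b="\<lambda>z. ?p z t"])
   show "((\<lambda>z. ?p z t) has_field_derivative 1 - of_real t) (at z)"
    by (auto intro!: derivative_eq_intros)
  qed (use that w seg in auto)
  show "(\<lambda>t. g z (?p z t)) integrable_on cbox 0 1" if "z \<in> D" for z
   by (intro integrable_continuous continuous_on_compose_pair[OF ch]) (use that w seg in \<open>auto intro!: continuous_intros\<close>)
  show "continuous_on (D \<times> cbox 0 1) (\<lambda>(z, t). deriv (\<lambda>x. g x (?p z t)) z * 1 + deriv (g z) (?p z t) * (1 - of_real t))"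
   unfolding split_def
   by (intro continuous_intros continuous_on_compose_pair[OF sholo_deriv2_continuous[OF D(1) g]]
     continuous_on_compose_pair[OF sholo_deriv_continuous[OF D(1) g]])
    (use w seg in \<open>auto intro!: continuous_intros\<close>)
 qed (use D in auto)
qed

section \<open>The Cauchy problem for polynomial Cauchy--Riemann systems\<close>

text \<open>Polynomials in the components of two complex vectors; below the second one is the conjugate of
  the first.\<close>

inductive poly2 :: "(('i => complex) => ('i => complex) => complex) => bool" where
 poly2_fst: "poly2 (\<lambda>a b. a i)"
| poly2_snd: "poly2 (\<lambda>a b. b i)"
| poly2_const: "poly2 (\<lambda>a b. c)"
| poly2_add: "poly2 f ==> poly2 g ==> poly2 (\<lambda>a b. f a b + g a b)"
| poly2_mult: "poly2 f ==> poly2 g ==> poly2 (\<lambda>a b. f a b * g a b)"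

lemma poly2_sum: "(\<And>i. i \<in> A ==> poly2 (f i)) ==> poly2 (\<lambda>a b. \<Sum>i\<in>A. f i a b)"
 by (induction A rule: infinite_finite_induct) (auto intro: poly2.intros)

definition close2 :: "real => real => ('i => complex) => ('i => complex) => bool" where
 "close2 B d a a' \<longleftrightarrow> (\<forall>i. cmod (a i) \<le> B \<and> cmod (a' i) \<le> B \<and> cmod (a i - a' i) \<le> d)"

lemma close2_nonneg: "close2 B d a a' ==> d \<ge> 0"
 unfolding close2_def using norm_ge_zero order_trans by blast

text \<open>The bound on the polydisc of radius B is kept together with the Lipschitz estimate,
  because the induction step for products needs both.\<close>

definition lip2 :: "real => (('i => complex) => ('i => complex) => complex) => real => bool" where
 "lip2 B g M \<longleftrightarrow> M \<ge> 0 \<and> (\<forall>a b a' b' d. close2 B d a a' \<longrightarrow> close2 B d b b' \<longrightarrow>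
   cmod (g a b) \<le> M \<and> cmod (g a' b') \<le> M \<and> cmod (g a b - g a' b') \<le> M * d)"

lemma poly2_lipschitz:
 fixes g :: "('i => complex) => ('i => complex) => complex"
 shows "poly2 g ==> \<exists>M. lip2 B g M"
proof (induction rule: poly2.induct)
 have c: "cmod (a i) \<le> \<bar>B\<bar> + 1 \<and> cmod (a' i) \<le> \<bar>B\<bar> + 1 \<and> cmod (a i - a' i) \<le> (\<bar>B\<bar> + 1) * d"
  if "close2 B d a a'" for d i and a a' :: "'i => complex"
 proof -
  have "cmod (a i) \<le> B" "cmod (a' i) \<le> B" "cmod (a i - a' i) \<le> d" "0 \<le> \<bar>B\<bar> * d"
   using that close2_nonneg[OF that] by (simp_all add: close2_def)
  thus ?thesis using abs_ge_self[of B] unfolding distrib_right by auto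
 qed
 show "\<exists>M. lip2 B (\<lambda>a b. a i) M" "\<exists>M. lip2 B (\<lambda>a b. b i) M" for i :: 'i
  unfolding lip2_def by (intro exI[of _ "\<bar>B\<bar> + 1"]; use c in simp)+
 show "\<exists>M. lip2 B (\<lambda>a b. c) M" for c unfolding lip2_def by (intro exI[of _ "cmod c"]) (auto dest: close2_nonneg)
next
 case (poly2_add f g)
 then obtain M N where MN: "lip2 B f M" "lip2 B g N" by auto
 thus ?case unfolding lip2_def
  by (intro exI[of _ "M + N"]) (simp add: add_diff_add distrib_right norm_triangle_mono)
next
 case (poly2_mult f g)
 then obtain M N where MN: "lip2 B f M" "lip2 B g N" by auto
 hence MN0: "M \<ge> 0" "N \<ge> 0" by (auto simp: lip2_def)
 have "cmod (f a b * g a b) \<le> 2 * M * N \<and> cmod (f a' b' * g a' b') \<le> 2 * M * N \<and> cmod (f a b * g a b - f a' b' * g a' b') \<le> 2 * M * N * d"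
  if c: "close2 B d a a'" "close2 B d b b'" for a b a' b' d
 proof -
  have fg: "cmod (f a b) \<le> M" "cmod (f a' b') \<le> M" "cmod (f a b - f a' b') \<le> M * d"
   "cmod (g a b) \<le> N" "cmod (g a' b') \<le> N" "cmod (g a b - g a' b') \<le> N * d" and "d \<ge> 0"
   using MN c close2_nonneg[OF c(1)] by (auto simp: lip2_def)
  hence "cmod (f a b * g a b) \<le> M * N" "cmod (f a' b' * g a' b') \<le> M * N"
   using MN0 by (simp_all add: norm_mult mult_mono)
  moreover have "M * N \<ge> 0" using MN0 by simp
  moreover have "f a b * g a b - f a' b' * g a' b' = f a b * (g a b - g a' b') + (f a b - f a' b') * g a' b'"
   by (simp add: algebra_simps)
  moreover have "cmod \<dots> \<le> M * (N * d) + (M * d) * N"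
   using fg MN0 \<open>d \<ge> 0\<close> by (intro norm_triangle_mono) (simp_all add: norm_mult mult_mono)
  ultimately show ?thesis by (simp add: algebra_simps)
 qed
 thus ?case using MN0 unfolding lip2_def by (intro exI[of _ "2 * M * N"]) auto
qed

lemma sholo_poly2:
 "poly2 g ==> (\<And>i. sholo D (\<lambda>z w. a z w i)) ==> (\<And>i. sholo D (\<lambda>z w. b z w i)) ==> sholo D (\<lambda>z w. g (a z w) (b z w))"
 by (induction rule: poly2.induct) (auto intro: sholo_const sholo_add sholo_mult)

text \<open>With cnj z replaced by an independent w the problem reads: the w-derivative of H is G
  applied to H and its reflection, and H (z, z) = W0 z. Integration from z to w gives a fixed point
  equation; a real x has w = cnj x = x, so the data sit exactly on the real axis of the slice w =
  cnj z.\<close>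

theorem poly_dbar_cauchy_problem:
 fixes G :: "'i::finite => ('i => complex) => ('i => complex) => complex"
 assumes G: "\<And>i. poly2 (G i)" and R: "R > 0" and W0: "\<And>i. W0 i holomorphic_on ball (of_real u) R"
 shows "\<exists>r>0. \<exists>f. r \<le> R \<and> (\<forall>i. smooth_on (ball (of_real u) r) (f i) \<and>
   (\<forall>z\<in>ball (of_real u) r. dzb (f i) z = G i (\<lambda>j. f j z) (\<lambda>j. cnj (f j z))) \<and>
   (\<forall>x. complex_of_real x \<in> ball (of_real u) r \<longrightarrow> f i (of_real x) = W0 i (of_real x)))"
proof -
 have "\<exists>b. \<forall>z\<in>cball (of_real u) (R/2). cmod (W0 i z) \<le> b" for i
 proof -
  have "compact (W0 i ` cball (of_real u) (R/2))"
   using R by (intro compact_continuous_image holomorphic_on_imp_continuous_on holomorphic_on_subset[OF W0]) auto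
  thus ?thesis using compact_imp_bounded bounded_iff by (metis image_eqI)
 qed
 then obtain b where b: "\<And>i z. z \<in> cball (of_real u) (R/2) ==> cmod (W0 i z) \<le> b i" by metis
 \<comment> \<open>One unit above the size of the initial data, as room for the integral
   term.\<close>
 define B where "B = (\<Sum>i\<in>UNIV. \<bar>b i\<bar>) + 1"
 have W0B: "cmod (W0 i z) \<le> B - 1" if "z \<in> cball (of_real u) (R/2)" for i z
  using b[OF that, of i] member_le_sum[of i UNIV "\<lambda>i. \<bar>b i\<bar>"] by (simp add: B_def)
 obtain Mf where Mf: "\<And>i. Mf i \<ge> 0" "\<And>i a c a' c' d. close2 B d a a' ==> close2 B d c c' ==>
   cmod (G i a c) \<le> Mf i \<and> cmod (G i a c - G i a' c') \<le> Mf i * d"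
  using poly2_lipschitz[OF G, where B=B] unfolding lip2_def by metis
 define M where "M = (\<Sum>i\<in>UNIV. Mf i)"
 have LM: "Mf i \<le> M" for i
  unfolding M_def using Mf(1) by (auto intro!: member_le_sum)
 have LM0: "M \<ge> 0" unfolding M_def using Mf(1) by (auto intro!: sum_nonneg)
 \<comment> \<open>A segment in the ball has length at most 2 r, and 2 r M <= 1/2 serves twice: the
   integral term stays below 1, and the iteration contracts by 1/2.\<close>
 define r where "r = min (R/2) (1 / (4 * (M + 1)))"
 have r: "r > 0" "r \<le> R / 2" "2 * r * M \<le> 1 / 2"
 proof -
  show "r > 0" "r \<le> R / 2" using R LM0 by (auto simp: r_def)
  have "r \<le> 1 / (4 * (M + 1))" by (simp add: r_def)
  hence "r * (4 * (M + 1)) \<le> 1" using LM0 by (subst (asm) pos_le_divide_eq) auto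
  thus "2 * r * M \<le> 1 / 2" using \<open>r > 0\<close> by (simp add: algebra_simps)
 qed
 define D where "D = ball (complex_of_real u) r"
 have D: "open D" "convex D" "\<And>z. z \<in> D ==> cnj z \<in> D"
 proof -
  show "cnj z \<in> D" if "z \<in> D" for z
  proof -
   have "complex_of_real u - cnj z = cnj (of_real u - z)" by simp
   hence "cmod (complex_of_real u - cnj z) = cmod (of_real u - z)" by (metis complex_mod_cnj)
   thus ?thesis using that by (simp add: D_def dist_norm)
  qed
 qed (auto simp: D_def)
 have DR: "D \<subseteq> cball (of_real u) (R/2)" "D \<subseteq> ball (of_real u) R" using r by (auto simp: D_def)
 have diam: "cmod (w - z) \<le> 2 * r" if "z \<in> D" "w \<in> D" for z w
  using that norm_triangle_ineq[of "w - of_real u" "of_real u - z"] by (simp add: D_def dist_norm norm_minus_commute)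
 \<comment> \<open>The conjugated unknowns enter through their reflection, which keeps the right
   side holomorphic in both z and t.\<close>
 define \<Gamma> where "\<Gamma> H i z t = G i (\<lambda>j. H j z t) (\<lambda>j. cnj (H j (cnj t) (cnj z)))" for H :: "'i => complex => complex => complex" and i z t
 define T where "T H i z w = W0 i z + segint z w (\<Gamma> H i z)" for H i z w
 define ok where "ok H \<longleftrightarrow> (\<forall>i. sholo D (H i) \<and> (\<forall>z\<in>D. \<forall>w\<in>D. cmod (H i z w) \<le> B))" for H :: "'i => complex => complex => complex"
 have \<Gamma>s: "sholo D (\<Gamma> H i)" if "\<And>i. sholo D (H i)" for H i
  unfolding \<Gamma>_def[abs_def] by (rule sholo_poly2[OF G]) (auto intro: that sholo_cnj[OF D(1,3) that])
 have \<Gamma>c: "continuous_on D (\<Gamma> H i z)" if "\<And>i. sholo D (H i)" "z \<in> D" for H i z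
  using \<Gamma>s[OF that(1)] that(2) by (auto simp: sholo_def intro: holomorphic_on_imp_continuous_on)
 have \<Gamma>b: "cmod (\<Gamma> H i z t) \<le> M" if "ok H" "z \<in> D" "t \<in> D" for H i z t
  using that D(3) Mf(2)[of 0 "\<lambda>j. H j z t" "\<lambda>j. H j z t" "\<lambda>j. cnj (H j (cnj t) (cnj z))" "\<lambda>j. cnj (H j (cnj t) (cnj z))" i] LM[of i]
  by (force simp: \<Gamma>_def ok_def close2_def)
 have okT: "ok (T H)" if H: "ok H" for H
 proof -
  have s: "sholo D (H i)" for i using H by (simp add: ok_def)
  have "sholo D (T H i)" for i unfolding T_def[abs_def]
   by (intro sholo_add sholo_fst sholo_segint \<Gamma>s s D holomorphic_on_subset[OF W0] DR)
  moreover have "cmod (T H i z w) \<le> B" if zw: "z \<in> D" "w \<in> D" for i z w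
  proof -
   have "cmod (segint z w (\<Gamma> H i z)) \<le> cmod (w - z) * M"
    by (intro segint_norm_le[OF D(2) zw] \<Gamma>c s zw \<Gamma>b H)
   also have "\<dots> \<le> 2 * r * M" using diam[OF zw] LM0 by (intro mult_right_mono) auto
   finally have "cmod (segint z w (\<Gamma> H i z)) \<le> 1" using r by simp
   thus ?thesis unfolding T_def
    using W0B[of z i] zw DR norm_triangle_ineq[of "W0 i z" "segint z w (\<Gamma> H i z)"] by auto
  qed
  ultimately show ?thesis by (simp add: ok_def)
 qed
 have contr: "cmod (T H i z w - T H' i z w) \<le> d / 2"
  if H: "ok H" "ok H'" and d: "\<And>i z w. z \<in> D ==> w \<in> D ==> cmod (H i z w - H' i z w) \<le> d" and zw: "z \<in> D" "w \<in> D"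
  for H H' d i z w
 proof -
  have s: "sholo D (H i)" "sholo D (H' i)" for i using H by (auto simp: ok_def)
  have d0: "d \<ge> 0" using d[OF zw] norm_ge_zero order_trans by blast
  have "T H i z w - T H' i z w = segint z w (\<lambda>t. \<Gamma> H i z t - \<Gamma> H' i z t)"
   unfolding T_def by (simp add: segint_diff[OF D(2) zw \<Gamma>c[OF s(1) zw(1)] \<Gamma>c[OF s(2) zw(1)], symmetric])
  also have "cmod \<dots> \<le> cmod (w - z) * (M * d)"
  proof (intro segint_norm_le[OF D(2) zw] continuous_intros \<Gamma>c s zw)
   fix t assume t: "t \<in> D"
   have "cmod (\<Gamma> H i z t - \<Gamma> H' i z t) \<le> Mf i * d"
    unfolding \<Gamma>_def
   proof (intro Mf(2)[THEN conjunct2])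
    show "close2 B d (\<lambda>j. H j z t) (\<lambda>j. H' j z t)" "close2 B d (\<lambda>j. cnj (H j (cnj t) (cnj z))) (\<lambda>j. cnj (H' j (cnj t) (cnj z)))"
     using H d zw t D(3) by (auto simp: ok_def close2_def simp flip: complex_cnj_diff)
   qed
   also have "\<dots> \<le> M * d" using LM d0 by (intro mult_right_mono) auto
   finally show "cmod (\<Gamma> H i z t - \<Gamma> H' i z t) \<le> M * d" .
  qed
  also have "\<dots> \<le> 2 * r * (M * d)" using diam[OF zw] LM0 d0 by (intro mult_right_mono) auto
  also have "\<dots> = 2 * r * M * d" by simp
  also have "\<dots> \<le> 1 / 2 * d" using r d0 by (intro mult_right_mono) auto
  finally show ?thesis by simp
 qed
 define Hn where "Hn n = (T ^^ n) (\<lambda>i z w. W0 i z)" for n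
 have Hn_Suc: "Hn (Suc n) = T (Hn n)" for n by (simp add: Hn_def)
 have okn: "ok (Hn n)" for n
 proof (induction n)
  case 0
  have "cmod (W0 i z) \<le> B" if "z \<in> D" for i z using W0B[of z i] that DR by force
  thus ?case unfolding ok_def Hn_def
   by (auto intro!: sholo_fst holomorphic_on_subset[OF W0] DR)
 qed (simp add: Hn_Suc okT)
 have Hn_diff: "cmod (Hn (Suc n) i z w - Hn n i z w) \<le> 2 * B * (1/2) ^ n" if "z \<in> D" "w \<in> D" for n i z w
  using that
 proof (induction n arbitrary: i z w)
  case 0
  have "cmod (Hn (Suc 0) i z w) \<le> B" "cmod (Hn 0 i z w) \<le> B" using okn 0 unfolding ok_def by blast+
  thus ?case using norm_triangle_ineq4[of "Hn (Suc 0) i z w" "Hn 0 i z w"] by simp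
 next
  case (Suc n)
  thus ?case using contr[OF okn[of "Suc n"] okn[of n] Suc.IH] by (simp add: Hn_Suc)
 qed
 have B0: "B \<ge> 0" unfolding B_def by (intro add_nonneg_nonneg sum_nonneg) auto
 \<comment> \<open>The limit of the iterates as a telescoping series, dominated by the geometric
   series of \<open>Hn_diff\<close>.\<close>
 define H where "H i z w = W0 i z + (\<Sum>n. Hn (Suc n) i z w - Hn n i z w)" for i z w
 have unifD: "uniform_limit (D \<times> D) (\<lambda>n x. Hn n i (fst x) (snd x)) (\<lambda>x. H i (fst x) (snd x)) sequentially" for i
 proof -
  have "uniform_limit (D \<times> D) (\<lambda>n x. \<Sum>k<n. Hn (Suc k) i (fst x) (snd x) - Hn k i (fst x) (snd x))
    (\<lambda>x. \<Sum>k. Hn (Suc k) i (fst x) (snd x) - Hn k i (fst x) (snd x)) sequentially"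
   by (rule Weierstrass_m_test[of _ _ "\<lambda>n. 2 * B * (1/2) ^ n"]) (use Hn_diff in \<open>auto intro: summable_geometric summable_mult\<close>)
  hence "uniform_limit (D \<times> D) (\<lambda>n x. W0 i (fst x) + (\<Sum>k<n. Hn (Suc k) i (fst x) (snd x) - Hn k i (fst x) (snd x)))
    (\<lambda>x. H i (fst x) (snd x)) sequentially"
   unfolding H_def by (intro uniform_limit_intros)
  moreover have "(\<Sum>k<n. Hn (Suc k) i z w - Hn k i z w) = Hn n i z w - W0 i z" for n z w
   using sum_lessThan_telescope[of "\<lambda>k. Hn k i z w" n] by (simp add: Hn_def[of 0])
  ultimately show ?thesis by simp
 qed
 have unif: "uniform_limit X (\<lambda>n x. Hn n i (a x) (b x)) (\<lambda>x. H i (a x) (b x)) sequentially"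
  if "\<And>x. x \<in> X ==> a x \<in> D \<and> b x \<in> D" for X and a b :: "'z => complex" and i
  using uniform_limit_compose'[OF unifD[of i], of "\<lambda>x. (a x, b x)" X] that by auto
 have Hlim: "(\<lambda>n. Hn n i z w) \<longlonglongrightarrow> H i z w" if zw: "z \<in> D" "w \<in> D" for i z w
  using tendsto_uniform_limitI[OF unifD[of i], of "(z, w)"] zw by simp
 have okH: "ok H"
  unfolding ok_def sholo_def
 proof (intro allI conjI ballI)
  fix i
  show "continuous_on (D \<times> D) (\<lambda>x. H i (fst x) (snd x))"
   by (rule uniform_limit_theorem[OF _ unif[of "D \<times> D" fst snd]]) (use okn in \<open>auto simp: ok_def sholo_def\<close>)
  have hol: "(\<lambda>x. H i (a x) (b x)) holomorphic_on D"
   if "\<And>n. (\<lambda>x. Hn n i (a x) (b x)) holomorphic_on D" "\<And>x. x \<in> D ==> a x \<in> D \<and> b x \<in> D" for a b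
  proof (rule holomorphic_uniform_sequence[OF D(1) that(1)])
   note ab = that(2)
   show "\<exists>d>0. cball x d \<subseteq> D \<and> uniform_limit (cball x d) (\<lambda>n x. Hn n i (a x) (b x)) (\<lambda>x. H i (a x) (b x)) sequentially" if "x \<in> D" for x
   proof -
    obtain d where "d > 0" "cball x d \<subseteq> D" using D(1) \<open>x \<in> D\<close> open_contains_cball by blast
    thus ?thesis using unif[of "cball x d" a b i] ab by (intro exI[of _ d]) (simp add: subset_iff)
   qed
  qed
  show "(\<lambda>z. H i z w) holomorphic_on D" if "w \<in> D" for w
   using hol[of "\<lambda>z. z" "\<lambda>_. w"] okn that by (simp add: ok_def sholo_def)
  show "H i z holomorphic_on D" if "z \<in> D" for z
   using hol[of "\<lambda>_. z" "\<lambda>w. w"] okn that by (simp add: ok_def sholo_def)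
  show "cmod (H i z w) \<le> B" if zw: "z \<in> D" "w \<in> D" for z w
   by (rule Lim_norm_ubound[OF sequentially_bot Hlim[OF zw]]) (use okn zw in \<open>auto simp: ok_def\<close>)
 qed
 have fixp: "H i z w = T H i z w" if zw: "z \<in> D" "w \<in> D" for i z w
 proof -
  have "(\<lambda>n. Hn (Suc n) i z w) \<longlonglongrightarrow> T H i z w"
  proof (rule tendstoI)
   fix e :: real assume e: "e > 0"
   have "\<forall>\<^sub>F n in sequentially. \<forall>j. \<forall>x\<in>D \<times> D. dist (Hn n j (fst x) (snd x)) (H j (fst x) (snd x)) < e"
    by (intro eventually_all_finite uniform_limitD[OF unifD e])
   thus "\<forall>\<^sub>F n in sequentially. dist (Hn (Suc n) i z w) (T H i z w) < e"
   proof eventually_elim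
    case (elim n)
    have "cmod (T (Hn n) i z w - T H i z w) \<le> e / 2"
     by (rule contr[OF okn okH _ zw]) (use elim in \<open>fastforce simp: dist_norm intro: less_imp_le\<close>)
    thus ?case using e by (simp add: Hn_Suc dist_norm)
   qed
  qed
  thus ?thesis using LIMSEQ_Suc[OF Hlim[OF zw]] LIMSEQ_unique by blast
 qed
 have Hs: "sholo D (H i)" for i using okH by (simp add: ok_def)
 define f where "f i z = H i z (cnj z)" for i z
 have "dzb (f i) z = G i (\<lambda>j. f j z) (\<lambda>j. cnj (f j z))" if z: "z \<in> D" for i z
 proof -
  have "\<Gamma> H i z holomorphic_on D" using \<Gamma>s[OF Hs] z by (simp add: sholo_def)
  then obtain F where F: "\<And>a w. a \<in> D ==> w \<in> D ==> segint a w (\<Gamma> H i z) = F w - F a"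
   "\<And>a. a \<in> D ==> (F has_field_derivative \<Gamma> H i z a) (at a)"
   using segint_primitive[OF D(1,2)] by metis
  have "((\<lambda>w. W0 i z + (F w - F z)) has_field_derivative \<Gamma> H i z (cnj z)) (at (cnj z))"
   using F(2)[OF D(3)[OF z]] by (auto intro!: derivative_eq_intros)
  hence "(H i z has_field_derivative \<Gamma> H i z (cnj z)) (at (cnj z))"
   by (rule has_field_derivative_transform_within_open[OF _ D(1) D(3)[OF z]])
    (use fixp[OF z] F(1)[OF z] in \<open>simp add: T_def\<close>)
  hence "deriv (H i z) (cnj z) = \<Gamma> H i z (cnj z)" by (rule DERIV_imp_deriv)
  moreover have "dzb (\<lambda>z. H i z (cnj z)) z = deriv (H i z) (cnj z)" by (rule sholo_diagonal(2)[OF D Hs z])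
  ultimately show ?thesis unfolding f_def[abs_def] \<Gamma>_def by simp
 qed
 moreover have "smooth_on D (f i)" for i unfolding f_def[abs_def] by (rule sholo_diagonal(1)[OF D Hs])
 \<comment> \<open>At a real point the segment from z to cnj z degenerates, so the integral term
   disappears.\<close>
 moreover have "f i (of_real x) = W0 i (of_real x)" if "complex_of_real x \<in> D" for i x
  using fixp[OF that that, of i] by (simp add: f_def T_def segint_def)
 ultimately show ?thesis using r unfolding D_def by (intro exI[of _ r] conjI exI[of _ f]) auto
qed

section \<open>Minkowski space in complex coordinates\<close>

text \<open>\<open>None\<close> indexes the time coordinate, so that the Lorentz product becomes one
  sum over \<open>'n option\<close> with the signs \<open>sg\<close>.\<close>

definition mc :: "'n::finite mink => 'n option => real" where
 "mc x a = (case a of None => fst x | Some i => snd x $ i)"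

definition sg :: "'n option => complex" where
 "sg a = (case a of None => -1 | Some i => 1)"

text \<open>Vector fields with values in the complexification of Minkowski space are families of complex
  functions; \<open>ip\<close> is the complex bilinear extension of the Lorentz product.\<close>

type_synonym 'n cfield = "'n option => complex => complex"

definition ip :: "('n::finite option => 'b => complex) => ('n option => 'b => complex) => 'b => complex" where
 "ip f g z = (\<Sum>a\<in>UNIV. sg a * f a z * g a z)"

definition bar :: "('n option => 'b => complex) => 'n option => 'b => complex" where
 "bar f a z = cnj (f a z)"

definition cf :: "('b => 'n::finite mink) => 'n option => 'b => complex" where
 "cf V a z = complex_of_real (mc (V z) a)"

definition dzf :: "'n cfield => 'n cfield" where "dzf f a = dz (f a)"
definition dzbf :: "'n cfield => 'n cfield" where "dzbf f a = dzb (f a)"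

definition smf :: "complex set => 'n cfield => bool" where
 "smf S f \<longleftrightarrow> (\<forall>a. smooth_on S (f a))"

lemma sum_option:
 fixes f :: "'n::finite option => 'b::comm_monoid_add"
 shows "(\<Sum>a\<in>UNIV. f a) = f None + (\<Sum>i\<in>UNIV. f (Some i))"
proof -
 have "(\<Sum>a\<in>UNIV. f a) = f None + sum f (range Some)"
  unfolding UNIV_option_conv by (subst sum.insert) auto
 also have "sum f (range Some) = (\<Sum>i\<in>UNIV. f (Some i))" by (subst sum.reindex) auto
 finally show ?thesis .
qed

lemma of_real_lor: "complex_of_real (lor (V z) (W z)) = ip (cf V) (cf W) z"
 unfolding ip_def sum_option
 by (simp add: lor_def sg_def cf_def mc_def inner_vec_def)

lemma bounded_linear_mc: "bounded_linear (\<lambda>x. mc x a)"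
 by (cases a) (auto simp: mc_def intro: bounded_linear_fst
   bounded_linear_compose[OF bounded_linear_vec_nth bounded_linear_snd])

lemma mink_eqI: "(\<And>a. mc x a = mc y a) ==> x = y"
 by (rule prod_eqI) (metis mc_def option.simps(4), metis (no_types) mc_def option.simps(5) vec_eq_iff)

lemma mc_simps [simp]: "mc (x + y) a = mc x a + mc y a" "mc (x - y) a = mc x a - mc y a"
 "mc (c *\<^sub>R x) a = c * mc x a" "mc (- x) a = - mc x a" "mc 0 a = 0"
 by (auto simp: mc_def split: option.splits)

lemma ip_commute: "ip f g z = ip g f z"
 by (simp add: ip_def mult_ac)

lemma cnj_sg [simp]: "cnj (sg a) = sg a"
 by (simp add: sg_def split: option.splits)

lemma cnj_ip: "cnj (ip f g z) = ip (bar f) (bar g) z"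
 by (simp add: ip_def bar_def)

lemma bar_bar [simp]: "bar (bar f) = f"
 by (simp add: bar_def fun_eq_iff)

lemma bar_cf [simp]: "bar (cf V) = cf V"
 by (simp add: bar_def cf_def fun_eq_iff)

lemma ip_cong: "(\<And>a. f a z = f' a z) ==> (\<And>a. g a z = g' a z) ==> ip f g z = ip f' g' z"
 by (simp add: ip_def)

lemma ip_lin:
 "ip (\<lambda>a z. f a z + g a z) h z = ip f h z + ip g h z"
 "ip (\<lambda>a z. f a z - g a z) h z = ip f h z - ip g h z"
 "ip (\<lambda>a z. - f a z) h z = - ip f h z"
 "ip (\<lambda>a z. c z * f a z) h z = c z * ip f h z"
 "ip (\<lambda>a z. f a z / d) h z = ip f h z / d"
 "ip h (\<lambda>a z. f a z + g a z) z = ip h f z + ip h g z"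
 "ip h (\<lambda>a z. f a z - g a z) z = ip h f z - ip h g z"
 "ip h (\<lambda>a z. - f a z) z = - ip h f z"
 "ip h (\<lambda>a z. c z * f a z) z = c z * ip h f z"
 "ip h (\<lambda>a z. f a z / d) z = ip h f z / d"
 by (simp_all add: ip_def algebra_simps sum.distrib sum_subtractf sum_negf sum_distrib_left sum_divide_distrib)

lemma smf_D: "smf S f ==> smooth_on S (f a)" by (simp add: smf_def)

lemma smooth_on_ip: "open S ==> smf S f ==> smf S g ==> smooth_on S (ip f g)"
 unfolding ip_def[abs_def] by (intro smooth_intros smf_D)

lemma smooth_on_divide_const: "open S ==> smooth_on S f ==> smooth_on S (\<lambda>z. f z / c :: complex)"
 unfolding divide_inverse by (intro smooth_on_mult smooth_on_const)

lemmas smooth_ops = smooth_on_add smooth_on_diff smooth_on_mult smooth_on_uminus smooth_on_cnj smooth_on_divide_const smooth_on_dz smooth_on_dzb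

context
 fixes S :: "complex set"
 assumes S: "open S"
begin

lemma smf_dzf: "smf S f ==> smf S (dzf f)" and smf_dzbf: "smf S f ==> smf S (dzbf f)"
 by (auto simp: smf_def dzf_def dzbf_def smooth_on_dz[OF S] smooth_on_dzb[OF S])

lemma smf_bar: "smf S f ==> smf S (bar f)"
 by (auto simp: smf_def bar_def[abs_def] intro: smooth_on_cnj[OF S])

lemma dz_ip: "smf S f ==> smf S g ==> z \<in> S ==> dz (ip f g) z = ip (dzf f) g z + ip f (dzf g) z"
 and dzb_ip: "smf S f ==> smf S g ==> z \<in> S ==> dzb (ip f g) z = ip (dzbf f) g z + ip f (dzbf g) z"
 unfolding ip_def[abs_def] dzf_def dzbf_def
 by (simp_all add: dz_sum[OF S] dzb_sum[OF S] dz_mult[OF S] dzb_mult[OF S] dz_const[OF S] dzb_const[OF S] smf_D smooth_on_mult[OF S]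
   sum.distrib[symmetric] algebra_simps)

lemma dzf_bar: "smf S f ==> z \<in> S ==> dzf (bar f) a z = bar (dzbf f) a z"
 and dzbf_bar: "smf S f ==> z \<in> S ==> dzbf (bar f) a z = bar (dzf f) a z"
 by (simp_all add: dzf_def dzbf_def bar_def[abs_def] dz_cnj[OF S] dzb_cnj[OF S] smf_D)

lemma dzf_dzbf: "smf S f ==> z \<in> S ==> dzf (dzbf f) a z = dzbf (dzf f) a z"
 by (simp add: dzf_def dzbf_def dz_dzb_commute[OF S] smf_D)

lemma dzf_cong: "z \<in> S ==> (\<And>w. w \<in> S ==> f a w = g a w) ==> dzf f a z = dzf g a z"
 and dzbf_cong: "z \<in> S ==> (\<And>w. w \<in> S ==> f a w = g a w) ==> dzbf f a z = dzbf g a z"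
 unfolding dzf_def dzbf_def by (intro dz_cong[OF S] dzb_cong[OF S]; simp)+

lemma smf_cf: "smooth_on S V ==> smf S (cf V)"
 unfolding smf_def cf_def[abs_def]
 by (intro allI smooth_on_of_real S smooth_on_linear_compose[OF bounded_linear_mc])

lemma cf_pd:
 assumes V: "smooth_on S V" and z: "z \<in> S"
 shows "pd (cf V a) v z = cf (pd V v) a z"
proof -
 have "pd (\<lambda>z. mc (V z) a) v z = mc (pd V v z) a"
  by (rule pd_linear_compose[OF bounded_linear_mc smooth_on_differentiable[OF V] S z])
 moreover have "pd (cf V a) v z = complex_of_real (pd (\<lambda>z. mc (V z) a) v z)"
  unfolding cf_def[abs_def]
  by (rule pd_linear_compose[OF bounded_linear_of_real smooth_on_differentiable S z])
   (rule smooth_on_linear_compose[OF bounded_linear_mc S V])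
 ultimately show ?thesis by (simp add: cf_def)
qed

lemma cf_pd_1: "smooth_on S V ==> z \<in> S ==> cf (pd V 1) a z = dzf (cf V) a z + dzbf (cf V) a z"
 and cf_pd_ii: "smooth_on S V ==> z \<in> S ==> cf (pd V \<i>) a z = \<i> * (dzf (cf V) a z - dzbf (cf V) a z)"
 by (simp_all add: cf_pd[symmetric] dzf_def dzbf_def pd_1_dz pd_ii_dz)

end

lemma dz_eq0: "open S ==> (\<And>z. z \<in> S ==> f z = c) ==> z \<in> S ==> dz f z = 0"
 and dzb_eq0: "open S ==> (\<And>z. z \<in> S ==> f z = c) ==> z \<in> S ==> dzb f z = 0"
 using dz_cong[of S z f "\<lambda>_. c"] dzb_cong[of S z f "\<lambda>_. c"] by auto

section \<open>Structure equations of a conformal surface\<close>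

locale conformal_lift =
 fixes S :: "complex set" and Y :: "'n::finite cfield"
 assumes S: "open S" and smY: "smf S Y" and real: "bar Y = Y"
  and YY: "\<And>z. z \<in> S ==> ip Y Y z = 0"
  and zz: "\<And>z. z \<in> S ==> ip (dzf Y) (dzf Y) z = 0"
  and zzb: "\<And>z. z \<in> S ==> ip (dzf Y) (dzbf Y) z = 1/2"
begin

abbreviation "Yz \<equiv> dzf Y"
abbreviation "Yb \<equiv> dzbf Y"
abbreviation "Yzz \<equiv> dzf Yz"
abbreviation "Yzb \<equiv> dzbf Yz"

lemmas ipc = ip_commute[of Y "dzf Y"] ip_commute[of Y "dzbf Y"] ip_commute[of "dzbf Y" "dzf Y"] ip_commute[of Y "dzf (dzf Y)"]
 ip_commute[of Y "dzbf (dzf Y)"] ip_commute[of "dzf Y" "dzf (dzf Y)"] ip_commute[of "dzf Y" "dzbf (dzf Y)"]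
 ip_commute[of "dzbf Y" "dzf (dzf Y)"] ip_commute[of "dzbf Y" "dzbf (dzf Y)"] ip_commute[of "dzbf (dzf Y)" "dzf (dzf Y)"]

lemmas sm = smY smf_dzf[OF S smY] smf_dzbf[OF S smY] smf_dzf[OF S smf_dzf[OF S smY]] smf_dzbf[OF S smf_dzf[OF S smY]]

lemma realY: "cnj (Y a z) = Y a z"
 using real by (simp add: bar_def fun_eq_iff)

lemma Yb_cnj: "z \<in> S ==> Yb a z = cnj (Yz a z)"
 using dzbf_bar[OF S smY, of z a] real by (simp add: bar_def)

lemma Yzb_comm: "z \<in> S ==> dzf Yb a z = Yzb a z"
 using dzf_dzbf[OF S smY] .

lemma Yzb_real: "z \<in> S ==> cnj (Yzb a z) = Yzb a z"
proof -
 assume z: "z \<in> S"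
 have "cnj (Yzb a z) = dzf (bar Yz) a z" using dzf_bar[OF S sm(2) z] by (simp add: bar_def)
 also have "\<dots> = dzf Yb a z"
  unfolding dzf_def[of "bar Yz"] dzf_def[of Yb] using Yb_cnj by (intro dz_cong[OF S z]) (simp add: bar_def)
 finally show ?thesis using Yzb_comm[OF z] by simp
qed

lemma bbar: "z \<in> S ==> ip (bar Yz) f z = ip Yb f z" "z \<in> S ==> ip (bar Yb) f z = ip Yz f z"
 "z \<in> S ==> ip f (bar Yz) z = ip f Yb z" "z \<in> S ==> ip f (bar Yb) z = ip f Yz z"
 "z \<in> S ==> ip f (bar Yzb) z = ip f Yzb z" "z \<in> S ==> ip (bar Yzb) f z = ip Yzb f z"
 by (auto intro!: ip_cong simp: bar_def Yb_cnj Yzb_real)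

lemma g1: assumes z: "z \<in> S" shows "ip Yz Y z = 0" "ip Yb Y z = 0"
 using dz_ip[OF S smY smY z] dzb_ip[OF S smY smY z] dz_eq0[OF S YY z] dzb_eq0[OF S YY z]
 by (simp_all add: ipc)

lemma bb: "z \<in> S ==> ip Yb Yb z = 0"
 using zz[of z] cnj_ip[of Yz Yz z] by (simp add: bbar)

lemma g2: assumes z: "z \<in> S"
 shows "ip Yzz Yz z = 0" "ip Yzb Yz z = 0" "ip Yzb Yb z = 0" "ip Yzz Yb z = 0" "ip Yzz Y z = 0" "ip Yzb Y z = -1/2"
proof -
 show 1: "ip Yzz Yz z = 0" and 2: "ip Yzb Yz z = 0"
  using dz_ip[OF S sm(2) sm(2) z] dzb_ip[OF S sm(2) sm(2) z] dz_eq0[OF S zz z] dzb_eq0[OF S zz z]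
  by (simp_all add: ipc)
 show 3: "ip Yzb Yb z = 0"
  using 2 cnj_ip[of Yzb Yz z] z by (simp add: bbar)
 have "ip Yz (dzf Yb) z = ip Yzb Yz z" by (subst ip_commute) (intro ip_cong Yzb_comm z refl)
 thus "ip Yzz Yb z = 0"
  using dz_ip[OF S sm(2) sm(3) z] dz_eq0[OF S zzb z] 2 by simp
 show "ip Yzz Y z = 0" using dz_ip[OF S sm(2) smY z] dz_eq0[OF S g1(1) z] zz[OF z] by simp
 show "ip Yzb Y z = -1/2" using dzb_ip[OF S sm(2) smY z] dzb_eq0[of S "ip Yz Y" 0, OF S g1(1) z] zzb[OF z]
  by (simp add: eq_neg_iff_add_eq_0)
qed

text \<open>\<open>q\<close> turns out to be the squared norm <kappa, conj kappa>, see
  \<open>qK\<close>; \<open>hs\<close> is half the Schwarzian s, since Y_zz = - (s/2) Y + kappa and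
  \<open>K\<close> is kappa.\<close>

definition q :: "complex => complex" where "q z = ip Yzb Yzb z"
definition N :: "'n cfield" where "N a z = 2 * Yzb a z + 2 * q z * Y a z"
definition hs :: "complex => complex" where "hs z = ip Yzz N z"
definition K :: "'n cfield" where "K a z = Yzz a z + hs z * Y a z"

lemma smq: "smooth_on S q" unfolding q_def[abs_def] by (intro smooth_on_ip S sm)
lemma smN: "smf S N" unfolding smf_def N_def[abs_def]
 by (intro allI smooth_intros S smq smf_D[OF smY] smf_D[OF sm(5)])
lemma smhs: "smooth_on S hs" unfolding hs_def[abs_def] by (intro smooth_on_ip S sm smN)
lemma smK: "smf S K" unfolding smf_def K_def[abs_def]
 by (intro allI smooth_intros S smhs smf_D[OF smY] smf_D[OF sm(4)])

lemma ipN: "ip f N z = 2 * ip f Yzb z + 2 * q z * ip f Y z" "ip N f z = 2 * ip f Yzb z + 2 * q z * ip f Y z"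
 unfolding ip_commute[of N] unfolding N_def[abs_def] mult.assoc by (simp_all add: ip_lin(6) ip_lin(9)[where c="\<lambda>_. 2"] ip_lin(9)[where c="q"])

lemma ipK: "ip f K z = ip f Yzz z + hs z * ip f Y z" "ip K f z = ip f Yzz z + hs z * ip f Y z"
 unfolding ip_commute[of K] unfolding K_def[abs_def] by (simp_all add: ip_lin)

lemma gN: assumes z: "z \<in> S"
 shows "ip N N z = 0" "ip N Y z = -1" "ip N Yz z = 0" "ip N Yb z = 0"
 using g1[OF z] g2[OF z] YY[OF z]
 by (simp_all add: ipN(2) q_def[symmetric] ipc)

lemma gK: assumes z: "z \<in> S"
 shows "ip K Y z = 0" "ip K Yz z = 0" "ip K Yb z = 0" "ip K N z = 0" "ip K Yzb z = 0"
proof -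
 show "ip K Y z = 0" "ip K Yz z = 0" "ip K Yb z = 0"
  using g1[OF z] g2[OF z] YY[OF z] by (simp_all add: ipK ipc)
 show N: "ip K N z = 0" using gN(2)[OF z] by (simp add: ipK(2) hs_def ip_commute[of N Yzz])
 show "ip K Yzb z = 0" using N \<open>ip K Y z = 0\<close> by (simp add: ipN)
qed

lemma q_real: "z \<in> S ==> cnj (q z) = q z"
 using cnj_ip[of Yzb Yzb z] by (simp add: q_def bbar)

lemma realN: "z \<in> S ==> cnj (N a z) = N a z"
 by (simp add: N_def Yzb_real q_real realY)

lemma Ybb: "z \<in> S ==> dzbf Yb a z = bar Yzz a z"
proof -
 assume z: "z \<in> S"
 have "dzbf Yb a z = dzbf (bar Yz) a z"
  unfolding dzbf_def using Yb_cnj by (intro dzb_cong[OF S z]) (simp add: bar_def dzbf_def)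
 thus ?thesis using dzbf_bar[OF S sm(2) z] by simp
qed

text \<open>Differentiate <Y_zz, Y_zbar> = 0 by zbar and <Y_zzbar, Y_zbar> = 0 by z. The third
  derivatives of Y agree, which leaves q = <Y_zz, Y_zbarzbar>; passing to \<open>K\<close> changes
  both factors only by multiples of Y.\<close>

lemma qK: assumes z: "z \<in> S" shows "q z = ip K (bar K) z"
proof -
 have c: "dzf Yzb a z = dzbf Yzz a z" if "z \<in> S" for a z using dzf_dzbf[OF S sm(2) that] .
 have "ip (dzbf Yzz) Yb z + ip Yzz (dzbf Yb) z = 0"
  using dzb_ip[OF S sm(4) sm(3) z] dzb_eq0[OF S g2(4) z] by simp
 moreover have "ip (dzf Yzb) Yb z + ip Yzb (dzf Yb) z = 0"
  using dz_ip[OF S sm(5) sm(3) z] dz_eq0[OF S g2(3) z] by simp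
 moreover have "ip (dzf Yzb) Yb z = ip (dzbf Yzz) Yb z" by (rule ip_cong) (simp_all add: c[OF z])
 moreover have "ip Yzb (dzf Yb) z = q z" unfolding q_def by (rule ip_cong) (simp_all add: Yzb_comm[OF z])
 moreover have "ip Yzz (dzbf Yb) z = ip Yzz (bar Yzz) z" by (rule ip_cong) (simp_all add: Ybb[OF z])
 ultimately have 1: "q z = ip Yzz (bar Yzz) z" by algebra
 have "bar K = (\<lambda>a z. bar Yzz a z + cnj (hs z) * Y a z)" by (simp add: fun_eq_iff bar_def K_def realY)
 hence "ip K (bar K) z = ip K (bar Yzz) z" using gK(1)[OF z] by (simp add: ip_lin)
 also have "\<dots> = ip Yzz (bar Yzz) z + hs z * ip (bar Yzz) Y z" by (simp add: ipK ip_commute[of "bar Yzz"])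
 also have "ip (bar Yzz) Y z = 0" using g2(5)[OF z] cnj_ip[of Yzz Y z] real by simp
 finally show ?thesis using 1 by simp
qed

lemma Yzb_eq: "z \<in> S ==> Yzb a z = N a z / 2 - q z * Y a z"
 by (simp add: N_def field_simps)

text \<open>The projection to the normal bundle in a null frame: Y and N pair to -1, Y_z and Y_zbar
  to 1/2, whence the signs and the factors 2.\<close>

definition perp :: "'n cfield => 'n cfield" where
 "perp f a z = f a z + ip f N z * Y a z + ip f Y z * N a z - 2 * ip f Yb z * Yz a z - 2 * ip f Yz z * Yb a z"

text \<open>The gradient of the Willmore energy: what remains of the integrand of
  \<open>density_deriv\<close> after all derivatives have been moved off the variation field, as
  done in \<open>energy_deriv\<close>.\<close>

definition EL :: "'n cfield" where
 "EL a z = of_real (Re (8 * dzb (dzb (K a)) z + 8 * cnj (hs z) * K a z + 16 * dzb (\<lambda>z. q z * Yz a z) z))"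

lemma barK: "z \<in> S ==> bar K a z = bar Yzz a z + cnj (hs z) * Y a z"
 by (simp add: bar_def K_def realY)

lemmas smo = smooth_ops[OF S] smooth_on_const smq smhs
 smY[THEN smf_D] smN[THEN smf_D] smK[THEN smf_D] smf_dzf[OF S smY, THEN smf_D] smf_dzbf[OF S smY, THEN smf_D]

lemmas wirt = wirtinger[OF S]

lemma K_b: assumes z: "z \<in> S"
 shows "ip (dzbf K) Y z = 0" "ip (dzbf K) Yz z = 0" (is ?g1) "ip (dzbf K) Yb z = - q z" (is ?g2)
proof -
 note d = dzb_ip[OF S smK _ z]
 show "ip (dzbf K) Y z = 0" using d[OF smY] dzb_eq0[of S "ip K Y" 0, OF S gK(1) z] gK(3)[OF z] by simp
 show ?g1 using d[OF sm(2)] dzb_eq0[of S "ip K Yz" 0, OF S gK(2) z] gK(5)[OF z] by simp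
 have "ip K (dzbf Yb) z = ip K (bar Yzz) z" by (rule ip_cong) (simp_all add: Ybb[OF z])
 also have "\<dots> = ip K (\<lambda>a z. bar K a z - cnj (hs z) * Y a z) z"
  by (rule ip_cong) (simp_all add: barK[OF z])
 also have "\<dots> = q z" using gK(1)[OF z] by (simp add: ip_lin qK[OF z])
 finally show ?g2
  using d[OF sm(3)] dzb_eq0[of S "ip K Yb" 0, OF S gK(3) z] by (simp add: eq_neg_iff_add_eq_0)
qed

end

section \<open>Structure equations of S-Willmore surfaces\<close>

locale swillmore_lift = conformal_lift S Y for S :: "complex set" and Y :: "'n::finite cfield" +
 fixes m :: "complex => complex"
 assumes smm: "smooth_on S m" and sw: "\<And>z a. z \<in> S ==> perp (dzbf K) a z + cnj (m z) / 2 * K a z = 0"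
begin

text \<open>\<open>P\<close> differs from Y_z by the multiple of Y that makes it orthogonal to the
  dual lift \<open>Yh\<close>. \<open>th\<close> and \<open>r\<close> are theta and rho; they become
  the coefficients of cnj P and P in the derivative of \<open>Yh\<close>, see
  \<open>Yh_z\<close>.\<close>

definition P :: "'n cfield" where "P a z = Yz a z + m z / 2 * Y a z"
definition Yh :: "'n cfield" where
 "Yh a z = N a z + cnj (m z) * Yz a z + m z * Yb a z + m z * cnj (m z) / 2 * Y a z"
definition th :: "complex => complex" where "th z = dz m z - (m z)^2 / 2 - 2 * hs z"
definition r :: "complex => complex" where "r z = cnj (dzb m z) - 2 * q z"

text \<open>By <kappa, N> = 0 the claim concerns <kappa, N_zbar>. The only relevant part of N_zbar
  is twice the z-derivative of conj kappa, and the conjugated S-Willmore equation evaluates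
  it.\<close>

lemma K_N: assumes z: "z \<in> S" shows "ip (dzbf K) N z = m z * q z"
proof -
 have NN: "dzbf N a z = 2 * dzf (bar Yzz) a z + 2 * dzb q z * Y a z + 2 * q z * Yb a z" for a
 proof -
  have 1: "dzbf Yzb a z = dzf (bar Yzz) a z"
  proof -
   have "dzbf Yzb a z = dzbf (dzf Yb) a z"
    by (intro dzbf_cong[OF S z]) (simp add: Yzb_comm)
   also have "\<dots> = dzf (dzbf Yb) a z" using dzf_dzbf[OF S sm(3) z] by simp
   also have "\<dots> = dzf (bar Yzz) a z"
    by (intro dzf_cong[OF S z]) (simp add: Ybb)
   finally show ?thesis .
  qed
  have "dzbf N a z = 2 * dzbf Yzb a z + 2 * (dzb q z * Y a z + q z * Yb a z)"
   unfolding dzbf_def[of N] unfolding N_def[abs_def] using z sm(5)[THEN smf_D, of a]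
   by (simp add: wirt smo) (simp add: dzbf_def)
  thus ?thesis using 1 by simp
 qed
 have bY: "dzf (bar K) a z = dzf (bar Yzz) a z + cnj (dzb hs z) * Y a z + cnj (hs z) * Yz a z" for a
 proof -
  have "dzf (bar K) a z = dz (\<lambda>z. bar Yzz a z + cnj (hs z) * Y a z) z"
   unfolding dzf_def[of "bar K"] by (intro dz_cong[OF S z]) (simp add: barK)
  thus ?thesis using z smf_bar[OF S sm(4), THEN smf_D, of a]
   by (simp add: wirt smo) (simp add: dzf_def)
 qed
 \<comment> \<open>The coefficient <K_zbar, N>, still unknown here, only multiplies Y, which is
   orthogonal to K; so there is no circularity.\<close>
 have sw': "dzbf K a z = - cnj (m z) / 2 * K a z - ip (dzbf K) N z * Y a z - 2 * q z * Yz a z" for a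
 proof -
  have "dzbf K a z - (- cnj (m z) / 2 * K a z - ip (dzbf K) N z * Y a z - 2 * q z * Yz a z) = perp (dzbf K) a z + cnj (m z) / 2 * K a z"
   unfolding perp_def K_b[OF z] by simp
  thus ?thesis using sw[OF z, of a] by (metis right_minus_eq)
 qed
 have "ip K (dzbf N) z = ip K (\<lambda>a z. 2 * (dzf (bar K) a z - cnj (dzb hs z) * Y a z - cnj (hs z) * Yz a z) + 2 * dzb q z * Y a z + 2 * q z * Yb a z) z"
  by (rule ip_cong) (simp_all add: NN bY)
 also have "\<dots> = 2 * ip K (dzf (bar K)) z"
   using gK[OF z] by (simp add: ip_lin)
 also have "ip K (dzf (bar K)) z = ip K (\<lambda>a z. - m z / 2 * bar K a z - cnj (ip (dzbf K) N z) * Y a z - 2 * q z * Yb a z) z"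
  by (rule ip_cong) (simp_all add: dzf_bar[OF S smK z] sw' realY q_real[OF z] Yb_cnj[OF z] bar_def)
 also have "\<dots> = - m z / 2 * q z"
   using gK[OF z] by (simp add: ip_lin qK[OF z])
 finally have "ip K (dzbf N) z = - m z * q z" by simp
 moreover have "ip (dzbf K) N z + ip K (dzbf N) z = 0"
  using dzb_ip[OF S smK smN z] dzb_eq0[of S "ip K N" 0, OF S gK(4) z] by simp
 ultimately show ?thesis by simp
qed

lemma Kb_eq: assumes z: "z \<in> S" shows "dzb (K a) z = - cnj (m z) / 2 * K a z - 2 * q z * P a z"
proof -
 have "dzb (K a) z - (- cnj (m z) / 2 * K a z - 2 * q z * P a z) = perp (dzbf K) a z + cnj (m z) / 2 * K a z"
  unfolding perp_def K_b[OF z] K_N[OF z] dzbf_def[of K] P_def by (simp add: algebra_simps)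
 thus ?thesis using sw[OF z, of a] by (metis right_minus_eq)
qed

lemma Pz_eq: assumes z: "z \<in> S" shows "dz (P a) z = m z / 2 * P a z + K a z + th z / 2 * Y a z"
proof -
 have "dz (P a) z = Yzz a z + (m z * Yz a z + dz m z * Y a z) / 2"
  unfolding P_def[abs_def] using z smm by (simp add: wirt smo) (simp add: dzf_def)
 thus ?thesis by (simp only:) (simp add: K_def P_def th_def power2_eq_square field_simps)
qed

lemma Pb_eq: assumes z: "z \<in> S" shows "dzb (P a) z = - cnj (m z) / 2 * P a z + Yh a z / 2 + cnj (r z) / 2 * Y a z"
proof -
 have "dzb (P a) z = Yzb a z + (m z * Yb a z + dzb m z * Y a z) / 2"
  unfolding P_def[abs_def] using z smm by (simp add: wirt smo) (simp add: dzbf_def)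
 moreover have "cnj (r z) = dzb m z - 2 * q z" by (simp add: r_def q_real[OF z])
 ultimately show ?thesis by (simp only:) (simp add: Yzb_eq[OF z] Yh_def P_def field_simps)
qed

lemma smP: "smooth_on S (P a)" unfolding P_def[abs_def] by (intro smo smm)

text \<open>The S-Willmore equation determines kappa_zbar completely, so its second zbar-derivative
  can be expanded in the frame. The components along Y_z and Y_zbar combine to a purely imaginary
  vector and vanish under \<open>Re\<close>; a real multiple of Y stays and will be invisible to
  variations tangent to the sphere.\<close>

lemma EL_eq: assumes z: "z \<in> S" shows "\<exists>c. \<forall>a. EL a z = - 4 * of_real (Re (cnj (th z) * K a z)) + of_real c * Y a z"
proof -
 have Kbb: "dzb (dzb (K a)) z = - cnj (dz m z) / 2 * K a z - cnj (m z) / 2 * dzb (K a) z - 2 * dzb q z * P a z - 2 * q z * dzb (P a) z" for a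
 proof -
  have "dzb (dzb (K a)) z = dzb (\<lambda>z. - cnj (m z) / 2 * K a z - 2 * q z * P a z) z"
   by (intro dzb_cong[OF S z]) (simp add: Kb_eq)
  also have "\<dots> = dzb (\<lambda>z. - cnj (m z) / 2 * K a z) z - dzb (\<lambda>z. 2 * q z * P a z) z"
   using z smm smP[of a] by (simp add: wirt smo)
  also have "dzb (\<lambda>z. - cnj (m z) / 2 * K a z) z = - cnj (dz m z) / 2 * K a z - cnj (m z) / 2 * dzb (K a) z"
   using z smm by (simp add: wirt smo add_divide_distrib)
  also have "dzb (\<lambda>z. 2 * q z * P a z) z = 2 * dzb q z * P a z + 2 * q z * dzb (P a) z"
   using z smP[of a] by (simp add: wirt smo)
  finally show ?thesis by simp
 qed
 have qY: "dzb (\<lambda>z. q z * Yz a z) z = q z * Yzb a z + dzb q z * Yz a z" for a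
  using z by (simp add: wirt smo) (simp add: dzbf_def)
 define c where "c = - 16 * dzb q z * (m z / 2) + 8 * q z * cnj (m z) * m z - 8 * q z * cnj (r z) - 4 * q z * cnj (m z) * m z - 16 * q z * q z"
 have e: "8 * dzb (dzb (K a)) z + 8 * cnj (hs z) * K a z + 16 * dzb (\<lambda>z. q z * Yz a z) z
   = - 4 * (cnj (th z) * K a z) + 8 * q z * (cnj (m z) * Yz a z - m z * Yb a z) + c * Y a z" for a
  unfolding Kbb qY Kb_eq[OF z] Pb_eq[OF z] c_def th_def Yh_def Yzb_eq[OF z]
  by (simp add: P_def power2_eq_square field_simps)
 have rq: "q z = of_real (Re (q z))" using q_real[OF z] by (simp add: complex_eq_iff)
 have rY: "Y a z = of_real (Re (Y a z))" for a using realY[of a z] by (simp add: complex_eq_iff)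
 have "EL a z = - 4 * of_real (Re (cnj (th z) * K a z)) + of_real (Re c) * Y a z" for a
 proof -
  have "Im (q z) = 0" "Im (Y a z) = 0" using rq rY[of a] by (metis Im_complex_of_real)+
  thus ?thesis unfolding EL_def e
   by (simp add: complex_eq_iff Yb_cnj[OF z])
 qed
 thus ?thesis by simp
qed

end

section \<open>Conformal immersions\<close>

lemma lor_commute: "lor x y = lor y x"
 by (simp add: lor_def inner_commute)

lemma bounded_bilinear_lor: "bounded_bilinear (lor :: 'n::finite mink => 'n mink => real)"
proof -
 have "bounded_bilinear (\<lambda>x y :: 'n mink. - (fst x * fst y) + snd x \<bullet> snd y)"
 proof
  fix a a' b b' :: "'n mink" and r :: real
  show "\<exists>K. \<forall>a b. norm (- (fst a * fst b) + snd a \<bullet> snd (b :: 'n mink)) \<le> norm a * norm b * K"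
  proof (intro exI[of _ 2] allI)
   fix a b :: "'n mink"
   have n: "\<bar>fst x\<bar> \<le> norm x" "norm (snd x) \<le> norm x" for x :: "'n mink"
    using norm_fst_le[of "fst x" "snd x"] norm_snd_le[of "snd x" "fst x"] by auto
   have "\<bar>fst a * fst b\<bar> \<le> norm a * norm b"
    unfolding abs_mult using n by (intro mult_mono) auto
   moreover have "\<bar>snd a \<bullet> snd b\<bar> \<le> norm a * norm b"
    using Cauchy_Schwarz_ineq2[of "snd a" "snd b"] mult_mono[of "norm (snd a)" "norm a" "norm (snd b)" "norm b"]
     n by fastforce
   ultimately show "norm (- (fst a * fst b) + snd a \<bullet> snd b) \<le> norm a * norm b * 2" by simp
  qed
 qed (simp_all add: algebra_simps)
 thus ?thesis by (simp add: lor_def[abs_def])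
qed

lemmas lor_simps = bounded_bilinear.add_left[OF bounded_bilinear_lor] bounded_bilinear.add_right[OF bounded_bilinear_lor]
 bounded_bilinear.diff_left[OF bounded_bilinear_lor] bounded_bilinear.diff_right[OF bounded_bilinear_lor]
 bounded_bilinear.scaleR_left[OF bounded_bilinear_lor] bounded_bilinear.scaleR_right[OF bounded_bilinear_lor]
 bounded_bilinear.minus_left[OF bounded_bilinear_lor] bounded_bilinear.minus_right[OF bounded_bilinear_lor]
 bounded_bilinear.zero_left[OF bounded_bilinear_lor] bounded_bilinear.zero_right[OF bounded_bilinear_lor]

lemmas smooth_on_lor = smooth_on_bilinear[OF bounded_bilinear_lor]

lemma pd_lor: "open S ==> z \<in> S ==> smooth_on S V ==> smooth_on S W ==>
  pd (\<lambda>z. lor (V z) (W z)) v z = lor (V z) (pd W v z) + lor (pd V v z) (W z)"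
 by (intro pd_bilinear[OF bounded_bilinear_lor] smooth_on_differentiable)

lemma pd_scaleR: "open S ==> z \<in> S ==> smooth_on S f ==> smooth_on S W ==>
  pd (\<lambda>z. f z *\<^sub>R W z) v z = f z *\<^sub>R pd W v z + pd f v z *\<^sub>R W z"
 by (intro pd_bilinear[OF bounded_bilinear_scaleR] smooth_on_differentiable)

lemma pd_eq0: "open S ==> (\<And>z. z \<in> S ==> f z = c) ==> z \<in> S ==> pd f v z = 0"
 using pd_cong[of S z f "\<lambda>_. c"] by auto

lemma conformal_lift_cf:
 assumes S: "open S" and V: "smooth_on S V" and VV: "\<And>z. z \<in> S ==> lor (V z) (V z) = 0"
  and uu: "\<And>z. z \<in> S ==> lor (pd V 1 z) (pd V 1 z) = 1"
  and vv: "\<And>z. z \<in> S ==> lor (pd V \<i> z) (pd V \<i> z) = 1"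
  and uv: "\<And>z. z \<in> S ==> lor (pd V 1 z) (pd V \<i> z) = 0"
 shows "conformal_lift S (cf V)"
proof
 have z: "dzf (cf V) a z = (cf (pd V 1) a z - \<i> * cf (pd V \<i>) a z) / 2" "dzbf (cf V) a z = (cf (pd V 1) a z + \<i> * cf (pd V \<i>) a z) / 2"
  if "z \<in> S" for a z
  using that by (simp_all add: dzf_def dzbf_def dz_def dzb_def cf_pd[OF S V])
 have g: "ip (cf (pd V 1)) (cf (pd V 1)) z = 1" "ip (cf (pd V \<i>)) (cf (pd V \<i>)) z = 1" "ip (cf (pd V 1)) (cf (pd V \<i>)) z = 0"
  if "z \<in> S" for z
  using that by (simp_all add: of_real_lor[symmetric] uu vv uv)
 have i: "ip (dzf (cf V)) f z = (ip (cf (pd V 1)) f z - \<i> * ip (cf (pd V \<i>)) f z) / 2" "ip (dzbf (cf V)) f z = (ip (cf (pd V 1)) f z + \<i> * ip (cf (pd V \<i>)) f z) / 2"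
  if "z \<in> S" for f z
  unfolding ip_def z[OF that] by (simp_all add: sum_distrib_left sum_subtractf[symmetric] sum.distrib[symmetric] sum_divide_distrib algebra_simps)
 show "ip (dzf (cf V)) (dzf (cf V)) z = 0" "ip (dzf (cf V)) (dzbf (cf V)) z = 1/2" if "z \<in> S" for z
  unfolding i(1)[OF that] ip_commute[of "cf _" "dzf _"] ip_commute[of "cf _" "dzbf _"] i[OF that]
  using g[OF that] by (simp_all add: ip_commute[of "cf (pd V \<i>)" "cf (pd V 1)"])
qed (use S V VV in \<open>auto simp: smf_cf of_real_lor[symmetric]\<close>)

text \<open>\<open>Pr\<close> below fixes the span pointwise and annihilates everything orthogonal
  to it. Hence x - Pr x is the only candidate for the \<open>THE\<close> in \<open>lperp\<close>.
  The spanning set contains M in place of N because \<open>cg_space\<close> is spanned with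
  \<open>Yzzb\<close>.\<close>

lemma lperp_frame:
 assumes g: "lor Y Y = 0" "lor Y U = 0" "lor Y V = 0" "lor U U = 1" "lor V V = 1" "lor U V = 0"
   "lor N Y = -1" "lor N N = 0" "lor N U = 0" "lor N V = 0"
  and M: "N = 2 *\<^sub>R M + c *\<^sub>R Y"
 shows "lperp (span {Y, U, V, M}) x = x + lor x N *\<^sub>R Y + lor x Y *\<^sub>R N - lor x U *\<^sub>R U - lor x V *\<^sub>R V"
proof -
 let ?W = "span {Y, U, V, M}"
 define Pr where "Pr x = lor x U *\<^sub>R U + lor x V *\<^sub>R V - lor x N *\<^sub>R Y - lor x Y *\<^sub>R N" for x
 have M': "M = (1/2) *\<^sub>R N - (c/2) *\<^sub>R Y" using M by (simp add: algebra_simps)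
 have NW: "N \<in> ?W" unfolding M by (intro span_add span_scale span_base) auto
 have PW: "Pr x \<in> ?W" for x unfolding Pr_def
  by (intro span_add span_diff span_scale NW) (auto intro: span_base)
 note g' = g lor_commute[of U Y] lor_commute[of V Y] lor_commute[of V U] lor_commute[of Y N] lor_commute[of U N] lor_commute[of V N]
 have Plin: "Pr (u + v) = Pr u + Pr v" "Pr (k *\<^sub>R u) = k *\<^sub>R Pr u" for u v k
  by (simp_all add: Pr_def lor_simps algebra_simps)
 have P0: "Pr 0 = 0" by (simp add: Pr_def lor_simps)
 have "?W \<subseteq> {d. Pr d = d}"
 proof (rule span_minimal)
  show "{Y, U, V, M} \<subseteq> {d. Pr d = d}" using g' by (auto simp: Pr_def M' lor_simps)
  show "subspace {d. Pr d = d}" by (auto simp: subspace_def Plin P0)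
 qed
 hence Pid: "Pr d = d" if "d \<in> ?W" for d using that by blast
 have perp: "x - Pr x \<in> lorth ?W"
 proof -
  have "?W \<subseteq> {w. lor (x - Pr x) w = 0}"
  proof (rule span_minimal)
   show "{Y, U, V, M} \<subseteq> {w. lor (x - Pr x) w = 0}" using g' by (auto simp: Pr_def M' lor_simps)
   show "subspace {w. lor (x - Pr x) w = 0}" by (auto simp: subspace_def lor_simps)
  qed
  thus ?thesis by (auto simp: lorth_def)
 qed
 have "lperp ?W x = x - Pr x"
  unfolding lperp_def
 proof (rule the_equality)
  show "x - Pr x \<in> lorth ?W \<and> x - (x - Pr x) \<in> ?W" using perp PW by simp
  fix w assume w: "w \<in> lorth ?W \<and> x - w \<in> ?W"
  have "x - w - Pr x \<in> ?W" using w by (intro span_diff[OF _ PW]) simp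
  hence "Pr (x - w - Pr x) = x - w - Pr x" by (rule Pid)
  moreover have "lor (x - w - Pr x) y = 0" if "y \<in> ?W" for y
  proof -
   have "lor (x - w - Pr x) y = lor (x - Pr x) y - lor w y" by (simp add: lor_simps)
   thus ?thesis using w perp that by (simp add: lorth_def)
  qed
  hence "Pr (x - w - Pr x) = 0" unfolding Pr_def[of "x - w - Pr x"] using NW by (simp add: span_base)
  ultimately show "w = x - Pr x" by (simp add: algebra_simps)
 qed
 thus ?thesis by (simp add: Pr_def)
qed

section \<open>Translation of the real definitions into the complex lift\<close>

locale conformal_surface =
 fixes S :: "complex set" and y :: "complex => 'n::finite mink"
 assumes conf: "conformal_immersion S y"
begin

abbreviation "L \<equiv> canon_lift y"

definition lam :: "complex => real" where "lam z = lor (pd y 1 z) (pd y 1 z)"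

lemma Sy: "open S" "smooth_on S y" "\<And>z. z \<in> S ==> fst (y z) = 1" "\<And>z. z \<in> S ==> lor (y z) (y z) = 0"
 "\<And>z. z \<in> S ==> lor (pd y \<i> z) (pd y \<i> z) = lam z" "\<And>z. z \<in> S ==> lor (pd y 1 z) (pd y \<i> z) = 0"
 "\<And>z. z \<in> S ==> lam z > 0"
 using conf by (auto simp: conformal_immersion_def on_sphere_def lam_def)

definition sig :: "complex => real" where "sig z = 1 / sqrt (lam z)"

lemma sig: "z \<in> S ==> sig z > 0" "z \<in> S ==> sig z * sig z * lam z = 1"
 using Sy(7)[of z] by (simp_all add: sig_def)

lemma smlam: "smooth_on S lam" unfolding lam_def by (intro smooth_on_lor smooth_on_pd Sy)

lemma smsig: "smooth_on S sig"
 unfolding sig_def using Sy(7) by (intro smooth_on_divide smooth_on_sqrt smlam smooth_on_const Sy) force+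

lemma L_eq: "L = (\<lambda>z. sig z *\<^sub>R y z)"
 by (simp add: fun_eq_iff canon_lift_def sig_def lam_def)

lemma smL: "smooth_on S L" unfolding L_eq by (intro smooth_on_scaleR smsig Sy)

lemma yyv: "z \<in> S ==> lor (y z) (pd y v z) = 0"
 using pd_lor[OF Sy(1) _ Sy(2) Sy(2), of z v] pd_eq0[of S "\<lambda>z. lor (y z) (y z)" 0 z v, OF Sy(1) Sy(4)]
 by (simp add: lor_commute[of "pd y v z"])

lemma pdL: "z \<in> S ==> pd L v z = sig z *\<^sub>R pd y v z + pd sig v z *\<^sub>R y z"
 unfolding L_eq by (rule pd_scaleR[OF Sy(1) _ smsig Sy(2)])

sublocale lift: conformal_lift S "cf L"
proof (rule conformal_lift_cf[OF Sy(1) smL])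
 fix z assume z: "z \<in> S"
 show "lor (L z) (L z) = 0" using Sy(4)[OF z] by (simp add: L_eq lor_simps)
 note e = pdL[OF z] lor_simps yyv[OF z] lor_commute[of "pd y _ z" "y z"] Sy(4,5,6)[OF z] lam_def[symmetric]
 show "lor (pd L 1 z) (pd L 1 z) = 1" "lor (pd L \<i> z) (pd L \<i> z) = 1" "lor (pd L 1 z) (pd L \<i> z) = 0"
  using sig(2)[OF z] by (simp_all add: e)
qed

lemma Yu_eq: "Yu y = pd L 1" and Yv_eq: "Yv y = pd L \<i>" and Yuu_eq: "Yuu y = pd (pd L 1) 1"
 and Yvv_eq: "Yvv y = pd (pd L \<i>) \<i>" and Yuv_eq: "Yuv y = pd (pd L 1) \<i>"
proof -
 show *: "Yu y = pd L 1" "Yv y = pd L \<i>" by (simp_all add: fun_eq_iff Yu_def Yv_def)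
 show "Yuu y = pd (pd L 1) 1" "Yvv y = pd (pd L \<i>) \<i>" "Yuv y = pd (pd L 1) \<i>"
  by (simp_all add: fun_eq_iff Yuu_def Yvv_def Yuv_def *)
qed

lemma cf1: assumes z: "z \<in> S"
 shows "cf (pd L 1) a z = lift.Yz a z + lift.Yb a z" "cf (pd L \<i>) a z = \<i> * (lift.Yz a z - lift.Yb a z)"
 using cf_pd_1[OF Sy(1) smL z] cf_pd_ii[OF Sy(1) smL z] by auto

lemma cf2: assumes z: "z \<in> S"
 shows "cf (Yuu y) a z = lift.Yzz a z + 2 * lift.Yzb a z + dzbf lift.Yb a z" (is ?g1)
  "cf (Yvv y) a z = - lift.Yzz a z + 2 * lift.Yzb a z - dzbf lift.Yb a z" (is ?g2)
  "cf (Yuv y) a z = \<i> * (lift.Yzz a z - dzbf lift.Yb a z)" (is ?g3)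
proof -
 have c: "dzf (cf (pd L 1)) a z = lift.Yzz a z + lift.Yzb a z" (is ?h1) "dzbf (cf (pd L 1)) a z = lift.Yzb a z + dzbf lift.Yb a z" (is ?h2)
  "dzf (cf (pd L \<i>)) a z = \<i> * (lift.Yzz a z - lift.Yzb a z)" (is ?h3) "dzbf (cf (pd L \<i>)) a z = \<i> * (lift.Yzb a z - dzbf lift.Yb a z)" (is ?h4)
 proof -
  have *: "dzf (cf (pd L 1)) a z = dz (\<lambda>z. lift.Yz a z + lift.Yb a z) z" "dzbf (cf (pd L 1)) a z = dzb (\<lambda>z. lift.Yz a z + lift.Yb a z) z"
   "dzf (cf (pd L \<i>)) a z = dz (\<lambda>z. \<i> * (lift.Yz a z - lift.Yb a z)) z" "dzbf (cf (pd L \<i>)) a z = dzb (\<lambda>z. \<i> * (lift.Yz a z - lift.Yb a z)) z"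
   unfolding dzf_def[of "cf (pd L 1)"] dzbf_def[of "cf (pd L 1)"] dzf_def[of "cf (pd L \<i>)"] dzbf_def[of "cf (pd L \<i>)"]
   by (auto intro!: dz_cong[OF Sy(1) z] dzb_cong[OF Sy(1) z] simp: cf1)
  have d: "dz (lift.Yz a) z = lift.Yzz a z" "dzb (lift.Yz a) z = lift.Yzb a z" "dz (lift.Yb a) z = lift.Yzb a z"
   "dzb (lift.Yb a) z = dzbf lift.Yb a z" using lift.Yzb_comm[OF z] by (auto simp: dzf_def dzbf_def)
  show ?h1 ?h2
  ?h3 ?h4
   unfolding * using z by (simp_all add: lift.wirt lift.smo d)
 qed
 note s = smooth_on_pd[OF smL]
 show ?g1
  ?g2
  ?g3
  unfolding Yuu_eq Yvv_eq Yuv_eq cf_pd_1[OF Sy(1) s z] cf_pd_ii[OF Sy(1) s z] c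
  by (simp_all add: algebra_simps)
qed

lemma cf_Yzzb: "z \<in> S ==> cf (Yzzb y) a z = lift.Yzb a z"
 using cf2[of z a] by (simp add: cf_def Yzzb_def)

lemma cf_frameN: assumes z: "z \<in> S" shows "cf (frameN y) a z = lift.N a z"
proof -
 have "complex_of_real (lor (Yzzb y z) (Yzzb y z)) = lift.q z"
  unfolding of_real_lor lift.q_def by (rule ip_cong) (simp_all add: cf_Yzzb z)
 thus ?thesis using cf_Yzzb[OF z, of a] by (simp add: lift.N_def cf_def frameN_def)
qed

lemma gram: assumes z: "z \<in> S"
 shows "lor (L z) (L z) = 0" (is ?g0) "lor (L z) (pd L 1 z) = 0" (is ?g1) "lor (L z) (pd L \<i> z) = 0" (is ?g2)
  "lor (pd L 1 z) (pd L 1 z) = 1" (is ?g3) "lor (pd L \<i> z) (pd L \<i> z) = 1" (is ?g4) "lor (pd L 1 z) (pd L \<i> z) = 0" (is ?g5)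
  "lor (frameN y z) (L z) = -1" (is ?g6) "lor (frameN y z) (frameN y z) = 0" (is ?g7) "lor (frameN y z) (pd L 1 z) = 0" (is ?g8) "lor (frameN y z) (pd L \<i> z) = 0" (is ?g9)
proof -
 have U: "ip f (cf (pd L 1)) z = ip f (\<lambda>a z. lift.Yz a z + lift.Yb a z) z" "ip f (cf (pd L \<i>)) z = ip f (\<lambda>a z. \<i> * (lift.Yz a z - lift.Yb a z)) z"
  "ip (cf (pd L 1)) f z = ip (\<lambda>a z. lift.Yz a z + lift.Yb a z) f z" "ip (cf (pd L \<i>)) f z = ip (\<lambda>a z. \<i> * (lift.Yz a z - lift.Yb a z)) f z"
  "ip (cf (frameN y)) f z = ip lift.N f z" "ip f (cf (frameN y)) z = ip f lift.N z" for f
  by (auto intro!: ip_cong simp: cf1[OF z] cf_frameN[OF z])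
 note l = ip_lin(1,2,6,7) ip_lin(4)[where c="\<lambda>_. \<i>"] ip_lin(9)[where c="\<lambda>_. \<i>"]
 show ?g0 ?g1 ?g2 ?g3 ?g4 ?g5 ?g6 ?g7 ?g8 ?g9
  unfolding of_real_eq_iff[where 'a=complex, symmetric] of_real_lor
  using lift.YY[OF z] lift.zz[OF z] lift.zzb[OF z] lift.bb[OF z] lift.g1[OF z] lift.gN[OF z]
  by (simp_all add: U l lift.ipc algebra_simps flip: mult.assoc)
qed

lemma lperp_eq: assumes z: "z \<in> S"
 shows "lperp (cg_space y z) x = x + lor x (frameN y z) *\<^sub>R L z + lor x (L z) *\<^sub>R frameN y z - lor x (pd L 1 z) *\<^sub>R pd L 1 z - lor x (pd L \<i> z) *\<^sub>R pd L \<i> z"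
 unfolding cg_space_def Yu_eq Yv_eq by (rule lperp_frame[OF gram[OF z]]) (rule frameN_def)

lemma cf_lperp: assumes z: "z \<in> S"
 shows "cf (\<lambda>z. lperp (cg_space y z) (V z)) a z = lift.perp (cf V) a z"
proof -
 have "ip (cf V) (cf (pd L 1)) z = ip (cf V) lift.Yz z + ip (cf V) lift.Yb z"
  "ip (cf V) (cf (pd L \<i>)) z = \<i> * (ip (cf V) lift.Yz z - ip (cf V) lift.Yb z)"
  "ip (cf V) (cf (frameN y)) z = ip (cf V) lift.N z"
  unfolding ip_def using z by (simp_all add: cf1 cf_frameN sum_distrib_left sum.distrib sum_subtractf algebra_simps)
 moreover have "cf (\<lambda>z. lperp (cg_space y z) (V z)) a z = cf V a z + ip (cf V) (cf (frameN y)) z * cf L a z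
   + ip (cf V) (cf L) z * cf (frameN y) a z - ip (cf V) (cf (pd L 1)) z * cf (pd L 1) a z - ip (cf V) (cf (pd L \<i>)) z * cf (pd L \<i>) a z"
  unfolding of_real_lor[symmetric] by (simp add: cf_def lperp_eq[OF z])
 ultimately show ?thesis unfolding lift.perp_def
  by (simp only: cf1[OF z] cf_frameN[OF z]) (simp add: algebra_simps)
qed

lemma cf_lperp_pair: "z \<in> S ==> cf (\<lambda>z. lperp (cg_space y z) (V z)) a z + \<i> * cf (\<lambda>z. lperp (cg_space y z) (W z)) a z = lift.perp (\<lambda>a z. cf V a z + \<i> * cf W a z) a z"
 unfolding cf_lperp lift.perp_def ip_lin(1) ip_lin(4)[where c="\<lambda>_. \<i>"] by (simp add: algebra_simps)

lemma perp_cong: "(\<And>a. f a z = g a z) ==> lift.perp f a z = lift.perp g a z"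
 unfolding lift.perp_def by (simp add: ip_def)

lemma kap: assumes z: "z \<in> S" shows "cf (kap_re y) a z + \<i> * cf (kap_im y) a z = lift.K a z"
proof -
 let ?x = "\<lambda>z. (1/4) *\<^sub>R (Yuu y z - Yvv y z)" and ?y = "\<lambda>z. (- 1/2) *\<^sub>R Yuv y z"
 have "kap_re y = (\<lambda>z. lperp (cg_space y z) (?x z))" "kap_im y = (\<lambda>z. lperp (cg_space y z) (?y z))"
  by (simp_all add: fun_eq_iff kap_re_def kap_im_def)
 hence "cf (kap_re y) a z + \<i> * cf (kap_im y) a z = lift.perp (\<lambda>a z. cf ?x a z + \<i> * cf ?y a z) a z"
  by (simp only: cf_lperp_pair[OF z])
 also have "\<dots> = lift.perp lift.Yzz a z"
 proof (rule perp_cong)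
  fix a
  have "cf ?x a z = (cf (Yuu y) a z - cf (Yvv y) a z) / 4" "cf ?y a z = - cf (Yuv y) a z / 2" by (simp_all add: cf_def)
  thus "cf ?x a z + \<i> * cf ?y a z = lift.Yzz a z" by (simp only: cf2[OF z]) (simp add: field_simps)
 qed
 also have "\<dots> = lift.K a z"
  unfolding lift.perp_def lift.K_def lift.hs_def using lift.g2[OF z] by simp
 finally show ?thesis .
qed

lemma smN: "smooth_on S (frameN y)"
 unfolding frameN_def[abs_def] Yzzb_def[abs_def] Yuu_eq Yvv_eq
 by (intro smooth_intros smooth_on_lor Sy(1) smL)

lemma sm_lperp: assumes "smooth_on S V" shows "smooth_on S (\<lambda>z. lperp (cg_space y z) (V z))"
 by (rule iffD2[OF smooth_on_cong[OF Sy(1) lperp_eq]]) (auto intro!: smooth_intros smooth_on_lor Sy(1) smL smN assms)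

lemma smkap: "smooth_on S (kap_re y)" "smooth_on S (kap_im y)"
 unfolding kap_re_def[abs_def] kap_im_def[abs_def] Yuu_eq Yvv_eq Yuv_eq
 by (intro sm_lperp smooth_intros Sy(1) smL)+

lemma Dzb_kap: assumes z: "z \<in> S"
 shows "cf (Dzb_kap_re y) a z + \<i> * cf (Dzb_kap_im y) a z = lift.perp (dzbf lift.K) a z"
proof -
 let ?x = "\<lambda>z. (1/2) *\<^sub>R (pd (kap_re y) 1 z - pd (kap_im y) \<i> z)" and ?y = "\<lambda>z. (1/2) *\<^sub>R (pd (kap_re y) \<i> z + pd (kap_im y) 1 z)"
 have "Dzb_kap_re y = (\<lambda>z. lperp (cg_space y z) (?x z))" "Dzb_kap_im y = (\<lambda>z. lperp (cg_space y z) (?y z))"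
  by (simp_all add: fun_eq_iff Dzb_kap_re_def Dzb_kap_im_def)
 hence "cf (Dzb_kap_re y) a z + \<i> * cf (Dzb_kap_im y) a z = lift.perp (\<lambda>a z. cf ?x a z + \<i> * cf ?y a z) a z"
  by (simp only: cf_lperp_pair[OF z])
 also have "\<dots> = lift.perp (dzbf lift.K) a z"
 proof (rule perp_cong)
  fix a
  have "dzbf lift.K a z = dzb (\<lambda>z. cf (kap_re y) a z + \<i> * cf (kap_im y) a z) z"
   unfolding dzbf_def[of lift.K] by (intro dzb_cong[OF Sy(1) z]) (simp add: kap)
  also have "\<dots> = dzb (cf (kap_re y) a) z + \<i> * dzb (cf (kap_im y) a) z"
   using z smkap[THEN smf_cf[OF Sy(1)], THEN smf_D] by (simp add: lift.wirt lift.smo)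
  also have "\<dots> = cf ?x a z + \<i> * cf ?y a z"
   unfolding dzb_def cf_pd[OF Sy(1) smkap(1) z] cf_pd[OF Sy(1) smkap(2) z]
   by (simp add: cf_def field_simps)
  finally show "cf ?x a z + \<i> * cf ?y a z = dzbf lift.K a z" by simp
 qed
 finally show ?thesis .
qed

lemma s_willmore_eq_iff: "s_willmore_eq S y \<mu> \<longleftrightarrow> (\<forall>z\<in>S. \<forall>a. lift.perp (dzbf lift.K) a z + cnj (\<mu> z) / 2 * lift.K a z = 0)"
 unfolding s_willmore_eq_def
proof (rule ball_cong[OF refl])
 fix z assume z: "z \<in> S"
 have "lift.perp (dzbf lift.K) a z + cnj (\<mu> z) / 2 * lift.K a z = 0 \<longleftrightarrow>
   mc (Dzb_kap_re y z + (Re (\<mu> z) / 2) *\<^sub>R kap_re y z + (Im (\<mu> z) / 2) *\<^sub>R kap_im y z) a = 0 \<and>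
   mc (Dzb_kap_im y z + (Re (\<mu> z) / 2) *\<^sub>R kap_im y z - (Im (\<mu> z) / 2) *\<^sub>R kap_re y z) a = 0" for a
  unfolding Dzb_kap[OF z, symmetric] kap[OF z, symmetric] cf_def by (simp add: complex_eq_iff algebra_simps)
 moreover have "V = 0 \<longleftrightarrow> (\<forall>a. mc V a = 0)" for V :: "'n mink" using mink_eqI[of V 0] by auto
 ultimately show "(Dzb_kap_re y z + (Re (\<mu> z) / 2) *\<^sub>R kap_re y z + (Im (\<mu> z) / 2) *\<^sub>R kap_im y z = 0 \<and>
   Dzb_kap_im y z + (Re (\<mu> z) / 2) *\<^sub>R kap_im y z - (Im (\<mu> z) / 2) *\<^sub>R kap_re y z = 0)
   \<longleftrightarrow> (\<forall>a. lift.perp (dzbf lift.K) a z + cnj (\<mu> z) / 2 * lift.K a z = 0)" by auto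
qed

end

section \<open>The Willmore density\<close>

text \<open>Cramer's rule for the Gram matrix of u and v. The explicit quotient, unlike
  \<open>eperp\<close>, visibly depends smoothly on all arguments and can be differentiated.\<close>

definition perv :: "real ^ 'n::finite => real ^ 'n => real ^ 'n => real ^ 'n => real ^ 'n" where
 "perv p u v x = x - (x \<bullet> p) *\<^sub>R p
   - (((v \<bullet> v) * (x \<bullet> u) - (u \<bullet> v) * (x \<bullet> v)) / ((u \<bullet> u) * (v \<bullet> v) - (u \<bullet> v)^2)) *\<^sub>R u
   - (((u \<bullet> u) * (x \<bullet> v) - (u \<bullet> v) * (x \<bullet> u)) / ((u \<bullet> u) * (v \<bullet> v) - (u \<bullet> v)^2)) *\<^sub>R v"

lemma eperp_eq:
 assumes p: "p \<bullet> p = 1" "p \<bullet> u = 0" "p \<bullet> v = 0" and D: "(u \<bullet> u) * (v \<bullet> v) - (u \<bullet> v)^2 > 0"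
 shows "eperp {p, u, v} x = perv p u v x"
proof -
 define D where "D = (u \<bullet> u) * (v \<bullet> v) - (u \<bullet> v)^2"
 have D0: "D \<noteq> 0" using D by (simp add: D_def)
 define \<alpha> where "\<alpha> = ((v \<bullet> v) * (x \<bullet> u) - (u \<bullet> v) * (x \<bullet> v)) / D"
 define \<beta> where "\<beta> = ((u \<bullet> u) * (x \<bullet> v) - (u \<bullet> v) * (x \<bullet> u)) / D"
 have ab: "D * \<alpha> = (v \<bullet> v) * (x \<bullet> u) - (u \<bullet> v) * (x \<bullet> v)" "D * \<beta> = (u \<bullet> u) * (x \<bullet> v) - (u \<bullet> v) * (x \<bullet> u)"
  using D0 by (simp_all add: \<alpha>_def \<beta>_def)
 have e: "perv p u v x = x - (x \<bullet> p) *\<^sub>R p - \<alpha> *\<^sub>R u - \<beta> *\<^sub>R v" by (simp add: perv_def \<alpha>_def \<beta>_def D_def)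
 have c: "u \<bullet> p = 0" "v \<bullet> p = 0" "v \<bullet> u = u \<bullet> v" using p by (simp_all add: inner_commute)
 have "D * (perv p u v x \<bullet> w) = D * (x \<bullet> w) - D * (x \<bullet> p) * (p \<bullet> w) - (D * \<alpha>) * (u \<bullet> w) - (D * \<beta>) * (v \<bullet> w)" for w
  by (simp add: e algebra_simps)
 from this[of u, unfolded ab] this[of v, unfolded ab] have "D * (perv p u v x \<bullet> u) = 0" "D * (perv p u v x \<bullet> v) = 0"
  using p by (simp_all add: c D_def power2_eq_square algebra_simps)
 hence orth: "\<forall>a\<in>{p, u, v}. perv p u v x \<bullet> a = 0" using D0 p c by (simp add: e inner_diff_left)
 have sp: "x - perv p u v x \<in> span {p, u, v}"
  by (simp add: e span_add span_scale span_base)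
 show ?thesis
  unfolding eperp_def
 proof (rule the_equality)
  fix w assume w: "(\<forall>a\<in>{p, u, v}. w \<bullet> a = 0) \<and> x - w \<in> span {p, u, v}"
  have "perv p u v x - w \<in> span {p, u, v}"
   using span_diff[OF conjunct2[OF w] sp] by simp
  moreover have "orthogonal (perv p u v x - w) a" if "a \<in> {p, u, v}" for a
   using w orth that by (auto simp: orthogonal_def inner_diff_left)
  ultimately have "orthogonal (perv p u v x - w) (perv p u v x - w)" using orthogonal_to_span by blast
  thus "w = perv p u v x" by (simp add: orthogonal_def)
 qed (use orth sp in simp)
qed

section \<open>The density in terms of the two fundamental forms\<close>

lemma has_real_derivative_inner:
 assumes "(f has_vector_derivative f') (at t)" "(g has_vector_derivative g') (at t)"
 shows "((\<lambda>t. f t \<bullet> g t) has_real_derivative f t \<bullet> g' + f' \<bullet> g t) (at t)"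
proof -
 have "(\<lambda>h. f t \<bullet> (h *\<^sub>R g') + (h *\<^sub>R f') \<bullet> g t) = (*) (f t \<bullet> g' + f' \<bullet> g t)"
    by (rule ext) (simp add: algebra_simps)
  then show ?thesis using has_derivative_inner[OF assms[unfolded has_vector_derivative_def]]
    by (simp add: has_field_derivative_def)
qed

text \<open>The density (|H|^2 - det II / det g) dA: with D = E G - F^2 the mean curvature vector is
  (G a - 2 F b + E c) / (2 D), and det II stands for a . c - b . b.\<close>

definition wdens :: "real \<Rightarrow> real \<Rightarrow> real \<Rightarrow> real ^ 'n::finite \<Rightarrow> real ^ 'n \<Rightarrow> real ^ 'n \<Rightarrow> real" where
  "wdens E F G a b c = (b \<bullet> b - a \<bullet> c) / sqrt (E * G - F\<^sup>2)
     + ((G *\<^sub>R a - (2 * F) *\<^sub>R b + E *\<^sub>R c) \<bullet> (G *\<^sub>R a - (2 * F) *\<^sub>R b + E *\<^sub>R c)) / (4 * (E * G - F\<^sup>2) * sqrt (E * G - F\<^sup>2))"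

text \<open>The trace-free parts satisfy G X - 2 F Y + E Z = 0. Subtracting the squared norm of this
  vector from the full contraction leaves 2 D (Y . Y - X . Z), in which the trace is easily split
  off.\<close>

lemma wdens_contraction:
  fixes a b c :: "real ^ 'n::finite"
  assumes D: "D = E * G - F\<^sup>2" "D > 0" and t: "t = (1 / D) *\<^sub>R (G *\<^sub>R a - (2 * F) *\<^sub>R b + E *\<^sub>R c)"
    and X: "X = a - (E / 2) *\<^sub>R t" and Y: "Y = b - (F / 2) *\<^sub>R t" and Z: "Z = c - (G / 2) *\<^sub>R t"
  shows "(1 / 2) * ((G * G * (X \<bullet> X) - 4 * G * F * (X \<bullet> Y) + 2 * F * F * (X \<bullet> Z) + (2 * E * G + 2 * F * F) * (Y \<bullet> Y)
     - 4 * E * F * (Y \<bullet> Z) + E * E * (Z \<bullet> Z)) / (D * D)) * sqrt D = wdens E F G a b c"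
proof -
  define w where "w = G *\<^sub>R a - (2 * F) *\<^sub>R b + E *\<^sub>R c"
  have tr: "G *\<^sub>R X - (2 * F) *\<^sub>R Y + E *\<^sub>R Z = 0"
  proof -
    have "G *\<^sub>R X - (2 * F) *\<^sub>R Y + E *\<^sub>R Z = w - (G * (E / 2) - 2 * F * (F / 2) + E * (G / 2)) *\<^sub>R t"
      unfolding X Y Z w_def scaleR_left_distrib by (simp add: algebra_simps)
    also have "G * (E / 2) - 2 * F * (F / 2) + E * (G / 2) = D" by (simp add: D(1) power2_eq_square)
    also have "D *\<^sub>R t = w" using D(2) by (simp add: t w_def)
    finally show ?thesis by simp
  qed
  have "0 = (G *\<^sub>R X - (2 * F) *\<^sub>R Y + E *\<^sub>R Z) \<bullet> (G *\<^sub>R X - (2 * F) *\<^sub>R Y + E *\<^sub>R Z)" by (simp add: tr)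
  also have "\<dots> = G * G * (X \<bullet> X) + 4 * F * F * (Y \<bullet> Y) + E * E * (Z \<bullet> Z) - 4 * G * F * (X \<bullet> Y) + 2 * E * G * (X \<bullet> Z) - 4 * E * F * (Y \<bullet> Z)"
    by (simp add: inner_commute algebra_simps)
  finally have "G * G * (X \<bullet> X) - 4 * G * F * (X \<bullet> Y) + 2 * F * F * (X \<bullet> Z) + (2 * E * G + 2 * F * F) * (Y \<bullet> Y)
     - 4 * E * F * (Y \<bullet> Z) + E * E * (Z \<bullet> Z) = 2 * D * (Y \<bullet> Y - X \<bullet> Z)"
    unfolding D(1) by (simp add: algebra_simps power2_eq_square)
  moreover have "Y \<bullet> Y - X \<bullet> Z = b \<bullet> b - a \<bullet> c + (w \<bullet> w) / (4 * D)"
  proof -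
    have "Y \<bullet> Y - X \<bullet> Z = b \<bullet> b - a \<bullet> c + (t \<bullet> w) / 2 - D / 4 * (t \<bullet> t)"
      unfolding X Y Z w_def D(1)
      by (simp add: inner_add_right inner_diff_right inner_commute field_simps power2_eq_square)
    also have "t = (1 / D) *\<^sub>R w" by (simp add: t w_def)
    finally show ?thesis by simp
  qed
  moreover have "1 / 2 * (2 * D * u / (D * D)) * sqrt D = u / sqrt D" for u
  proof -
    define r where "r = sqrt D"
    have "D = r * r" "r > 0" using D(2) by (simp_all add: r_def)
    then show ?thesis by simp
  qed
  ultimately show ?thesis
    unfolding wdens_def w_def[symmetric] D(1)[symmetric]
    by (simp only: add_divide_distrib diff_divide_distrib) simp
qed

lemma willmore_density_eq:
  fixes p :: "complex \<Rightarrow> real ^ 'n::finite"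
  assumes p: "p z \<bullet> p z = 1" "p z \<bullet> pd p 1 z = 0" "p z \<bullet> pd p \<i> z = 0" and D: "gdet p z > 0"
    and comm: "pd (pd p \<i>) 1 z = pd (pd p 1) \<i> z"
  defines "E \<equiv> pd p 1 z \<bullet> pd p 1 z" and "F \<equiv> pd p 1 z \<bullet> pd p \<i> z" and "G \<equiv> pd p \<i> z \<bullet> pd p \<i> z"
    and "Pr \<equiv> perv (p z) (pd p 1 z) (pd p \<i> z)"
  shows "willmore_density p z = wdens E F G (Pr (pd (pd p 1) 1 z)) (Pr (pd (pd p 1) \<i> z)) (Pr (pd (pd p \<i>) \<i> z))"
proof -
  have gm: "gmet p z 0 0 = E" "gmet p z 0 1 = F" "gmet p z 1 0 = F" "gmet p z 1 1 = G"
    by (simp_all add: gmet_def cdir_def E_def F_def G_def inner_commute)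
  have D': "gdet p z = E * G - F\<^sup>2" by (simp add: gdet_def gm[simplified] power2_eq_square)
  have ep: "eperp {p z, pd p 1 z, pd p \<i> z} x = Pr x" for x
    unfolding Pr_def using p D D' by (intro eperp_eq) (auto simp: E_def F_def G_def)
  define a where "a = Pr (pd (pd p 1) 1 z)"
  define b where "b = Pr (pd (pd p 1) \<i> z)"
  define c where "c = Pr (pd (pd p \<i>) \<i> z)"
  have sf: "sff p z 0 0 = a" "sff p z 0 1 = b" "sff p z 1 0 = b" "sff p z 1 1 = c"
    unfolding sff_def ep by (simp_all add: cdir_def a_def b_def c_def comm)
  define D where "D = gdet p z"
  have D1: "D = E * G - F\<^sup>2" "D > 0" using D' assms(4) by (simp_all add: D_def)
  have gi: "ginv p z 0 0 = G / D" "ginv p z 0 1 = - F / D" "ginv p z 1 0 = - F / D" "ginv p z 1 1 = E / D"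
    by (simp_all add: ginv_def gm[simplified] D_def)
  define t where "t = (1 / D) *\<^sub>R (G *\<^sub>R a - (2 * F) *\<^sub>R b + E *\<^sub>R c)"
  have two: "{..<2::nat} = {0, 1}" by auto
  have tr: "(\<Sum>k<2. \<Sum>l<2. ginv p z k l *\<^sub>R sff p z k l) = t"
    unfolding two t_def by (simp add: gi[simplified] sf[simplified] algebra_simps scaleR_2[symmetric])
  define X where "X = a - (E / 2) *\<^sub>R t"
  define Y where "Y = b - (F / 2) *\<^sub>R t"
  define Z where "Z = c - (G / 2) *\<^sub>R t"
  have s0: "sff0 p z 0 0 = X" "sff0 p z 0 1 = Y" "sff0 p z 1 0 = Y" "sff0 p z 1 1 = Z"
    unfolding sff0_def tr by (simp_all add: gm[simplified] sf[simplified] X_def Y_def Z_def)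
  have "willmore_density p z = (1 / 2) * ((G * G * (X \<bullet> X) - 4 * G * F * (X \<bullet> Y) + 2 * F * F * (X \<bullet> Z) + (2 * E * G + 2 * F * F) * (Y \<bullet> Y)
     - 4 * E * F * (Y \<bullet> Z) + E * E * (Z \<bullet> Z)) / (D * D)) * sqrt D"
    unfolding willmore_density_def two D_def[symmetric] using D1(2)
    by (simp add: gi[simplified] s0[simplified] inner_commute) (simp add: field_simps)
  also have "\<dots> = wdens E F G a b c" by (rule wdens_contraction[OF D1 t_def X_def Y_def Z_def])
  finally show ?thesis by (simp add: a_def b_def c_def)
qed

text \<open>The parametrization is conformal only at time t0, so general E, F, G have to be
  differentiated first; their values l, 0, l then collapse the quotient rule to this
  formula.\<close>

lemma wdens_deriv:
  fixes a b c :: "real \<Rightarrow> real ^ 'n::finite"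
  assumes EFG: "E t0 = l" "F t0 = 0" "G t0 = l" "l > 0"
    and d: "(E has_real_derivative E') (at t0)" "(F has_real_derivative F') (at t0)" "(G has_real_derivative G') (at t0)"
      "(a has_vector_derivative a') (at t0)" "(b has_vector_derivative b') (at t0)" "(c has_vector_derivative c') (at t0)"
  defines "h \<equiv> (1/2) *\<^sub>R (a t0 - c t0)" and "s \<equiv> a t0 + c t0"
  shows "((\<lambda>t. wdens (E t) (F t) (G t) (a t) (b t) (c t)) has_real_derivative
     (h \<bullet> (a' - c') + 2 * (b t0 \<bullet> b')) / l - ((s \<bullet> h) * (E' - G') + 2 * F' * (s \<bullet> b t0)) / (2 * l\<^sup>2)
       - (E' + G') * (h \<bullet> h + b t0 \<bullet> b t0) / (2 * l\<^sup>2)) (at t0)"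
    (is "(_ has_real_derivative ?e) _")
proof -
  define D where "D t = E t * G t - (F t)\<^sup>2" for t
  define w where "w t = G t *\<^sub>R a t - (2 * F t) *\<^sub>R b t + E t *\<^sub>R c t" for t
  have D0: "D t0 = l\<^sup>2" "sqrt (D t0) = l" using EFG by (simp_all add: D_def power2_eq_square)
  have dD: "(D has_real_derivative l * (E' + G')) (at t0)"
    unfolding D_def by (auto intro!: derivative_eq_intros d simp: EFG algebra_simps)
  have dS: "((\<lambda>t. sqrt (D t)) has_real_derivative (E' + G') / 2) (at t0)"
    using EFG(4) D0 by (auto intro!: derivative_eq_intros dD)
  note dv = d(4-6)[unfolded has_vector_derivative_def]
  note dr = d(1-3)[unfolded has_field_derivative_def]
  let ?w = "l *\<^sub>R a' + G' *\<^sub>R a t0 - (2 * F') *\<^sub>R b t0 + l *\<^sub>R c' + E' *\<^sub>R c t0"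
  have dw: "(w has_vector_derivative ?w) (at t0)"
    unfolding w_def using EFG by (auto intro!: derivative_eq_intros d)
  note ip = has_real_derivative_inner
  have w0: "w t0 = l *\<^sub>R s" using EFG by (simp add: w_def s_def algebra_simps)
  have "((\<lambda>t. (b t \<bullet> b t - a t \<bullet> c t) / sqrt (D t) + (w t \<bullet> w t) / (4 * D t * sqrt (D t))) has_real_derivative
     ((b t0 \<bullet> b' + b' \<bullet> b t0 - (a t0 \<bullet> c' + a' \<bullet> c t0)) * l - (b t0 \<bullet> b t0 - a t0 \<bullet> c t0) * ((E' + G') / 2)) / (l * l)
     + ((w t0 \<bullet> ?w
        + ?w \<bullet> w t0) * (4 * l\<^sup>2 * l)
        - (w t0 \<bullet> w t0) * (4 * l\<^sup>2 * ((E' + G') / 2) + 4 * (l * (E' + G')) * l)) / ((4 * l\<^sup>2 * l) * (4 * l\<^sup>2 * l))) (at t0)"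
    (is "(_ has_real_derivative ?d) _")
    using EFG(4) D0
    by (intro DERIV_add DERIV_cong[OF DERIV_divide[OF DERIV_diff[OF ip[OF d(5,5)] ip[OF d(4,6)]] dS]]
        DERIV_cong[OF DERIV_divide[OF ip[OF dw dw] DERIV_mult[OF DERIV_cmult[OF dD, of 4] dS]]]) auto
  moreover have "?d = ?e"
    using EFG(4) unfolding w0 h_def s_def
    by (simp add: inner_add_right inner_diff_right inner_commute field_simps power2_eq_square)
  ultimately show ?thesis by (simp add: wdens_def D_def w_def)
qed

text \<open>Passes from the sphere to the light cone. A and B will be the space parts of 2 Re kappa
  and -2 Im kappa, with time parts A0 and B0; orthogonality to the lift says A . p = A0, so h and b,
  the trace-free second fundamental form, are recovered by removing A0 p and dividing by the scale.
  r and q stand for twice the real and imaginary part of \<open>hs\<close>.\<close>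

lemma variation_density_algebra:
  fixes p :: "real ^ 'n::finite"
  assumes \<sigma>: "\<sigma> > 0" "\<sigma> * \<sigma> * l = 1"
    and A: "A \<bullet> p = A0" "A \<bullet> (p11 + p22) = 0" and B: "B \<bullet> p = B0" "B \<bullet> (p11 + p22) = 0"
    and pp: "p \<bullet> p = 1" "p11 \<bullet> p = - l" "p22 \<bullet> p = - l"
    and r: "s11 *\<^sub>R p + (2 * s1) *\<^sub>R p1 + \<sigma> *\<^sub>R p11 - (s22 *\<^sub>R p + (2 * s2) *\<^sub>R p2 + \<sigma> *\<^sub>R p22) = (2::real) *\<^sub>R A - (2 * r * \<sigma>) *\<^sub>R p"
      "s11 - s22 = 2 * A0 - 2 * r * \<sigma>"
    and q: "s12 *\<^sub>R p + s1 *\<^sub>R p2 + s2 *\<^sub>R p1 + \<sigma> *\<^sub>R p12 = B + (q * \<sigma>) *\<^sub>R p" "s12 = B0 + q * \<sigma>"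
    and \<xi>: "\<xi> \<bullet> p = 0" "\<xi>1 \<bullet> p = - (\<xi> \<bullet> p1)" "\<xi>2 \<bullet> p = - (\<xi> \<bullet> p2)" "\<xi>11 \<bullet> p = - (2 * (\<xi>1 \<bullet> p1)) - \<xi> \<bullet> p11"
      "\<xi>22 \<bullet> p = - (2 * (\<xi>2 \<bullet> p2)) - \<xi> \<bullet> p22" "\<xi>12 \<bullet> p = - (\<xi>1 \<bullet> p2) - \<xi>2 \<bullet> p1 - \<xi> \<bullet> p12"
  defines "h \<equiv> (1 / \<sigma>) *\<^sub>R (A - A0 *\<^sub>R p)" and "b \<equiv> (1 / \<sigma>) *\<^sub>R (B - B0 *\<^sub>R p)"
  shows "(h \<bullet> (\<xi>11 - \<xi>22) + 2 * s1 / \<sigma> * (h \<bullet> \<xi>1) - 2 * s2 / \<sigma> * (h \<bullet> \<xi>2)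
       + 2 * (b \<bullet> \<xi>12 + s2 / \<sigma> * (b \<bullet> \<xi>1) + s1 / \<sigma> * (b \<bullet> \<xi>2))) / l
     - (((p11 + p22) \<bullet> h) * (2 * (\<xi>1 \<bullet> p1) - 2 * (\<xi>2 \<bullet> p2)) + 2 * (\<xi>1 \<bullet> p2 + \<xi>2 \<bullet> p1) * ((p11 + p22) \<bullet> b)) / (2 * l\<^sup>2)
     - (2 * (\<xi>1 \<bullet> p1) + 2 * (\<xi>2 \<bullet> p2)) * (h \<bullet> h + b \<bullet> b) / (2 * l\<^sup>2)
   = A \<bullet> ((s11 - s22) *\<^sub>R \<xi> + (2 * s1) *\<^sub>R \<xi>1 - (2 * s2) *\<^sub>R \<xi>2 + \<sigma> *\<^sub>R (\<xi>11 - \<xi>22))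
     + 2 * (B \<bullet> (s12 *\<^sub>R \<xi> + s1 *\<^sub>R \<xi>2 + s2 *\<^sub>R \<xi>1 + \<sigma> *\<^sub>R \<xi>12)) + 2 * r * \<sigma> * (A \<bullet> \<xi>) - 2 * q * \<sigma> * (B \<bullet> \<xi>)
     - (A \<bullet> A - A0 * A0 + B \<bullet> B - B0 * B0) * (\<sigma> * \<sigma> * (\<xi>1 \<bullet> p1 + \<xi>2 \<bullet> p2))"
    (is "?L = ?R")
proof -
  have l: "l = 1 / (\<sigma> * \<sigma>)" using \<sigma> by (simp add: field_simps)
  have rx: "\<sigma> * (\<xi> \<bullet> p11 - \<xi> \<bullet> p22) = 2 * (A \<bullet> \<xi>) - 2 * s1 * (\<xi> \<bullet> p1) + 2 * s2 * (\<xi> \<bullet> p2)"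
    using arg_cong[OF r(1), of "\<lambda>v. \<xi> \<bullet> v"] \<xi>(1) by (simp add: inner_commute algebra_simps)
  have qx: "\<sigma> * (\<xi> \<bullet> p12) = B \<bullet> \<xi> - s1 * (\<xi> \<bullet> p2) - s2 * (\<xi> \<bullet> p1)"
    using arg_cong[OF q(1), of "\<lambda>v. \<xi> \<bullet> v"] \<xi>(1) by (simp add: inner_commute algebra_simps)
  have h: "\<sigma> * (h \<bullet> v) = A \<bullet> v - A0 * (v \<bullet> p)" "\<sigma> * (b \<bullet> v) = B \<bullet> v - B0 * (v \<bullet> p)" for v
    using \<sigma>(1) by (simp_all add: h_def b_def inner_diff_right inner_commute)
  have hh: "\<sigma> * \<sigma> * (h \<bullet> h) = A \<bullet> A - A0 * A0" "\<sigma> * \<sigma> * (b \<bullet> b) = B \<bullet> B - B0 * B0"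
    using \<sigma>(1) A B pp by (simp_all add: h_def b_def inner_diff_right inner_commute)
  have "\<sigma> * ((p11 + p22) \<bullet> h) = 2 * l * A0" "\<sigma> * ((p11 + p22) \<bullet> b) = 2 * l * B0"
    using h[of "p11 + p22"] A B pp by (simp_all add: inner_commute inner_add_right)
  then have sh: "\<sigma> * \<sigma> * (\<sigma> * ((p11 + p22) \<bullet> h)) = 2 * A0" "\<sigma> * \<sigma> * (\<sigma> * ((p11 + p22) \<bullet> b)) = 2 * B0"
    unfolding l using \<sigma>(1) by simp_all
  \<comment> \<open>Since l = 1 / \<sigma>^2, everything becomes polynomial in \<sigma> times
    pairings with h and b, whose values are known from A and B.\<close>
  have "?L = \<sigma> * (\<sigma> * (h \<bullet> \<xi>11) - \<sigma> * (h \<bullet> \<xi>22)) + 2 * s1 * (\<sigma> * (h \<bullet> \<xi>1)) - 2 * s2 * (\<sigma> * (h \<bullet> \<xi>2))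
     + 2 * (\<sigma> * (\<sigma> * (b \<bullet> \<xi>12)) + s2 * (\<sigma> * (b \<bullet> \<xi>1)) + s1 * (\<sigma> * (b \<bullet> \<xi>2)))
     - (\<sigma> * \<sigma> * (\<sigma> * ((p11 + p22) \<bullet> h)) * (\<xi>1 \<bullet> p1 - \<xi>2 \<bullet> p2) + (\<xi>1 \<bullet> p2 + \<xi>2 \<bullet> p1) * (\<sigma> * \<sigma> * (\<sigma> * ((p11 + p22) \<bullet> b)))) * \<sigma>
     - (\<xi>1 \<bullet> p1 + \<xi>2 \<bullet> p2) * (\<sigma> * \<sigma> * (h \<bullet> h) + \<sigma> * \<sigma> * (b \<bullet> b)) * \<sigma> * \<sigma>"
    unfolding l  by (simp add: inner_diff_right field_simps power2_eq_square)
  also have "\<dots> = \<sigma> * (A \<bullet> \<xi>11 - A \<bullet> \<xi>22) + 2 * s1 * (A \<bullet> \<xi>1) - 2 * s2 * (A \<bullet> \<xi>2) + 2 * A0 * (A \<bullet> \<xi>)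
     + 2 * (\<sigma> * (B \<bullet> \<xi>12) + s2 * (B \<bullet> \<xi>1) + s1 * (B \<bullet> \<xi>2)) + 2 * B0 * (B \<bullet> \<xi>)
     - (\<xi>1 \<bullet> p1 + \<xi>2 \<bullet> p2) * (A \<bullet> A - A0 * A0 + (B \<bullet> B - B0 * B0)) * \<sigma> * \<sigma>"
  proof -
    have "\<sigma> * (\<sigma> * (h \<bullet> \<xi>11) - \<sigma> * (h \<bullet> \<xi>22)) = \<sigma> * (A \<bullet> \<xi>11 - A \<bullet> \<xi>22) + A0 * (2 * \<sigma> * (\<xi>1 \<bullet> p1 - \<xi>2 \<bullet> p2) + \<sigma> * (\<xi> \<bullet> p11 - \<xi> \<bullet> p22))"
      unfolding h \<xi> by (simp add: algebra_simps)
    moreover have "\<sigma> * (\<sigma> * (b \<bullet> \<xi>12)) = \<sigma> * (B \<bullet> \<xi>12) + B0 * (\<sigma> * (\<xi>1 \<bullet> p2 + \<xi>2 \<bullet> p1) + \<sigma> * (\<xi> \<bullet> p12))"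
      unfolding h \<xi> by (simp add: algebra_simps)
    ultimately show ?thesis unfolding hh sh h(1)[of \<xi>1] h(1)[of \<xi>2] h(2)[of \<xi>1] h(2)[of \<xi>2] \<xi> rx qx
      by (simp add: algebra_simps)
  qed
  also have "\<dots> = ?R" unfolding r(2) q(2) by (simp add: algebra_simps)
  finally show ?thesis .
qed

text \<open>The derivatives of the coefficients multiply p, u and v and disappear when paired with a
  normal n. In the first variation the derivative is only paired with normals, so nothing else about
  it is recorded.\<close>

lemma perv_deriv_normal:
  fixes p u v x :: "real \<Rightarrow> real ^ 'n::finite"
  assumes d: "(p has_vector_derivative p') (at t)" "(u has_vector_derivative u') (at t)" "(v has_vector_derivative v') (at t)"
      "(x has_vector_derivative x') (at t)"
    and g: "u t \<bullet> u t = l" "v t \<bullet> v t = l" "u t \<bullet> v t = 0" "l > 0"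
  shows "\<exists>q. ((\<lambda>t. perv (p t) (u t) (v t) (x t)) has_vector_derivative q) (at t) \<and>
     (\<forall>n. n \<bullet> p t = 0 \<longrightarrow> n \<bullet> u t = 0 \<longrightarrow> n \<bullet> v t = 0 \<longrightarrow>
        n \<bullet> q = n \<bullet> x' - (x t \<bullet> p t) * (n \<bullet> p') - (x t \<bullet> u t) / l * (n \<bullet> u') - (x t \<bullet> v t) / l * (n \<bullet> v'))"
proof -
  note ip = has_real_derivative_inner
  define D where "D t = (u t \<bullet> u t) * (v t \<bullet> v t) - (u t \<bullet> v t)\<^sup>2" for t
  define a where "a t = ((v t \<bullet> v t) * (x t \<bullet> u t) - (u t \<bullet> v t) * (x t \<bullet> v t)) / D t" for t
  define b where "b t = ((u t \<bullet> u t) * (x t \<bullet> v t) - (u t \<bullet> v t) * (x t \<bullet> u t)) / D t" for t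
  have D0: "D t \<noteq> 0" using g by (simp add: D_def)
  note i = ip[OF d(2,2)] ip[OF d(3,3)] ip[OF d(2,3)] ip[OF d(4,2)] ip[OF d(4,3)]
  obtain D' where dD: "(D has_real_derivative D') (at t)"
    by (rule that, unfold D_def) (rule derivative_intros i)+
  obtain a' where a': "(a has_real_derivative a') (at t)"
    by (rule that, unfold a_def) (rule derivative_intros i dD D0)+
  obtain b' where b': "(b has_real_derivative b') (at t)"
    by (rule that, unfold b_def) (rule derivative_intros i dD D0)+
  have eq: "perv (p t) (u t) (v t) (x t) = x t - (x t \<bullet> p t) *\<^sub>R p t - a t *\<^sub>R u t - b t *\<^sub>R v t" for t
    by (simp add: perv_def a_def b_def D_def)
  define q where "q = x' - ((x t \<bullet> p t) *\<^sub>R p' + (x t \<bullet> p' + x' \<bullet> p t) *\<^sub>R p t) - (a t *\<^sub>R u' + a' *\<^sub>R u t) - (b t *\<^sub>R v' + b' *\<^sub>R v t)"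
  have "((\<lambda>t. perv (p t) (u t) (v t) (x t)) has_vector_derivative q) (at t)"
    unfolding eq q_def by (intro has_vector_derivative_diff d has_vector_derivative_scaleR ip a' b')
  moreover have "a t = (x t \<bullet> u t) / l" "b t = (x t \<bullet> v t) / l"
    using g by (simp_all add: a_def b_def D_def)
  ultimately show ?thesis
    by (intro exI[of _ q]) (simp add: q_def inner_diff_right inner_add_right)
qed

section \<open>The density along a variation\<close>

lemma smooth_on_slice:
  fixes Q :: "real \<times> complex \<Rightarrow> 'b::real_normed_vector"
  assumes S: "open S" and e: "t \<in> {-e<..<e}" and Q: "smooth_on ({-e<..<e} \<times> S) Q"
  shows "smooth_on S (\<lambda>w. Q (t, w))" (is ?g1) and "z \<in> S \<Longrightarrow> pd (\<lambda>w. Q (t, w)) v z = pd Q (0, v) (t, z)"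
    and "z \<in> S \<Longrightarrow> ((\<lambda>t. Q (t, z)) has_vector_derivative pd Q (1, 0) (t, z)) (at t)"
proof -
  have l: "bounded_linear (\<lambda>w::complex. (0::real, w))" "bounded_linear (\<lambda>t::real. (t, 0::complex))"
    by (intro bounded_linear_intros)+
  have o: "open ({-e<..<e} \<times> S)" using S by (intro open_Times) auto
  show ?g1
    using smooth_on_affine_compose[OF l(1) o S _ Q, of "(t, 0)"] e by simp
  assume z: "z \<in> S"
  show "pd (\<lambda>w. Q (t, w)) v z = pd Q (0, v) (t, z)"
    using pd_affine_compose[OF l(1) smooth_on_differentiable[OF Q] o, of "(t, 0)" z v] e z by simp
  have "((\<lambda>s. Q (s, z)) has_derivative (\<lambda>v. pd Q (v, 0) (t, z))) (at t)"
  proof -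
    have "((\<lambda>s. (s, z)) has_derivative (\<lambda>v. (v, 0))) (at t)" by (intro derivative_intros)
    moreover have "(Q has_derivative (\<lambda>v. pd Q v (t, z))) (at (t, z))"
      using smooth_on_has_derivative[OF Q o, of "(t, z)"] e z by simp
    ultimately show ?thesis using has_derivative_compose by blast
  qed
  moreover have "(\<lambda>v. pd Q (v, 0) (t, z)) = (\<lambda>v. v *\<^sub>R pd Q (1, 0) (t, z))"
  proof
    fix v :: real
    have "linear (\<lambda>v. pd Q v (t, z))"
      using smooth_on_has_derivative[OF Q o, of "(t, z)"] e z by (auto dest: has_derivative_linear)
    from linear_scale[OF this, of v "(1, 0)"] show "pd Q (v, 0) (t, z) = v *\<^sub>R pd Q (1, 0) (t, z)" by simp
  qed
  ultimately show "((\<lambda>t. Q (t, z)) has_vector_derivative pd Q (1, 0) (t, z)) (at t)"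
    by (simp only: has_vector_derivative_def)
qed

text \<open>All space derivatives are taken as derivatives of one function on time x space, so that
  they commute with the time derivative.\<close>

definition vden :: "(real \<times> complex \<Rightarrow> real ^ 'n::finite) \<Rightarrow> real \<times> complex \<Rightarrow> real" where
  "vden Q x = wdens (pd Q (0, 1) x \<bullet> pd Q (0, 1) x) (pd Q (0, 1) x \<bullet> pd Q (0, \<i>) x) (pd Q (0, \<i>) x \<bullet> pd Q (0, \<i>) x)
     (perv (Q x) (pd Q (0, 1) x) (pd Q (0, \<i>) x) (pd (pd Q (0, 1)) (0, 1) x))
     (perv (Q x) (pd Q (0, 1) x) (pd Q (0, \<i>) x) (pd (pd Q (0, 1)) (0, \<i>) x))
     (perv (Q x) (pd Q (0, 1) x) (pd Q (0, \<i>) x) (pd (pd Q (0, \<i>)) (0, \<i>) x))"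

context
  fixes Q :: "real \<times> complex \<Rightarrow> real ^ 'n::finite" and S :: "complex set" and e :: real
  assumes S: "open S" and e: "e > 0" and Q: "smooth_on ({-e<..<e} \<times> S) Q"
    and unit_all: "\<forall>t\<in>{-e<..<e}. \<forall>z\<in>S. Q (t, z) \<bullet> Q (t, z) = 1"
    and imm_all: "\<forall>t\<in>{-e<..<e}. \<forall>z\<in>S. gdet (\<lambda>w. Q (t, w)) z > 0"
begin

lemma unit: "t \<in> {-e<..<e} \<Longrightarrow> z \<in> S \<Longrightarrow> Q (t, z) \<bullet> Q (t, z) = 1"
  and imm: "t \<in> {-e<..<e} \<Longrightarrow> z \<in> S \<Longrightarrow> gdet (\<lambda>w. Q (t, w)) z > 0"
  using unit_all imm_all by auto

lemma variation_box: "open ({-e<..<e} \<times> S)" using S by (intro open_Times) auto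

lemma unit_orth: "x \<in> {-e<..<e} \<times> S \<Longrightarrow> Q x \<bullet> pd Q v x = 0"
  using pd_bilinear[OF bounded_bilinear_inner smooth_on_differentiable[OF Q] smooth_on_differentiable[OF Q] variation_box, of x v]
    pd_eq0[OF variation_box, of "\<lambda>x. Q x \<bullet> Q x" 1 x v] unit by (auto simp: inner_commute)

lemma gdet_slice: "t \<in> {-e<..<e} \<Longrightarrow> z \<in> S \<Longrightarrow> gdet (\<lambda>w. Q (t, w)) z
    = (pd Q (0, 1) (t, z) \<bullet> pd Q (0, 1) (t, z)) * (pd Q (0, \<i>) (t, z) \<bullet> pd Q (0, \<i>) (t, z)) - (pd Q (0, 1) (t, z) \<bullet> pd Q (0, \<i>) (t, z))\<^sup>2"
  by (simp add: gdet_def gmet_def cdir_def smooth_on_slice(2)[OF S _ Q] power2_eq_square inner_commute)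

lemma smooth_on_vden: "smooth_on ({-e<..<e} \<times> S) (vden Q)"
proof -
  have D': "x \<in> {-e<..<e} \<times> S \<Longrightarrow> (pd Q (0, 1) x \<bullet> pd Q (0, 1) x) * (pd Q (0, \<i>) x \<bullet> pd Q (0, \<i>) x) - (pd Q (0, 1) x \<bullet> pd Q (0, \<i>) x)\<^sup>2 > 0" for x
    using imm[of "fst x" "snd x"] gdet_slice[of "fst x" "snd x"] by (simp add: mem_Times_iff)
  show ?thesis
    unfolding vden_def[abs_def] wdens_def perv_def
    by (intro smooth_intros smooth_on_divide smooth_on_sqrt variation_box Q) (use D' in force)+
qed

lemma willmore_density_slice:
  assumes t: "t \<in> {-e<..<e}" and z: "z \<in> S"
  shows "willmore_density (\<lambda>w. Q (t, w)) z = vden Q (t, z)"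
proof -
  have 2: "pd (pd (\<lambda>w. Q (t, w)) u) v z = pd (pd Q (0, u)) (0, v) (t, z)" for u v
  proof -
    have "pd (pd (\<lambda>w. Q (t, w)) u) v z = pd (\<lambda>w. pd Q (0, u) (t, w)) v z"
      by (rule pd_cong[OF S z]) (rule smooth_on_slice(2)[OF S t Q])
    then show ?thesis by (simp add: smooth_on_slice(2)[OF S t smooth_on_pd[OF Q] z])
  qed
  have o: "Q (t, z) \<bullet> pd (\<lambda>w. Q (t, w)) v z = 0" for v
    using unit_orth[of "(t, z)"] t z by (simp add: smooth_on_slice(2)[OF S t Q z])
  have "pd (pd (\<lambda>w. Q (t, w)) \<i>) 1 z = pd (pd (\<lambda>w. Q (t, w)) 1) \<i> z"
    by (rule pd_commute[OF S smooth_on_slice(1)[OF S t Q] z])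
  from willmore_density_eq[where p="\<lambda>w. Q (t, w)", OF unit[OF t z] o o imm[OF t z] this]
  show ?thesis unfolding 2 smooth_on_slice(2)[OF S t Q z] by (simp add: vden_def)
qed

text \<open>\<open>wdens_deriv\<close> pairs the time derivatives of the normal second derivatives
  only with h and b, and these are normal; \<open>perv_deriv_normal\<close> evaluates exactly such
  pairings in terms of the variation field \<xi>.\<close>

lemma vden_deriv:
  assumes z: "z \<in> S"
  defines "p \<equiv> \<lambda>w. Q (0, w)" and "\<xi> \<equiv> \<lambda>w. pd Q (1, 0) (0, w)"
  assumes g: "pd p 1 z \<bullet> pd p 1 z = l" "pd p \<i> z \<bullet> pd p \<i> z = l" "pd p 1 z \<bullet> pd p \<i> z = 0" "l > 0"
  defines "Pr \<equiv> perv (p z) (pd p 1 z) (pd p \<i> z)"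
  defines "a \<equiv> Pr (pd (pd p 1) 1 z)" and "b \<equiv> Pr (pd (pd p 1) \<i> z)" and "c \<equiv> Pr (pd (pd p \<i>) \<i> z)"
  defines "h \<equiv> (1/2) *\<^sub>R (a - c)" and "\<delta> \<equiv> pd (pd p 1) 1 z - pd (pd p \<i>) \<i> z" and "\<epsilon> \<equiv> pd (pd p 1) \<i> z"
  shows "pd (vden Q) (1, 0) (0, z) =
     (h \<bullet> (pd (pd \<xi> 1) 1 z - pd (pd \<xi> \<i>) \<i> z) - (\<delta> \<bullet> p z) * (h \<bullet> \<xi> z) - (\<delta> \<bullet> pd p 1 z) / l * (h \<bullet> pd \<xi> 1 z) - (\<delta> \<bullet> pd p \<i> z) / l * (h \<bullet> pd \<xi> \<i> z)
       + 2 * (b \<bullet> pd (pd \<xi> 1) \<i> z - (\<epsilon> \<bullet> p z) * (b \<bullet> \<xi> z) - (\<epsilon> \<bullet> pd p 1 z) / l * (b \<bullet> pd \<xi> 1 z) - (\<epsilon> \<bullet> pd p \<i> z) / l * (b \<bullet> pd \<xi> \<i> z))) / l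
     - (((a + c) \<bullet> h) * (2 * (pd \<xi> 1 z \<bullet> pd p 1 z) - 2 * (pd \<xi> \<i> z \<bullet> pd p \<i> z))
        + 2 * (pd \<xi> 1 z \<bullet> pd p \<i> z + pd \<xi> \<i> z \<bullet> pd p 1 z) * ((a + c) \<bullet> b)) / (2 * l\<^sup>2)
     - (2 * (pd \<xi> 1 z \<bullet> pd p 1 z) + 2 * (pd \<xi> \<i> z \<bullet> pd p \<i> z)) * (h \<bullet> h + b \<bullet> b) / (2 * l\<^sup>2)"
    (is "_ = _ - ?T1 - ?T2")
proof -
  have t: "0 \<in> {-e<..<e}" using e by simp
  note s1 = smooth_on_slice(2)[OF S t _ z] and vd = smooth_on_slice(3)[OF S t _ z]
  note sQ = smooth_on_pd[OF Q]
  have zb: "(0, z) \<in> {-e<..<e} \<times> S" using t z by simp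
  have p1: "pd p v z = pd Q (0, v) (0, z)" for v unfolding p_def by (rule s1[OF Q])
  have p2: "pd (pd p u) v z = pd (pd Q (0, u)) (0, v) (0, z)" for u v
  proof -
    have "pd (pd p u) v z = pd (\<lambda>w. pd Q (0, u) (0, w)) v z"
      unfolding p_def by (rule pd_cong[OF S z]) (rule smooth_on_slice(2)[OF S t Q])
    then show ?thesis by (simp add: s1[OF sQ])
  qed
  have x1: "pd \<xi> v z = pd (pd Q (0, v)) (1, 0) (0, z)" for v
    unfolding \<xi>_def s1[OF sQ] by (rule pd_commute[OF variation_box Q zb])
  have x2: "pd (pd \<xi> u) v z = pd (pd (pd Q (0, u)) (0, v)) (1, 0) (0, z)" for u v
  proof -
    have "pd (pd \<xi> u) v z = pd (\<lambda>w. pd (pd Q (0, u)) (1, 0) (0, w)) v z"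
    proof (rule pd_cong[OF S z])
      fix w assume "w \<in> S"
      then show "pd \<xi> u w = pd (pd Q (0, u)) (1, 0) (0, w)"
        unfolding \<xi>_def using smooth_on_slice(2)[OF S t sQ] pd_commute[OF variation_box Q] t by simp
    qed
    also have "\<dots> = pd (pd (pd Q (0, u)) (1, 0)) (0, v) (0, z)" by (rule s1[OF smooth_on_pd[OF sQ]])
    also have "\<dots> = pd (pd (pd Q (0, u)) (0, v)) (1, 0) (0, z)" by (rule pd_commute[OF variation_box sQ zb])
    finally show ?thesis .
  qed
  have x0: "\<xi> z = pd Q (1, 0) (0, z)" by (simp add: \<xi>_def)
  note g' = g[unfolded p1]
  define R where "R u v q \<longleftrightarrow> ((\<lambda>t. perv (Q (t, z)) (pd Q (0, 1) (t, z)) (pd Q (0, \<i>) (t, z)) (pd (pd Q (0, u)) (0, v) (t, z))) has_vector_derivative q) (at 0) \<and>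
     (\<forall>n. n \<bullet> p z = 0 \<longrightarrow> n \<bullet> pd p 1 z = 0 \<longrightarrow> n \<bullet> pd p \<i> z = 0 \<longrightarrow>
        n \<bullet> q = n \<bullet> pd (pd \<xi> u) v z - (pd (pd p u) v z \<bullet> p z) * (n \<bullet> \<xi> z) - (pd (pd p u) v z \<bullet> pd p 1 z) / l * (n \<bullet> pd \<xi> 1 z)
           - (pd (pd p u) v z \<bullet> pd p \<i> z) / l * (n \<bullet> pd \<xi> \<i> z))" for u v q
  have "\<exists>q. R u v q" for u v
    unfolding R_def p1 p2 x1 x2 x0
    using perv_deriv_normal[OF vd[OF Q] vd[OF sQ[of "(0, 1)"]] vd[OF sQ[of "(0, \<i>)"]] vd[OF smooth_on_pd[OF sQ, of "(0, u)" "(0, v)"]] g'(1,2,3,4)]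
    by (simp add: p_def)
  then obtain q where R: "R u v (q u v)" for u v by metis
  note q = R[unfolded R_def, THEN conjunct1] R[unfolded R_def, THEN conjunct2, rule_format]
  note ip = has_real_derivative_inner
  have nrm: "n \<bullet> p z = 0 \<and> n \<bullet> pd p 1 z = 0 \<and> n \<bullet> pd p \<i> z = 0" if "n = Pr x" for n x
  proof -
    have o: "p z \<bullet> p z = 1" "p z \<bullet> pd p 1 z = 0" "p z \<bullet> pd p \<i> z = 0" "pd p 1 z \<bullet> p z = 0" "pd p \<i> z \<bullet> p z = 0"
      using unit[OF t z] unit_orth[OF zb] p1 by (simp_all add: p_def inner_commute)
    show ?thesis using o g by (simp add: that Pr_def perv_def inner_diff_right inner_commute)
  qed
  have nh: "h \<bullet> p z = 0" "h \<bullet> pd p 1 z = 0" "h \<bullet> pd p \<i> z = 0" and nb: "b \<bullet> p z = 0" "b \<bullet> pd p 1 z = 0" "b \<bullet> pd p \<i> z = 0"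
    using nrm[OF meta_eq_to_obj_eq[OF a_def]] nrm[OF meta_eq_to_obj_eq[OF b_def]] nrm[OF meta_eq_to_obj_eq[OF c_def]] by (simp_all add: h_def inner_diff_left)
  have "((\<lambda>t. vden Q (t, z)) has_real_derivative
     (h \<bullet> (q 1 1 - q \<i> \<i>) + 2 * (b \<bullet> q 1 \<i>)) / l - ?T1 - ?T2) (at 0)"
    unfolding vden_def h_def a_def b_def c_def Pr_def p2 unfolding p1 x1 unfolding p_def
    by (rule wdens_deriv[OF g'(1,3,2,4) DERIV_cong[OF ip[OF vd[OF sQ] vd[OF sQ]]] DERIV_cong[OF ip[OF vd[OF sQ] vd[OF sQ]]]
      DERIV_cong[OF ip[OF vd[OF sQ] vd[OF sQ]]] q(1) q(1) q(1)])
      (simp_all add: inner_commute)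
  moreover have "((\<lambda>t. vden Q (t, z)) has_real_derivative pd (vden Q) (1, 0) (0, z)) (at 0)"
    using vd[OF smooth_on_vden] by (simp add: has_real_derivative_iff_has_vector_derivative)
  ultimately have "pd (vden Q) (1, 0) (0, z) = (h \<bullet> (q 1 1 - q \<i> \<i>) + 2 * (b \<bullet> q 1 \<i>)) / l - ?T1 - ?T2"
    by (rule DERIV_unique[rotated])
  moreover have "h \<bullet> (q 1 1 - q \<i> \<i>) = h \<bullet> (pd (pd \<xi> 1) 1 z - pd (pd \<xi> \<i>) \<i> z) - (\<delta> \<bullet> p z) * (h \<bullet> \<xi> z) - (\<delta> \<bullet> pd p 1 z) / l * (h \<bullet> pd \<xi> 1 z) - (\<delta> \<bullet> pd p \<i> z) / l * (h \<bullet> pd \<xi> \<i> z)"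
    unfolding inner_diff_right[of h] q(2)[OF nh] \<delta>_def inner_diff_left diff_divide_distrib by (simp add: algebra_simps)
  moreover note q(2)[OF nb, of 1 \<i>, folded \<epsilon>_def]
  ultimately show ?thesis by simp
qed

end

section \<open>Second order relations for the surface in the sphere and for its lift\<close>

lemma pd_inner_const:
  fixes f g :: "complex \<Rightarrow> real ^ 'n::finite"
  assumes S: "open S" "z \<in> S" and f: "smooth_on S f" and g: "smooth_on S g" and c: "\<And>z. z \<in> S \<Longrightarrow> f z \<bullet> g z = c z"
  shows "pd c v z = pd f v z \<bullet> g z + f z \<bullet> pd g v z"
proof -
  have "pd c v z = pd (\<lambda>z. f z \<bullet> g z) v z" using c by (intro pd_cong[OF S]) simp
  also have "\<dots> = pd f v z \<bullet> g z + f z \<bullet> pd g v z"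
    using pd_bilinear[OF bounded_bilinear_inner smooth_on_differentiable[OF f] smooth_on_differentiable[OF g] S] by simp
  finally show ?thesis .
qed

lemma pd_pd_scaleR:
  assumes S: "open S" "z \<in> S" and f: "smooth_on S f" and W: "smooth_on S W"
  shows "pd (pd (\<lambda>z. f z *\<^sub>R W z) u) v z = pd (pd f u) v z *\<^sub>R W z + pd f u z *\<^sub>R pd W v z + pd f v z *\<^sub>R pd W u z + f z *\<^sub>R pd (pd W u) v z"
proof -
  note sm = f W smooth_on_pd[OF f] smooth_on_pd[OF W]
  have "pd (pd (\<lambda>z. f z *\<^sub>R W z) u) v z = pd (\<lambda>z. f z *\<^sub>R pd W u z + pd f u z *\<^sub>R W z) v z"
    using S f W by (intro pd_cong[OF S] pd_scaleR)
  also have "\<dots> = pd (\<lambda>z. f z *\<^sub>R pd W u z) v z + pd (\<lambda>z. pd f u z *\<^sub>R W z) v z"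
    using S sm by (intro pd_add[of _ S] smooth_on_differentiable smooth_on_scaleR)
  finally show ?thesis using pd_scaleR[OF S f sm(4)] pd_scaleR[OF S sm(3) W] by simp
qed

lemma snd_pd: "open S \<Longrightarrow> z \<in> S \<Longrightarrow> smooth_on S V \<Longrightarrow> snd (pd V v z) = pd (\<lambda>z. snd (V z)) v z"
  and fst_pd: "open S \<Longrightarrow> z \<in> S \<Longrightarrow> smooth_on S V \<Longrightarrow> fst (pd V v z) = pd (\<lambda>z. fst (V z)) v z"
  using pd_linear_compose[OF bounded_linear_snd smooth_on_differentiable] pd_linear_compose[OF bounded_linear_fst smooth_on_differentiable]
  by metis+

lemma snd_pd_pd: "open S \<Longrightarrow> z \<in> S \<Longrightarrow> smooth_on S V \<Longrightarrow> snd (pd (pd V u) v z) = pd (pd (\<lambda>z. snd (V z)) u) v z"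
  and fst_pd_pd: "open S \<Longrightarrow> z \<in> S \<Longrightarrow> smooth_on S V \<Longrightarrow> fst (pd (pd V u) v z) = pd (pd (\<lambda>z. fst (V z)) u) v z"
proof -
  assume a: "open S" "z \<in> S" "smooth_on S V"
  have "pd (\<lambda>z. snd (pd V u z)) v z = pd (pd (\<lambda>z. snd (V z)) u) v z" "pd (\<lambda>z. fst (pd V u z)) v z = pd (pd (\<lambda>z. fst (V z)) u) v z"
    using a by (auto intro!: pd_cong[OF a(1,2)] simp: snd_pd fst_pd)
  then show "snd (pd (pd V u) v z) = pd (pd (\<lambda>z. snd (V z)) u) v z" "fst (pd (pd V u) v z) = pd (pd (\<lambda>z. fst (V z)) u) v z"
    using snd_pd[OF a(1,2) smooth_on_pd[OF a(3)]] fst_pd[OF a(1,2) smooth_on_pd[OF a(3)]] by auto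
qed

context conformal_surface
begin

abbreviation "pt \<equiv> \<lambda>z. snd (y z)"

lemma smpt: "smooth_on S pt" by (intro smooth_on_snd Sy)

lemma pt_jets: assumes z: "z \<in> S"
  shows "pt z \<bullet> pt z = 1" (is ?g1) "pt z \<bullet> pd pt v z = 0" (is ?g2) "pd (pd pt u) v z \<bullet> pt z = - (pd pt u z \<bullet> pd pt v z)" (is ?g3)
    "pd pt 1 z \<bullet> pd pt 1 z = lam z" (is ?g4) "pd pt \<i> z \<bullet> pd pt \<i> z = lam z" (is ?g5) "pd pt 1 z \<bullet> pd pt \<i> z = 0" (is ?g6)
    "pd (pd pt 1) 1 z \<bullet> pd pt 1 z = pd lam 1 z / 2" "pd (pd pt 1) 1 z \<bullet> pd pt \<i> z = - (pd lam \<i> z / 2)" (is ?g7)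
    "pd (pd pt 1) \<i> z \<bullet> pd pt 1 z = pd lam \<i> z / 2" "pd (pd pt 1) \<i> z \<bullet> pd pt \<i> z = pd lam 1 z / 2"
    "pd (pd pt \<i>) \<i> z \<bullet> pd pt 1 z = - (pd lam 1 z / 2)" (is ?g8) "pd (pd pt \<i>) \<i> z \<bullet> pd pt \<i> z = pd lam \<i> z / 2"
    "2 * sig z * pd sig v z * lam z = - (sig z * sig z * pd lam v z)" (is ?g9)
proof -
  note sp = smooth_on_pd[OF smpt]
  have 1: "pt w \<bullet> pt w = 1" if "w \<in> S" for w using Sy(3,4)[OF that] by (simp add: lor_def)
  have 2: "pt w \<bullet> pd pt v w = 0" if "w \<in> S" for w v
    using pd_inner_const[OF Sy(1) that smpt smpt 1, of v] by (simp add: inner_commute)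
  have f0: "fst (pd y v w) = 0" if "w \<in> S" for v w
    using fst_pd[OF Sy(1) that Sy(2), of v] pd_eq0[OF Sy(1), of "\<lambda>z. fst (y z)" 1 w v] Sy(3) that by simp
  have lp: "lor (pd y u w) (pd y v w) = pd pt u w \<bullet> pd pt v w" if "w \<in> S" for u v w
    using f0[OF that] snd_pd[OF Sy(1) that Sy(2)] by (simp add: lor_def)
  have 4: "pd pt 1 w \<bullet> pd pt 1 w = lam w" "pd pt \<i> w \<bullet> pd pt \<i> w = lam w" "pd pt 1 w \<bullet> pd pt \<i> w = 0" if "w \<in> S" for w
    using Sy(5,6)[OF that] lp[OF that] by (simp_all add: lam_def)
  show ?g1 ?g2 ?g4 ?g5 ?g6
    using 1 2 4 z by auto
  show ?g3
    using pd_inner_const[OF Sy(1) z sp smpt, of u "\<lambda>_. 0" v] 2 by (simp add: inner_commute)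
  have c: "pd (pd pt \<i>) 1 z = pd (pd pt 1) \<i> z" by (rule pd_commute[OF Sy(1) smpt z])
  note a = pd_inner_const[OF Sy(1) z sp sp 4(1)] and b = pd_inner_const[OF Sy(1) z sp sp 4(2)] and d = pd_inner_const[OF Sy(1) z sp sp, of 1 \<i> "\<lambda>_. 0", OF 4(3)]
  show A: "pd (pd pt 1) 1 z \<bullet> pd pt 1 z = pd lam 1 z / 2" "pd (pd pt 1) \<i> z \<bullet> pd pt 1 z = pd lam \<i> z / 2"
    using a[of 1] a[of \<i>] by (simp_all add: inner_commute)
  show B: "pd (pd pt 1) \<i> z \<bullet> pd pt \<i> z = pd lam 1 z / 2" "pd (pd pt \<i>) \<i> z \<bullet> pd pt \<i> z = pd lam \<i> z / 2"
    using b[of 1] b[of \<i>] c by (simp_all add: inner_commute)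
  show ?g7 ?g8
    using d[of 1] d[of \<i>] A B c by (simp_all add: inner_commute)
  have "pd (\<lambda>z. (sig z * sig z) * lam z) v z = sig z * sig z * pd lam v z + 2 * sig z * pd sig v z * lam z"
    using pd_bilinear[OF bounded_bilinear_mult smooth_on_differentiable[OF smooth_on_mult[OF Sy(1) smsig smsig]] smooth_on_differentiable[OF smlam] Sy(1) z, of v]
      pd_bilinear[OF bounded_bilinear_mult smooth_on_differentiable[OF smsig] smooth_on_differentiable[OF smsig] Sy(1) z, of v]
    by simp
  then show ?g9
    using pd_eq0[OF Sy(1), of "\<lambda>z. (sig z * sig z) * lam z" 1 z v] sig(2) z by simp
qed

lemma kap_ip: "z \<in> S \<Longrightarrow> ip lift.K (cf V) z = of_real (lor (kap_re y z) (V z)) + \<i> * of_real (lor (kap_im y z) (V z))"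
proof -
  assume z: "z \<in> S"
  have "ip lift.K (cf V) z = ip (\<lambda>a z. cf (kap_re y) a z + \<i> * cf (kap_im y) a z) (cf V) z"
    by (rule ip_cong) (simp_all add: kap[OF z])
  then show ?thesis unfolding of_real_lor ip_lin(1) ip_lin(4)[where c="\<lambda>_. \<i>"] .
qed

lemma kap_normal:
  assumes z: "z \<in> S" and W: "W \<in> {L z, pd L 1 z, pd L \<i> z, frameN y z, Yzzb y z}"
  shows "lor (kap_re y z) W = 0" (is ?g1) "lor (kap_im y z) W = 0" (is ?g2)
proof -
  have "ip lift.K (cf (pd L 1)) z = ip lift.K (\<lambda>a z. lift.Yz a z + lift.Yb a z) z"
    "ip lift.K (cf (pd L \<i>)) z = ip lift.K (\<lambda>a z. \<i> * (lift.Yz a z - lift.Yb a z)) z"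
    "ip lift.K (cf (frameN y)) z = ip lift.K lift.N z" "ip lift.K (cf (Yzzb y)) z = ip lift.K lift.Yzb z"
    by (auto intro!: ip_cong simp: cf1[OF z] cf_frameN[OF z] cf_Yzzb[OF z])
  then have "ip lift.K (cf V) z = 0" if "V \<in> {L, pd L 1, pd L \<i>, frameN y, Yzzb y}" for V
    using that lift.gK[OF z] by (auto simp: ip_lin)
  then have "lor (kap_re y z) (V z) = 0 \<and> lor (kap_im y z) (V z) = 0" if "V \<in> {L, pd L 1, pd L \<i>, frameN y, Yzzb y}" for V
    using kap_ip[OF z, of V] that by (auto simp: complex_eq_iff)
  then show ?g1 ?g2 using W by auto
qed

lemma q_lor: assumes z: "z \<in> S"
  shows "lift.q z = of_real (lor (kap_re y z) (kap_re y z) + lor (kap_im y z) (kap_im y z))"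
proof -
  have "ip lift.K (bar lift.K) z = ip lift.K (\<lambda>a z. cf (kap_re y) a z - \<i> * cf (kap_im y) a z) z"
    by (rule ip_cong) (auto simp: bar_def kap[OF z, symmetric] cf_def)
  also have "\<dots> = ip lift.K (cf (kap_re y)) z - \<i> * ip lift.K (cf (kap_im y)) z"
    unfolding ip_lin(7) ip_lin(9)[where c="\<lambda>_. \<i>"] ..
  finally show ?thesis unfolding lift.qK[OF z] kap_ip[OF z] by (simp add: algebra_simps lor_commute)
qed

text \<open>Real and imaginary part of Y_zz = kappa - hs Y, because Y_uu - Y_vv = 4 Re Y_zz and Y_uv
  = -2 Im Y_zz.\<close>

lemma L_second: assumes z: "z \<in> S"
  shows "pd (pd L 1) 1 z - pd (pd L \<i>) \<i> z = 4 *\<^sub>R kap_re y z - (4 * Re (lift.hs z)) *\<^sub>R L z" (is ?g1)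
    "pd (pd L 1) \<i> z = (- 2) *\<^sub>R kap_im y z + (2 * Im (lift.hs z)) *\<^sub>R L z" (is ?g2)
proof -
  have k: "lift.Yzz a z = cf (kap_re y) a z + \<i> * cf (kap_im y) a z - lift.hs z * cf L a z" for a
    using kap[OF z, of a] by (simp add: lift.K_def)
  have Y: "dzbf lift.Yb a z = cnj (lift.Yzz a z)" for a using lift.Ybb[OF z, of a] by (simp add: bar_def)
  note c = cf2[OF z, unfolded Yuu_eq Yvv_eq Yuv_eq Y k]
  show ?g1
  proof (rule mink_eqI)
    fix a show "mc (pd (pd L 1) 1 z - pd (pd L \<i>) \<i> z) a = mc (4 *\<^sub>R kap_re y z - (4 * Re (lift.hs z)) *\<^sub>R L z) a"
      using arg_cong[OF c(1)[of a], of Re] arg_cong[OF c(2)[of a], of Re] by (simp add: cf_def)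
  qed
  show ?g2
  proof (rule mink_eqI)
    fix a show "mc (pd (pd L 1) \<i> z) a = mc ((- 2) *\<^sub>R kap_im y z + (2 * Im (lift.hs z)) *\<^sub>R L z) a"
      using arg_cong[OF c(3)[of a], of Re] by (simp add: cf_def)
  qed
qed

end

lemma perv_simps:
  "perv p u v (x + y) = perv p u v x + perv p u v y" "perv p u v (x - y) = perv p u v x - perv p u v y"
  "perv p u v (c *\<^sub>R x) = c *\<^sub>R perv p u v x"
  by (simp_all add: perv_def algebra_simps add_divide_distrib diff_divide_distrib)

section \<open>The first variation of the Willmore energy\<close>

locale surface_variation = conformal_surface S y for S :: "complex set" and y :: "complex \<Rightarrow> 'n::finite mink" +
  fixes F :: "real \<times> complex \<Rightarrow> 'n mink" and e :: real
  assumes e: "e > 0" and smF: "smooth_on ({-e<..<e} \<times> S) F"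
    and immF: "\<And>t. t \<in> {-e<..<e} \<Longrightarrow> immersion_on S (\<lambda>z. F (t, z))"
    and F0: "\<And>z. z \<in> S \<Longrightarrow> F (0, z) = y z"
begin

definition Q :: "real \<times> complex \<Rightarrow> real ^ 'n" where "Q x = snd (F x)"
definition \<xi> :: "complex \<Rightarrow> real ^ 'n" where "\<xi> w = pd Q (1, 0) (0, w)"
text \<open>The velocity of the lift when the scale \<open>sig\<close> is frozen at its initial
  value. Its time component is 0, as the varied surfaces stay in the slice with first coordinate
  1.\<close>

definition X :: "complex \<Rightarrow> 'n mink" where "X w = sig w *\<^sub>R (0, \<xi> w)"

lemma smQ: "smooth_on ({-e<..<e} \<times> S) Q"
  unfolding Q_def using Sy(1) by (intro smooth_on_snd smF open_Times) auto

lemma Q0pt: "w \<in> S \<Longrightarrow> Q (0, w) = pt w" by (simp add: Q_def F0)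

lemma unitQ: "\<forall>t\<in>{-e<..<e}. \<forall>z\<in>S. Q (t, z) \<bullet> Q (t, z) = 1"
  using immF by (simp add: immersion_on_def on_sphere_def lor_def Q_def)

lemma immQ: "\<forall>t\<in>{-e<..<e}. \<forall>z\<in>S. gdet (\<lambda>w. Q (t, w)) z > 0"
  using immF by (simp add: immersion_on_def Q_def)

lemma sm\<xi>: "smooth_on S \<xi>"
  unfolding \<xi>_def using e by (intro smooth_on_slice(1)[OF Sy(1) _ smooth_on_pd[OF smQ]]) simp

lemma smX: "smooth_on S X"
  unfolding X_def by (intro smooth_intros Sy(1) sm\<xi> smsig)

lemma \<xi>_jets: assumes z: "z \<in> S"
  shows "\<xi> z \<bullet> pt z = 0" (is ?g1) "pd \<xi> v z \<bullet> pt z = - (\<xi> z \<bullet> pd pt v z)" (is ?g2)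
    "pd (pd \<xi> u) v z \<bullet> pt z = - (pd \<xi> u z \<bullet> pd pt v z) - pd \<xi> v z \<bullet> pd pt u z - \<xi> z \<bullet> pd (pd pt u) v z" (is ?g3)
proof -
  have 0: "\<xi> w \<bullet> pt w = 0" if "w \<in> S" for w
    using unit_orth[OF Sy(1) e smQ unitQ immQ, of "(0, w)" "(1, 0)"] that e by (simp add: \<xi>_def Q0pt inner_commute)
  have 1: "pd \<xi> v w \<bullet> pt w = - (\<xi> w \<bullet> pd pt v w)" if "w \<in> S" for v w
    using pd_inner_const[OF Sy(1) that sm\<xi> smpt, of "\<lambda>_. 0" v] 0 by simp
  show ?g1 ?g2 using 0 1 z by auto
  have "pd (\<lambda>w. - (\<xi> w \<bullet> pd pt u w)) v z = pd (pd \<xi> u) v z \<bullet> pt z + pd \<xi> u z \<bullet> pd pt v z"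
    using pd_inner_const[OF Sy(1) z smooth_on_pd[OF sm\<xi>] smpt, of u "\<lambda>w. - (\<xi> w \<bullet> pd pt u w)" v] 1 by simp
  moreover have "pd (\<lambda>w. - (\<xi> w \<bullet> pd pt u w)) v z = - (pd \<xi> v z \<bullet> pd pt u z + \<xi> z \<bullet> pd (pd pt u) v z)"
    using pd_linear_compose[OF bounded_linear_minus[OF bounded_linear_ident] smooth_on_differentiable[OF smooth_on_inner[OF Sy(1) sm\<xi> smooth_on_pd[OF smpt]]] Sy(1) z, of u v]
      pd_inner_const[OF Sy(1) z sm\<xi> smooth_on_pd[OF smpt] refl, of u v] by simp
  ultimately show ?g3 by simp
qed

text \<open>Collects the 2-jets of surface, scale and variation field that
  \<open>variation_density_algebra\<close> expects; its right side is then read as Lorentz products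
  of kappa with derivatives of X.\<close>

lemma density_deriv_real: assumes z: "z \<in> S"
  defines "A \<equiv> 2 *\<^sub>R kap_re y z" and "B \<equiv> (- 2) *\<^sub>R kap_im y z"
  shows "pd (vden Q) (1, 0) (0, z) = lor A (pd (pd X 1) 1 z - pd (pd X \<i>) \<i> z) + 2 * lor B (pd (pd X 1) \<i> z)
     + 4 * Re (lift.hs z) * lor A (X z) - 4 * Im (lift.hs z) * lor B (X z)
     - (lor A A + lor B B) * (lor (pd X 1 z) (pd L 1 z) + lor (pd X \<i> z) (pd L \<i> z))"
proof -
  let ?A' = "snd A" and ?B' = "snd B" and ?A0 = "fst A" and ?B0 = "fst B" and ?p = "pt z" and ?p1 = "pd pt 1 z" and ?p2 = "pd pt \<i> z" and ?p11 = "pd (pd pt 1) 1 z" and ?p12 = "pd (pd pt 1) \<i> z" and ?p22 = "pd (pd pt \<i>) \<i> z" and ?s = "sig z" and ?s1 = "pd sig 1 z" and ?s2 = "pd sig \<i> z" and ?s11 = "pd (pd sig 1) 1 z" and ?s12 = "pd (pd sig 1) \<i> z" and ?s22 = "pd (pd sig \<i>) \<i> z"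
  note J = pt_jets[OF z]
  have sl: "?s > 0" "?s * ?s * lam z = 1" and l0: "lam z > 0" using sig[OF z] Sy(7)[OF z] by simp_all
  \<comment> \<open>Logarithmic differentiation of sig^2 lam = 1.\<close>
  have l1: "pd lam 1 z / 2 / lam z = - ?s1 / ?s" (is ?h1) "pd lam \<i> z / 2 / lam z = - ?s2 / ?s" (is ?h2)
  proof -
    have "?s * (2 * pd sig v z * lam z + ?s * pd lam v z) = 0" for v
      using J(13)[of v] by (simp add: algebra_simps)
    then have "?s * (pd lam v z / 2) = - (pd sig v z) * lam z" for v
      using sl(1) by (simp add: add_eq_0_iff)
    then show ?h1 ?h2
      using sl(1) l0 by (simp_all add: field_simps)
  qed
  have sL: "snd (L w) = sig w *\<^sub>R pt w" "fst (L w) = sig w" if "w \<in> S" for w using Sy(3)[OF that] by (simp_all add: L_eq)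
  have L1: "snd (pd L v z) = ?s *\<^sub>R pd pt v z + pd sig v z *\<^sub>R ?p" "fst (pd L v z) = pd sig v z" for v
    unfolding snd_pd[OF Sy(1) z smL] fst_pd[OF Sy(1) z smL]
    using pd_cong[OF Sy(1) z sL(1)] pd_cong[OF Sy(1) z sL(2)] pd_scaleR[OF Sy(1) z smsig smpt] by auto
  have L2: "snd (pd (pd L u) v z) = pd (pd sig u) v z *\<^sub>R ?p + pd sig u z *\<^sub>R pd pt v z + pd sig v z *\<^sub>R pd pt u z + ?s *\<^sub>R pd (pd pt u) v z" (is ?h3)
    "fst (pd (pd L u) v z) = pd (pd sig u) v z" (is ?h4) for u v
  proof -
    have "pd (pd (\<lambda>z. snd (L z)) u) v z = pd (pd (\<lambda>z. sig z *\<^sub>R pt z) u) v z" "pd (pd (\<lambda>z. fst (L z)) u) v z = pd (pd sig u) v z"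
      by (auto intro!: pd_cong[OF Sy(1) z] pd_cong[OF Sy(1)] simp: sL)
    then show ?h3
    ?h4
      unfolding snd_pd_pd[OF Sy(1) z smL] fst_pd_pd[OF Sy(1) z smL] using pd_pd_scaleR[OF Sy(1) z smsig smpt] by simp_all
  qed
  have lL2: "lor V (pd (pd L u) v z) = - fst V * pd (pd sig u) v z + pd (pd sig u) v z * (snd V \<bullet> ?p) + pd sig u z * (snd V \<bullet> pd pt v z)
      + pd sig v z * (snd V \<bullet> pd pt u z) + ?s * (snd V \<bullet> pd (pd pt u) v z)" for u v V
    by (simp add: lor_def L2 inner_add_right)
  have X0: "fst (X w) = 0" "snd (X w) = sig w *\<^sub>R \<xi> w" for w by (simp_all add: X_def)
  have X1: "snd (pd X v z) = ?s *\<^sub>R pd \<xi> v z + pd sig v z *\<^sub>R \<xi> z" "fst (pd X v z) = 0" for v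
    unfolding snd_pd[OF Sy(1) z smX] fst_pd[OF Sy(1) z smX] X0
    using pd_scaleR[OF Sy(1) z smsig sm\<xi>] by auto
  have pd0: "pd (\<lambda>_::complex. 0::real) u = (\<lambda>_. 0)" for u by auto
  have X2: "snd (pd (pd X u) v z) = pd (pd sig u) v z *\<^sub>R \<xi> z + pd sig u z *\<^sub>R pd \<xi> v z + pd sig v z *\<^sub>R pd \<xi> u z + ?s *\<^sub>R pd (pd \<xi> u) v z"
    "fst (pd (pd X u) v z) = 0" for u v
    unfolding snd_pd_pd[OF Sy(1) z smX] fst_pd_pd[OF Sy(1) z smX] X0
    using pd_pd_scaleR[OF Sy(1) z smsig sm\<xi>] by (simp_all add: pd0)
  have lX2: "lor V (pd (pd X u) v z) = pd (pd sig u) v z * (snd V \<bullet> \<xi> z) + pd sig u z * (snd V \<bullet> pd \<xi> v z)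
      + pd sig v z * (snd V \<bullet> pd \<xi> u z) + ?s * (snd V \<bullet> pd (pd \<xi> u) v z)" for u v V
    by (simp add: lor_def X2 inner_add_right)
  have AN: "lor A (L z) = 0" "lor B (L z) = 0" "lor A (pd L 1 z) = 0" "lor B (pd L 1 z) = 0" "lor A (pd L \<i> z) = 0" "lor B (pd L \<i> z) = 0"
    "lor A (pd (pd L 1) 1 z + pd (pd L \<i>) \<i> z) = 0" "lor B (pd (pd L 1) 1 z + pd (pd L \<i>) \<i> z) = 0"
    using kap_normal[OF z] kap_normal[OF z, of "Yzzb y z"] by (simp_all add: A_def B_def lor_simps Yzzb_def Yuu_eq Yvv_eq)
  have Ap: "?A' \<bullet> ?p = ?A0" "?B' \<bullet> ?p = ?B0"
  proof -
    have "?s * (?A' \<bullet> ?p) = ?s * ?A0" "?s * (?B' \<bullet> ?p) = ?s * ?B0"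
      using AN(1,2) sL[OF z] by (simp_all add: lor_def)
    then show "?A' \<bullet> ?p = ?A0" "?B' \<bullet> ?p = ?B0" using sl(1) by simp_all
  qed
  have Av: "?A' \<bullet> ?p1 = 0" "?A' \<bullet> ?p2 = 0" "?B' \<bullet> ?p1 = 0" "?B' \<bullet> ?p2 = 0"
    using AN(3-6) L1 Ap sl(1) by (simp_all add: lor_def inner_add_right)
  have AD: "?A' \<bullet> (?p11 + ?p22) = 0" (is ?h5) "?B' \<bullet> (?p11 + ?p22) = 0" (is ?h6)
  proof -
    have "lor A (pd (pd L 1) 1 z + pd (pd L \<i>) \<i> z) = ?s * (?A' \<bullet> (?p11 + ?p22))" "lor B (pd (pd L 1) 1 z + pd (pd L \<i>) \<i> z) = ?s * (?B' \<bullet> (?p11 + ?p22))"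
      using Ap Av by (simp_all add: lor_simps lL2 algebra_simps)
    then show ?h5 ?h6 using AN(7,8) sl(1) by simp_all
  qed
  have r: "?s11 *\<^sub>R ?p + (2 * ?s1) *\<^sub>R ?p1 + ?s *\<^sub>R ?p11 - (?s22 *\<^sub>R ?p + (2 * ?s2) *\<^sub>R ?p2 + ?s *\<^sub>R ?p22) = (2::real) *\<^sub>R ?A' - (2 * (2 * Re (lift.hs z)) * ?s) *\<^sub>R ?p"
      "?s11 - ?s22 = 2 * ?A0 - 2 * (2 * Re (lift.hs z)) * ?s"
    using arg_cong[OF L_second(1)[OF z], of snd] arg_cong[OF L_second(1)[OF z], of fst] sL[OF z]
    by (simp_all add: L2 A_def algebra_simps flip: scaleR_2)
  have q: "?s12 *\<^sub>R ?p + ?s1 *\<^sub>R ?p2 + ?s2 *\<^sub>R ?p1 + ?s *\<^sub>R ?p12 = ?B' + (2 * Im (lift.hs z) * ?s) *\<^sub>R ?p" "?s12 = ?B0 + 2 * Im (lift.hs z) * ?s"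
    using arg_cong[OF L_second(2)[OF z], of snd] arg_cong[OF L_second(2)[OF z], of fst] sL[OF z]
    by (simp_all add: L2 B_def)
  define h where "h = (1 / ?s) *\<^sub>R (?A' - ?A0 *\<^sub>R ?p)"
  define b where "b = (1 / ?s) *\<^sub>R (?B' - ?B0 *\<^sub>R ?p)"
  have J': "?p \<bullet> ?p = 1" "?p \<bullet> ?p1 = 0" "?p \<bullet> ?p2 = 0" "?p1 \<bullet> ?p = 0" "?p2 \<bullet> ?p = 0" "?p1 \<bullet> ?p1 = lam z" "?p2 \<bullet> ?p2 = lam z" "?p1 \<bullet> ?p2 = 0" "?p2 \<bullet> ?p1 = 0"
    using J(1,4,5,6) J(2)[of 1] J(2)[of \<i>] by (simp_all add: inner_commute)
  let ?Pr = "perv ?p ?p1 ?p2"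
  have Pr0: "?Pr ?p = 0" "?Pr ?p1 = 0" "?Pr ?p2 = 0" "?Pr ?A' = ?A' - ?A0 *\<^sub>R ?p" "?Pr ?B' = ?B' - ?B0 *\<^sub>R ?p"
    using J' l0 Ap Av by (simp_all add: perv_def)
  \<comment> \<open>The projection kills p and its first derivatives in the equations
    \<open>r\<close> and \<open>q\<close>, which identifies h and b with the trace-free second
    fundamental form.\<close>
  have Prh: "(1/2) *\<^sub>R (?Pr ?p11 - ?Pr ?p22) = h" (is ?h7) and Prb: "?Pr ?p12 = b"
  proof -
    have "?s *\<^sub>R (?Pr ?p11 - ?Pr ?p22) = 2 *\<^sub>R (?A' - ?A0 *\<^sub>R ?p)" "?s *\<^sub>R ?Pr ?p12 = ?B' - ?B0 *\<^sub>R ?p"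
      using arg_cong[OF r(1), of ?Pr] arg_cong[OF q(1), of ?Pr] by (simp_all add: perv_simps Pr0 algebra_simps)
    then have "(1/?s) *\<^sub>R ?s *\<^sub>R (?Pr ?p11 - ?Pr ?p22) = (1/?s) *\<^sub>R 2 *\<^sub>R (?A' - ?A0 *\<^sub>R ?p)" "(1/?s) *\<^sub>R ?s *\<^sub>R ?Pr ?p12 = (1/?s) *\<^sub>R (?B' - ?B0 *\<^sub>R ?p)"
      by auto
    then show ?h7 "?Pr ?p12 = b" using sl(1) by (simp_all add: h_def b_def)
  qed
  have Q0: "pd (\<lambda>w. Q (0, w)) v w = pd pt v w" if "w \<in> S" for v w
    by (rule pd_cong[OF Sy(1) that]) (rule Q0pt)
  have Q0': "Q (0, z) = ?p" "pd (pd (\<lambda>w. Q (0, w)) u) v z = pd (pd pt u) v z" for u v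
    by (simp_all only: Q0pt[OF z] pd_cong[OF Sy(1) z Q0])
  have nr: "h \<bullet> ?p = 0" "h \<bullet> ?p1 = 0" "h \<bullet> ?p2 = 0" "b \<bullet> ?p = 0" "b \<bullet> ?p1 = 0" "b \<bullet> ?p2 = 0"
    using J' Ap Av by (simp_all add: h_def b_def inner_diff_left)
  have tr: "(?Pr ?p11 + ?Pr ?p22) \<bullet> n = (?p11 + ?p22) \<bullet> n" if "n \<bullet> ?p = 0" "n \<bullet> ?p1 = 0" "n \<bullet> ?p2 = 0" for n
    using that by (simp add: perv_def inner_add_right inner_diff_right inner_commute)
  have vd: "pd (vden Q) (1, 0) (0, z) =
     (h \<bullet> (pd (pd \<xi> 1) 1 z - pd (pd \<xi> \<i>) \<i> z) + 2 * ?s1 / ?s * (h \<bullet> pd \<xi> 1 z) - 2 * ?s2 / ?s * (h \<bullet> pd \<xi> \<i> z)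
       + 2 * (b \<bullet> pd (pd \<xi> 1) \<i> z + ?s2 / ?s * (b \<bullet> pd \<xi> 1 z) + ?s1 / ?s * (b \<bullet> pd \<xi> \<i> z))) / lam z
     - (((?p11 + ?p22) \<bullet> h) * (2 * (pd \<xi> 1 z \<bullet> ?p1) - 2 * (pd \<xi> \<i> z \<bullet> ?p2)) + 2 * (pd \<xi> 1 z \<bullet> ?p2 + pd \<xi> \<i> z \<bullet> ?p1) * ((?p11 + ?p22) \<bullet> b)) / (2 * (lam z)\<^sup>2)
     - (2 * (pd \<xi> 1 z \<bullet> ?p1) + 2 * (pd \<xi> \<i> z \<bullet> ?p2)) * (h \<bullet> h + b \<bullet> b) / (2 * (lam z)\<^sup>2)"
  proof -
    have d: "(?p11 - ?p22) \<bullet> ?p = 0" "(?p11 - ?p22) \<bullet> ?p1 / lam z = - (2 * ?s1 / ?s)" (is ?h8) "(?p11 - ?p22) \<bullet> ?p2 / lam z = 2 * ?s2 / ?s" (is ?h9)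
      "?p12 \<bullet> ?p = 0" "?p12 \<bullet> ?p1 / lam z = - (?s2 / ?s)" (is ?h10) "?p12 \<bullet> ?p2 / lam z = - (?s1 / ?s)" (is ?h11)
    proof -
      have "(?p11 - ?p22) \<bullet> ?p1 = pd lam 1 z" "(?p11 - ?p22) \<bullet> ?p2 = - pd lam \<i> z" "?p12 \<bullet> ?p1 = pd lam \<i> z / 2" "?p12 \<bullet> ?p2 = pd lam 1 z / 2"
        using J(7-12) by (simp_all add: inner_diff_left)
      then have "(?p11 - ?p22) \<bullet> ?p1 / lam z = 2 * (pd lam 1 z / 2 / lam z)" "(?p11 - ?p22) \<bullet> ?p2 / lam z = - 2 * (pd lam \<i> z / 2 / lam z)"
        "?p12 \<bullet> ?p1 / lam z = pd lam \<i> z / 2 / lam z" "?p12 \<bullet> ?p2 / lam z = pd lam 1 z / 2 / lam z"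
        by (simp, simp, simp only:, simp only:)
      then show ?h8 ?h9
        ?h10 ?h11 unfolding l1 by simp_all
      show "(?p11 - ?p22) \<bullet> ?p = 0" "?p12 \<bullet> ?p = 0" using J(3)[of 1 1] J(3)[of \<i> \<i>] J(3)[of 1 \<i>] J(4-6) by (simp_all add: inner_diff_left)
    qed
    from vden_deriv[OF Sy(1) e smQ unitQ immQ z, unfolded Q0[OF z] Q0', folded \<xi>_def[abs_def], OF J(4,5,6) l0, unfolded Prh Prb]
    show ?thesis unfolding d tr[OF nr(1-3)] tr[OF nr(4-6)] by simp
  qed
  note X' = \<xi>_jets[OF z]
  have pp: "?p11 \<bullet> ?p = - lam z" "?p22 \<bullet> ?p = - lam z" using J(3)[of 1 1] J(3)[of \<i> \<i>] J(4,5) by simp_all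
  have "pd (vden Q) (1, 0) (0, z) = ?A' \<bullet> ((?s11 - ?s22) *\<^sub>R \<xi> z + (2 * ?s1) *\<^sub>R pd \<xi> 1 z - (2 * ?s2) *\<^sub>R pd \<xi> \<i> z + ?s *\<^sub>R (pd (pd \<xi> 1) 1 z - pd (pd \<xi> \<i>) \<i> z))
     + 2 * (?B' \<bullet> (?s12 *\<^sub>R \<xi> z + ?s1 *\<^sub>R pd \<xi> \<i> z + ?s2 *\<^sub>R pd \<xi> 1 z + ?s *\<^sub>R pd (pd \<xi> 1) \<i> z)) + 2 * (2 * Re (lift.hs z)) * ?s * (?A' \<bullet> \<xi> z)
     - 2 * (2 * Im (lift.hs z)) * ?s * (?B' \<bullet> \<xi> z)
     - (?A' \<bullet> ?A' - ?A0 * ?A0 + ?B' \<bullet> ?B' - ?B0 * ?B0) * (?s * ?s * (pd \<xi> 1 z \<bullet> ?p1 + pd \<xi> \<i> z \<bullet> ?p2))"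
    unfolding vd h_def b_def
    using X' by (intro variation_density_algebra[OF sl Ap(1) AD(1) Ap(2) AD(2) J'(1) pp r q]) simp_all
  also have "?A' \<bullet> ?A' - ?A0 * ?A0 + ?B' \<bullet> ?B' - ?B0 * ?B0 = lor A A + lor B B"
    by (simp add: lor_def)
  also have "?s * ?s * (pd \<xi> 1 z \<bullet> ?p1 + pd \<xi> \<i> z \<bullet> ?p2) = lor (pd X 1 z) (pd L 1 z) + lor (pd X \<i> z) (pd L \<i> z)"
    using X' by (simp add: lor_def X1 L1 algebra_simps)
  also note fin = calculation
  show ?thesis
  proof -
    have "lor A (X z) = ?s * (?A' \<bullet> \<xi> z)" "lor B (X z) = ?s * (?B' \<bullet> \<xi> z)" by (simp_all add: lor_def X0)
    moreover have "?A' \<bullet> ((?s11 - ?s22) *\<^sub>R \<xi> z + (2 * ?s1) *\<^sub>R pd \<xi> 1 z - (2 * ?s2) *\<^sub>R pd \<xi> \<i> z + ?s *\<^sub>R (pd (pd \<xi> 1) 1 z - pd (pd \<xi> \<i>) \<i> z))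
      = lor A (pd (pd X 1) 1 z - pd (pd X \<i>) \<i> z)"
      by (simp only: lor_simps lX2 inner_add_right inner_diff_right inner_scaleR_right) (simp add: algebra_simps)
    moreover have "?B' \<bullet> (?s12 *\<^sub>R \<xi> z + ?s1 *\<^sub>R pd \<xi> \<i> z + ?s2 *\<^sub>R pd \<xi> 1 z + ?s *\<^sub>R pd (pd \<xi> 1) \<i> z) = lor B (pd (pd X 1) \<i> z)"
      by (simp only: lX2 inner_add_right inner_scaleR_right)
    ultimately show ?thesis using fin by (simp only:)
  qed
qed

end

text \<open>Re (dz f) is half the divergence of the field (Re f, Im f).\<close>

lemma integral_dz_eq_0:
  assumes S: "open S" and K: "compact K" "K \<subseteq> S" and f: "smooth_on S f" and f0: "\<And>z. z \<in> S - K \<Longrightarrow> f z = 0"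
  shows "integral K (\<lambda>z. Re (dz f z)) = 0"
proof -
  define g where "g z = (if z \<in> S then f z else 0)" for z
  have smg: "smooth_on UNIV g"
    using f Ck_zero_extension[OF S K _ f0] by (simp add: smooth_on_def g_def[abs_def])
  define a where "a z = Re (g z)" for z
  define b where "b z = Im (g z)" for z
  have sm: "smooth_on UNIV a" "smooth_on UNIV b" unfolding a_def b_def by (intro smooth_on_Re smooth_on_Im smg open_UNIV)+
  have C1: "Ck_on 1 UNIV a" "Ck_on 1 UNIV b" using sm by (auto simp: smooth_on_def)
  have z: "a z = 0" "b z = 0" if "z \<notin> K" for z using that f0 by (auto simp: a_def b_def g_def)
  have i: "(\<lambda>z. pd h v z / 2) integrable_on K" if "smooth_on UNIV h" for h :: "complex \<Rightarrow> real" and v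
    using smooth_on_continuous[OF smooth_on_pd[OF that]]
    by (intro integrable_on_compact K continuous_intros) (auto intro: continuous_on_subset)
  have eq: "Re (dz f z) = pd a 1 z / 2 + pd b \<i> z / 2" if "z \<in> K" for z
  proof -
    have e: "dz f z = dz g z" using that K by (intro dz_cong[OF S]) (auto simp: g_def)
    have "pd a 1 z = Re (pd g 1 z)" "pd b \<i> z = Im (pd g \<i> z)"
      unfolding a_def[abs_def] b_def[abs_def]
      using pd_linear_compose[OF bounded_linear_Re smooth_on_differentiable[OF smg]] pd_linear_compose[OF bounded_linear_Im smooth_on_differentiable[OF smg]]
      by auto
    then show ?thesis unfolding e by (simp add: dz_def add_divide_distrib)
  qed
  have "integral K (\<lambda>z. Re (dz f z)) = integral K (\<lambda>z. pd a 1 z / 2 + pd b \<i> z / 2)"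
    by (rule Henstock_Kurzweil_Integration.integral_cong) (rule eq)
  also have "\<dots> = 0"
    using integral_pd_eq_0_real[OF C1(1) K(1) z(1)] integral_pd_eq_0_real[OF C1(2) K(1) z(2)]
    by (simp add: Henstock_Kurzweil_Integration.integral_add[OF i[OF sm(1)] i[OF sm(2)]])
  finally show ?thesis .
qed

context surface_variation
begin

definition Z :: "'n cfield" where "Z = cf X"

lemma smZ: "smf S Z" unfolding Z_def by (rule smf_cf[OF Sy(1) smX])

lemma Z_real: "cnj (Z a z) = Z a z" by (simp add: Z_def cf_def)

text \<open>With A = 2 Re kappa and B = -2 Im kappa the real formula is the real part of a pairing
  with conj kappa; stated by components it is ready for integration by parts in z.\<close>

lemma density_deriv: assumes z: "z \<in> S"
  shows "pd (vden Q) (1, 0) (0, z) = Re (\<Sum>a\<in>UNIV. sg a * (8 * cnj (lift.K a z) * dz (dz (Z a)) z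
     + 8 * lift.hs z * cnj (lift.K a z) * Z a z - 16 * lift.q z * dz (Z a) z * dzb (cf L a) z))"
    (is "_ = Re (\<Sum>a\<in>UNIV. ?S a)")
proof -
  have d: "dz (Z a) z = (of_real (mc (pd X 1 z) a) - \<i> * of_real (mc (pd X \<i> z) a)) / 2" if "z \<in> S" for a z
    using cf_pd[OF Sy(1) smX that] by (simp add: dz_def Z_def cf_def)
  have dd: "dz (dz (Z a)) z = of_real (mc (pd (pd X 1) 1 z - pd (pd X \<i>) \<i> z) a) / 4 - \<i> * of_real (mc (pd (pd X 1) \<i> z) a) / 2" for a
  proof -
    have "dz (dz (Z a)) z = dz (\<lambda>z. (cf (pd X 1) a z - \<i> * cf (pd X \<i>) a z) / 2) z"
      by (rule dz_cong[OF Sy(1) z]) (simp add: d cf_def)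
    also have "\<dots> = (dz (cf (pd X 1) a) z - \<i> * dz (cf (pd X \<i>) a) z) / 2"
      using z smf_D[OF smf_cf[OF Sy(1) smooth_on_pd[OF smX]]] by (simp add: lift.wirt lift.smo)
    also have "\<dots> = of_real (mc (pd (pd X 1) 1 z - pd (pd X \<i>) \<i> z) a) / 4 - \<i> * of_real (mc (pd (pd X 1) \<i> z) a) / 2"
      unfolding dz_def cf_pd[OF Sy(1) smooth_on_pd[OF smX] z] using pd_commute[OF Sy(1) smX z, of 1 \<i>] by (simp add: cf_def field_simps)
    finally show ?thesis .
  qed
  have dY: "dzb (cf L a) z = (of_real (mc (pd L 1 z) a) + \<i> * of_real (mc (pd L \<i> z) a)) / 2" for a
    using cf_pd[OF Sy(1) smL z] by (simp add: dzb_def cf_def)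
  have K: "lift.K a z = of_real (mc (kap_re y z) a) + \<i> * of_real (mc (kap_im y z) a)" for a
    using kap[OF z, of a] by (simp add: cf_def)
  have lorR: "lor v w = (\<Sum>a\<in>UNIV. Re (sg a) * (mc v a * mc w a))" for v w :: "'n mink"
  proof -
    have "complex_of_real (lor v w) = ip (cf (\<lambda>_. v)) (cf (\<lambda>_. w)) z" by (rule of_real_lor)
    then have "lor v w = Re (ip (cf (\<lambda>_. v)) (cf (\<lambda>_. w)) z)" by (metis Re_complex_of_real)
    also have "\<dots> = (\<Sum>a\<in>UNIV. Re (sg a) * (mc v a * mc w a))"
      unfolding ip_def Re_sum by (rule sum.cong) (auto simp: cf_def)
    finally show ?thesis .
  qed
  let ?A = "2 *\<^sub>R kap_re y z" and ?B = "(- 2) *\<^sub>R kap_im y z"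
  have "Re (?S a) = Re (sg a) * (mc ?A a * mc (pd (pd X 1) 1 z - pd (pd X \<i>) \<i> z) a) + 2 * (Re (sg a) * (mc ?B a * mc (pd (pd X 1) \<i> z) a))
       + 4 * Re (lift.hs z) * (Re (sg a) * (mc ?A a * mc (X z) a)) - 4 * Im (lift.hs z) * (Re (sg a) * (mc ?B a * mc (X z) a))
       - (lor ?A ?A + lor ?B ?B) * (Re (sg a) * (mc (pd X 1 z) a * mc (pd L 1 z) a) + Re (sg a) * (mc (pd X \<i> z) a * mc (pd L \<i> z) a))" for a
    unfolding dd d[OF z] dY K q_lor[OF z]
    by (cases a) (simp_all add: sg_def Z_def cf_def lor_simps field_simps)
  then have "Re (\<Sum>a\<in>UNIV. ?S a) = lor ?A (pd (pd X 1) 1 z - pd (pd X \<i>) \<i> z) + 2 * lor ?B (pd (pd X 1) \<i> z)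
     + 4 * Re (lift.hs z) * lor ?A (X z) - 4 * Im (lift.hs z) * lor ?B (X z)
     - (lor ?A ?A + lor ?B ?B) * (lor (pd X 1 z) (pd L 1 z) + lor (pd X \<i> z) (pd L \<i> z))"
    unfolding Re_sum unfolding lorR[of ?A "pd (pd X 1) 1 z - pd (pd X \<i>) \<i> z"] lorR[of ?B "pd (pd X 1) \<i> z"] lorR[of ?A "X z"] lorR[of ?B "X z"] lorR[of "pd X 1 z"] lorR[of "pd X \<i> z"]
    by (simp only: sum_distrib_left sum.distrib[symmetric] sum_subtractf[symmetric])
  then show ?thesis using density_deriv_real[OF z] by simp
qed

context
  fixes K :: "complex set"
  assumes K: "compact K" "K \<subseteq> S" and FK: "\<And>t z. t \<in> {-e<..<e} \<Longrightarrow> z \<in> S - K \<Longrightarrow> F (t, z) = y z"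
begin

lemma Z_outside: "z \<in> S - K \<Longrightarrow> Z a z = 0"
proof -
  assume z: "z \<in> S - K"
  have "((\<lambda>t. Q (t, z)) has_vector_derivative pd Q (1, 0) (0, z)) (at 0)"
    using smooth_on_slice(3)[OF Sy(1) _ smQ] z e by simp
  moreover have "((\<lambda>t. Q (t, z)) has_vector_derivative 0) (at 0)"
    by (rule has_vector_derivative_transform_within_open[OF has_vector_derivative_const[of "pt z"], of "{-e<..<e}"])
      (use e z FK in \<open>auto simp: Q_def\<close>)
  ultimately have "pd Q (1, 0) (0, z) = 0" by (rule vector_derivative_unique_at)
  then show "Z a z = 0" by (cases a) (simp_all add: Z_def cf_def X_def \<xi>_def mc_def)
qed

text \<open>Differentiation under the integral followed by Green's formula; the boundary terms
  vanish since the variation field is zero outside K.\<close>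

lemma energy_deriv:
  "((\<lambda>t. willmore_energy K (\<lambda>z. snd (F (t, z)))) has_real_derivative integral K (\<lambda>z. Re (ip lift.EL Z z))) (at 0)"
proof -
  have box: "open ({-e<..<e} \<times> S)" using Sy(1) by (intro open_Times) auto
  note sv = smooth_on_vden[OF Sy(1) e smQ unitQ immQ]
  have D: "((\<lambda>t. integral K (\<lambda>z. vden Q (t, z))) has_real_derivative integral K (\<lambda>z. pd (vden Q) (1, 0) (0, z))) (at 0)"
  proof (rule has_real_derivative_integral_compact[OF K(1) e])
    fix t :: real assume "\<bar>t\<bar> < e"
    then have t: "t \<in> {-e<..<e}" by auto
    show "((\<lambda>t. vden Q (t, z)) has_real_derivative pd (vden Q) (1, 0) (t, z)) (at t)" if "z \<in> K" for z
      using smooth_on_slice(3)[OF Sy(1) t sv, of z] that K by (auto simp: has_real_derivative_iff_has_vector_derivative)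
    show "continuous_on K (\<lambda>z. vden Q (t, z))"
      using smooth_on_continuous[OF smooth_on_slice(1)[OF Sy(1) t sv]] K by (auto intro: continuous_on_subset)
  next
    show "continuous_on ({-e<..<e} \<times> K) (\<lambda>(t, z). pd (vden Q) (1, 0) (t, z))"
      using continuous_on_subset[OF smooth_on_continuous[OF smooth_on_pd[OF sv, of "(1, 0)"]], of "{-e<..<e} \<times> K"] K
      by (simp add: Sigma_mono)
  qed
  have eq: "integral K (\<lambda>z. vden Q (t, z)) = willmore_energy K (\<lambda>z. snd (F (t, z)))" if "t \<in> {-e<..<e}" for t
    unfolding willmore_energy_def
    using willmore_density_slice[OF Sy(1) e smQ unitQ immQ that] K
    by (intro Henstock_Kurzweil_Integration.integral_cong) (auto simp: Q_def[symmetric])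
  have 1: "((\<lambda>t. willmore_energy K (\<lambda>z. snd (F (t, z)))) has_real_derivative integral K (\<lambda>z. pd (vden Q) (1, 0) (0, z))) (at 0)"
    by (rule has_field_derivative_transform_within_open[OF D, of "{-e<..<e}"]) (use e eq in auto)
  define cK where "cK a z = cnj (lift.K a z)" for a z
  define qb where "qb a z = lift.q z * dzb (cf L a) z" for a z
  have smc: "smooth_on S (cK a)" "smooth_on S (qb a)" "smooth_on S (Z a)" for a
    unfolding cK_def qb_def by (intro lift.smo smZ[THEN smf_D])+
  \<comment> \<open>The primitive left by moving two derivatives from Z to conj kappa and one from Z
    to q Y_zbar.\<close>
  define \<Phi> where "\<Phi> z = (\<Sum>a\<in>UNIV. sg a * (8 * (cK a z * dz (Z a) z - dz (cK a) z * Z a z) - 16 * (qb a z * Z a z)))" for z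
  have sm\<Phi>: "smooth_on S \<Phi>"
    unfolding \<Phi>_def by (intro smooth_on_sum Sy(1) lift.smo smc)
  have \<Phi>0: "\<Phi> z = 0" if z: "z \<in> S - K" for z
  proof -
    have "open (S - K)" using Sy(1) K by (simp add: open_Diff compact_imp_closed)
    then have "dz (Z a) z = 0" for a using dz_eq0[of "S - K" "Z a" 0] Z_outside z by blast
    then show ?thesis unfolding \<Phi>_def using Z_outside[OF z] by simp
  qed
  have cd: "dz (dz (cK a)) z = cnj (dzb (dzb (lift.K a)) z)" (is ?h1) "dz (qb a) z = cnj (dzb (\<lambda>z. lift.q z * lift.Yz a z) z)" (is ?h2) if z: "z \<in> S" for a z
  proof -
    have "dz (dz (cK a)) z = dz (\<lambda>z. cnj (dzb (lift.K a) z)) z"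
      unfolding cK_def by (rule dz_cong[OF Sy(1) z]) (simp add: lift.wirt lift.smo)
    then show ?h1 using z by (simp add: lift.wirt lift.smo)
    have "dz (qb a) z = dz (\<lambda>z. cnj (lift.q z * lift.Yz a z)) z"
      unfolding qb_def by (rule dz_cong[OF Sy(1) z]) (use lift.q_real lift.Yb_cnj in \<open>simp add: dzbf_def\<close>)
    then show ?h2 using z by (simp add: lift.wirt lift.smo)
  qed
  have key: "pd (vden Q) (1, 0) (0, z) = Re (ip lift.EL Z z) + Re (dz \<Phi> z)" if z: "z \<in> S" for z
  proof -
    have d\<Phi>: "dz \<Phi> z = (\<Sum>a\<in>UNIV. sg a * (8 * (cK a z * dz (dz (Z a)) z - dz (dz (cK a)) z * Z a z) - 16 * (qb a z * dz (Z a) z + dz (qb a) z * Z a z)))"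
      unfolding \<Phi>_def using z
      by (subst dz_sum[OF Sy(1)]) (auto simp: lift.wirt lift.smo smc)
    have "Re (sg a * (8 * cnj (lift.K a z) * dz (dz (Z a)) z
     + 8 * lift.hs z * cnj (lift.K a z) * Z a z - 16 * lift.q z * dz (Z a) z * dzb (cf L a) z))
     = Re (sg a * lift.EL a z * Z a z) + Re (sg a * (8 * (cK a z * dz (dz (Z a)) z - dz (dz (cK a)) z * Z a z) - 16 * (qb a z * dz (Z a) z + dz (qb a) z * Z a z)))" for a
    proof -
      obtain x where x: "Z a z = of_real x" using Z_real[of a z] by (metis Reals_cases complex_is_Real_iff complex_cnj_cancel_iff Reals_cnj_iff)
      obtain s where s: "sg a = of_real s" by (cases a) (auto simp: sg_def intro: that[of "-1"])
      have "Re (cnj (dzb (dzb (lift.K a)) z)) = Re (dzb (dzb (lift.K a)) z)" "Re (cnj (dzb (\<lambda>z. lift.q z * lift.Yz a z) z)) = Re (dzb (\<lambda>z. lift.q z * lift.Yz a z) z)"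
        "Re (lift.hs z * cnj (lift.K a z)) = Re (cnj (lift.hs z) * lift.K a z)" by auto
      then show ?thesis unfolding cd[OF z] x s lift.EL_def by (simp add: cK_def qb_def algebra_simps)
    qed
    then show ?thesis unfolding density_deriv[OF z] d\<Phi> ip_def by (simp add: sum.distrib)
  qed
  have cont: "continuous_on K (\<lambda>z. Re (dz \<Phi> z))" (is ?h3) "continuous_on K (\<lambda>z. pd (vden Q) (1, 0) (0, z))" (is ?h4)
  proof -
    show ?h3
      using smooth_on_continuous[OF smooth_on_dz[OF Sy(1) sm\<Phi>]] K by (auto intro!: continuous_intros intro: continuous_on_subset)
    show ?h4
      using smooth_on_continuous[OF smooth_on_slice(1)[OF Sy(1) _ smooth_on_pd[OF sv], of 0]] e K by (auto intro: continuous_on_subset)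
  qed
  have "integral K (\<lambda>z. Re (ip lift.EL Z z)) = integral K (\<lambda>z. pd (vden Q) (1, 0) (0, z) - Re (dz \<Phi> z))"
    by (rule Henstock_Kurzweil_Integration.integral_cong) (use key K in auto)
  also have "\<dots> = integral K (\<lambda>z. pd (vden Q) (1, 0) (0, z)) - integral K (\<lambda>z. Re (dz \<Phi> z))"
    by (intro Henstock_Kurzweil_Integration.integral_diff integrable_on_compact K cont)
  finally show ?thesis using 1 integral_dz_eq_0[OF Sy(1) K sm\<Phi> \<Phi>0] by simp
qed

end

lemma EL_Z: assumes z: "z \<in> S"
  shows "Re (ip lift.EL Z z) = sig z * ((\<chi> i. Re (lift.EL (Some i) z)) \<bullet> \<xi> z)"
  by (simp add: ip_def sum_option Z_def cf_def X_def mc_def sg_def inner_vec_def sum_distrib_left mult_ac)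

end

text \<open>A multiple of the lift pairs to zero with every variation, because the velocity \<xi> is
  tangent to the sphere and hence orthogonal to the point.\<close>

lemma (in conformal_surface) willmoreI:
  assumes EL: "\<And>z. z \<in> S \<Longrightarrow> \<exists>c. \<forall>a. lift.EL a z = of_real c * cf L a z"
  shows "willmore S y"
  unfolding willmore_def
proof (intro conjI conf allI impI)
  fix K e and F :: "real \<times> complex \<Rightarrow> 'n mink"
  assume a: "compact K \<and> K \<subseteq> S \<and> 0 < e \<and> smooth_on ({-e<..<e} \<times> S) F \<and> (\<forall>t\<in>{-e<..<e}. immersion_on S (\<lambda>z. F (t, z))) \<and>
       (\<forall>z\<in>S. F (0, z) = y z) \<and> (\<forall>t\<in>{-e<..<e}. \<forall>z\<in>S - K. F (t, z) = y z)"
  interpret surface_variation S y F e by unfold_locales (use a in auto)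
  have "Re (ip lift.EL Z z) = 0" if "z \<in> K" for z
  proof -
    have z: "z \<in> S" using that a by auto
    obtain c where c: "\<forall>a. lift.EL a z = of_real c * cf L a z" using EL[OF z] by blast
    have "(\<chi> i. Re (lift.EL (Some i) z)) = (c * sig z) *\<^sub>R pt z"
      by (simp add: vec_eq_iff c cf_def mc_def L_eq[THEN fun_cong, of z])
    then show ?thesis unfolding EL_Z[OF z] using \<xi>_jets(1)[OF z] by (simp add: inner_commute)
  qed
  then have "integral K (\<lambda>z. Re (ip lift.EL Z z)) = 0"
    by (subst Henstock_Kurzweil_Integration.integral_cong[of K _ "\<lambda>_. 0"]) auto
  then show "((\<lambda>t. willmore_energy K (\<lambda>z. snd (F (t, z)))) has_real_derivative 0) (at 0)"
    using energy_deriv[of K] a by simp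
qed

text \<open>Variations by rotations in a coordinate plane stay on the sphere; the rotation is parametrized
  rationally.\<close>

lemma (in conformal_surface) willmoreD:
  assumes w: "willmore S y" and z0: "z0 \<in> S"
  shows "\<exists>c. (\<chi> i. Re (lift.EL (Some i) z0)) = c *\<^sub>R pt z0"
proof -
  define E where "E z = (\<chi> i. Re (lift.EL (Some i) z))" for z
  define \<epsilon> where "\<epsilon> i = (axis i 1 :: real ^ 'n)" for i
  have \<epsilon>: "\<epsilon> i \<bullet> \<epsilon> j = (if i = j then 1 else 0)" for i j by (simp add: \<epsilon>_def inner_axis_axis)
  \<comment> \<open>E is parallel to the point iff all their 2 x 2 minors vanish. The minor for i
    and j is the pairing of E with the velocity of the rotation in the plane of the axes i and
    j.\<close>
  have key: "(E z0 \<bullet> \<epsilon> j) * (pt z0 \<bullet> \<epsilon> i) = (E z0 \<bullet> \<epsilon> i) * (pt z0 \<bullet> \<epsilon> j)" if ij: "i \<noteq> j" for i j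
  proof (rule ccontr)
    assume ne: "(E z0 \<bullet> \<epsilon> j) * (pt z0 \<bullet> \<epsilon> i) \<noteq> (E z0 \<bullet> \<epsilon> i) * (pt z0 \<bullet> \<epsilon> j)"
    define v where "v z = (pt z \<bullet> \<epsilon> i) *\<^sub>R \<epsilon> j - (pt z \<bullet> \<epsilon> j) *\<^sub>R \<epsilon> i" for z
    define q where "q z = (pt z \<bullet> \<epsilon> i) *\<^sub>R \<epsilon> i + (pt z \<bullet> \<epsilon> j) *\<^sub>R \<epsilon> j" for z
    have sm: "smooth_on S v" "smooth_on S q" unfolding v_def q_def by (intro smooth_intros smpt Sy(1))+
    \<comment> \<open>The constant factor fixes the sign: at z0 this is the square of a nonzero
      minor.\<close>
    define g where "g z = (E z0 \<bullet> v z0) * (E z \<bullet> v z)" for z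
    have contE: "continuous_on S g"
    proof -
      have "continuous_on S (lift.EL a)" for a
        unfolding lift.EL_def by (intro continuous_on_of_real continuous_on_Re smooth_on_continuous lift.smo)
      then have "continuous_on S E" unfolding E_def by (intro continuous_on_vec_lambda continuous_on_Re)
      then show ?thesis unfolding g_def by (intro continuous_intros smooth_on_continuous[OF sm(1)])
    qed
    have "open (S \<inter> g -` {0<..})" using continuous_open_preimage[OF contE Sy(1), of "{0<..}"] by simp
    moreover have "z0 \<in> S \<inter> g -` {0<..}" using z0 ne by (simp add: g_def v_def inner_diff_right mult.commute flip: power2_eq_square)
    ultimately obtain a b where ab: "cbox a b \<subseteq> S \<inter> g -` {0<..}" "z0 \<in> box a b" by (rule open_contains_cbox)
    let ?K = "cbox a b"
    have K: "compact ?K" "?K \<subseteq> S" using ab by auto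
    obtain r where r: "r > 0" "ball z0 r \<subseteq> box a b" using ab(2) open_contains_ball[of "box a b"] by blast
    let ?\<eta> = "bump z0 (r / 2)"
    have \<eta>0: "?\<eta> z = 0" if "z \<notin> ?K" for z
      using bump_0[of "r / 2" z z0] that r box_subset_cbox[of a b] by (force simp: dist_norm norm_minus_commute)
    have sm\<eta>: "smooth_on S ?\<eta>" using smooth_on_subset[OF smooth_on_bump[of "r / 2"]] r by simp
    define s where "s x = fst x * ?\<eta> (snd x)" for x :: "real \<times> complex"
    \<comment> \<open>With s = tan (angle / 2) the coefficients are sin and 1 - cos;
      \<open>q\<close> is the part of the point in the rotation plane. The bump in \<open>s\<close>
      confines the rotation to the box, and at t = 0 the velocity is 2 times the bump times
      \<open>v\<close>.\<close>
    define R where "R x = pt (snd x) + (2 * s x / (1 + s x * s x)) *\<^sub>R v (snd x)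
      - (2 * (s x * s x) / (1 + s x * s x)) *\<^sub>R q (snd x)" for x
    have s0: "1 + s x * s x > 0" for x by (simp add: add_pos_nonneg)
    have oUS: "open ((UNIV :: real set) \<times> S)" using Sy(1) by (intro open_Times) auto
    have smR: "smooth_on (UNIV \<times> S) R"
    proof -
      note comp = smooth_on_affine_compose[OF bounded_linear_snd Sy(1) oUS, of 0, simplified]
      have "smooth_on (UNIV \<times> S) s"
        unfolding s_def by (intro smooth_intros comp sm\<eta> oUS) auto
      then show ?thesis unfolding R_def
        using s0 by (intro smooth_intros smooth_on_divide comp smpt sm oUS) (auto simp: less_imp_neq[symmetric])
    qed
    have RR: "R (t, z) \<bullet> R (t, z) = 1" if "z \<in> S" for t z
    proof -
      let ?x = "pt z \<bullet> \<epsilon> i" and ?y = "pt z \<bullet> \<epsilon> j"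
      let ?s = "s (t, z)"
      define A where "A = 2 * ?s / (1 + ?s * ?s)"
      define B where "B = 2 * (?s * ?s) / (1 + ?s * ?s)"
      have "A * A + B * B = 2 * B"
        using s0[of "(t, z)"] unfolding A_def B_def by (simp add: divide_simps) (simp add: algebra_simps)
      moreover have "R (t, z) \<bullet> R (t, z) = pt z \<bullet> pt z + (A * A + B * B - 2 * B) * (?x * ?x + ?y * ?y)"
        using ij by (simp add: R_def A_def[symmetric] B_def[symmetric] v_def q_def \<epsilon> inner_commute[of "\<epsilon> _" "pt z"] algebra_simps)
      ultimately show ?thesis using pt_jets(1)[OF that] by simp
    qed
    have R0: "R (0, z) = pt z" for z by (simp add: R_def s_def)
    have RK: "R (t, z) = pt z" if "z \<notin> ?K" for t z using \<eta>0[OF that] by (simp add: R_def s_def)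
    define D where "D x = (pd R (0, 1) x \<bullet> pd R (0, 1) x) * (pd R (0, \<i>) x \<bullet> pd R (0, \<i>) x) - (pd R (0, 1) x \<bullet> pd R (0, \<i>) x)\<^sup>2" for x
    have contD: "continuous_on (UNIV \<times> S) D"
      unfolding D_def by (intro continuous_intros smooth_on_continuous smooth_on_pd smR)
    have gD: "gdet (\<lambda>w. R (t, w)) z = D (t, z)" if "z \<in> S" for t z
    proof -
      have "bounded_linear (\<lambda>w::complex. (0::real, w))" by (intro bounded_linear_intros)
      from pd_affine_compose[OF this smooth_on_differentiable[OF smR] oUS, of "(t, 0)" z] that
      show ?thesis by (simp add: gdet_def gmet_def cdir_def D_def power2_eq_square inner_commute)
    qed
    have gpt: "gdet pt z > 0" if "z \<in> S" for z
      using pt_jets(4-6)[OF that] Sy(7)[OF that] by (simp add: gdet_def gmet_def cdir_def)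
    have D0: "D (0, z) > 0" if "z \<in> S" for z using gD[OF that, of 0] gpt[OF that] by (simp add: R0)
    have oD: "open ((UNIV \<times> S) \<inter> D -` {0<..})" by (rule continuous_open_preimage[OF contD oUS]) simp
    have "{0} \<times> ?K \<subseteq> (UNIV \<times> S) \<inter> D -` {0<..}" using D0 K by auto
    \<comment> \<open>The immersion condition is open and holds at time 0, so by compactness of the
      box it holds there for a common range of t; outside the box nothing moves.\<close>
    from Elementary_Topology.tube_lemma[OF K(1) oD this] obtain X0 where X0: "0 \<in> X0" "open X0" "X0 \<times> ?K \<subseteq> (UNIV \<times> S) \<inter> D -` {0<..}"
      by auto
    then obtain e where e: "e > 0" "ball 0 e \<subseteq> X0" using open_contains_ball by blast
    have gpos: "gdet (\<lambda>w. R (t, w)) z > 0" if "t \<in> {-e<..<e}" "z \<in> S" for t z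
    proof (cases "z \<in> ?K")
      case True
      have "t \<in> X0" using that(1) e(2) by auto
      then show ?thesis using True X0(3) gD[OF that(2)] by auto
    next
      case False
      have "open (S - ?K)" using Sy(1) by (intro open_Diff closed_cbox)
      then have "pd (\<lambda>w. R (t, w)) u z = pd pt u z" for u by (rule pd_cong) (use that False RK in auto)
      then show ?thesis using gpt[OF that(2)] by (simp add: gdet_def gmet_def)
    qed
    define F where "F x = (1 :: real, R x)" for x
    have obox: "open ({-e<..<e} \<times> S)" using Sy(1) by (intro open_Times) auto
    have smF: "smooth_on ({-e<..<e} \<times> S) F"
      unfolding F_def by (intro smooth_on_Pair obox smooth_on_const smooth_on_subset[OF smR]) auto
    have ptp: "y z = (1, pt z)" if "z \<in> S" for z using Sy(3)[OF that] by (simp add: prod_eq_iff)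
    interpret surface_variation S y F e
    proof
      show "immersion_on S (\<lambda>z. F (t, z))" if "t \<in> {-e<..<e}" for t
        unfolding immersion_on_def using smooth_on_slice(1)[OF Sy(1) that smF] gpos[OF that] RR
        by (auto simp: on_sphere_def lor_def F_def)
    qed (use e smF R0 ptp in \<open>auto simp: F_def\<close>)
    have FK: "F (t, z) = y z" if "t \<in> {-e<..<e}" "z \<in> S - ?K" for t z
      using RK[of z t] ptp that by (simp add: F_def)
    have "((\<lambda>t. willmore_energy ?K (\<lambda>z. snd (F (t, z)))) has_real_derivative 0) (at 0)"
      using w K e smF immF F0 FK unfolding willmore_def by blast
    with energy_deriv[OF K FK] have I0: "integral ?K (\<lambda>z. Re (ip lift.EL Z z)) = 0" by (rule DERIV_unique)
    have \<xi>: "\<xi> z = (2 * ?\<eta> z) *\<^sub>R v z" if z: "z \<in> S" for z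
    proof -
      have "((\<lambda>t. Q (t, z)) has_vector_derivative \<xi> z) (at 0)"
        unfolding \<xi>_def using smooth_on_slice(3)[OF Sy(1) _ smQ z, of 0] e by simp
      moreover have "((\<lambda>t. Q (t, z)) has_vector_derivative (2 * ?\<eta> z) *\<^sub>R v z) (at 0)"
        unfolding Q_def F_def snd_conv R_def s_def fst_conv by (auto intro!: derivative_eq_intros)
      ultimately show ?thesis by (rule vector_derivative_unique_at)
    qed
    define f where "f z = sig z * (?\<eta> z * g z)" for z
    have f: "f z = (E z0 \<bullet> v z0) / 2 * Re (ip lift.EL Z z)" if "z \<in> S" for z
      unfolding EL_Z[OF that] \<xi>[OF that] f_def g_def E_def[symmetric] by simp
    have contf: "continuous_on ?K f"
      using continuous_on_subset[OF smooth_on_continuous[OF smsig] K(2)] continuous_on_subset[OF smooth_on_continuous[OF sm\<eta>] K(2)]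
        continuous_on_subset[OF contE K(2)] unfolding f_def by (intro continuous_intros)
    have "integral ?K f = integral ?K (\<lambda>z. (E z0 \<bullet> v z0) / 2 * Re (ip lift.EL Z z))"
      by (rule Henstock_Kurzweil_Integration.integral_cong) (use f K in auto)
    also have "\<dots> = 0" by (simp add: I0)
    finally have int: "(f has_integral 0) ?K" using integrable_on_compact[OF K(1) contf] by (metis integrable_integral)
    \<comment> \<open>A continuous integrand that is nonnegative with integral 0 vanishes, yet at z0
      it is positive.\<close>
    have pos: "0 \<le> f x" if "x \<in> box a b" for x
      using that ab box_subset_cbox[of a b] sig(1)[of x] bump_nonneg[of z0 "r / 2" x] by (force simp: f_def)
    have "f z0 = 0" by (rule has_integral_0_cbox_imp_0[OF contf pos int]) (use ab box_subset_cbox[of a b] in auto)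
    moreover have "?\<eta> z0 = 1" using r(1) by (simp add: bump_1)
    moreover have "g z0 > 0" using ab box_subset_cbox[of a b] by auto
    ultimately show False using sig(1)[OF z0] by (simp add: f_def)
  qed
  let ?x = "pt z0"
  have xE: "u \<bullet> w = (\<Sum>j\<in>UNIV. (u \<bullet> \<epsilon> j) * (w \<bullet> \<epsilon> j))" for u w
    by (simp add: \<epsilon>_def inner_axis inner_vec_def[of u])
  have "E z0 \<bullet> \<epsilon> i = (E z0 \<bullet> ?x) * (?x \<bullet> \<epsilon> i)" for i
  proof -
    have "(E z0 \<bullet> ?x) * (?x \<bullet> \<epsilon> i) = (\<Sum>j\<in>UNIV. ((E z0 \<bullet> \<epsilon> j) * (?x \<bullet> \<epsilon> i)) * (?x \<bullet> \<epsilon> j))"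
      unfolding xE[of _ ?x] by (simp add: sum_distrib_left mult_ac)
    also have "\<dots> = (\<Sum>j\<in>UNIV. ((E z0 \<bullet> \<epsilon> i) * (?x \<bullet> \<epsilon> j)) * (?x \<bullet> \<epsilon> j))" using key by (intro sum.cong refl) metis
    also have "\<dots> = (E z0 \<bullet> \<epsilon> i) * (?x \<bullet> ?x)" unfolding xE[of ?x ?x] by (simp add: sum_distrib_left mult_ac)
    finally show ?thesis using pt_jets(1)[OF z0] by simp
  qed
  then show ?thesis unfolding E_def[symmetric] by (intro exI[of _ "E z0 \<bullet> ?x"]) (simp add: vec_eq_iff \<epsilon>_def inner_axis)
qed

section \<open>Orthonormal frames and orientations\<close>

text \<open>Let p be the unit vector in the direction of a. Orthogonality to a says that the time
  part of x is snd x . p, so <x, x> is the squared norm of the part of snd x orthogonal to p; it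
  vanishes only on multiples of a, which b excludes.\<close>

lemma lor_spacelike:
  fixes x a b :: "'n::finite mink"
  assumes a: "lor a a = 0" "fst a \<noteq> 0" and b: "lor a b \<noteq> 0" and x: "lor x a = 0" "lor x b = 0"
  shows "lor x x \<ge> 0" and "lor x x = 0 \<Longrightarrow> x = 0"
proof -
  define p where "p = (1 / fst a) *\<^sub>R snd a"
  have p: "p \<bullet> p = 1" using a by (simp add: p_def lor_def)
  have x0: "fst x = snd x \<bullet> p" using x(1) a(2) by (simp add: lor_def p_def)
  define w where "w = snd x - (snd x \<bullet> p) *\<^sub>R p"
  have w: "lor x x = w \<bullet> w"
    using p by (simp add: lor_def w_def x0 inner_commute algebra_simps)
  then show "lor x x \<ge> 0" by simp
  assume "lor x x = 0"
  then have "snd x = fst x *\<^sub>R p" using w x0 by (simp add: w_def)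
  then have xa: "x = (fst x / fst a) *\<^sub>R a" using a(2) by (simp add: prod_eq_iff p_def)
  have "lor x b = fst x / fst a * lor a b" by (subst xa) (simp add: lor_simps)
  then have "fst x = 0" using x(2) b a(2) by simp
  then show "x = 0" using xa by simp
qed

lemma vector_4 [simp]:
  "(vector [a, b, c, d] :: 'a::zero ^ 4) $ 1 = a" "(vector [a, b, c, d] :: 'a::zero ^ 4) $ 2 = b"
  "(vector [a, b, c, d] :: 'a::zero ^ 4) $ 3 = c" "(vector [a, b, c, d] :: 'a::zero ^ 4) $ 4 = d"
  unfolding vector_def by simp_all

lemma same_orientation_refl: "same_orientation b b"
  unfolding same_orientation_def
proof (intro exI[of _ "mat 1"] conjI allI)
  fix i show "b $ i = (\<Sum>j\<in>UNIV. (mat 1 :: real ^ 4 ^ 4) $ i $ j *\<^sub>R b $ j)"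
    by (simp add: mat_def if_distrib[of "\<lambda>x. x *\<^sub>R _"] cong: if_cong)
qed (simp add: det_I)

lemma frame_change_mult:
  fixes b c d :: "'a::real_vector ^ 4" and A B :: "real ^ 4 ^ 4"
  assumes "\<And>i. c $ i = (\<Sum>j\<in>UNIV. A $ i $ j *\<^sub>R b $ j)" "\<And>i. d $ i = (\<Sum>j\<in>UNIV. B $ i $ j *\<^sub>R c $ j)"
  shows "d $ i = (\<Sum>j\<in>UNIV. (B ** A) $ i $ j *\<^sub>R b $ j)"
proof -
  have "d $ i = (\<Sum>k\<in>UNIV. \<Sum>j\<in>UNIV. (B $ i $ k * A $ k $ j) *\<^sub>R b $ j)"
    by (simp add: assms scaleR_sum_right)
  also have "\<dots> = (\<Sum>j\<in>UNIV. (B ** A) $ i $ j *\<^sub>R b $ j)"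
    by (subst sum.swap) (simp add: matrix_matrix_mult_def scaleR_sum_left)
  finally show ?thesis .
qed

lemma same_orientation_trans:
  assumes "same_orientation b c" "same_orientation c d"
  shows "same_orientation b d"
proof -
  obtain A where A: "det A > 0" "\<And>i. c $ i = (\<Sum>j\<in>UNIV. A $ i $ j *\<^sub>R b $ j)" using assms(1) by (auto simp: same_orientation_def)
  obtain B where B: "det B > 0" "\<And>i. d $ i = (\<Sum>j\<in>UNIV. B $ i $ j *\<^sub>R c $ j)" using assms(2) by (auto simp: same_orientation_def)
  show ?thesis unfolding same_orientation_def
    using frame_change_mult[of c A b d B, OF A(2) B(2)] A(1) B(1) by (intro exI[of _ "B ** A"]) (simp add: det_mul)
qed

lemma same_orientation_sym:
  fixes b c :: "'n::finite mink ^ 4"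
  assumes "same_orientation b c"
  shows "same_orientation c b"
proof -
  obtain A :: "real ^ 4 ^ 4" where A: "det A > 0" "\<And>i. c $ i = (\<Sum>j\<in>UNIV. A $ i $ j *\<^sub>R b $ j)" using assms by (auto simp: same_orientation_def)
  then obtain B where B: "B ** A = mat 1" using invertible_det_nz[of A] by (auto simp: invertible_def)
  have "det B * det A = 1" using B by (metis det_mul det_I)
  then have "det B > 0" using A(1) by (metis zero_less_mult_pos2 zero_less_one)
  moreover have "b $ i = (\<Sum>j\<in>UNIV. B $ i $ j *\<^sub>R c $ j)" for i
  proof -
    have "(\<Sum>j\<in>UNIV. B $ i $ j *\<^sub>R c $ j) = (\<Sum>j\<in>UNIV. (B ** A) $ i $ j *\<^sub>R b $ j)"
      using frame_change_mult[of c A b "\<chi> i. \<Sum>j\<in>UNIV. B $ i $ j *\<^sub>R c $ j" B i] A(2) by simp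
    also have "\<dots> = b $ i" unfolding B by (simp add: mat_def if_distrib[of "\<lambda>x. x *\<^sub>R _"] cong: if_cong)
    finally show ?thesis by simp
  qed
  ultimately show ?thesis unfolding same_orientation_def by blast
qed

lemma or_class_eqI:
  assumes "same_orientation b c"
  shows "or_class b = or_class c"
  using same_orientation_trans[OF assms] same_orientation_trans[OF same_orientation_sym[OF assms]] by (auto simp: or_class_def)

lemma is_frame_orientation:
  fixes b c :: "'n::finite mink ^ 4"
  assumes "is_frame b" "same_orientation b c"
  shows "is_frame c"
  unfolding is_frame_def
proof (intro allI impI)
  obtain A :: "real ^ 4 ^ 4" where A: "det A > 0" "\<And>i. c $ i = (\<Sum>j\<in>UNIV. A $ i $ j *\<^sub>R b $ j)" using assms by (auto simp: same_orientation_def)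
  fix v :: "real ^ 4" assume "(\<Sum>i\<in>UNIV. v $ i *\<^sub>R c $ i) = 0"
  moreover have "(\<Sum>i\<in>UNIV. v $ i *\<^sub>R c $ i) = (\<Sum>j\<in>UNIV. (transpose A *v v) $ j *\<^sub>R b $ j)"
    unfolding A(2) scaleR_sum_right by (subst sum.swap) (simp add: matrix_vector_mult_def transpose_def scaleR_sum_left mult.commute)
  ultimately have "transpose A *v v = 0" using assms(1) by (simp add: is_frame_def)
  moreover obtain B where "B ** transpose A = mat 1" using A(1) invertible_det_nz[of "transpose A"] by (auto simp: invertible_def)
  ultimately show "v = 0" by (metis matrix_left_invertible_ker)
qed

section \<open>Null frames, orientation and constancy of planes\<close>

lemma is_frame_dual:
  fixes g h :: "'n::finite mink ^ 4"
  assumes "\<And>i j. lor (g $ i) (h $ j) = (if i = j then 1 else 0)"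
  shows "is_frame g"
  unfolding is_frame_def
proof (intro allI impI)
  fix c :: "real ^ 4" assume c: "(\<Sum>i\<in>UNIV. c $ i *\<^sub>R g $ i) = 0"
  have "c $ j = lor (\<Sum>i\<in>UNIV. c $ i *\<^sub>R g $ i) (h $ j)" for j
    by (simp add: bounded_bilinear.sum_left[OF bounded_bilinear_lor] lor_simps assms if_distrib cong: if_cong)
  then show "c = 0" unfolding c by (simp add: vec_eq_iff lor_simps)
qed

abbreviation fr :: "'n::finite mink \<Rightarrow> 'n mink \<Rightarrow> 'n mink \<Rightarrow> 'n mink \<Rightarrow> 'n mink ^ 4" where "fr a p x b \<equiv> vector [a, p, x, b]"

text \<open>a and b are null with product -1 and p, x are orthonormal, so the dual frame is (-b, p,
  x, -a), see \<open>lor_frame_dual\<close>.\<close>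

definition lor_frame :: "'n::finite mink \<Rightarrow> 'n mink \<Rightarrow> 'n mink \<Rightarrow> 'n mink \<Rightarrow> bool" where
  "lor_frame a p x b \<longleftrightarrow> lor a a = 0 \<and> lor b b = 0 \<and> lor a b = -1 \<and> lor a p = 0 \<and> lor b p = 0 \<and> lor p p = 1 \<and>
    lor x a = 0 \<and> lor x b = 0 \<and> lor x p = 0 \<and> lor x x = 1"

lemma lor_frame_dual:
  assumes "lor_frame a p x b"
  shows "lor (fr a p x b $ i) (fr (- b) p x (- a) $ j) = (if i = j then 1 else 0)"
proof -
  have "\<forall>i j. lor (fr a p x b $ i) (fr (- b) p x (- a) $ j) = (if i = j then 1 else 0)"
    unfolding forall_4 using assms by (simp add: lor_frame_def lor_simps lor_commute)
  then show ?thesis by simp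
qed

lemma is_frame_fr: "lor_frame a p x b \<Longrightarrow> is_frame (fr a p x b)"
  by (rule is_frame_dual[OF lor_frame_dual])

text \<open>The change of frame adds to one row of the identity a combination of the other rows, so
  its determinant is 1.\<close>

lemma same_orientation_shear:
  fixes b c :: "'n::finite mink ^ 4"
  assumes j: "\<forall>j. j \<noteq> i \<longrightarrow> c $ j = b $ j" and i: "c $ i = b $ i + (\<Sum>j\<in>UNIV. k j *\<^sub>R b $ j)" and k: "k i = 0"
  shows "same_orientation b c"
proof -
  let ?M = "mat 1 :: real ^ 4 ^ 4"
  define x where "x = (\<chi> j. k j)"
  define A where "A = (\<chi> l. if l = i then row i ?M + x else row l ?M)"
  have r: "row l ?M $ j = (if l = j then 1 else 0)" for l j by (simp add: row_def mat_def)
  have "x = (\<Sum>j\<in>-{i}. k j *s row j ?M)"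
  proof -
    have "x $ l = (\<Sum>j\<in>-{i}. k j * (if j = l then 1 else 0))" for l
      using k by (cases "l = i") (auto simp: x_def if_distrib[of "(*) _"] cong: if_cong)
  thus ?thesis by (simp add: vec_eq_iff r)
 qed
 also have "\<dots> \<in> vec.span {row j ?M |j. j \<noteq> i}"
  by (intro vec.span_sum vec.span_scale vec.span_base) auto
 finally have "det A = det ?M" unfolding A_def by (rule det_row_span)
 moreover have "c $ l = (\<Sum>j\<in>UNIV. A $ l $ j *\<^sub>R b $ j)" for l
 proof (cases "l = i")
  case True
  have "A $ i $ j = (if i = j then 1 else 0) + k j" for j by (simp add: A_def r x_def)
  thus ?thesis using True i by (simp add: scaleR_left_distrib sum.distrib if_distrib[of "\<lambda>x. x *\<^sub>R _"] cong: if_cong)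
 next
  case False
  have "A $ l $ j = (if l = j then 1 else 0)" for j using False by (simp add: A_def r)
  thus ?thesis using False j by (simp add: if_distrib[of "\<lambda>x. x *\<^sub>R _"] cong: if_cong)
 qed
 ultimately show ?thesis unfolding same_orientation_def by (intro exI[of _ A]) simp
qed

lemma same_orientation_unipotent:
 fixes Y :: "'n::finite mink"
 shows "same_orientation (vector [Y, U, V, N]) (vector [Y, U + u *\<^sub>R Y, V + v *\<^sub>R Y, N + p *\<^sub>R U + q *\<^sub>R V + w *\<^sub>R Y])"
proof -
 have a: "same_orientation (vector [Y, U, V, N]) (vector [Y, U + u *\<^sub>R Y, V, N])"
  by (rule same_orientation_shear[where i=2 and k="\<lambda>j. if j = 1 then u else 0"])
   (simp_all add: forall_4 sum_4)
 have b: "same_orientation (vector [Y, U + u *\<^sub>R Y, V, N]) (vector [Y, U + u *\<^sub>R Y, V + v *\<^sub>R Y, N])"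
  by (rule same_orientation_shear[where i=3 and k="\<lambda>j. if j = 1 then v else 0"])
   (simp_all add: forall_4 sum_4)
 \<comment> \<open>The coefficient of Y is corrected by p u + q v because U and V have already been
   shifted by multiples of Y.\<close>
 have c: "same_orientation (vector [Y, U + u *\<^sub>R Y, V + v *\<^sub>R Y, N]) (vector [Y, U + u *\<^sub>R Y, V + v *\<^sub>R Y, N + p *\<^sub>R U + q *\<^sub>R V + w *\<^sub>R Y])"
  by (rule same_orientation_shear[where i=4 and k="\<lambda>j. if j = 1 then w - p * u - q * v else if j = 2 then p else if j = 3 then q else 0"])
   (simp_all add: forall_4 sum_4 algebra_simps)
 show ?thesis by (rule same_orientation_trans[OF same_orientation_trans[OF a b] c])
qed

text \<open>\<open>proj\<close> says that the projection onto the plane is constant, so any two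
  frames are related by an invertible matrix. Its determinant is continuous on the interval, never
  0, and 1 at u'; hence it stays positive.\<close>

lemma or_class_constant:
 fixes g h :: "real => 'n::finite mink ^ 4"
 assumes I: "is_interval I" and u: "u \<in> I" "u' \<in> I"
  and dual: "\<And>u i j. u \<in> I ==> lor (g u $ i) (h u $ j) = (if i = j then 1 else 0)"
  and cont: "\<And>i. continuous_on I (\<lambda>u. g u $ i)"
  and proj: "\<And>u u' x. u \<in> I ==> u' \<in> I ==> (\<Sum>j\<in>UNIV. lor x (h u $ j) *\<^sub>R g u $ j) = (\<Sum>j\<in>UNIV. lor x (h u' $ j) *\<^sub>R g u' $ j)"
 shows "or_class (g u) = or_class (g u')"
proof -
 note s = bounded_bilinear.sum_left[OF bounded_bilinear_lor] lor_simps
 define A :: "real => real => real ^ 4 ^ 4" where "A v w = (\<chi> i j. lor (g v $ i) (h w $ j))" for v w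
 have g: "g v $ i = (\<Sum>j\<in>UNIV. A v w $ i $ j *\<^sub>R g w $ j)" if "v \<in> I" "w \<in> I" for v w i
 proof -
  have "g v $ i = (\<Sum>j\<in>UNIV. lor (g v $ i) (h v $ j) *\<^sub>R g v $ j)"
   by (simp add: dual[OF that(1)] if_distrib[of "\<lambda>x. x *\<^sub>R _"] cong: if_cong)
  also have "\<dots> = (\<Sum>j\<in>UNIV. lor (g v $ i) (h w $ j) *\<^sub>R g w $ j)" by (rule proj[OF that])
  finally show ?thesis by (simp add: A_def)
 qed
 have inv: "A v w ** A w v = mat 1" if "v \<in> I" "w \<in> I" for v w
 proof -
  have "(A v w ** A w v) $ i $ k = (mat 1 :: real ^ 4 ^ 4) $ i $ k" for i k
  proof -
   have "(A v w ** A w v) $ i $ k = lor (\<Sum>j\<in>UNIV. A v w $ i $ j *\<^sub>R g w $ j) (h v $ k)"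
    by (simp add: matrix_matrix_mult_def s) (simp add: A_def)
   also have "\<dots> = lor (g v $ i) (h v $ k)" by (simp flip: g[OF that])
   finally show ?thesis by (simp add: dual[OF that(1)] mat_def)
  qed
  thus ?thesis by (simp add: vec_eq_iff)
 qed
 have nz: "det (A v u') \<noteq> 0" if "v \<in> I" for v
  using arg_cong[OF inv[OF that u(2)], of det] by (auto simp: det_mul)
 have cd: "continuous_on I (\<lambda>v. det (A v u'))"
  unfolding det_def A_def by (auto intro!: continuous_intros bounded_bilinear.continuous_on[OF bounded_bilinear_lor] cont)
 have "A u' u' = mat 1" by (simp add: A_def mat_def dual[OF u(2)])
 hence 1: "det (A u' u') = 1" by simp
 have "det (A u u') > 0"
 proof (rule ccontr)
  assume "\<not> det (A u u') > 0"
  have "connected ((\<lambda>v. det (A v u')) ` I)" by (rule connected_continuous_image[OF cd is_interval_connected[OF I]])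
  hence "0 \<in> (\<lambda>v. det (A v u')) ` I"
   unfolding connected_iff_interval using u 1 \<open>\<not> det (A u u') > 0\<close>
   by (elim ballE[of _ _ "det (A u u')"] ballE[of _ _ "det (A u' u')"]) auto
  thus False using nz by auto
 qed
 hence "same_orientation (g u') (g u)"
  unfolding same_orientation_def using g[OF u] by (intro exI[of _ "A u u'"]) simp
 thus ?thesis by (simp add: or_class_eqI)
qed

lemma frame_span_or_class:
 assumes "c \<in> or_class b"
 shows "frame_span c = frame_span b"
proof -
 have "frame_span c \<subseteq> frame_span b" if so: "same_orientation b c" for b c :: "'n::finite mink ^ 4"
 proof -
  obtain A :: "real ^ 4 ^ 4" where "\<And>i. c $ i = (\<Sum>j\<in>UNIV. A $ i $ j *\<^sub>R b $ j)" using so unfolding same_orientation_def by blast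
  hence "c $ i \<in> span (range (\<lambda>i. b $ i))" for i by (simp add: span_sum span_scale span_base)
  thus ?thesis unfolding frame_span_def by (intro span_minimal) auto
 qed
 thus ?thesis using assms same_orientation_sym by (fastforce simp: or_class_def)
qed

lemma plane_of_or_class: "is_frame b ==> plane_of (or_class b) = frame_span b"
 using frame_span_or_class same_orientation_refl by (fastforce simp: plane_of_def or_class_def)

section \<open>Uniqueness\<close>

context swillmore_lift
begin

lemma smr: "smooth_on S r" unfolding r_def[abs_def] by (intro smo smm)
lemma smth: "smooth_on S th" unfolding th_def[abs_def] power2_eq_square by (intro smo smm)
lemma smYh: "smooth_on S (Yh a)" unfolding Yh_def[abs_def] by (intro smo smm)

lemma bP: "z \<in> S ==> cnj (P a z) = Yb a z + cnj (m z) / 2 * Y a z"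
 by (simp add: P_def Yb_cnj realY)

lemma Yh_real: "z \<in> S ==> cnj (Yh a z) = Yh a z"
 by (simp add: Yh_def realN Yb_cnj realY)

lemma ipP: "ip P f z = ip Yz f z + m z / 2 * ip Y f z"
 by (simp add: ip_def P_def sum.distrib sum_distrib_left algebra_simps)

lemma ipbP: "z \<in> S ==> ip (bar P) f z = ip Yb f z + cnj (m z) / 2 * ip Y f z"
 by (simp add: ip_def bar_def bP sum.distrib sum_distrib_left algebra_simps)

lemma ipYh: "ip Yh f z = ip N f z + cnj (m z) * ip Yz f z + m z * ip Yb f z + m z * cnj (m z) / 2 * ip Y f z"
 by (simp add: ip_def Yh_def sum.distrib sum_distrib_left algebra_simps)

lemma ipr_frame: assumes z: "z \<in> S"
 shows "ip f P z = ip f Yz z + m z / 2 * ip f Y z" "ip f (bar P) z = ip f Yb z + cnj (m z) / 2 * ip f Y z"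
  "ip f Yh z = ip f N z + cnj (m z) * ip f Yz z + m z * ip f Yb z + m z * cnj (m z) / 2 * ip f Y z"
 unfolding ip_commute[of f] ipP ipbP[OF z] ipYh by simp_all

lemma gP: assumes z: "z \<in> S"
 shows "ip P Y z = 0" "ip P P z = 0" "ip P (bar P) z = 1/2" "ip Yh Y z = -1" "ip Yh P z = 0" "ip Yh Yh z = 0" "ip Yh K z = 0" "ip P K z = 0"
  "ip (bar P) K z = 0"
 by (simp_all add: ipP ipbP[OF z] ipYh ipr_frame[OF z] YY[OF z] g1[OF z] bb[OF z] zz[OF z] zzb[OF z] gN[OF z] gK[OF z] ipc
  ip_commute[of Y K] ip_commute[of "Yz" K] ip_commute[of Yb K] ip_commute[of N K] ip_commute[of Y N] ip_commute[of Yz N] ip_commute[of Yb N])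

text \<open>\<open>Pb_eq\<close> solved for the dual lift and differentiated, with dz and dzb
  exchanged on P. The coefficient of Y is not yet understood.\<close>

lemma Yh_z_aux: assumes z: "z \<in> S"
 shows "dz (Yh a) z = m z / 2 * Yh a z + r z * P a z + th z * cnj (P a z) + (m z * cnj (r z) + dzb th z - cnj (dzb r z)) * Y a z"
proof -
 have Yhe: "Yh a w = 2 * dzb (P a) w + cnj (m w) * P a w - cnj (r w) * Y a w" if "w \<in> S" for w
  unfolding Pb_eq[OF that] by simp
 have cm: "cnj (dzb m w) = r w + 2 * q w" for w by (simp add: r_def)
 have mb: "dzb m z = cnj (r z) + 2 * q z" by (simp add: r_def q_real[OF z])
 have "dz (dzb (P a)) z = dzb (\<lambda>z. m z / 2 * P a z + K a z + th z / 2 * Y a z) z"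
  unfolding dz_dzb_commute[OF S z smP] by (rule dzb_cong[OF S z]) (simp add: Pz_eq)
 also have "\<dots> = dzb m z / 2 * P a z + m z / 2 * dzb (P a) z + dzb (K a) z + dzb th z / 2 * Y a z + th z / 2 * Yb a z"
  using z smm smP smth by (simp add: wirt smo dzbf_def add_divide_distrib)
 finally have Pbz: "dz (dzb (P a)) z = dzb m z / 2 * P a z + m z / 2 * dzb (P a) z + dzb (K a) z + dzb th z / 2 * Y a z + th z / 2 * Yb a z" .
 have "dz (Yh a) z = dz (\<lambda>w. 2 * dzb (P a) w + cnj (m w) * P a w - cnj (r w) * Y a w) z"
  by (rule dz_cong[OF S z Yhe])
 also have "\<dots> = 2 * dz (dzb (P a)) z + (cnj (m z) * dz (P a) z + cnj (dzb m z) * P a z) - (cnj (r z) * Yz a z + cnj (dzb r z) * Y a z)"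
  using z smm smP smr by (simp add: wirt smo) (simp add: dzf_def)
 finally have 1: "dz (Yh a) z = \<dots>" .
 have Yz': "Yz a z = P a z - m z / 2 * Y a z" "Yb a z = cnj (P a z) - cnj (m z) / 2 * Y a z" by (simp_all add: P_def Yb_cnj[OF z] realY)
 show ?thesis unfolding 1 Pbz Kb_eq[OF z] Pz_eq[OF z] Pb_eq[OF z] Yz' mb by (simp add: q_real[OF z] field_simps)
qed

text \<open>The dual lift is null, so its derivative is orthogonal to it. In \<open>Yh_z_aux\<close>
  only the Y-term has nonzero product with \<open>Yh\<close>, hence its coefficient
  vanishes.\<close>

lemma r_b: assumes z: "z \<in> S" shows "cnj (dzb r z) = m z * cnj (r z) + dzb th z"
proof -
 have sm: "smf S Yh" using smYh by (simp add: smf_def)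
 have "ip (dzf Yh) Yh z = 0"
  using dz_ip[OF S sm sm z] dz_eq0[OF S gP(6) z] by (simp add: ip_commute[of Yh "dzf Yh"])
 moreover have "ip (dzf Yh) Yh z = ip (\<lambda>a z. m z / 2 * Yh a z + r z * P a z + th z * bar P a z + (m z * cnj (r z) + dzb th z - cnj (dzb r z)) * Y a z) Yh z"
  by (rule ip_cong) (simp_all add: dzf_def Yh_z_aux[OF z] bar_def)
 moreover have "ip (bar P) Yh z = 0"
  using gP(5)[OF z] cnj_ip[of P Yh z] ip_cong[of "bar P" z "bar P" "bar Yh" Yh] Yh_real[OF z] by (simp add: bar_def ip_commute)
 ultimately show ?thesis using gP[OF z] unfolding ip_lin(1) ip_lin(4)[where c="\<lambda>z. m z / 2"] ip_lin(4)[where c=r] ip_lin(4)[where c=th]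
  ip_lin(4)[where c="\<lambda>z. m z * cnj (r z) + dzb th z - cnj (dzb r z)"]
  by (simp add: ip_commute[of P Yh] ip_commute[of Y Yh])
qed

lemma Yh_z: assumes z: "z \<in> S"
 shows "dz (Yh a) z = m z / 2 * Yh a z + r z * P a z + th z * cnj (P a z)"
 using Yh_z_aux[OF z] r_b[OF z] by simp

lemma Yh_b: assumes z: "z \<in> S"
 shows "dzb (Yh a) z = cnj (m z) / 2 * Yh a z + cnj (r z) * cnj (P a z) + cnj (th z) * P a z"
proof -
 have "dzb (Yh a) z = dzb (\<lambda>z. cnj (Yh a z)) z" by (rule dzb_cong[OF S z]) (simp add: Yh_real)
 thus ?thesis using z smYh Yh_z[OF z] Yh_real[OF z] by (simp add: wirt)
qed

text \<open>Yh_zzbar is real, and its normal part is theta conj kappa. Pairing with kappa gives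
  theta q; pairing the conjugate expansion gives conj theta <kappa, kappa>, which by the assumption
  is - theta q.\<close>

lemma th_q: assumes z: "z \<in> S" and c: "\<And>a. cnj (th z) * K a z + th z * cnj (K a z) = 0"
 shows "th z * q z = 0"
proof -
 define \<alpha> where "\<alpha> = dzb m z / 2 + m z / 2 * cnj (m z) / 2 + r z / 2"
 define \<beta> where "\<beta> = m z / 2 * cnj (th z) + dzb r z - r z * cnj (m z) / 2"
 define \<gamma> where "\<gamma> = m z / 2 * cnj (r z) + dzb th z + th z * cnj (m z) / 2"
 define \<delta> where "\<delta> = r z * cnj (r z) / 2 + th z * cnj (th z) / 2"
 \<comment> \<open>Constant in w: the vector at the fixed point z, typed as a field so that
   \<open>ip\<close> applies.\<close>
 define v where "v a (w::complex) = dzb (dz (Yh a)) z" for a w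
 have v: "v a z = \<alpha> * Yh a z + \<beta> * P a z + \<gamma> * cnj (P a z) + \<delta> * Y a z + th z * cnj (K a z)" for a
 proof -
  have "v a z = dzb (\<lambda>z. m z / 2 * Yh a z + r z * P a z + th z * cnj (P a z)) z"
   unfolding v_def by (rule dzb_cong[OF S z Yh_z])
  also have "\<dots> = m z / 2 * dzb (Yh a) z + dzb m z / 2 * Yh a z + (r z * dzb (P a) z + dzb r z * P a z) + (th z * cnj (dz (P a) z) + dzb th z * cnj (P a z))"
   using z smm smP smr smth smYh by (simp add: wirt smo)
  finally have 2: "v a z = \<dots>" .
  show ?thesis unfolding 2 Yh_b[OF z] Pz_eq[OF z] Pb_eq[OF z] \<alpha>_def \<beta>_def \<gamma>_def \<delta>_def by (simp add: realY field_simps)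
 qed
 have vr: "cnj (v a z) = v a z" for a
 proof -
  have "cnj (dzb (dz (Yh a)) z) = dz (\<lambda>z. cnj (dz (Yh a) z)) z" using z smYh by (simp add: wirt smo)
  also have "\<dots> = dz (dzb (Yh a)) z"
  proof (rule dz_cong[OF S z])
   fix w assume w: "w \<in> S"
   have "cnj (dz (Yh a) w) = dzb (\<lambda>z. cnj (Yh a z)) w" using w smYh by (simp add: wirt)
   also have "\<dots> = dzb (Yh a) w" by (rule dzb_cong[OF S w]) (simp add: Yh_real)
   finally show "cnj (dz (Yh a) w) = dzb (Yh a) w" .
  qed
  also have "\<dots> = dzb (dz (Yh a)) z" by (rule dz_dzb_commute[OF S z smYh])
  finally show ?thesis by (simp add: v_def)
 qed
 note k = ip_lin(1) ip_lin(4)[where c="\<lambda>_. \<alpha>"] ip_lin(4)[where c="\<lambda>_. \<beta>"] ip_lin(4)[where c="\<lambda>_. \<gamma>"] ip_lin(4)[where c="\<lambda>_. \<delta>"] ip_lin(4)[where c=th]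
  ip_lin(4)[where c="\<lambda>_. cnj \<alpha>"] ip_lin(4)[where c="\<lambda>_. cnj \<beta>"] ip_lin(4)[where c="\<lambda>_. cnj \<gamma>"] ip_lin(4)[where c="\<lambda>_. cnj \<delta>"] ip_lin(4)[where c="\<lambda>z. cnj (th z)"]
 have gY: "ip Y K z = 0" using gK(1)[OF z] by (simp add: ip_commute)
 have "ip v K z = ip (\<lambda>a w. \<alpha> * Yh a w + \<beta> * P a w + \<gamma> * bar P a w + \<delta> * Y a w + th w * bar K a w) K z"
  by (rule ip_cong) (simp_all add: v bar_def)
 also have "\<dots> = th z * q z" unfolding k using gP[OF z] gY by (simp add: qK[OF z] ip_commute[of "bar K"])
 finally have 1: "ip v K z = th z * q z" .
 have "ip v K z = ip (\<lambda>a w. cnj \<alpha> * Yh a w + cnj \<beta> * bar P a w + cnj \<gamma> * P a w + cnj \<delta> * Y a w + cnj (th w) * K a w) K z"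
  by (rule ip_cong) (subst vr[symmetric], simp_all add: v bar_def Yh_real[OF z] realY)
 also have "\<dots> = cnj (th z) * ip K K z" unfolding k using gP[OF z] gY by simp
 also have "\<dots> = ip (\<lambda>a w. - (th w * bar K a w)) K z"
  unfolding ip_lin(4)[where c="\<lambda>z. cnj (th z)", symmetric]
  by (rule ip_cong) (use c in \<open>simp_all add: bar_def eq_neg_iff_add_eq_0\<close>)
 also have "\<dots> = - (th z * q z)" unfolding ip_lin(3) ip_lin(4)[where c=th] by (simp add: qK[OF z] ip_commute[of "bar K"])
 finally show ?thesis using 1 by auto
qed

text \<open>The orthogonal projection onto the mean curvature sphere, as a symmetric tensor in the
  null frame Y, Yh, P, cnj P.\<close>

definition T :: "'n option => 'n option => complex => complex" where
 "T a b z = - Yh a z * Y b z - Y a z * Yh b z + 2 * P a z * cnj (P b z) + 2 * cnj (P a z) * P b z"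

text \<open>In the derivative of the projection the tangential terms of the structure equations
  cancel, and what remains is linear in kappa.\<close>

lemma T_const: assumes z: "z \<in> S" and K0: "\<And>a. K a z = 0" shows "pd (T a b) v z = 0"
proof -
 have sm: "smooth_on S (T a b)" unfolding T_def[abs_def] by (intro smo smP smYh smooth_on_const)
 have Yz': "dz (Y a) z = P a z - m z / 2 * Y a z" for a by (simp add: P_def dzf_def)
 have cP: "dz (\<lambda>z. cnj (P a z)) z = cnj (dzb (P a) z)" for a using z smP by (simp add: wirt)
 have "dz (T a b) z = - (Yh a z * dz (Y b) z + dz (Yh a) z * Y b z) - (Y a z * dz (Yh b) z + dz (Y a) z * Yh b z)
   + 2 * (P a z * cnj (dzb (P b) z) + dz (P a) z * cnj (P b z)) + 2 * (cnj (P a z) * dz (P b) z + cnj (dzb (P a) z) * P b z)"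
  unfolding T_def[abs_def] using z smP smYh by (simp add: wirt smo)
 also have "\<dots> = 0"
  unfolding Yz' Yh_z[OF z] Pz_eq[OF z] Pb_eq[OF z] K0 by (simp add: Yh_real[OF z] realY field_simps)
 finally have 1: "dz (T a b) z = 0" .
 have "cnj (T a b w) = T a b w" if "w \<in> S" for w by (simp add: T_def Yh_real[OF that] realY)
 hence "dzb (T a b) z = dzb (\<lambda>z. cnj (T a b z)) z" by (intro dzb_cong[OF S z]) simp
 also have "\<dots> = 0" using z sm 1 by (simp add: wirt)
 finally have 2: "dzb (T a b) z = 0" .
 show ?thesis using pd_complex_dir[OF smooth_on_differentiable[OF sm] S z] 1 2 by (simp add: pd_1_dz pd_ii_dz)
qed

end

lemma (in swillmore_lift) T_frame:
 "T a b z = - (N a z * Y b z) - Y a z * N b z + 2 * Yz a z * Yb b z + 2 * Yb a z * Yz b z" if "z \<in> S"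
 unfolding T_def bP[OF that] unfolding Yh_def P_def by (simp add: field_simps)

section \<open>The Willmore condition and the vanishing of theta\<close>

locale dual_surface = conformal_surface S y for S :: "complex set" and y :: "complex => 'n::finite mink" +
 fixes m :: "complex => complex"
 assumes sws: "s_willmore_with S y m"
begin

sublocale sw: swillmore_lift S "cf L" m
 using sws s_willmore_eq_iff[of m] by unfold_locales (auto simp: s_willmore_with_def)

lemma cf_dual: assumes z: "z \<in> S" shows "cf (dual_lift y m) a z = sw.Yh a z"
proof -
 have "cf (dual_lift y m) a z = cf (frameN y) a z + of_real (Re (m z)) * cf (pd L 1) a z - of_real (Im (m z)) * cf (pd L \<i>) a z + of_real ((cmod (m z))^2 / 2) * cf L a z"
  by (simp add: cf_def dual_lift_def Yu_eq Yv_eq)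
 also have "of_real ((cmod (m z))^2 / 2) = m z * cnj (m z) / 2" by (simp add: complex_norm_square[symmetric])
 also have "cf (frameN y) a z + of_real (Re (m z)) * cf (pd L 1) a z - of_real (Im (m z)) * cf (pd L \<i>) a z
  = lift.N a z + cnj (m z) * lift.Yz a z + m z * lift.Yb a z"
  unfolding cf_frameN[OF z] cf1[OF z] by (simp add: complex_eq_iff algebra_simps)
 finally show ?thesis by (simp add: sw.Yh_def)
qed

lemma normal_spacelike: assumes z: "z \<in> S" and x: "lor x (L z) = 0" "lor x (frameN y z) = 0"
 shows "lor x x \<ge> 0" "lor x x = 0 ==> x = 0"
proof -
 have "fst (L z) \<noteq> 0" using sig(1)[OF z] Sy(3)[OF z] by (simp add: L_eq)
 note * = lor_spacelike[OF gram(1)[OF z] this _ x]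
 show "lor x x \<ge> 0" "lor x x = 0 ==> x = 0" using * gram(7)[OF z] by (simp_all add: lor_commute)
qed

lemma K_eq_0: assumes z: "z \<in> S" and q: "lift.q z = 0" shows "lift.K a z = 0"
proof -
 note n = kap_normal[OF z]
 have "lor (kap_re y z) (kap_re y z) + lor (kap_im y z) (kap_im y z) = 0"
  using q unfolding q_lor[OF z] by (metis of_real_eq_0_iff)
 hence "kap_re y z = 0" "kap_im y z = 0"
  using normal_spacelike[OF z n(1) n(1)] normal_spacelike[OF z n(2) n(2)] by auto
 thus ?thesis using kap[OF z, of a] by (simp add: cf_def split: option.splits)
qed

text \<open>By the Willmore condition the space part of the gradient is parallel to the point. So
  \<nu> = Re (conj theta kappa) is a multiple of the light vector y, while being normal; the normal
  bundle is positive definite, which forces \<nu> = 0. Then \<open>th_q\<close> applies.\<close>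

lemma th_K: assumes z: "z \<in> S" shows "sw.th z * lift.K a z = 0"
proof -
 obtain c where c: "\<And>a. lift.EL a z = - 4 * of_real (Re (cnj (sw.th z) * lift.K a z)) + of_real c * cf L a z"
  using sw.EL_eq[OF z] by blast
 obtain d where d: "(\<chi> i. Re (lift.EL (Some i) z)) = d *\<^sub>R pt z"
  using willmoreD[OF _ z] sws by (auto simp: s_willmore_with_def)
 define \<nu> where "\<nu> = (Re (sw.th z)) *\<^sub>R kap_re y z + (Im (sw.th z)) *\<^sub>R kap_im y z"
 have \<nu>: "Re (cnj (sw.th z) * lift.K a z) = mc \<nu> a" for a
  using kap[OF z, of a, symmetric] by (simp add: \<nu>_def cf_def)
 note n = kap_normal[OF z]
 have \<nu>n: "lor \<nu> (L z) = 0" "lor \<nu> (frameN y z) = 0" using n by (simp_all add: \<nu>_def lor_simps)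
 have "d * (pt z $ i) = - 4 * (snd \<nu> $ i) + c * sig z * (pt z $ i)" for i
  using arg_cong[OF d, of "\<lambda>v. v $ i"] c[of "Some i"] unfolding \<nu>
  by (simp add: cf_def mc_def L_eq[THEN fun_cong, of z])
 hence "snd \<nu> $ i = ((c * sig z - d) / 4) * (pt z $ i)" for i by (simp add: field_simps)
 hence "snd \<nu> = ((c * sig z - d) / 4) *\<^sub>R pt z" by (simp only: vec_eq_iff vector_scaleR_component real_scaleR_def simp_thms)
 then obtain k where s: "snd \<nu> = k *\<^sub>R pt z" by blast
 have "fst \<nu> * sig z = (snd \<nu> \<bullet> pt z) * sig z"
  using \<nu>n(1) Sy(3)[OF z] by (auto simp: lor_def L_eq[THEN fun_cong, of z])
 hence "fst \<nu> = k" using sig(1)[OF z] pt_jets(1)[OF z] by (simp add: s)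
 hence "lor \<nu> \<nu> = 0" using pt_jets(1)[OF z] by (simp add: lor_def s)
 hence "\<nu> = 0" by (rule normal_spacelike(2)[OF z \<nu>n])
 hence "Re (cnj (sw.th z) * lift.K a z) = 0" for a unfolding \<nu> by (simp split: option.splits)
 hence "cnj (sw.th z) * lift.K a z + sw.th z * cnj (lift.K a z) = 0" for a
  by (simp add: complex_eq_iff)
 hence "sw.th z * lift.q z = 0" by (rule sw.th_q[OF z])
 thus ?thesis using K_eq_0[OF z] by auto
qed

context
 fixes U :: "complex set"
 assumes U: "open U" "connected U" "U \<subseteq> S"
begin

text \<open>\<open>Kb_eq\<close> bounds dzb kappa by kappa: its last term contains q, which is a sum
  of components of kappa times continuous functions.\<close>

lemma K_unique_continuation:
 assumes V: "open V" "V \<noteq> {}" "V \<subseteq> U" and K0: "\<And>z a. z \<in> V ==> lift.K a z = 0" and z: "z \<in> U"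
 shows "lift.K a z = 0"
proof (rule unique_continuation_open[where w="lift.K a" and z=z and W="range lift.K", OF _ U(1,2) _ _ V])
 have c: "continuous_on U f" if "smooth_on S f" for f :: "complex => complex"
  using continuous_on_subset[OF smooth_on_continuous[OF that] U(3)] .
 show "lbd U (range lift.K) (dzb w)" if "w \<in> range lift.K" for w
 proof -
  obtain a where w: "w = lift.K a" using \<open>w \<in> range lift.K\<close> by auto
  have b: "lbd U (range lift.K) (lift.K a)" for a by (rule lbd_base) auto
  have "lbd U (range lift.K) (\<lambda>z. - cnj (m z) / 2 * lift.K a z - (\<Sum>d\<in>UNIV. 2 * sg d * lift.K d z * cnj (lift.K d z)) * sw.P a z)"
   by (intro lbd_diff lbd_mult_left lbd_mult_right lbd_sum lbd_cmult b c smooth_intros(6) Sy(1) lift.smo sw.smP sw.smm)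
  thus ?thesis
  proof (rule lbd_cong)
   fix z assume "z \<in> U"
   hence z: "z \<in> S" using U by auto
   have "2 * lift.q z = (\<Sum>d\<in>UNIV. 2 * sg d * lift.K d z * cnj (lift.K d z))"
    unfolding lift.qK[OF z] by (simp add: ip_def bar_def sum_distrib_left mult.assoc)
   thus "dzb w z = - cnj (m z) / 2 * lift.K a z - (\<Sum>d\<in>UNIV. 2 * sg d * lift.K d z * cnj (lift.K d z)) * sw.P a z"
    unfolding w sw.Kb_eq[OF z] by simp
  qed
 qed
 show "smooth_on U w" if "w \<in> range lift.K" for w using that lift.smK[THEN smf_D] smooth_on_subset U(3) by blast
qed (use K0 z in auto)

text \<open>Where theta is nonzero kappa vanishes, and this set is open; were it nonempty, kappa
  would vanish on all of U.\<close>

lemma th_eq_0: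
 assumes K: "z0 \<in> U" "lift.K a z0 \<noteq> 0" and z: "z \<in> U"
 shows "sw.th z = 0"
proof (rule ccontr)
 assume t: "sw.th z \<noteq> 0"
 have "continuous_on U sw.th" using continuous_on_subset[OF smooth_on_continuous[OF sw.smth] U(3)] .
 hence o: "open (U \<inter> sw.th -` (- {0}))" using U(1) by (intro continuous_open_preimage) auto
 have ne: "U \<inter> sw.th -` (- {0}) \<noteq> {}" using t z by auto
 have "lift.K a w = 0" if "w \<in> U \<inter> sw.th -` (- {0})" for w a
  using th_K[of w a] that U(3) by auto
 from K_unique_continuation[OF o ne _ this K(1)] have "lift.K a z0 = 0" by simp
 thus False using K by simp
qed

text \<open>Used in contrapositive form: a nonconstant congruence on the axis excludes kappa = 0.
  The tensor T is constant on U by \<open>T_const\<close>, which gives a constant plane, and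
  continuity along I takes care of the orientation.\<close>

lemma gauss_map_constant:
 assumes K0: "\<And>z a. z \<in> U ==> lift.K a z = 0" and I: "is_interval I" "complex_of_real ` I \<subseteq> U" and u: "u \<in> I" "u' \<in> I"
 shows "conformal_gauss_map y (of_real u) = conformal_gauss_map y (of_real u')"
proof -
 define g where "g u = fr (L (of_real u)) (pd L 1 (of_real u)) (pd L \<i> (of_real u)) (frameN y (of_real u))" for u
 define h where "h u = fr (- frameN y (of_real u)) (pd L 1 (of_real u)) (pd L \<i> (of_real u)) (- L (of_real u))" for u
 have IS: "complex_of_real v \<in> S" if "v \<in> I" for v using that I U by auto
 have "or_class (g u) = or_class (g u')"
 proof (rule or_class_constant[OF I(1) u])
  show "lor (g v $ i) (h v $ j) = (if i = j then 1 else 0)" if "v \<in> I" for v i j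
   unfolding g_def h_def by (rule lor_frame_dual) (simp add: lor_frame_def gram[OF IS[OF that]] lor_commute[of "L _" "frameN y _"] lor_commute[of "pd L \<i> _" "pd L 1 _"] lor_commute[of "pd L \<i> _" "L _"] lor_commute[of "pd L \<i> _" "frameN y _"])
  show "continuous_on I (\<lambda>u. g u $ i)" for i
  proof -
   have c: "continuous_on I (\<lambda>u. f (complex_of_real u))" if "smooth_on S f" for f :: "complex => 'n mink"
    using IS by (intro continuous_on_compose2[OF smooth_on_continuous[OF that]] continuous_intros) auto
   have "\<forall>i. continuous_on I (\<lambda>u. g u $ i)"
    unfolding forall_4 by (simp add: g_def c smL smooth_on_pd smN)
   thus ?thesis by simp
  qed
  have T: "sw.T a b (of_real v) = sw.T a b (of_real w)" if "v \<in> I" "w \<in> I" for a b v w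
  proof -
   have sm: "smooth_on S (sw.T a b)" unfolding sw.T_def[abs_def] by (intro lift.smo sw.smP sw.smYh smooth_on_const)
   have "(sw.T a b has_derivative (\<lambda>_. 0)) (at z)" if "z \<in> U" for z
    using smooth_on_has_derivative[OF sm Sy(1), of z] sw.T_const[of z a b] K0[OF that] that U(3) by auto
   from has_derivative_zero_unique_connected[OF U(1,2) this] show ?thesis using that I(2) by blast
  qed
  fix v w x assume vw: "v \<in> I" "w \<in> I"
  let ?s = "\<lambda>v. \<Sum>j\<in>UNIV. lor x (h v $ j) *\<^sub>R g v $ j"
  have pr: "complex_of_real (mc (?s v) b) = ip (cf (\<lambda>_. x)) (\<lambda>a. sw.T a b) (of_real v)" if "v \<in> I" for v b
  proof -
   let ?z = "complex_of_real v"
   note z = IS[OF that]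
   have "complex_of_real (mc (?s v) b)
    = - of_real (lor x (frameN y ?z)) * cf L b ?z + of_real (lor x (pd L 1 ?z)) * cf (pd L 1) b ?z + of_real (lor x (pd L \<i> ?z)) * cf (pd L \<i>) b ?z
     - of_real (lor x (L ?z)) * cf (frameN y) b ?z"
    by (simp add: sum_4 g_def h_def lor_simps cf_def)
   also have "\<dots> = ip (cf (\<lambda>_. x)) (\<lambda>a. sw.T a b) ?z"
   proof -
    have l: "complex_of_real (lor x (V ?z)) = ip (cf (\<lambda>_. x)) (cf V) ?z" for V :: "complex => 'n mink"
     using of_real_lor[of "\<lambda>_. x" ?z V] by simp
    show ?thesis
     unfolding l ip_def sum_distrib_right sum.distrib[symmetric] sum_subtractf[symmetric] sum_negf[symmetric] sw.T_frame[OF z] cf1[OF z] cf_frameN[OF z]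
     by (rule sum.cong) (simp_all add: algebra_simps)
   qed
   finally show ?thesis .
  qed
  have "mc (?s v) b = mc (?s w) b" for b
  proof -
   have "complex_of_real (mc (?s v) b) = complex_of_real (mc (?s w) b)"
    unfolding pr[OF vw(1)] pr[OF vw(2)] by (simp add: ip_def T[OF vw] cf_def)
   thus ?thesis by simp
  qed
  thus "?s v = ?s w" by (rule mink_eqI)
 qed
 thus ?thesis by (simp add: conformal_gauss_map_def g_def Yu_eq Yv_eq)
qed

end

end

text \<open>The two frames differ only in the third vector, so the change of frame is diagonal with
  entries 1, 1, c, 1. Both vectors have norm 1, so c^2 = 1, and the common orientation gives c >
  0.\<close>

lemma oriented_normal_unique:
 assumes g: "lor_frame a p x b" "lor_frame a p x' b" and c: "fr a p x' b \<in> or_class (fr a p x b)"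
 shows "x' = x"
proof -
 let ?f = "fr a p x b" and ?h = "fr (- b) p x (- a)"
 obtain A :: "real ^ 4 ^ 4" where A: "det A > 0" "\<And>i. fr a p x' b $ i = (\<Sum>j\<in>UNIV. A $ i $ j *\<^sub>R ?f $ j)"
  using c by (auto simp: or_class_def same_orientation_def)
 note dual = lor_frame_dual[OF g(1)]
 have Aij: "A $ i $ j = lor (fr a p x' b $ i) (?h $ j)" for i j
  unfolding A(2) by (simp add: bounded_bilinear.sum_left[OF bounded_bilinear_lor] lor_simps dual if_distrib cong: if_cong)
 have rows: "A $ 1 $ j = (if j = 1 then 1 else 0)" "A $ 2 $ j = (if j = 2 then 1 else 0)" "A $ 4 $ j = (if j = 4 then 1 else 0)" for j
  using dual[of 1 j] dual[of 2 j] dual[of 4 j] by (simp_all add: Aij)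
 have "\<forall>j. j \<noteq> 3 \<longrightarrow> A $ 3 $ j = 0"
  unfolding forall_4 Aij using g(2) by (simp add: lor_simps lor_frame_def)
 hence r3: "A $ 3 $ j = (if j = 3 then A $ 3 $ 3 else 0)" for j by simp
 have "x' = fr a p x' b $ 3" by simp
 also have "\<dots> = A $ 3 $ 3 *\<^sub>R x" unfolding A(2) sum_4 by (subst (1 2 3 4) r3) simp
 finally have x'x: "x' = A $ 3 $ 3 *\<^sub>R x" .
 have "\<forall>i j. i \<noteq> j \<longrightarrow> A $ i $ j = 0" unfolding forall_4[where P="\<lambda>i. \<forall>j. i \<noteq> j \<longrightarrow> A $ i $ j = 0"] using rows r3 by auto
 hence "det A = (\<Prod>i\<in>UNIV. A $ i $ i)" by (intro det_diagonal) blast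
 also have "\<dots> = A $ 3 $ 3" unfolding UNIV_4 by (simp add: rows)
 finally have "A $ 3 $ 3 > 0" using A(1) by simp
 moreover have "A $ 3 $ 3 * A $ 3 $ 3 = 1" using g unfolding x'x by (simp add: lor_simps lor_frame_def)
 ultimately have "A $ 3 $ 3 = 1" by (metis square_eq_1_iff neg_0_less_iff_less not_less_iff_gr_or_eq zero_less_one)
 thus ?thesis using x'x by simp
qed

section \<open>Recovering the frame from its values on the axis\<close>

context dual_surface
begin

definition Pu :: "complex => 'n mink" where "Pu z = pd L 1 z + Re (m z) *\<^sub>R L z"
definition Pv :: "complex => 'n mink" where "Pv z = pd L \<i> z - Im (m z) *\<^sub>R L z"

lemma cf_Pu: "z \<in> S ==> cf Pu a z = sw.P a z + cnj (sw.P a z)"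
 and cf_Pv: "z \<in> S ==> cf Pv a z = \<i> * (sw.P a z - cnj (sw.P a z))"
proof -
 assume z: "z \<in> S"
 have 1: "cf Pu a z = cf (pd L 1) a z + of_real (Re (m z)) * cf L a z" "cf Pv a z = cf (pd L \<i>) a z - of_real (Im (m z)) * cf L a z"
  by (simp_all add: cf_def Pu_def Pv_def)
 have e: "of_real (Re (m z)) = (m z + cnj (m z)) / 2" "of_real (Im (m z)) = \<i> * (cnj (m z) - m z) / 2"
  by (simp_all add: complex_eq_iff)
 show "cf Pu a z = sw.P a z + cnj (sw.P a z)" "cf Pv a z = \<i> * (sw.P a z - cnj (sw.P a z))"
  unfolding 1 sw.bP[OF z] cf1[OF z] unfolding sw.P_def e by (simp_all add: field_simps)
qed

lemma P_uv: "z \<in> S ==> sw.P a z = (cf Pu a z - \<i> * cf Pv a z) / 2"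
 by (simp add: cf_Pu cf_Pv)

lemma dual_lift_uv: "dual_lift y m z = frameN y z + Re (m z) *\<^sub>R pd L 1 z + (- Im (m z)) *\<^sub>R pd L \<i> z + ((cmod (m z))^2 / 2) *\<^sub>R L z"
 by (simp add: dual_lift_def Yu_eq Yv_eq)

text \<open>The adapted frame arises from (Y, Y_u, Y_v, N) by a unipotent change, which keeps the
  orientation.\<close>

lemma gauss_map_eq: "conformal_gauss_map y z = or_class (vector [L z, Pu z, Pv z, dual_lift y m z])"
 unfolding conformal_gauss_map_def Yu_eq Yv_eq dual_lift_uv Pu_def Pv_def
 using or_class_eqI[OF same_orientation_unipotent[of "L z" "pd L 1 z" "pd L \<i> z" "frameN y z" "Re (m z)" "- Im (m z)" "Re (m z)" "- Im (m z)" "(cmod (m z))^2 / 2"]]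
 by simp

lemma dual_frame: assumes z: "z \<in> S"
 shows "lor_frame (L z) (Pu z) (Pv z) (dual_lift y m z)"
 unfolding lor_frame_def dual_lift_uv Pu_def Pv_def cmod_power2
 by (simp add: gram[OF z] lor_commute[of "L z" "frameN y z"] lor_commute[of "pd L _ z" "frameN y z"] lor_commute[of "pd L _ z" "L z"] lor_commute[of "pd L \<i> z" "pd L 1 z"]
  lor_simps power2_eq_square)

text \<open>Only a derivative along the axis occurs on the right, so Re mu is known there once both
  lifts are.\<close>

lemma Re_m: "z \<in> S ==> Re (m z) = lor (pd L 1 z) (dual_lift y m z)"
 unfolding lor_commute[of "pd L 1 z"] using dual_frame[of z] by (auto simp: lor_frame_def Pu_def lor_simps lor_commute[of "dual_lift y m z" "L z"])

lemma gauss_map_frame: "z \<in> S ==> fr (L z) (Pu z) (Pv z) (dual_lift y m z) \<in> conformal_gauss_map y z"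
 using is_frame_fr[OF dual_frame] unfolding gauss_map_eq by (simp add: or_class_def same_orientation_refl)

text \<open>With theta = 0 the derivative of P along the axis contains no derivative of mu. Its
  products with cnj P and Yh isolate Im mu and rho, after which the first equation determines
  kappa.\<close>

lemma P_u: assumes z: "z \<in> S" "sw.th z = 0"
 shows "pd (sw.P a) 1 z = \<i> * of_real (Im (m z)) * sw.P a z + lift.K a z + sw.Yh a z / 2 + cnj (sw.r z) / 2 * cf L a z"
  and "ip (\<lambda>a. pd (sw.P a) 1) (bar sw.P) z = \<i> * of_real (Im (m z)) / 2" (is ?g1) "ip (\<lambda>a. pd (sw.P a) 1) sw.Yh z = - cnj (sw.r z) / 2" (is ?g2)
proof -
 have i: "\<i> * complex_of_real (Im w) = (w - cnj w) / 2" for w by (simp add: complex_eq_iff)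
 show 1: "pd (sw.P a) 1 z = \<i> * of_real (Im (m z)) * sw.P a z + lift.K a z + sw.Yh a z / 2 + cnj (sw.r z) / 2 * cf L a z" for a
  unfolding pd_1_dz i sw.Pz_eq[OF z(1)] sw.Pb_eq[OF z(1)] z(2) by (simp add: field_simps)
 have 2: "ip (\<lambda>a. pd (sw.P a) 1) f z = \<i> * of_real (Im (m z)) * ip sw.P f z + ip lift.K f z + ip sw.Yh f z / 2 + cnj (sw.r z) / 2 * ip (cf L) f z" for f
  unfolding ip_def 1 by (simp add: sum.distrib sum_distrib_left algebra_simps)
 have "ip (cf L) (bar sw.P) z = 0" "ip sw.Yh (bar sw.P) z = 0"
  using sw.gP[OF z(1)] cnj_ip[of sw.P "cf L" z] cnj_ip[of sw.Yh sw.P z] ip_cong[of "bar sw.Yh" z sw.Yh "bar sw.P" "bar sw.P"] sw.Yh_real[OF z(1)]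
  by (simp_all add: ip_commute[of "cf L"] bar_def[of sw.Yh])
 thus ?g1 ?g2
  unfolding 2 using sw.gP[OF z(1)] by (simp_all add: ip_commute[of "cf L" sw.Yh] ip_commute[of lift.K] ip_commute[of sw.P sw.Yh])
qed

end

text \<open>Congruence modulo W in the sense of \<open>lbd\<close>. It is compatible with sums and
  products, hence with polynomials, and so gives a Lipschitz estimate for polynomial right
  sides.\<close>

definition dep :: "complex set => (complex => complex) set => (complex => complex) => (complex => complex) => bool" where
 "dep U W f g \<longleftrightarrow> continuous_on U f \<and> continuous_on U g \<and> lbd U W (\<lambda>z. f z - g z)"

lemma dep_add: "dep U W f g ==> dep U W f' g' ==> dep U W (\<lambda>z. f z + f' z) (\<lambda>z. g z + g' z)"
 and dep_mult: "dep U W f g ==> dep U W f' g' ==> dep U W (\<lambda>z. f z * f' z) (\<lambda>z. g z * g' z)"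
proof -
 assume a: "dep U W f g" "dep U W f' g'"
 note c = a[unfolded dep_def]
 have 1: "lbd U W (\<lambda>z. (f z + f' z) - (g z + g' z))"
  by (rule lbd_cong[OF lbd_add[of U W "\<lambda>z. f z - g z" "\<lambda>z. f' z - g' z"]]) (use c in auto)
 have 2: "lbd U W (\<lambda>z. f z * f' z - g z * g' z)"
  by (rule lbd_cong[OF lbd_add[OF lbd_mult_left[of U W "\<lambda>z. f' z - g' z" f] lbd_mult_left[of U W "\<lambda>z. f z - g z" g']]]) (use c in \<open>auto simp: algebra_simps\<close>)
 show "dep U W (\<lambda>z. f z + f' z) (\<lambda>z. g z + g' z)" "dep U W (\<lambda>z. f z * f' z) (\<lambda>z. g z * g' z)"
  using c 1 2 by (auto simp: dep_def intro!: continuous_intros)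
qed

lemma dep_cnj: "dep U W f g ==> dep U W (\<lambda>z. cnj (f z)) (\<lambda>z. cnj (g z))"
 using lbd_cnj[of U W "\<lambda>z. f z - g z"] by (auto simp: dep_def)

lemma dep_const: "dep U W (\<lambda>_. c) (\<lambda>_. c)"
 by (simp add: dep_def lbd_0)

lemma poly2_dep:
 "poly2 g ==> (\<And>i. dep U W (a i) (a' i)) ==> (\<And>i. dep U W (b i) (b' i)) ==> dep U W (\<lambda>z. g (\<lambda>i. a i z) (\<lambda>i. b i z)) (\<lambda>z. g (\<lambda>i. a' i z) (\<lambda>i. b' i z))"
 by (induction rule: poly2.induct) (auto intro: dep_add dep_mult dep_const)

text \<open>W consists of the component differences; by \<open>poly2_dep\<close> their dzb is
  bounded by W, and they vanish on the axis.\<close>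

lemma dbar_system_unique:
 fixes G :: "'i::finite => ('i => complex) => ('i => complex) => complex"
 assumes G: "\<And>i. poly2 (G i)" and U: "open U" "connected U" "of_real x0 \<in> U"
  and f: "\<And>i. smooth_on U (f i)" "\<And>i z. z \<in> U ==> dzb (f i) z = G i (\<lambda>j. f j z) (\<lambda>j. cnj (f j z))"
  and g: "\<And>i. smooth_on U (g i)" "\<And>i z. z \<in> U ==> dzb (g i) z = G i (\<lambda>j. g j z) (\<lambda>j. cnj (g j z))"
  and 0: "\<And>i x. of_real x \<in> U ==> f i (of_real x) = g i (of_real x)" and z: "z \<in> U"
 shows "f i z = g i z"
proof -
 define W where "W = range (\<lambda>i z. f i z - g i z)"
 have W: "finite W" by (simp add: W_def)
 have smW: "smooth_on U w" if "w \<in> W" for w using that by (auto simp: W_def intro!: smooth_on_diff U(1) f(1) g(1))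
 have d: "dep U W (f i) (g i)" for i
  using lbd_base[OF W] smooth_on_continuous[OF f(1)] smooth_on_continuous[OF g(1)] by (auto simp: dep_def W_def)
 have "lbd U W (dzb (\<lambda>z. f i z - g i z))" for i
 proof -
  have "dep U W (\<lambda>z. G i (\<lambda>j. f j z) (\<lambda>j. cnj (f j z))) (\<lambda>z. G i (\<lambda>j. g j z) (\<lambda>j. cnj (g j z)))"
   by (intro poly2_dep[OF G] d dep_cnj)
  hence "lbd U W (\<lambda>z. G i (\<lambda>j. f j z) (\<lambda>j. cnj (f j z)) - G i (\<lambda>j. g j z) (\<lambda>j. cnj (g j z)))" by (simp add: dep_def)
  thus ?thesis by (rule lbd_cong) (simp add: dzb_diff[OF U(1) _ f(1) g(1)] f(2) g(2))
 qed
 hence bd: "lbd U W (dzb w)" if "w \<in> W" for w using that by (auto simp: W_def)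
 have zero: "w (of_real x) = 0" if "w \<in> W" "of_real x \<in> U" for w x using that 0 by (auto simp: W_def)
 have m: "(\<lambda>z. f i z - g i z) \<in> W" by (auto simp: W_def)
 have "f i z - g i z = 0"
  by (rule unique_continuation_line[where w="\<lambda>z. f i z - g i z" and W=W, OF W U(1,2) _ _ U(3)]) (auto intro: smW bd zero m z)
 thus ?thesis by simp
qed

section \<open>The closed system for Y, Yh, P, kappa, mu and rho\<close>

type_synonym 'n idx = "(bool \<times> bool \<times> 'n option) + bool"

text \<open>The unknowns of the system, in this order: the components of \<open>Y\<close>, \<open>Yh\<close>, \<open>P\<close>, \<open>K\<close>, then \<open>m\<close> and \<open>r\<close>.\<close>
abbreviation "iY a \<equiv> Inl (False, False, a)"
abbreviation "iYh a \<equiv> Inl (False, True, a)"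
abbreviation "iP a \<equiv> Inl (True, False, a)"
abbreviation "iK a \<equiv> Inl (True, True, a)"
abbreviation "im \<equiv> Inr False"
abbreviation "ir \<equiv> Inr True"

definition state :: "('n option => 'a) => ('n option => 'a) => ('n option => 'a) => ('n option => 'a) => 'a => 'a => 'n idx => 'a" where
 "state Y Yh P K m r i = (case i of Inl (b, c, a) => if b then (if c then K a else P a) else (if c then Yh a else Y a) | Inr b => if b then r else m)"

definition kk :: "('n::finite idx => complex) => ('n idx => complex) => complex" where
 "kk w v = (\<Sum>a\<in>UNIV. sg a * w (iK a) * v (iK a))"

text \<open>The dzb structure equations with theta = 0, where v holds the conjugates of w and
  \<open>kk w v\<close> stands for q. Reality of Y and Yh is not built in; it is recovered later
  from the axis.\<close>

fun Gsys :: "'n::finite idx => ('n idx => complex) => ('n idx => complex) => complex" where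
 "Gsys (Inl (False, False, a)) w v = (- 1/2) * v im * w (iY a) + v (iP a)"
| "Gsys (Inl (False, True, a)) w v = (1/2) * v im * w (iYh a) + v ir * v (iP a)"
| "Gsys (Inl (True, False, a)) w v = (- 1/2) * v im * w (iP a) + (1/2) * w (iYh a) + (1/2) * v ir * w (iY a)"
| "Gsys (Inl (True, True, a)) w v = (- 1/2) * v im * w (iK a) + (- 2) * kk w v * w (iP a)"
| "Gsys (Inr False) w v = v ir + 2 * kk w v"
| "Gsys (Inr True) w v = v im * w ir"

lemma poly2_Gsys: "poly2 (Gsys i)"
proof -
 have k: "poly2 kk" unfolding kk_def[abs_def] by (intro poly2_sum poly2_mult poly2_const poly2_fst poly2_snd)
 note p = poly2_add poly2_mult poly2_const poly2_fst poly2_snd k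
 have "poly2 (\<lambda>w v. Gsys i w v)"
 proof (cases i)
  case (Inl x)
  obtain b c a where x: "x = (b, c, a)" by (cases x)
  show ?thesis unfolding Inl x by (cases b; cases c) (simp only: Gsys.simps; intro p)+
 next
  case (Inr b)
  show ?thesis unfolding Inr by (cases b) (simp only: Gsys.simps; intro p)+
 qed
 thus ?thesis .
qed

context dual_surface
begin

definition sys :: "'n idx => complex => complex" where "sys = state (cf L) sw.Yh sw.P lift.K m sw.r"

lemma smooth_on_sys: "smooth_on S (sys i)"
 unfolding sys_def state_def using lift.smo sw.smP sw.smYh sw.smm sw.smr by (auto split: sum.split)

lemma dzb_sys:
 assumes U: "open U" "U \<subseteq> S" and th: "\<And>z. z \<in> U ==> sw.th z = 0" and z: "z \<in> U"
 shows "dzb (sys i) z = Gsys i (\<lambda>j. sys j z) (\<lambda>j. cnj (sys j z))"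
proof -
 have zS: "z \<in> S" using U z by auto
 have kk: "kk (\<lambda>j. sys j z) (\<lambda>j. cnj (sys j z)) = lift.q z"
  unfolding lift.qK[OF zS] by (simp add: kk_def sys_def state_def ip_def bar_def)
 have "dzb sw.th z = 0" by (rule dzb_eq0[OF U(1) th z])
 hence r: "dzb sw.r z = cnj (m z) * sw.r z"
  using arg_cong[OF sw.r_b[OF zS], of cnj] by simp
 have m: "dzb m z = cnj (sw.r z) + 2 * lift.q z" using lift.q_real[OF zS] by (simp add: sw.r_def)
 have Y: "dzb (cf L a) z = cnj (sw.P a z) - cnj (m z) / 2 * cf L a z" for a by (simp add: sw.bP[OF zS] dzbf_def)
 \<comment> \<open>The dummy functions only complete the argument of the case rule; the split
   concerns the index i.\<close>
 show ?thesis
  by (rule Gsys.cases[of "(i, \<lambda>_. 0, \<lambda>_. 0)"]) (simp_all add: kk, simp_all add: sys_def state_def Y sw.Yh_b[OF zS] sw.Pb_eq[OF zS] sw.Kb_eq[OF zS] th[OF z] m r)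
qed

end

text \<open>Only the lifts and the Gauss map agree on the axis by assumption. They yield, in turn,
  Y_u, Re mu, Pu, then Pv by orientation, thus P, and through \<open>P_u\<close> also Im mu, rho and
  kappa; then the two states solve the same Cauchy problem.\<close>

lemma dual_surfaces_agree:
 fixes y1 y2 :: "complex => 'n::finite mink"
 assumes D: "dual_surface S1 y1 m1" "dual_surface S2 y2 m2"
  and U: "open U" "connected U" "U \<subseteq> S1" "U \<subseteq> S2"
  and I: "complex_of_real x0 \<in> U"
  and L: "\<And>x. of_real x \<in> U ==> canon_lift y1 (of_real x) = canon_lift y2 (of_real x)"
  and dl: "\<And>x. of_real x \<in> U ==> dual_lift y1 m1 (of_real x) = dual_lift y2 m2 (of_real x)"
  and gm: "\<And>x. of_real x \<in> U ==> conformal_gauss_map y1 (of_real x) = conformal_gauss_map y2 (of_real x)"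
  and th: "\<And>z. z \<in> U ==> swillmore_lift.th (cf (canon_lift y1)) m1 z = 0" "\<And>z. z \<in> U ==> swillmore_lift.th (cf (canon_lift y2)) m2 z = 0"
  and z: "z \<in> U"
 shows "canon_lift y1 z = canon_lift y2 z" (is ?g1) "dual_lift y1 m1 z = dual_lift y2 m2 z" (is ?g2)
proof -
 interpret A: dual_surface S1 y1 m1 by fact
 interpret B: dual_surface S2 y2 m2 by fact
 have inS: "w \<in> S1" "w \<in> S2" if "w \<in> U" for w using that U by auto
 have sU: "smooth_on U (A.sys i)" "smooth_on U (B.sys i)" for i
  using A.smooth_on_sys B.smooth_on_sys U(3,4) by (blast intro: smooth_on_subset)+
 have real: "pd (A.sys i) 1 (of_real x) = pd (B.sys i) 1 (of_real x)"
  if e: "\<And>x. complex_of_real x \<in> U ==> A.sys i (of_real x) = B.sys i (of_real x)" and x: "of_real x \<in> U" for i x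
  using pd_1_real_axis[OF U(1) smooth_on_diff[OF U(1) sU] _ x, of i i] pd_diff[OF smooth_on_differentiable[OF sU(1)] smooth_on_differentiable[OF sU(2)] U(1) x, of i i] e
  by simp
 have ini: "A.sys (iY a) (of_real x) = B.sys (iY a) (of_real x) \<and> A.sys (iYh a) (of_real x) = B.sys (iYh a) (of_real x) \<and>
   A.sys (iP a) (of_real x) = B.sys (iP a) (of_real x) \<and> Re (m1 (of_real x)) = Re (m2 (of_real x))" if x: "of_real x \<in> U" for a x
 proof -
  let ?x = "complex_of_real x"
  note xS = inS[OF x]
  have "cf (pd A.L 1) a ?x = cf (pd B.L 1) a ?x" for a
   using real[of "iY a" x] L x unfolding A.cf1[OF xS(1)] B.cf1[OF xS(2)] by (simp add: A.sys_def B.sys_def state_def pd_1_dz dzf_def dzbf_def cf_def)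
  hence p1: "pd A.L 1 ?x = pd B.L 1 ?x" by (intro mink_eqI) (simp add: cf_def)
  hence m: "Re (m1 ?x) = Re (m2 ?x)" by (simp add: A.Re_m[OF xS(1)] B.Re_m[OF xS(2)] dl[OF x])
  hence Pu: "A.Pu ?x = B.Pu ?x" by (simp add: A.Pu_def B.Pu_def p1 L[OF x])
  have "A.Pv ?x = B.Pv ?x"
   by (rule oriented_normal_unique[OF B.dual_frame[OF xS(2)]])
    (use A.dual_frame[OF xS(1)] A.gauss_map_frame[OF xS(1)] gm[OF x] L[OF x] dl[OF x] Pu in \<open>simp_all add: B.gauss_map_eq\<close>)
  hence "A.sw.P a ?x = B.sw.P a ?x"
   unfolding A.P_uv[OF xS(1)] B.P_uv[OF xS(2)] using Pu by (simp add: cf_def)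
  thus ?thesis
   using L[OF x] dl[OF x] A.cf_dual[OF xS(1), of a] B.cf_dual[OF xS(2), of a] m by (simp add: A.sys_def B.sys_def state_def cf_def)
 qed
 note [simp] = A.sys_def B.sys_def state_def
 have ini2: "m1 (of_real x) = m2 (of_real x) \<and> A.sw.r (of_real x) = B.sw.r (of_real x) \<and> A.lift.K a (of_real x) = B.lift.K a (of_real x)" if x: "of_real x \<in> U" for a x
 proof -
  let ?x = "complex_of_real x"
  note xS = inS[OF x] and i = ini[OF x, simplified]
  have d: "pd (A.sw.P a) 1 ?x = pd (B.sw.P a) 1 ?x" for a using real[of "iP a", OF _ x] ini by simp
  have e: "ip (\<lambda>a. pd (A.sw.P a) 1) (bar A.sw.P) ?x = ip (\<lambda>a. pd (B.sw.P a) 1) (bar B.sw.P) ?x" "ip (\<lambda>a. pd (A.sw.P a) 1) A.sw.Yh ?x = ip (\<lambda>a. pd (B.sw.P a) 1) B.sw.Yh ?x"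
   by (rule ip_cong; use i d in \<open>simp add: bar_def\<close>)+
  note PA = A.P_u[OF xS(1) th(1)[OF x]] and PB = B.P_u[OF xS(2) th(2)[OF x]]
  have im: "Im (m1 ?x) = Im (m2 ?x)" and r: "A.sw.r ?x = B.sw.r ?x"
   using e unfolding PA(2,3) PB(2,3) by simp_all
  have "A.lift.K a ?x = B.lift.K a ?x" using d[of a] i unfolding PA(1) PB(1) im r by simp
  thus ?thesis using im r i by (simp add: complex_eq_iff)
 qed
 have fin: "A.sys i z = B.sys i z" for i
 proof (rule dbar_system_unique[OF poly2_Gsys U(1,2) I sU(1) A.dzb_sys[OF U(1,3) th(1)] sU(2) B.dzb_sys[OF U(1,4) th(2)] _ z])
  show "A.sys i (of_real x) = B.sys i (of_real x)" if "of_real x \<in> U" for i x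
   using ini[OF that] ini2[OF that] by (auto split: sum.split)
 qed
 show ?g1 by (rule mink_eqI) (use fin[of "iY _"] in \<open>simp add: cf_def\<close>)
 have "complex_of_real (mc (dual_lift y1 m1 z) a) = of_real (mc (dual_lift y2 m2 z) a)" for a
  using fin[of "iYh a"] A.cf_dual[OF inS(1)[OF z], of a] B.cf_dual[OF inS(2)[OF z], of a] by (simp add: cf_def)
 thus ?g2 by (intro mink_eqI) (simp only: of_real_eq_iff)
qed

section \<open>Existence\<close>

text \<open>Products of the adapted frame. Those with cnj P that are missing here follow by
  conjugation once Y and Yh are real.\<close>

definition gram_rel :: "('n::finite option => 'b => complex) => ('n option => 'b => complex) => ('n option => 'b => complex) => ('n option => 'b => complex) => 'b => bool" where
 "gram_rel Y Yh P K z \<longleftrightarrow> ip Y Y z = 0 \<and> ip Y P z = 0 \<and> ip P P z = 0 \<and> ip P (bar P) z = 1/2 \<and> ip K (bar P) z = 0 \<and> ip K P z = 0 \<and>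
   ip K Y z = 0 \<and> ip K Yh z = 0 \<and> ip P Yh z = 0 \<and> ip Yh Yh z = 0 \<and> ip Y Yh z = -1"

text \<open>A solution of the dbar half alone: F need not be real where it should be, nor satisfy
  any dz equation.\<close>

locale dbar_state =
 fixes S :: "complex set" and F :: "'n::finite idx => complex => complex"
 assumes S: "open S" and smF: "\<And>i. smooth_on S (F i)"
  and sysF: "\<And>i z. z \<in> S ==> dzb (F i) z = Gsys i (\<lambda>j. F j z) (\<lambda>j. cnj (F j z))"
begin

abbreviation "Y \<equiv> \<lambda>a. F (iY a)"
abbreviation "Yh \<equiv> \<lambda>a. F (iYh a)"
abbreviation "P \<equiv> \<lambda>a. F (iP a)"
abbreviation "K \<equiv> \<lambda>a. F (iK a)"
abbreviation "m \<equiv> F im"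
abbreviation "r \<equiv> F ir"

lemma sm: "smf S Y" "smf S Yh" "smf S P" "smf S K" "smooth_on S m" "smooth_on S r"
 by (simp_all add: smf_def smF)

definition k :: "complex => complex" where "k z = ip K (bar K) z"

lemma eqs: assumes "z \<in> S"
 shows "dzb (Y a) z = - cnj (m z) / 2 * Y a z + cnj (P a z)" (is ?g1)
  "dzb (Yh a) z = cnj (m z) / 2 * Yh a z + cnj (r z) * cnj (P a z)" (is ?g2)
  "dzb (P a) z = - cnj (m z) / 2 * P a z + Yh a z / 2 + cnj (r z) / 2 * Y a z" (is ?g3)
  "dzb (K a) z = - cnj (m z) / 2 * K a z - 2 * k z * P a z" (is ?g4)
  "dzb m z = cnj (r z) + 2 * k z" (is ?g5)
  "dzb r z = cnj (m z) * r z" (is ?g6)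
proof -
 have "kk (\<lambda>j. F j z) (\<lambda>j. cnj (F j z)) = k z" by (simp add: kk_def k_def ip_def bar_def)
 note [simp] = sysF[OF assms] this
 show ?g1
  ?g2
  ?g3
  ?g4
  ?g5
  ?g6 by simp_all
qed

lemmas wirt = wirtinger[OF S]

lemmas smo = smooth_ops[OF S] smooth_on_const smF

lemma k_real: "cnj (k z) = k z"
 using cnj_ip[of K "bar K" z] by (simp add: k_def ip_commute)

lemma smk: "smooth_on S k"
 unfolding k_def[abs_def] by (intro smooth_on_ip S sm smf_bar)

end

section \<open>Propagation of the remaining equations off the axis\<close>

locale willmore_system = dbar_state S F for S and F :: "'n::finite idx => complex => complex" +
 fixes x0 :: real
 assumes conn: "connected S" "of_real x0 \<in> S"
  and real0: "\<And>z a. z \<in> S \<inter> \<real> ==> cnj (Y a z) = Y a z \<and> cnj (Yh a z) = Yh a z"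
  and d0: "\<And>z a. z \<in> S \<inter> \<real> ==> pd (Y a) 1 z = P a z + cnj (P a z) - of_real (Re (m z)) * Y a z"
   "\<And>z a. z \<in> S \<inter> \<real> ==> pd (Yh a) 1 z = of_real (Re (m z)) * Yh a z + r z * P a z + cnj (r z * P a z)"
   "\<And>z a. z \<in> S \<inter> \<real> ==> pd (P a) 1 z = \<i> * of_real (Im (m z)) * P a z + K a z + Yh a z / 2 + cnj (r z) / 2 * Y a z"
  and g0: "\<And>z. z \<in> S \<inter> \<real> ==> gram_rel Y Yh P K z"
begin

lemma im2: "\<i> * complex_of_real (Im w) = (w - cnj w) / 2" and re2: "complex_of_real (Re w) = (w + cnj w) / 2"
 by (simp_all add: complex_eq_iff)

lemma cst: "continuous_on S f" if "smooth_on S f" for f :: "complex => complex" using smooth_on_continuous[OF that] .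

lemmas cont = cst[OF smooth_on_cnj[OF S sm(5)]] cst[OF sm(6)] cst[OF smooth_on_cnj[OF S sm(6)]] cst[OF sm(5)] cst[OF smk]

text \<open>The d measure the failure of Y and Yh to be real, the e the failure of the dz equations
  of Y, Yh and P with theta = 0.\<close>

definition d1 where "d1 a z = Y a z - cnj (Y a z)"
definition d2 where "d2 a z = Yh a z - cnj (Yh a z)"
definition e1 where "e1 a z = dz (Y a) z + m z / 2 * Y a z - P a z"
definition e2 where "e2 a z = dz (Yh a) z - m z / 2 * Yh a z - r z * P a z"
definition e3 where "e3 a z = dz (P a) z - m z / 2 * P a z - K a z"

text \<open>Commuting dz with dzb and inserting the dbar equations, all inhomogeneous terms cancel:
  the defects satisfy a linear homogeneous system, which is the integrability of the structure
  equations.\<close>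

lemma defects_b: assumes z: "z \<in> S"
 shows "dzb (d1 a) z = - cnj (m z) / 2 * d1 a z - cnj (e1 a z)" (is ?A)
  "dzb (d2 a) z = cnj (m z) / 2 * d2 a z - cnj (e2 a z)" (is ?B)
  "dzb (e1 a) z = - cnj (m z) / 2 * e1 a z - r z / 2 * d1 a z - d2 a z / 2" (is ?C)
  "dzb (e2 a) z = cnj (m z) / 2 * e2 a z - cnj (r z) / 2 * d2 a z - r z * cnj (r z) / 2 * d1 a z" (is ?D)
  "dzb (e3 a) z = - cnj (m z) / 2 * e3 a z + e2 a z / 2 + cnj (r z) / 2 * e1 a z" (is ?E)
proof -
 note eqs' = eqs and eqs = eqs[OF z]
 have Yz: "dz (Y a) z = e1 a z - m z / 2 * Y a z + P a z" and Yhz: "dz (Yh a) z = e2 a z + m z / 2 * Yh a z + r z * P a z"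
  and Pz: "dz (P a) z = e3 a z + m z / 2 * P a z + K a z" by (simp_all add: e1_def e2_def e3_def)
 have cm: "cnj (dzb m z) = r z + 2 * k z" "dzb m z = cnj (r z) + 2 * k z" "cnj (dzb r z) = m z * cnj (r z)"
  unfolding eqs using k_real[of z] by simp_all
 have D1: "dzb (d1 a) z = dzb (Y a) z - cnj (dz (Y a) z)" unfolding d1_def[abs_def] using z by (simp add: wirt smo)
 show ?A
  unfolding D1 eqs Yz by (simp add: d1_def field_simps)
 have D2: "dzb (d2 a) z = dzb (Yh a) z - cnj (dz (Yh a) z)" unfolding d2_def[abs_def] using z by (simp add: wirt smo)
 show ?B
  unfolding D2 eqs Yhz by (simp add: d2_def field_simps)
 have Yzb: "dzb (dz (Y a)) z = - (cnj (m z) / 2 * dz (Y a) z) - cnj (dzb m z) / 2 * Y a z + cnj (dzb (P a) z)"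
 proof -
  have "dzb (dz (Y a)) z = dz (\<lambda>z. - cnj (m z) / 2 * Y a z + cnj (P a z)) z"
   unfolding dz_dzb_commute[OF S z smF, symmetric] by (rule dz_cong[OF S z eqs'(1)])
  thus ?thesis using z by (simp add: wirt smo add_divide_distrib)
 qed
 have E1: "dzb (e1 a) z = dzb (dz (Y a)) z + (m z / 2 * dzb (Y a) z + dzb m z / 2 * Y a z) - dzb (P a) z"
  unfolding e1_def[abs_def] using z by (simp add: wirt smo)
 show ?C
  unfolding E1 Yzb cm unfolding Yz eqs(1-3) d1_def d2_def by (simp add: k_real field_simps)
 have Yhzb: "dzb (dz (Yh a)) z = cnj (m z) / 2 * dz (Yh a) z + cnj (dzb m z) / 2 * Yh a z + cnj (r z) * cnj (dzb (P a) z) + cnj (dzb r z) * cnj (P a z)"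
 proof -
  have "dzb (dz (Yh a)) z = dz (\<lambda>z. cnj (m z) / 2 * Yh a z + cnj (r z) * cnj (P a z)) z"
   unfolding dz_dzb_commute[OF S z smF, symmetric] by (rule dz_cong[OF S z eqs'(2)])
  thus ?thesis using z by (simp add: wirt smo)
 qed
 have E2: "dzb (e2 a) z = dzb (dz (Yh a)) z - (m z / 2 * dzb (Yh a) z + dzb m z / 2 * Yh a z) - (r z * dzb (P a) z + dzb r z * P a z)"
  unfolding e2_def[abs_def] using z by (simp add: wirt smo add_divide_distrib)
 show ?D
  unfolding E2 Yhzb cm unfolding Yhz eqs(1-3,6) d1_def d2_def by (simp add: k_real field_simps)
 have Pzb: "dzb (dz (P a)) z = - (cnj (m z) / 2 * dz (P a) z) - cnj (dzb m z) / 2 * P a z + dz (Yh a) z / 2 + (cnj (r z) / 2 * dz (Y a) z + cnj (dzb r z) / 2 * Y a z)"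
 proof -
  have "dzb (dz (P a)) z = dz (\<lambda>z. - cnj (m z) / 2 * P a z + Yh a z / 2 + cnj (r z) / 2 * Y a z) z"
   unfolding dz_dzb_commute[OF S z smF, symmetric] by (rule dz_cong[OF S z eqs'(3)])
  thus ?thesis using z by (simp add: wirt smo add_divide_distrib)
 qed
 have E3: "dzb (e3 a) z = dzb (dz (P a)) z - (m z / 2 * dzb (P a) z + dzb m z / 2 * P a z) - dzb (K a) z"
  unfolding e3_def[abs_def] using z by (simp add: wirt smo add_divide_distrib)
 show ?E
  unfolding E3 Pzb unfolding Yz Yhz Pz eqs(1-4) cm by (simp add: k_real field_simps)
qed

lemma defects_0: assumes z: "z \<in> S"
 shows "d1 a z = 0" "d2 a z = 0" "e1 a z = 0" "e2 a z = 0" "e3 a z = 0"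
proof -
 define W where "W = range d1 \<union> range d2 \<union> range e1 \<union> range e2 \<union> range e3"
 have finW: "finite W" by (simp add: W_def)
 have smW: "smooth_on S w" if "w \<in> W" for w
 proof -
  have "smooth_on S (d1 a)" "smooth_on S (d2 a)" "smooth_on S (e1 a)" "smooth_on S (e2 a)" "smooth_on S (e3 a)" for a
   unfolding d1_def[abs_def] d2_def[abs_def] e1_def[abs_def] e2_def[abs_def] e3_def[abs_def] by (intro smo)+
  thus ?thesis using that by (auto simp: W_def)
 qed
 have b: "lbd S W (d1 a)" "lbd S W (d2 a)" "lbd S W (e1 a)" "lbd S W (e2 a)" "lbd S W (e3 a)" for a
  by (rule lbd_base[OF finW]; simp add: W_def)+
 note c = cont continuous_on_divide[OF cont(1) continuous_on_const] continuous_on_divide[OF cont(2) continuous_on_const] continuous_on_divide[OF cont(3) continuous_on_const]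
 have bd: "lbd S W (dzb w)" if "w \<in> W" for w
 proof -
  note l = lbd_add lbd_diff lbd_mult_left lbd_cnj b
  have h: "lbd S W (\<lambda>z. d2 a z / 2)" "lbd S W (\<lambda>z. e2 a z / 2)" for a
   using lbd_cmult[OF b(2), of "1/2"] lbd_cmult[OF b(4), of "1/2"] by simp_all
  have "lbd S W (dzb (d1 a))" "lbd S W (dzb (d2 a))" "lbd S W (dzb (e1 a))" "lbd S W (dzb (e2 a))" "lbd S W (dzb (e3 a))" for a
   by (rule lbd_cong[OF _ defects_b(1)] lbd_cong[OF _ defects_b(2)] lbd_cong[OF _ defects_b(3)] lbd_cong[OF _ defects_b(4)] lbd_cong[OF _ defects_b(5)],
    (intro l h continuous_intros c; simp), assumption)+
  thus ?thesis using that by (auto simp: W_def)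
 qed
 \<comment> \<open>On the axis dz is the tangential derivative minus dzb; the former is prescribed
   by \<open>d0\<close>, the latter by the system.\<close>
 have zero: "w (of_real x) = 0" if w: "w \<in> W" and x: "of_real x \<in> S" for w x
 proof -
  have x': "of_real x \<in> S \<inter> \<real>" using x by simp
  note i = d0[OF x', unfolded pd_1_dz, THEN eq_diff_eq[THEN iffD2]] and e = eqs[OF x]
  have "d1 a (of_real x) = 0" "d2 a (of_real x) = 0" for a using real0[OF x'] by (simp_all add: d1_def d2_def)
  moreover have "e1 a (of_real x) = 0" "e2 a (of_real x) = 0" "e3 a (of_real x) = 0" for a
   unfolding e1_def e2_def e3_def i e re2 im2 by (simp_all add: field_simps)
  ultimately show ?thesis using w by (auto simp: W_def)
 qed
 have "w z = 0" if "w \<in> W" for w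
  by (rule unique_continuation_line[where w=w and W=W, OF finW S conn(1) _ _ conn(2)]) (auto intro: smW bd zero that z)
 thus "d1 a z = 0" "d2 a z = 0" "e1 a z = 0" "e2 a z = 0" "e3 a z = 0" by (simp_all add: W_def)
qed

lemma reals: assumes z: "z \<in> S" shows "cnj (Y a z) = Y a z" "cnj (Yh a z) = Yh a z"
 using defects_0(1,2)[OF z, of a] by (simp_all add: d1_def d2_def)

lemma Yz: assumes z: "z \<in> S" shows "dz (Y a) z = P a z - m z / 2 * Y a z"
 using defects_0(3)[OF z, of a] by (simp add: e1_def eq_diff_eq)

lemma Pz: assumes z: "z \<in> S" shows "dz (P a) z = m z / 2 * P a z + K a z"
 using defects_0(5)[OF z, of a] by (simp add: e3_def algebra_simps)

lemma bPb: assumes z: "z \<in> S" shows "dzb (bar P a) z = cnj (m z) / 2 * bar P a z + bar K a z"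
proof -
 have "dzb (bar P a) z = cnj (dz (P a) z)" unfolding bar_def using z by (simp add: wirt smo)
 thus ?thesis unfolding Pz[OF z] by (simp add: bar_def)
qed

lemma ipb: assumes z: "z \<in> S"
 shows "ip (dzbf Y) f z = - cnj (m z) / 2 * ip Y f z + ip (bar P) f z"
  "ip (dzbf Yh) f z = cnj (m z) / 2 * ip Yh f z + cnj (r z) * ip (bar P) f z"
  "ip (dzbf P) f z = - cnj (m z) / 2 * ip P f z + ip Yh f z / 2 + cnj (r z) / 2 * ip Y f z"
  "ip (dzbf K) f z = - cnj (m z) / 2 * ip K f z - 2 * k z * ip P f z"
  "ip (dzbf (bar P)) f z = cnj (m z) / 2 * ip (bar P) f z + ip (bar K) f z"
 unfolding ip_def dzbf_def eqs[OF z] bPb[OF z]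
 by (simp_all add: bar_def sum_distrib_left sum.distrib[symmetric] sum_divide_distrib algebra_simps)

lemma ip_real: assumes z: "z \<in> S" shows "ip (bar P) Y z = cnj (ip P Y z)" "ip (bar P) Yh z = cnj (ip P Yh z)" "ip (bar K) P z = cnj (ip K (bar P) z)"
 using reals[OF z] by (simp_all add: ip_def bar_def)

text \<open>Written in terms of the deviations from the required values, the right sides are linear
  homogeneous in these deviations and their conjugates, so that vanishing on the axis
  propagates.\<close>

lemma gram_b: assumes z: "z \<in> S"
 shows "dzb (ip Y Y) z = - cnj (m z) * ip Y Y z + 2 * cnj (ip Y P z)" (is ?A)
  "dzb (ip Y P) z = - cnj (m z) * ip Y P z + (ip P (bar P) z - 1/2) + (ip Y Yh z + 1) / 2 + cnj (r z) / 2 * ip Y Y z" (is ?B)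
  "dzb (ip P P) z = - cnj (m z) * ip P P z + ip P Yh z + cnj (r z) * ip Y P z" (is ?C)
  "dzb (ip P (bar P)) z = cnj (ip P Yh z) / 2 + cnj (r z) / 2 * cnj (ip Y P z) + cnj (ip K (bar P) z)" (is ?D)
  "dzb (ip K (bar P)) z = - 2 * k z * (ip P (bar P) z - 1/2)" (is ?E)
  "dzb (ip K P) z = - cnj (m z) * ip K P z - 2 * k z * ip P P z + ip K Yh z / 2 + cnj (r z) / 2 * ip K Y z" (is ?F)
  "dzb (ip K Y) z = - cnj (m z) * ip K Y z - 2 * k z * ip Y P z + ip K (bar P) z" (is ?G)
  "dzb (ip K Yh) z = - 2 * k z * ip P Yh z + cnj (r z) * ip K (bar P) z" (is ?H)
  "dzb (ip P Yh) z = ip Yh Yh z / 2 + cnj (r z) / 2 * (ip Y Yh z + 1) + cnj (r z) * (ip P (bar P) z - 1/2)" (is ?I)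
  "dzb (ip Yh Yh) z = cnj (m z) * ip Yh Yh z + 2 * cnj (r z) * cnj (ip P Yh z)" (is ?J)
  "dzb (ip Y Yh) z = cnj (ip P Yh z) + cnj (r z) * cnj (ip Y P z)" (is ?K)
proof -
 note d = dzb_ip[OF S _ _ z]
 note sm' = sm smf_bar[OF S sm(3)]
 have c: "ip P Y z = ip Y P z" "ip Yh P z = ip P Yh z" "ip Yh Y z = ip Y Yh z" "ip Y K z = ip K Y z" "ip P K z = ip K P z" "ip Yh K z = ip K Yh z" "ip (bar P) K z = ip K (bar P) z"
  "ip (bar P) P z = ip P (bar P) z" "ip (bar K) K z = k z" "ip Y (bar P) z = ip (bar P) Y z" "ip Yh (bar P) z = ip (bar P) Yh z"
  by (simp_all add: ip_commute k_def)
 have i: "ip g (dzbf f) z = ip (dzbf f) g z" for f g by (rule ip_commute)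
 show ?A
  unfolding d[OF sm'(1) sm'(1)] i ipb[OF z] ip_real[OF z] c by simp
 show ?B
  unfolding d[OF sm'(1) sm'(3)] i ipb[OF z] c by (simp add: field_simps)
 show ?C
  unfolding d[OF sm'(3) sm'(3)] i ipb[OF z] c by simp
 show ?D
  unfolding d[OF sm'(3) sm'(7)] i ipb[OF z] unfolding ip_real[OF z] c by simp
 show ?E
  unfolding d[OF sm'(4) sm'(7)] i ipb[OF z] c  by (simp add: field_simps)
 show ?F
  unfolding d[OF sm'(4) sm'(3)] i ipb[OF z] c by simp
 show ?G
  unfolding d[OF sm'(4) sm'(1)] i ipb[OF z] c by simp
 show ?H
  unfolding d[OF sm'(4) sm'(2)] i ipb[OF z] c by simp
 show ?I
  unfolding d[OF sm'(3) sm'(2)] i ipb[OF z] c by (simp add: field_simps)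
 show ?J
  unfolding d[OF sm'(2) sm'(2)] i ipb[OF z] ip_real[OF z] by simp
 show ?K
  unfolding d[OF sm'(1) sm'(2)] i ipb[OF z] unfolding ip_real[OF z] c by simp
qed

lemma gram: assumes z: "z \<in> S"
 shows "gram_rel Y Yh P K z"
proof -
 define n4 where "n4 z = ip P (bar P) z - 1/2" for z
 define n11 where "n11 z = ip Y Yh z + 1" for z
 define W where "W = {ip Y Y, ip Y P, ip P P, n4, ip K (bar P), ip K P, ip K Y, ip K Yh, ip P Yh, ip Yh Yh, n11}"
 have finW: "finite W" by (simp add: W_def)
 have s: "smooth_on S (ip P (bar P))" "smooth_on S (ip Y Yh)" by (intro smooth_on_ip S sm smf_bar)+
 have smW: "smooth_on S w" if "w \<in> W" for w
  using that unfolding W_def n4_def[abs_def] n11_def[abs_def]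
  by (auto intro!: smooth_on_ip S sm smf_bar smooth_on_add smooth_on_diff)
 have b: "lbd S W (ip Y Y)" "lbd S W (ip Y P)" "lbd S W (ip P P)" "lbd S W (\<lambda>z. ip P (bar P) z - 1/2)" "lbd S W (ip K (bar P))" "lbd S W (ip K P)"
  "lbd S W (ip K Y)" "lbd S W (ip K Yh)" "lbd S W (ip P Yh)" "lbd S W (ip Yh Yh)" "lbd S W (\<lambda>z. ip Y Yh z + 1)"
  by (rule lbd_base[OF finW]; simp add: W_def n4_def[abs_def] n11_def[abs_def])+
 have h: "lbd S W (\<lambda>z. (ip Y Yh z + 1) / 2)" "lbd S W (\<lambda>z. ip K Yh z / 2)" "lbd S W (\<lambda>z. ip Yh Yh z / 2)" "lbd S W (\<lambda>z. cnj (ip P Yh z) / 2)"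
  using lbd_cmult[OF b(11), of "1/2"] lbd_cmult[OF b(8), of "1/2"] lbd_cmult[OF b(10), of "1/2"] lbd_cmult[OF lbd_cnj[OF b(9)], of "1/2"] by simp_all
 note c = cont continuous_on_divide[OF cont(1) continuous_on_const] continuous_on_divide[OF cont(2) continuous_on_const] continuous_on_divide[OF cont(3) continuous_on_const]
 note l = lbd_add lbd_diff lbd_mult_left lbd_cnj lbd_uminus b h
 note t = continuous_on_mult continuous_on_minus continuous_on_const c
 have n: "dzb n4 z = dzb (ip P (bar P)) z" "dzb n11 z = dzb (ip Y Yh) z" if "z \<in> S" for z
  unfolding n4_def[abs_def] n11_def[abs_def] using that s by (simp_all add: wirt)
 have bd: "lbd S W (dzb w)" if "w \<in> W" for w
 proof -
  have "lbd S W (dzb (ip Y Y))" "lbd S W (dzb (ip Y P))" "lbd S W (dzb (ip P P))" "lbd S W (dzb n4)" "lbd S W (dzb (ip K (bar P)))" "lbd S W (dzb (ip K P))" "lbd S W (dzb (ip K Y))" "lbd S W (dzb (ip K Yh))" "lbd S W (dzb (ip P Yh))" "lbd S W (dzb (ip Yh Yh))" "lbd S W (dzb n11)"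
   by (rule lbd_cong[OF _ gram_b(1)] lbd_cong[OF _ gram_b(2)] lbd_cong[OF _ gram_b(3)] lbd_cong[OF _ gram_b(5)] lbd_cong[OF _ gram_b(6)] lbd_cong[OF _ gram_b(7)] lbd_cong[OF _ gram_b(8)] lbd_cong[OF _ gram_b(9)] lbd_cong[OF _ gram_b(10)]
    lbd_cong[OF _ trans[OF n(1) gram_b(4)]] lbd_cong[OF _ trans[OF n(2) gram_b(11)]], (intro l t; simp), assumption+)+
  thus ?thesis using that by (auto simp: W_def)
 qed
 have zero: "w (of_real x) = 0" if "w \<in> W" "of_real x \<in> S" for w x
  using that(1) g0[of "of_real x"] that(2) by (auto simp: gram_rel_def W_def n4_def n11_def)
 have "w z = 0" if "w \<in> W" for w
  by (rule unique_continuation_line[where w=w and W=W, OF finW S conn(1) _ _ conn(2)]) (auto intro: smW bd zero that z)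
 hence "\<forall>w\<in>W. w z = 0" by simp
 thus ?thesis
  unfolding W_def n4_def n11_def gram_rel_def by (simp add: eq_neg_iff_add_eq_0)
qed

end

section \<open>From a frame satisfying all equations to the surface\<close>

definition rv :: "'n::finite cfield => complex => 'n mink" where
 "rv f z = (Re (f None z), \<chi> i. Re (f (Some i) z))"

lemma mc_rv: "mc (rv f z) a = Re (f a z)"
 by (cases a) (simp_all add: rv_def mc_def)

lemma cf_rv: "cnj (f a z) = f a z ==> cf (rv f) a z = f a z"
 by (simp add: cf_def mc_rv complex_eq_iff)

lemma smooth_on_rv: assumes S: "open S" and f: "smf S f" shows "smooth_on S (rv f)"
proof -
 have "(\<chi> i. Re (f (Some i) z)) = (\<Sum>i\<in>UNIV. Re (f (Some i) z) *\<^sub>R axis i (1::real))" for z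
  by (simp add: vec_eq_iff axis_def if_distrib cong: if_cong)
 hence "rv f = (\<lambda>z. (Re (f None z), \<Sum>i\<in>UNIV. Re (f (Some i) z) *\<^sub>R axis i (1::real)))" by (simp add: rv_def fun_eq_iff)
 thus ?thesis by (simp only:) (intro smooth_intros S smf_D[OF f])
qed

text \<open>The full set of equations, without reference to the axis or to connectedness, so that it
  can be verified point by point on a union of balls.\<close>

locale willmore_frame = dbar_state S F for S and F :: "'n::finite idx => complex => complex" +
 assumes reals: "\<And>z a. z \<in> S ==> cnj (Y a z) = Y a z" "\<And>z a. z \<in> S ==> cnj (Yh a z) = Yh a z"
  and Yz: "\<And>z a. z \<in> S ==> dz (Y a) z = P a z - m z / 2 * Y a z"
  and Pz: "\<And>z a. z \<in> S ==> dz (P a) z = m z / 2 * P a z + K a z"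
  and gram_rel: "\<And>z. z \<in> S ==> gram_rel Y Yh P K z"
  and pos: "\<And>z. z \<in> S ==> Re (Y None z) > 0"
begin

definition y :: "complex => 'n mink" where "y z = (1 / fst (rv Y z)) *\<^sub>R rv Y z"

abbreviation "V \<equiv> rv Y"

lemma smV: "smooth_on S V" by (rule smooth_on_rv[OF S sm(1)])

lemma cfV: "z \<in> S ==> cf V a z = Y a z" by (simp add: cf_rv reals)

lemma fstV: "z \<in> S ==> fst (V z) > 0" using pos by (simp add: rv_def)

lemma cfpd: assumes z: "z \<in> S"
 shows "cf (pd V 1) a z = P a z + bar P a z - (m z + cnj (m z)) / 2 * Y a z" (is ?A) "cf (pd V \<i>) a z = \<i> * (P a z - bar P a z) + \<i> * (cnj (m z) - m z) / 2 * Y a z" (is ?B)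
proof -
 have e: "dzf (cf V) a z = dz (Y a) z" "dzbf (cf V) a z = dzb (Y a) z"
  unfolding dzf_def dzbf_def by (auto intro!: dz_cong[OF S z] dzb_cong[OF S z] cfV)
 show ?A ?B
  unfolding cf_pd_1[OF S smV z] cf_pd_ii[OF S smV z] e by (simp_all add: Yz[OF z] eqs[OF z] bar_def field_simps)
qed

lemma gram: assumes z: "z \<in> S"
 shows "ip Y Y z = 0" "ip Y P z = 0" "ip P P z = 0" "ip P (bar P) z = 1/2" (is ?g1) "ip K (bar P) z = 0" "ip K P z = 0" "ip K Y z = 0" "ip K Yh z = 0"
  "ip P Yh z = 0" "ip Yh Yh z = 0" "ip Y Yh z = -1" "ip P Y z = 0" "ip (bar P) P z = 1/2" (is ?g2) "ip Yh P z = 0" "ip Yh Y z = -1" "ip P K z = 0" "ip (bar P) K z = 0" "ip Y K z = 0" "ip Yh K z = 0"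
  "ip (bar P) Y z = 0" "ip (bar P) Yh z = 0" "ip Y (bar P) z = 0" "ip Yh (bar P) z = 0" "ip (bar P) (bar P) z = 0" (is ?g3)
proof -
 have "ip (bar P) Y z = cnj (ip P Y z)" "ip (bar P) Yh z = cnj (ip P Yh z)" "ip (bar P) (bar P) z = cnj (ip P P z)" 
  using reals[OF z] by (simp_all add: ip_def bar_def)
 note g = this gram_rel[OF z, unfolded gram_rel_def]
 show "ip Y Y z = 0" "ip Y P z = 0" "ip P P z = 0" ?g1 "ip K (bar P) z = 0" "ip K P z = 0" "ip K Y z = 0" "ip K Yh z = 0"
  "ip P Yh z = 0" "ip Yh Yh z = 0" "ip Y Yh z = -1" "ip P Y z = 0" ?g2 "ip Yh P z = 0" "ip Yh Y z = -1" "ip P K z = 0" "ip (bar P) K z = 0" "ip Y K z = 0" "ip Yh K z = 0"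
  "ip (bar P) Y z = 0" "ip (bar P) Yh z = 0" "ip Y (bar P) z = 0" "ip Yh (bar P) z = 0" ?g3
  using g by (simp_all add: ip_commute)
qed

lemma lorV: assumes z: "z \<in> S"
 shows "lor (V z) (V z) = 0" "lor (pd V 1 z) (pd V 1 z) = 1" (is ?g1) "lor (pd V \<i> z) (pd V \<i> z) = 1" (is ?g2) "lor (pd V 1 z) (pd V \<i> z) = 0" (is ?g3) "lor (V z) (pd V v z) = 0" (is ?g4)
proof -
 have VV: "lor (V w) (V w) = 0" if "w \<in> S" for w
 proof -
  have "complex_of_real (lor (V w) (V w)) = ip Y Y w" unfolding of_real_lor by (rule ip_cong) (simp_all add: cfV that)
  thus ?thesis using gram(1)[OF that] by simp
 qed
 show "lor (V z) (V z) = 0" using VV z by auto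
 show ?g4
  using pd_lor[OF S z smV smV, of v] pd_eq0[of S "\<lambda>z. lor (V z) (V z)" 0 z v, OF S VV z] by (simp add: lor_commute[of "pd V v z"])
 have i: "ip (cf (pd V 1)) f z = ip P f z + ip (bar P) f z - (m z + cnj (m z)) / 2 * ip Y f z"
  "ip (cf (pd V \<i>)) f z = \<i> * (ip P f z - ip (bar P) f z) + \<i> * (cnj (m z) - m z) / 2 * ip Y f z" for f
  unfolding ip_def cfpd[OF z]
  by (simp_all add: sum.distrib sum_subtractf sum_distrib_left algebra_simps diff_divide_distrib)
 show ?g1 ?g2 ?g3
  unfolding of_real_eq_iff[where 'a=complex, symmetric] of_real_lor
  unfolding trans[OF ip_commute i(1)] trans[OF ip_commute i(2)]
  unfolding gram[OF z] by simp_all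
qed

lemma smf: "smooth_on S (\<lambda>z. 1 / fst (V z))"
 using fstV by (intro smooth_on_divide smooth_on_const smooth_on_fst S smV) force

lemma lor_pd_y: assumes z: "z \<in> S" shows "lor (pd y u z) (pd y v z) = (1 / fst (V z))^2 * lor (pd V u z) (pd V v z)"
 unfolding y_def[abs_def] pd_scaleR[OF S z smf smV] using lorV(1)[OF z] lorV(5)[OF z]
 by (simp add: lor_simps lor_commute[of "pd V _ z" "V z"] power2_eq_square)

lemma conf: "conformal_immersion S y"
 unfolding conformal_immersion_def
proof (intro conjI ballI S)
 show "smooth_on S y" unfolding y_def[abs_def] by (intro smooth_on_scaleR S smf smV)
 fix z assume z: "z \<in> S"
 show "on_sphere (y z)" using fstV[OF z] lorV(1)[OF z] by (simp add: on_sphere_def y_def lor_simps)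
 show "lor (pd y 1 z) (pd y 1 z) = lor (pd y \<i> z) (pd y \<i> z)" "lor (pd y 1 z) (pd y \<i> z) = 0" "0 < lor (pd y 1 z) (pd y 1 z)"
  using fstV[OF z] by (simp_all add: lor_pd_y[OF z] lorV[OF z])
qed

sublocale cs: conformal_surface S y by unfold_locales (rule conf)

lemma L_V: "z \<in> S ==> canon_lift y z = V z"
 using fstV[of z] by (simp add: canon_lift_def lor_pd_y lorV) (simp add: y_def)

lemma cfL: "z \<in> S ==> cf cs.L a z = Y a z"
 using cfV[of z a] L_V[of z] by (simp add: cf_def)

lemma lz: assumes z: "z \<in> S"
 shows "cs.lift.Yz a z = P a z - m z / 2 * Y a z" (is ?g1) "cs.lift.Yb a z = bar P a z - cnj (m z) / 2 * Y a z" (is ?g2)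
proof -
 have "cs.lift.Yz a z = dz (Y a) z" "cs.lift.Yb a z = dzb (Y a) z"
  unfolding dzf_def dzbf_def by (auto intro!: dz_cong[OF S z] dzb_cong[OF S z] cfL)
 thus ?g1 ?g2
  using Yz[OF z] eqs[OF z] by (simp_all add: bar_def)
qed

lemma lzz: assumes z: "z \<in> S"
 shows "cs.lift.Yzz a z = K a z + ((m z)^2 / 4 - dz m z / 2) * Y a z" (is ?g1)
  "cs.lift.Yzb a z = Yh a z / 2 - cnj (m z) / 2 * P a z - m z / 2 * bar P a z + (m z * cnj (m z) / 4 - k z) * Y a z" (is ?g2)
proof -
 have 1: "cs.lift.Yzz a z = dz (\<lambda>z. P a z - m z / 2 * Y a z) z" (is ?h1) "cs.lift.Yzb a z = dzb (\<lambda>z. P a z - m z / 2 * Y a z) z" (is ?h2)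
 proof -
  have l: "cs.lift.Yz a w = P a w - m w / 2 * Y a w" if "w \<in> S" for w by (rule lz(1)[OF that])
  show ?h1 unfolding dzf_def[of cs.lift.Yz] by (rule dz_cong[OF S z l])
  show ?h2 unfolding dzbf_def[of cs.lift.Yz] by (rule dzb_cong[OF S z l])
 qed
 have 2: "dz (\<lambda>z. P a z - m z / 2 * Y a z) z = dz (P a) z - (m z / 2 * dz (Y a) z + dz m z / 2 * Y a z)"
  "dzb (\<lambda>z. P a z - m z / 2 * Y a z) z = dzb (P a) z - (m z / 2 * dzb (Y a) z + dzb m z / 2 * Y a z)"
  using z smF by (simp_all add: cs.lift.wirt cs.lift.smo add_divide_distrib)
 show ?g1
  unfolding 1 2 Pz[OF z] Yz[OF z] by (simp add: power2_eq_square field_simps)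
 show ?g2
  unfolding 1 2 eqs[OF z] by (simp add: bar_def field_simps)
qed

lemma ip_lzb: assumes z: "z \<in> S"
 shows "ip cs.lift.Yzb f z = ip Yh f z / 2 - cnj (m z) / 2 * ip P f z - m z / 2 * ip (bar P) f z + (m z * cnj (m z) / 4 - k z) * ip Y f z"
 unfolding ip_def[of cs.lift.Yzb] lzz[OF z] by (simp add: ip_def[of _ f] sum.distrib sum_subtractf sum_distrib_left algebra_simps)

lemma q_eq: "z \<in> S ==> cs.lift.q z = k z"
 unfolding cs.lift.q_def by (simp add: ip_lzb) (simp add: ip_commute[of _ cs.lift.Yzb] ip_lzb gram field_simps)

lemma N_eq: "z \<in> S ==> cs.lift.N a z = Yh a z - cnj (m z) * P a z - m z * bar P a z + m z * cnj (m z) / 2 * Y a z"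
 unfolding cs.lift.N_def lzz q_eq cfL by (simp add: field_simps)

lemma ip_N: assumes z: "z \<in> S"
 shows "ip f cs.lift.N z = ip f Yh z - cnj (m z) * ip f P z - m z * ip f (bar P) z + m z * cnj (m z) / 2 * ip f Y z"
 unfolding ip_def[of f cs.lift.N] N_eq[OF z] by (simp add: ip_def[of f] sum.distrib sum_subtractf sum_distrib_left algebra_simps)

text \<open>Equivalent to theta = 0: the equation for P_z has no Y-component.\<close>

lemma hs_eq: assumes z: "z \<in> S" shows "cs.lift.hs z = dz m z / 2 - (m z)^2 / 4"
proof -
 have "ip cs.lift.Yzz f z = ip K f z + ((m z)^2 / 4 - dz m z / 2) * ip Y f z" for f
  unfolding ip_def[of cs.lift.Yzz] lzz[OF z] by (simp add: ip_def[of _ f] sum.distrib sum_subtractf sum_distrib_left algebra_simps)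
 thus ?thesis unfolding cs.lift.hs_def ip_N[OF z] using gram[OF z] by simp
qed

lemma K_eq: "z \<in> S ==> cs.lift.K a z = K a z"
 unfolding cs.lift.K_def lzz hs_eq cfL by (simp add: algebra_simps)

lemma s_willmore: "s_willmore_eq S y m"
 unfolding cs.s_willmore_eq_iff
proof (intro ballI allI)
 fix z a assume z: "z \<in> S"
 have Kb': "dzbf cs.lift.K a z = - cnj (m z) / 2 * K a z - 2 * k z * P a z" for a
  unfolding dzbf_def eqs(4)[OF z, symmetric] by (rule dzb_cong[OF S z]) (rule K_eq)
 have i: "ip (dzbf cs.lift.K) f z = - cnj (m z) / 2 * ip K f z - 2 * k z * ip P f z" for f
  unfolding ip_def[of "dzbf cs.lift.K"] Kb' by (simp add: ip_def[of _ f] sum_subtractf sum_distrib_left algebra_simps)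
 have l: "ip f cs.lift.Yz z = ip f P z - m z / 2 * ip f Y z" "ip f cs.lift.Yb z = ip f (bar P) z - cnj (m z) / 2 * ip f Y z" "ip f (cf cs.L) z = ip f Y z" for f
  unfolding ip_def[of f cs.lift.Yz] ip_def[of f cs.lift.Yb] ip_def[of f "cf cs.L"] lz[OF z] cfL[OF z]
  by (simp_all add: ip_def[of f] sum_subtractf sum_distrib_left algebra_simps)
 show "cs.lift.perp (dzbf cs.lift.K) a z + cnj (m z) / 2 * cs.lift.K a z = 0"
  unfolding cs.lift.perp_def Kb' K_eq[OF z] i l ip_N[OF z] lz[OF z] cfL[OF z] using gram[OF z]
  by (simp add: field_simps)
qed

sublocale sw: swillmore_lift S "cf cs.L" m
 using s_willmore smF unfolding cs.s_willmore_eq_iff by unfold_locales auto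

lemma th: "z \<in> S ==> sw.th z = 0"
 by (simp add: sw.th_def hs_eq)

text \<open>With theta = 0 the Euler-Lagrange vector reduces to a real multiple of Y.\<close>

lemma willmore: "willmore S y"
proof (rule cs.willmoreI)
 fix z assume z: "z \<in> S"
 show "\<exists>c. \<forall>a. cs.lift.EL a z = of_real c * cf cs.L a z"
  using sw.EL_eq[OF z] by (simp add: th[OF z])
qed

sublocale ds: dual_surface S y m
 using willmore smF s_willmore by unfold_locales (simp add: s_willmore_with_def)

lemma swP: "z \<in> S ==> sw.P a z = P a z"
 by (simp add: sw.P_def lz cfL)

lemma swYh: "z \<in> S ==> cf (dual_lift y m) a z = Yh a z"
 unfolding ds.cf_dual sw.Yh_def N_eq lz cfL by (simp add: field_simps)

end

section \<open>Gluing local solutions along the interval\<close>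

definition hol_ext :: "(real => complex) => real => bool" where
 "hol_ext f u \<longleftrightarrow> (\<exists>R>0. \<exists>g. g holomorphic_on ball (of_real u) R \<and> (\<forall>x. \<bar>x - u\<bar> < R \<longrightarrow> g (of_real x) = f x))"

lemma has_vector_derivative_of_real:
 fixes f :: "complex => 'b::real_normed_vector"
 assumes S: "open S" "of_real x \<in> S" and f: "smooth_on S f"
 shows "((\<lambda>t. f (of_real t)) has_vector_derivative pd f 1 (of_real x)) (at x)"
proof -
 have "(f has_derivative (\<lambda>v. pd f v (of_real x))) (at (of_real x))" by (rule smooth_on_has_derivative[OF f S])
 moreover have "(complex_of_real has_derivative complex_of_real) (at x)"
  by simp
 ultimately have "((\<lambda>t. f (of_real t)) has_derivative (\<lambda>v. pd f (of_real v) (of_real x))) (at x)"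
  using has_derivative_compose by blast
 moreover have "(\<lambda>v. pd f (complex_of_real v) (of_real x)) = (\<lambda>v. v *\<^sub>R pd f 1 (of_real x))"
 proof
  fix v show "pd f (complex_of_real v) (of_real x) = v *\<^sub>R pd f 1 (of_real x)"
   using pd_complex_dir[OF smooth_on_differentiable[OF f] S, of "of_real v"] by simp
 qed
 ultimately show ?thesis by (simp add: has_vector_derivative_def)
qed

text \<open>B is required to meet the real axis only inside I, so that the initial values are
  meaningful at all its real points.\<close>

definition cauchy_solution :: "('i::finite => ('i => complex) => ('i => complex) => complex) => ('i => real => complex) => real set => complex set => ('i => complex => complex) => bool" where
 "cauchy_solution G W0 I B f \<longleftrightarrow> (\<forall>i. smooth_on B (f i)) \<and> (\<forall>i. \<forall>z\<in>B. dzb (f i) z = G i (\<lambda>j. f j z) (\<lambda>j. cnj (f j z))) \<and>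
   (\<forall>x. complex_of_real x \<in> B \<longrightarrow> x \<in> I \<and> (\<forall>i. f i (of_real x) = W0 i x))"

text \<open>Two balls centered on the axis meet in a convex set symmetric to the axis; hence it
  contains real points, and uniqueness makes the local solutions agree on it.\<close>

theorem glued_dbar_solution:
 assumes G: "\<And>i. poly2 (G i)" and I: "open I" and W0: "\<forall>u\<in>I. \<forall>i. hol_ext (W0 i) u"
 shows "\<exists>\<rho> F. \<forall>u\<in>I. \<rho> u > 0 \<and> cauchy_solution G W0 I (ball (of_real u) (\<rho> u)) F"
proof -
 define Q where "Q u \<rho> f \<longleftrightarrow> \<rho> > 0 \<and> cauchy_solution G W0 I (ball (of_real u) \<rho>) f" for u \<rho> f
 note Q_def = Q_def cauchy_solution_def
 have rb: "complex_of_real x \<in> ball (of_real u) R \<longleftrightarrow> \<bar>x - u\<bar> < R" for x u R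
  by (simp add: dist_norm abs_minus_commute flip: of_real_diff)
 have "\<exists>\<rho> f. Q u \<rho> f" if u: "u \<in> I" for u
 proof -
  have "\<forall>i. \<exists>R g. R > 0 \<and> g holomorphic_on ball (of_real u) R \<and> (\<forall>x. \<bar>x - u\<bar> < R \<longrightarrow> g (of_real x) = W0 i x)"
   using W0 u unfolding hol_ext_def by blast
  then obtain R g where R: "\<And>i. R i > 0" "\<And>i. g i holomorphic_on ball (of_real u) (R i)" "\<And>i x. \<bar>x - u\<bar> < R i ==> g i (of_real x) = W0 i x"
   by metis
  obtain e where e: "e > 0" "ball u e \<subseteq> I" using I u open_contains_ball by blast
  define R0 where "R0 = min e (Min (range R))"
  have R0: "R0 > 0" "R0 \<le> e" "\<And>i. R0 \<le> R i" using e R(1) by (auto simp: R0_def intro: min.coboundedI2)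
  have "\<exists>r>0. \<exists>f. r \<le> R0 \<and> (\<forall>i. smooth_on (ball (of_real u) r) (f i) \<and>
   (\<forall>z\<in>ball (of_real u) r. dzb (f i) z = G i (\<lambda>j. f j z) (\<lambda>j. cnj (f j z))) \<and>
   (\<forall>x. complex_of_real x \<in> ball (of_real u) r \<longrightarrow> f i (of_real x) = g i (of_real x)))"
   by (rule poly_dbar_cauchy_problem[OF G R0(1) holomorphic_on_subset[OF R(2) subset_ball[OF R0(3)]]])
  then obtain r f where r: "r > 0" "r \<le> R0" "\<And>i. smooth_on (ball (of_real u) r) (f i)"
    "\<And>i z. z \<in> ball (of_real u) r ==> dzb (f i) z = G i (\<lambda>j. f j z) (\<lambda>j. cnj (f j z))"
    "\<And>i x. complex_of_real x \<in> ball (of_real u) r ==> f i (of_real x) = g i (of_real x)" by blast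
  have "x \<in> I \<and> (\<forall>i. f i (of_real x) = W0 i x)" if x: "complex_of_real x \<in> ball (of_real u) r" for x
  proof -
   have a: "\<bar>x - u\<bar> < r" using x unfolding rb .
   hence "x \<in> ball u e" using r(2) R0(2) by (simp add: dist_real_def)
   moreover have "f i (of_real x) = W0 i x" for i using r(5)[OF x, of i] R(3)[of x i] a r(2) R0(3)[of i] by simp
   ultimately show ?thesis using e(2) by blast
  qed
  thus ?thesis unfolding Q_def using r by (intro exI[of _ r] exI[of _ f]) auto
 qed
 then obtain \<rho> f where Qu: "\<And>u. u \<in> I ==> Q u (\<rho> u) (f u)" by metis
 let ?B = "\<lambda>u. ball (complex_of_real u) (\<rho> u)"
 have agree: "f u i z = f v i z" if uv: "u \<in> I" "v \<in> I" and z: "z \<in> ?B u" "z \<in> ?B v" for u v i z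
 proof (rule dbar_system_unique[where G=G and U="?B u \<inter> ?B v" and f="f u" and g="f v" and ?x0.0="Re z", OF G])
  show "connected (?B u \<inter> ?B v)" by (intro convex_connected convex_Int convex_ball)
  \<comment> \<open>The real part of z is no farther from a real center than z itself, so it is a
    common real point of both balls.\<close>
  have "dist (complex_of_real w) (of_real (Re z)) \<le> dist (of_real w) z" for w
   using abs_Re_le_cmod[of "of_real w - z"] by (simp add: dist_norm flip: of_real_diff)
  thus "of_real (Re z) \<in> ?B u \<inter> ?B v" using z by (auto intro: le_less_trans)
  show "smooth_on (?B u \<inter> ?B v) (f u i)" "smooth_on (?B u \<inter> ?B v) (f v i)" for i
   using Qu[OF uv(1)] Qu[OF uv(2)] unfolding Q_def by (auto intro: smooth_on_subset)
 qed (use Qu[OF uv(1)] Qu[OF uv(2)] z in \<open>auto simp: Q_def\<close>)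
 \<comment> \<open>Any choice of a ball containing z gives the same value by
   \<open>agree\<close>.\<close>
 define F where "F i z = f (SOME u. u \<in> I \<and> z \<in> ?B u) i z" for i z
 have F: "F i z = f u i z" if "u \<in> I" "z \<in> ?B u" for u i z
 proof -
  have "(SOME u. u \<in> I \<and> z \<in> ?B u) \<in> I \<and> z \<in> ?B (SOME u. u \<in> I \<and> z \<in> ?B u)" by (rule someI[of _ u]) (use that in auto)
  thus ?thesis unfolding F_def using agree that by blast
 qed
 have "Q u (\<rho> u) F" if u: "u \<in> I" for u
 proof -
  note q = Qu[OF u, unfolded Q_def]
  have "smooth_on (?B u) (F i)" for i
  proof -
   have "smooth_on (?B u) (F i) \<longleftrightarrow> smooth_on (?B u) (f u i)" by (rule smooth_on_cong) (simp_all add: F[OF u])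
   thus ?thesis using q by blast
  qed
  moreover have "dzb (F i) z = G i (\<lambda>j. F j z) (\<lambda>j. cnj (F j z))" if z: "z \<in> ?B u" for i z
  proof -
   have "dzb (F i) z = dzb (f u i) z" by (rule dzb_cong[OF open_ball z F[OF u]])
   thus ?thesis using q z by (simp add: F[OF u z])
  qed
  moreover have "x \<in> I \<and> (\<forall>i. F i (of_real x) = W0 i x)" if "complex_of_real x \<in> ?B u" for x
   using q that by (simp add: F[OF u that])
  ultimately show ?thesis using q unfolding Q_def by blast
 qed
 thus ?thesis unfolding Q_def(1) by blast
qed

text \<open>The propagation is done in each ball separately, where connectedness and a real point
  are at hand; the resulting pointwise equations are then combined on the union.\<close>

theorem willmore_system_solvable:
 fixes Y0 Yh0 P0 K0 :: "'n::finite option => real => complex" and m0 r0 :: "real => complex"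
 assumes I: "open I"
  and hol: "\<And>u a. u \<in> I ==> hol_ext (Y0 a) u \<and> hol_ext (Yh0 a) u \<and> hol_ext (P0 a) u \<and> hol_ext (K0 a) u" "\<And>u. u \<in> I ==> hol_ext m0 u \<and> hol_ext r0 u"
  and real: "\<And>x a. x \<in> I ==> cnj (Y0 a x) = Y0 a x" "\<And>x a. x \<in> I ==> cnj (Yh0 a x) = Yh0 a x"
  and pos: "\<And>x. x \<in> I ==> Re (Y0 None x) > 0" "\<And>x. x \<in> I ==> Re (Yh0 None x) > 0"
  and d: "\<And>x a. x \<in> I ==> (Y0 a has_vector_derivative P0 a x + cnj (P0 a x) - of_real (Re (m0 x)) * Y0 a x) (at x)"
   "\<And>x a. x \<in> I ==> (Yh0 a has_vector_derivative of_real (Re (m0 x)) * Yh0 a x + r0 x * P0 a x + cnj (r0 x * P0 a x)) (at x)"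
   "\<And>x a. x \<in> I ==> (P0 a has_vector_derivative \<i> * of_real (Im (m0 x)) * P0 a x + K0 a x + Yh0 a x / 2 + cnj (r0 x) / 2 * Y0 a x) (at x)"
  and g: "\<And>x. x \<in> I ==> gram_rel Y0 Yh0 P0 K0 x"
 shows "\<exists>S y m. complex_of_real ` I \<subseteq> S \<and> dual_surface S y m \<and> (\<forall>z\<in>S. fst (canon_lift y z) > 0 \<and> fst (dual_lift y m z) > 0) \<and>
   (\<forall>x\<in>I. \<forall>a. cf (canon_lift y) a (of_real x) = Y0 a x \<and> cf (dual_lift y m) a (of_real x) = Yh0 a x \<and>
    swillmore_lift.P (cf (canon_lift y)) m a (of_real x) = P0 a x)"
proof -
 define W0 where "W0 = state Y0 Yh0 P0 K0 m0 r0"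
 have "\<forall>u\<in>I. \<forall>i. hol_ext (W0 i) u"
  using hol by (auto simp: W0_def state_def split: sum.split)
 from glued_dbar_solution[where G=Gsys and ?W0.0=W0, OF poly2_Gsys I this] obtain \<rho> F
  where FF: "\<And>u. u \<in> I ==> \<rho> u > 0" "\<And>u. u \<in> I ==> cauchy_solution Gsys W0 I (ball (of_real u) (\<rho> u)) F"
  by blast
 let ?B = "\<lambda>u. ball (complex_of_real u) (\<rho> u)"
 note F = FF(1) FF(2)[unfolded cauchy_solution_def, THEN conjunct1, rule_format] FF(2)[unfolded cauchy_solution_def, THEN conjunct2, THEN conjunct1, rule_format]
  FF(2)[unfolded cauchy_solution_def, THEN conjunct2, THEN conjunct2, rule_format]
 note [simp] = W0_def state_def
 have sys: "willmore_system (?B u) F u" if u: "u \<in> I" for u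
 proof
  show "open (?B u)" "connected (?B u)" "of_real u \<in> ?B u" using F(1)[OF u] by auto
  show "smooth_on (?B u) (F i)" for i by (rule F(2)[OF u])
  show "dzb (F i) z = Gsys i (\<lambda>j. F j z) (\<lambda>j. cnj (F j z))" if "z \<in> ?B u" for z i by (rule F(3)[OF u that])
  fix z assume "z \<in> ?B u \<inter> \<real>"
  then obtain x where z: "z = of_real x" and x: "complex_of_real x \<in> ?B u" by (auto elim: Reals_cases)
  have xI: "x \<in> I" using F(4)[OF u x] by simp
  have v: "F i z = W0 i x" for i using F(4)[OF u x] z by simp
  show "cnj (F (iY a) z) = F (iY a) z \<and> cnj (F (iYh a) z) = F (iYh a) z" for a using real[OF xI] by (simp add: v)
  have dx: "pd (F i) 1 z = D" if D: "(W0 i has_vector_derivative D) (at x)" for i D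
  proof -
   have "((\<lambda>t. F i (of_real t)) has_vector_derivative pd (F i) 1 z) (at x)"
    unfolding z by (rule has_vector_derivative_of_real[OF open_ball x F(2)[OF u]])
   moreover have "((\<lambda>t. F i (of_real t)) has_vector_derivative D) (at x)"
   proof (rule has_vector_derivative_transform_within_open[OF D, of "ball u (\<rho> u)"])
    show "x \<in> ball u (\<rho> u)" using x by (simp flip: of_real_diff)
    show "W0 i t = F i (of_real t)" if "t \<in> ball u (\<rho> u)" for t
     using F(4)[OF u, of t] that by (simp flip: of_real_diff)
   qed simp
   ultimately show ?thesis by (rule vector_derivative_unique_at)
  qed
  show "pd (F (iY a)) 1 z = F (iP a) z + cnj (F (iP a) z) - of_real (Re (F im z)) * F (iY a) z"
   "pd (F (iYh a)) 1 z = of_real (Re (F im z)) * F (iYh a) z + F ir z * F (iP a) z + cnj (F ir z * F (iP a) z)"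
   "pd (F (iP a)) 1 z = \<i> * of_real (Im (F im z)) * F (iP a) z + F (iK a) z + F (iYh a) z / 2 + cnj (F ir z) / 2 * F (iY a) z" for a
   unfolding v by (rule dx, use d[OF xI, of a] in simp)+
  show "gram_rel (\<lambda>a. F (iY a)) (\<lambda>a. F (iYh a)) (\<lambda>a. F (iP a)) (\<lambda>a. F (iK a)) z"
   using g[OF xI] by (simp add: gram_rel_def ip_def bar_def v)
 qed
 \<comment> \<open>Shrinks the domain so that both lifts stay in the forward light cone; on I this
   holds by assumption.\<close>
 define \<Sigma> where "\<Sigma> = (\<Union>u\<in>I. {z \<in> ?B u. Re (F (iY None) z) > 0 \<and> Re (F (iYh None) z) > 0})"
 have op: "open {z \<in> ?B u. Re (F (iY None) z) > 0 \<and> Re (F (iYh None) z) > 0}" if u: "u \<in> I" for u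
 proof -
  have c: "continuous_on (?B u) (\<lambda>z. Re (F (iY None) z))" "continuous_on (?B u) (\<lambda>z. Re (F (iYh None) z))"
   by (intro continuous_on_Re smooth_on_continuous F(2)[OF u])+
  have "{z \<in> ?B u. Re (F (iY None) z) > 0 \<and> Re (F (iYh None) z) > 0} = (?B u \<inter> (\<lambda>z. Re (F (iY None) z)) -` {0<..}) \<inter> (?B u \<inter> (\<lambda>z. Re (F (iYh None) z)) -` {0<..})" by auto
  thus ?thesis using continuous_open_preimage[OF c(1) open_ball, of "{0<..}"] continuous_open_preimage[OF c(2) open_ball, of "{0<..}"] by (simp add: open_Int)
 qed
 have o\<Sigma>: "open \<Sigma>" unfolding \<Sigma>_def using op by blast
 have I\<Sigma>: "complex_of_real x \<in> \<Sigma>" if "x \<in> I" for x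
 proof -
  have "complex_of_real x \<in> ?B x" using F(1)[OF that] by simp
  thus ?thesis unfolding \<Sigma>_def using that pos[OF that] F(4)[OF that, of x] by (auto intro!: bexI[of _ x])
 qed
 have ball: "\<exists>u\<in>I. z \<in> ?B u" if "z \<in> \<Sigma>" for z using that by (auto simp: \<Sigma>_def)
 have posz: "Re (F (iY None) z) > 0" "Re (F (iYh None) z) > 0" if "z \<in> \<Sigma>" for z using that by (auto simp: \<Sigma>_def)
 have smF: "smooth_on \<Sigma> (F i)" for i
 proof (rule smooth_on_local)
  fix z assume z: "z \<in> \<Sigma>"
  then obtain u where u: "u \<in> I" "z \<in> ?B u" using ball by blast
  show "\<exists>T. open T \<and> z \<in> T \<and> T \<subseteq> \<Sigma> \<and> smooth_on T (F i)"
   using u z o\<Sigma> smooth_on_subset[OF F(2)[OF u(1)]] by (intro exI[of _ "\<Sigma> \<inter> ?B u"]) auto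
 qed
 interpret wf: willmore_frame \<Sigma> F
 proof
  show "open \<Sigma>" by (rule o\<Sigma>)
  show "smooth_on \<Sigma> (F i)" for i by (rule smF)
  fix z assume z: "z \<in> \<Sigma>"
  then obtain u where u: "u \<in> I" "z \<in> ?B u" using ball by blast
  interpret ws: willmore_system "?B u" F u by (rule sys[OF u(1)])
  show "dzb (F i) z = Gsys i (\<lambda>j. F j z) (\<lambda>j. cnj (F j z))" for i by (rule ws.sysF[OF u(2)])
  show "cnj (F (iY a) z) = F (iY a) z" "cnj (F (iYh a) z) = F (iYh a) z" "dz (F (iY a)) z = F (iP a) z - F im z / 2 * F (iY a) z" "dz (F (iP a)) z = F im z / 2 * F (iP a) z + F (iK a) z" for a
   by (rule ws.reals[OF u(2)] ws.Yz[OF u(2)] ws.Pz[OF u(2)])+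
  show "gram_rel (\<lambda>a. F (iY a)) (\<lambda>a. F (iYh a)) (\<lambda>a. F (iP a)) (\<lambda>a. F (iK a)) z" by (rule ws.gram[OF u(2)])
  show "Re (F (iY None) z) > 0" by (rule posz[OF z])
 qed
 show ?thesis
 proof (intro exI conjI)
  show "complex_of_real ` I \<subseteq> \<Sigma>" using I\<Sigma> by blast
  show "dual_surface \<Sigma> wf.y (F im)" by (rule wf.ds.dual_surface_axioms)
  show "\<forall>z\<in>\<Sigma>. fst (canon_lift wf.y z) > 0 \<and> fst (dual_lift wf.y (F im) z) > 0"
  proof
   fix z assume z: "z \<in> \<Sigma>"
   have "complex_of_real (fst (canon_lift wf.y z)) = F (iY None) z" "complex_of_real (fst (dual_lift wf.y (F im) z)) = F (iYh None) z"
    using wf.cfL[OF z, of None] wf.swYh[OF z, of None] by (simp_all add: cf_def mc_def)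
   thus "fst (canon_lift wf.y z) > 0 \<and> fst (dual_lift wf.y (F im) z) > 0"
    using posz[OF z] by (metis Re_complex_of_real)
  qed
  show "\<forall>x\<in>I. \<forall>a. cf (canon_lift wf.y) a (of_real x) = Y0 a x \<and> cf (dual_lift wf.y (F im)) a (of_real x) = Yh0 a x \<and>
    swillmore_lift.P (cf (canon_lift wf.y)) (F im) a (of_real x) = P0 a x"
   using wf.cfL[OF I\<Sigma>] wf.swYh[OF I\<Sigma>] wf.swP[OF I\<Sigma>] F(1,4) by simp
 qed
qed

section \<open>Real analytic initial data\<close>

lemma hol_extI: "R > 0 ==> g holomorphic_on ball (of_real u) R ==> (\<And>x. \<bar>x - u\<bar> < R ==> g (of_real x) = f x) ==> hol_ext f u"
 unfolding hol_ext_def by blast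

lemma hol_extE:
 assumes "hol_ext f u"
 obtains R g where "R > 0" "g holomorphic_on ball (of_real u) R" "\<And>x. \<bar>x - u\<bar> < R ==> g (of_real x) = f x"
 using assms unfolding hol_ext_def by blast

lemma of_real_in_ball: "complex_of_real x \<in> ball (of_real u) R \<longleftrightarrow> \<bar>x - u\<bar> < R"
 by (simp add: dist_norm abs_minus_commute flip: of_real_diff)

lemma hol_ext_cong:
 assumes f: "hol_ext f u" and d: "d > 0" "\<And>x. \<bar>x - u\<bar> < d ==> h x = f x"
 shows "hol_ext h u"
proof -
 obtain R g where g: "R > 0" "g holomorphic_on ball (of_real u) R" "\<And>x. \<bar>x - u\<bar> < R ==> g (of_real x) = f x" using f by (rule hol_extE) blast
 show ?thesis
  by (rule hol_extI[of "min R d" g]) (use g d in \<open>auto intro: holomorphic_on_subset\<close>)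
qed

lemma hol_ext_const: "hol_ext (\<lambda>_. c) u"
 by (rule hol_extI[of 1 "\<lambda>_. c"]) auto

lemma hol_ext_binop:
 assumes f: "hol_ext f u" and h: "hol_ext h u"
  and op: "\<And>g k S. g holomorphic_on S ==> k holomorphic_on S ==> (\<lambda>z. opr (g z) (k z)) holomorphic_on S"
 shows "hol_ext (\<lambda>x. opr (f x) (h x)) u"
proof -
 obtain R g where g: "R > 0" "g holomorphic_on ball (of_real u) R" "\<And>x. \<bar>x - u\<bar> < R ==> g (of_real x) = f x" using f by (rule hol_extE) blast
 obtain R' k where k: "R' > 0" "k holomorphic_on ball (of_real u) R'" "\<And>x. \<bar>x - u\<bar> < R' ==> k (of_real x) = h x" using h by (rule hol_extE) blast
 show ?thesis
 proof (rule hol_extI[of "min R R'" "\<lambda>z. opr (g z) (k z)"])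
  show "(\<lambda>z. opr (g z) (k z)) holomorphic_on ball (of_real u) (min R R')"
   by (intro op holomorphic_on_subset[OF g(2)] holomorphic_on_subset[OF k(2)] subset_ball) auto
 qed (use g k in auto)
qed

lemma hol_ext_add: "hol_ext f u ==> hol_ext h u ==> hol_ext (\<lambda>x. f x + h x) u"
 and hol_ext_diff: "hol_ext f u ==> hol_ext h u ==> hol_ext (\<lambda>x. f x - h x) u"
 and hol_ext_mult: "hol_ext f u ==> hol_ext h u ==> hol_ext (\<lambda>x. f x * h x) u"
 by (intro hol_ext_binop[where opr="(+)"] hol_ext_binop[where opr="(-)"] hol_ext_binop[where opr="(*)"] holomorphic_intros; assumption)+

lemma hol_ext_divide_const: "hol_ext f u ==> hol_ext (\<lambda>x. f x / c) u"
 using hol_ext_mult[OF _ hol_ext_const[of "inverse c"]] by (simp add: divide_inverse)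

lemma hol_ext_sum: "(\<And>i. i \<in> A ==> hol_ext (f i) u) ==> hol_ext (\<lambda>x. \<Sum>i\<in>A. f i x) u"
 by (induction A rule: infinite_finite_induct) (auto intro: hol_ext_add hol_ext_const)

lemma hol_ext_has_deriv:
 assumes f: "hol_ext f u"
 shows "\<exists>d>0. \<exists>f'. hol_ext f' u \<and> (\<forall>x. \<bar>x - u\<bar> < d \<longrightarrow> (f has_vector_derivative f' x) (at x))"
proof -
 obtain R g where g: "R > 0" "g holomorphic_on ball (of_real u) R" "\<And>x. \<bar>x - u\<bar> < R ==> g (of_real x) = f x" using f by (rule hol_extE) blast
 define f' where "f' x = deriv g (of_real x)" for x :: real
 have "hol_ext f' u"
  by (rule hol_extI[OF g(1) holomorphic_deriv[OF g(2)]]) (simp_all add: f'_def)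
 moreover have "(f has_vector_derivative f' x) (at x)" if x: "\<bar>x - u\<bar> < R" for x
 proof -
  have xb: "complex_of_real x \<in> ball (of_real u) R" using x by (simp only: of_real_in_ball)
  have "(g has_field_derivative f' x) (at (of_real x))"
   unfolding f'_def by (rule holomorphic_derivI[OF g(2) open_ball xb])
  hence "((\<lambda>t. g (of_real t)) has_vector_derivative f' x) (at x)"
   by (rule has_vector_derivative_real_field)
  thus ?thesis
  proof (rule has_vector_derivative_transform_within_open[of _ _ _ "ball u R"])
   show "x \<in> ball u R" using x by (simp add: dist_real_def)
   show "g (of_real t) = f t" if "t \<in> ball u R" for t using that by (intro g(3)) (simp add: dist_real_def)
  qed simp
 qed
 ultimately show ?thesis using g(1) by blast
qed

lemma hol_ext_continuous: "hol_ext f u ==> isCont f u"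
 using hol_ext_has_deriv[of f u] has_vector_derivative_continuous by force

text \<open>Near u the extension of f has positive real part, where the principal square root is
  holomorphic.\<close>

lemma hol_ext_inverse_sqrt:
 assumes f: "hol_ext (\<lambda>t. complex_of_real (f t)) u" and pos: "f u > 0"
 shows "hol_ext (\<lambda>t. complex_of_real (1 / sqrt (f t))) u"
proof -
 obtain R g where g: "R > 0" "g holomorphic_on ball (of_real u) R" "\<And>x. \<bar>x - u\<bar> < R ==> g (of_real x) = complex_of_real (f x)" using f by (rule hol_extE) blast
 have gu: "g (of_real u) = of_real (f u)" using g by simp
 have "open (ball (of_real u) R \<inter> g -` {z. Re z > 0})"
  by (intro continuous_open_preimage holomorphic_on_imp_continuous_on g open_ball open_halfspace_Re_gt)
 moreover have "of_real u \<in> ball (of_real u) R \<inter> g -` {z. Re z > 0}" using g(1) gu pos by simp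
 ultimately obtain d where d: "d > 0" "ball (of_real u) d \<subseteq> ball (of_real u) R \<inter> g -` {z. Re z > 0}"
  using open_contains_ball by blast
 show ?thesis
 proof (rule hol_extI[OF d(1), of "\<lambda>z. 1 / csqrt (g z)"])
  have "g z \<notin> \<real>\<^sub>\<le>\<^sub>0 \<and> g z \<noteq> 0" if "z \<in> ball (of_real u) d" for z
   using that d(2) by (auto simp: complex_nonpos_Reals_iff)
  thus "(\<lambda>z. 1 / csqrt (g z)) holomorphic_on ball (of_real u) d"
   using holomorphic_on_subset[OF g(2), of "ball (of_real u) d"] d(2) by (intro holomorphic_intros) auto
  fix x assume x: "\<bar>x - u\<bar> < d"
  hence xd: "complex_of_real x \<in> ball (of_real u) d" by (simp only: of_real_in_ball)
  hence "complex_of_real x \<in> ball (of_real u) R" "Re (g (of_real x)) > 0"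
   using subsetD[OF d(2) xd] by (simp_all only: Int_iff vimage_eq mem_Collect_eq)
  hence "g (of_real x) = of_real (f x)" "f x > 0" using g(3)[of x] by (simp_all only: of_real_in_ball Re_complex_of_real)
  thus "1 / csqrt (g (of_real x)) = complex_of_real (1 / sqrt (f x))" by simp
 qed
qed

text \<open>The expansion converges at all real points within R of u, hence on the complex disc of
  the same radius.\<close>

lemma real_analytic_hol_ext:
 fixes f :: "real => 'n::finite mink"
 assumes f: "real_analytic_on f I" and u: "u \<in> I" and I: "open I"
 shows "hol_ext (cf f a) u"
proof -
 obtain r c where r: "r > 0" "\<And>t. t \<in> I ==> dist t u < r ==> (\<lambda>k. (t - u) ^ k *\<^sub>R c k) sums f t"
  using f u unfolding real_analytic_on_def by blast
 obtain e where e: "e > 0" "ball u e \<subseteq> I" using I u open_contains_ball by blast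
 define R where "R = min r e"
 define C where "C k = complex_of_real (mc (c k) a)" for k
 have s: "(\<lambda>k. C k * (of_real t - of_real u) ^ k) sums of_real (mc (f t) a)" if "\<bar>t - u\<bar> < R" for t
 proof -
  have "t \<in> I" "dist t u < r" using that e(2) by (auto simp: R_def dist_real_def)
  from bounded_linear.sums[OF bounded_linear_mc r(2)[OF this], of a]
  have "(\<lambda>k. (t - u) ^ k * mc (c k) a) sums mc (f t) a" by simp
  hence "(\<lambda>k. complex_of_real ((t - u) ^ k * mc (c k) a)) sums of_real (mc (f t) a)" by (rule sums_of_real)
  thus ?thesis by (simp add: C_def mult.commute)
 qed
 have R: "R > 0" using r e by (simp add: R_def)
 define g where "g z = (\<Sum>k. C k * (z - of_real u) ^ k)" for z
 have "(\<lambda>k. C k * (w - of_real u) ^ k) sums g w" if w: "w \<in> ball (of_real u) R" for w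
 proof -
  \<comment> \<open>Convergence at the real point u + \<rho> with |w - u| < \<rho> gives convergence
    at w.\<close>
  obtain \<rho> where \<rho>: "cmod (w - of_real u) < \<rho>" "\<rho> < R" using w dense[of "cmod (w - of_real u)" R] by (auto simp: dist_norm norm_minus_commute)
  have \<rho>0: "\<rho> > 0" using \<rho>(1) norm_ge_zero[of "w - of_real u"] by linarith
  have "summable (\<lambda>k. C k * (of_real \<rho>) ^ k)"
   using sums_summable[OF s[of "u + \<rho>"]] \<rho> \<rho>0 by simp
  hence "summable (\<lambda>k. C k * (w - of_real u) ^ k)" by (rule powser_inside) (use \<rho> \<rho>0 in simp)
  thus ?thesis unfolding g_def by (rule summable_sums)
 qed
 hence "g holomorphic_on ball (of_real u) R" by (rule power_series_holomorphic)
 moreover have "g (of_real x) = of_real (mc (f x) a)" if "\<bar>x - u\<bar> < R" for x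
  unfolding g_def using s[OF that] by (rule sums_unique[symmetric])
 ultimately show ?thesis using R by (intro hol_extI) (auto simp: cf_def)
qed

definition hol_vec :: "(real => 'n::finite mink) => real => bool" where
 "hol_vec F u \<longleftrightarrow> (\<forall>a. hol_ext (cf F a) u)"

lemma hol_vec_add: "hol_vec F u ==> hol_vec G u ==> hol_vec (\<lambda>t. F t + G t) u"
 and hol_vec_diff: "hol_vec F u ==> hol_vec G u ==> hol_vec (\<lambda>t. F t - G t) u"
 and hol_vec_scaleR: "hol_ext (\<lambda>t. complex_of_real (f t)) u ==> hol_vec F u ==> hol_vec (\<lambda>t. f t *\<^sub>R F t) u"
 by (simp_all add: hol_vec_def cf_def[abs_def] hol_ext_add hol_ext_diff hol_ext_mult)

lemma hol_vec_cong: "hol_vec F u ==> d > 0 ==> (\<And>x. \<bar>x - u\<bar> < d ==> G x = F x) ==> hol_vec G u"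
 unfolding hol_vec_def by (rule allI, rule hol_ext_cong[of "cf F _" u d]) (auto simp: cf_def)

lemma hol_ext_lor:
 assumes "hol_vec F u" "hol_vec G u"
 shows "hol_ext (\<lambda>t. complex_of_real (lor (F t) (G t))) u"
 using assms unfolding of_real_lor ip_def by (intro hol_ext_sum hol_ext_mult hol_ext_const) (simp_all add: hol_vec_def)

lemma mink_has_vector_derivative:
 fixes F :: "real => 'n::finite mink"
 assumes "\<And>a. ((\<lambda>t. mc (F t) a) has_real_derivative D a) (at x)"
 shows "(F has_vector_derivative (D None, \<chi> i. D (Some i))) (at x)"
proof -
 have eq: "(\<lambda>t. (mc (F t) None, \<chi> i. mc (F t) (Some i))) = F" by (simp add: mc_def)
 have 2: "((\<lambda>t. \<chi> i. mc (F t) (Some i)) has_vector_derivative (\<chi> i. D (Some i))) (at x)"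
 proof -
  have e: "(\<chi> i. g i) = (\<Sum>i\<in>UNIV. g i *\<^sub>R axis i (1::real))" for g :: "'n => real"
   by (simp add: vec_eq_iff axis_def if_distrib cong: if_cong)
  have "((\<lambda>t. \<Sum>i\<in>UNIV. mc (F t) (Some i) *\<^sub>R axis i (1::real)) has_vector_derivative (\<Sum>i\<in>UNIV. D (Some i) *\<^sub>R axis i (1::real))) (at x)"
   by (rule has_vector_derivative_sum) (use has_vector_derivative_scaleR[OF assms has_vector_derivative_const] in simp)
  thus ?thesis unfolding e .
 qed
 show ?thesis
  using has_vector_derivative_Pair[OF assms[of None, unfolded has_real_derivative_iff_has_vector_derivative] 2] unfolding eq .
qed

lemma hol_vec_deriv:
 assumes F: "hol_vec F u"
 shows "(F has_vector_derivative vector_derivative F (at u)) (at u)" (is ?g1) and "hol_vec (\<lambda>t. vector_derivative F (at t)) u" (is ?g2)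
proof -
 have "\<forall>a. \<exists>d f'. d > 0 \<and> hol_ext f' u \<and> (\<forall>x. \<bar>x - u\<bar> < d \<longrightarrow> (cf F a has_vector_derivative f' x) (at x))"
  using hol_ext_has_deriv F unfolding hol_vec_def by metis
 then obtain d f' where d: "\<And>a. d a > 0" "\<And>a. hol_ext (f' a) u"
  "\<And>a x. \<bar>x - u\<bar> < d a ==> (cf F a has_vector_derivative f' a x) (at x)" by metis
 define e where "e = Min (range d)"
 have e: "e > 0" "\<And>a. e \<le> d a" using d(1) by (auto simp: e_def)
 define G where "G x = (Re (f' None x), \<chi> i. Re (f' (Some i) x))" for x
 have D: "(F has_vector_derivative G x) (at x)" if x: "\<bar>x - u\<bar> < e" for x
 proof -
  have "((\<lambda>t. mc (F t) a) has_real_derivative Re (f' a x)) (at x)" for a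
   using bounded_linear.has_vector_derivative[OF bounded_linear_Re d(3)[of x a]] x e(2)[of a]
   by (simp add: cf_def has_real_derivative_iff_has_vector_derivative)
  thus ?thesis unfolding G_def by (rule mink_has_vector_derivative)
 qed
 have vd: "vector_derivative F (at x) = G x" if "\<bar>x - u\<bar> < e" for x by (rule vector_derivative_at[OF D[OF that]])
 show ?g1 using D[of u] vd[of u] e(1) by simp
 have im: "complex_of_real (mc (G x) a) = f' a x" if x: "\<bar>x - u\<bar> < e" for x a
 proof -
  have "(cf F a has_vector_derivative of_real (mc (G x) a)) (at x)"
   using bounded_linear.has_vector_derivative[OF bounded_linear_of_real bounded_linear.has_vector_derivative[OF bounded_linear_mc D[OF x]]] unfolding cf_def[abs_def] .
  thus ?thesis using d(3)[of x a] x e(2)[of a] by (intro vector_derivative_unique_at) auto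
 qed
 show ?g2
  unfolding hol_vec_def by (intro allI hol_ext_cong[OF d(2) e(1)]) (simp add: cf_def vd im)
qed

section \<open>The adapted frame along the two enveloping curves\<close>

lemma frame_dim:
 fixes b :: "'n::finite mink ^ 4"
 assumes "is_frame b"
 shows "independent (range (\<lambda>i. b $ i))" (is ?g1) "card (range (\<lambda>i. b $ i)) = 4" (is ?g2)
proof -
 have inj: "inj (\<lambda>i. b $ i)"
 proof (rule injI, rule ccontr)
  fix i j assume ij: "b $ i = b $ j" "i \<noteq> j"
  let ?c = "axis i 1 - axis j 1 :: real ^ 4"
  have "(\<Sum>k\<in>UNIV. ?c $ k *\<^sub>R b $ k) = b $ i - b $ j"
   by (simp add: scaleR_left_diff_distrib sum_subtractf axis_def if_distrib[of "\<lambda>x. x *\<^sub>R _"] cong: if_cong)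
  also have "\<dots> = 0" using ij by simp
  finally have "?c = 0" using assms unfolding is_frame_def by blast
  hence "?c $ i = 0" by simp
  thus False using ij(2) by (simp add: axis_def)
 qed
 thus ?g2 by (simp add: card_image)
 show ?g1
 proof (rule independent_if_scalars_zero)
  fix f v assume f: "(\<Sum>x\<in>range (\<lambda>i. b $ i). f x *\<^sub>R x) = 0" and v: "v \<in> range (\<lambda>i. b $ i)"
  have "(\<Sum>i\<in>UNIV. (\<chi> i. f (b $ i)) $ i *\<^sub>R b $ i) = 0"
   using f sum.reindex[OF inj, of "\<lambda>x. f x *\<^sub>R x"] by simp
  hence "(\<chi> i. f (b $ i)) = 0" using assms unfolding is_frame_def by blast
  thus "f v = 0" using v by (auto simp: vec_eq_iff)
 qed simp
qed

lemma span_dual_frame: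
 fixes g h :: "'n::finite mink ^ 4"
 assumes dual: "\<And>i j. lor (g $ i) (h $ j) = (if i = j then 1 else 0)" and x: "x \<in> span (range (\<lambda>i. g $ i))"
 shows "x = (\<Sum>i\<in>UNIV. lor x (h $ i) *\<^sub>R g $ i)"
 using x
proof (induction rule: span_induct_alt)
 case base show ?case by (simp add: lor_simps)
next
 case (step c y z)
 then obtain j where y: "y = g $ j" by auto
 have "(\<Sum>i\<in>UNIV. lor (c *\<^sub>R y + z) (h $ i) *\<^sub>R g $ i) = c *\<^sub>R (\<Sum>i\<in>UNIV. lor y (h $ i) *\<^sub>R g $ i) + (\<Sum>i\<in>UNIV. lor z (h $ i) *\<^sub>R g $ i)"
  by (simp add: lor_simps scaleR_add_left sum.distrib scaleR_sum_right)
 also have "(\<Sum>i\<in>UNIV. lor y (h $ i) *\<^sub>R g $ i) = y"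
  by (simp add: y dual if_distrib[of "\<lambda>x. x *\<^sub>R _"] cong: if_cong)
 finally show ?case using step by simp
qed

locale congruence_curve =
 fixes I :: "real set" and \<Phi>0 :: "real => ('n::finite mink ^ 4) set" and Y0 Yh0 :: "real => 'n mink"
 assumes I_open: "open I" and \<Phi>0_plane: "\<And>u. u \<in> I ==> oriented_lorentzian_4plane (\<Phi>0 u)"
  and \<Phi>0_analytic: "analytic_plane_curve \<Phi>0 I"
  and an: "real_analytic_on Y0 I" "real_analytic_on Yh0 I"
  and cone: "\<And>u. u \<in> I ==> in_cone (Y0 u)" "\<And>u. u \<in> I ==> in_cone (Yh0 u)"
  and prod: "\<And>u. u \<in> I ==> lor (Y0 u) (Yh0 u) = -1"
  and arclength: "\<And>u. u \<in> I ==> lor (vector_derivative Y0 (at u)) (vector_derivative Y0 (at u)) = 1"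
  and env: "\<And>u. u \<in> I ==> Y0 u \<in> plane_of (\<Phi>0 u) \<and> vector_derivative Y0 (at u) \<in> plane_of (\<Phi>0 u)"
   "\<And>u. u \<in> I ==> Yh0 u \<in> plane_of (\<Phi>0 u) \<and> vector_derivative Yh0 (at u) \<in> plane_of (\<Phi>0 u)"
begin

abbreviation D :: "(real => 'n mink) => real => 'n mink" where "D F \<equiv> \<lambda>t. vector_derivative F (at t)"

lemma hol_Y: "u \<in> I ==> hol_vec Y0 u" "u \<in> I ==> hol_vec Yh0 u"
 unfolding hol_vec_def using real_analytic_hol_ext[OF an(1) _ I_open] real_analytic_hol_ext[OF an(2) _ I_open] by auto

lemma lor_const_deriv:
 assumes t: "t \<in> I" and V: "hol_vec V t" and W: "hol_vec W t" and c: "\<And>t. t \<in> I ==> lor (V t) (W t) = c"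
 shows "lor (D V t) (W t) = - lor (V t) (D W t)"
proof -
 have "((\<lambda>t. lor (V t) (W t)) has_vector_derivative lor (V t) (D W t) + lor (D V t) (W t)) (at t)"
  by (rule bounded_bilinear.has_vector_derivative[OF bounded_bilinear_lor hol_vec_deriv(1)[OF V] hol_vec_deriv(1)[OF W]])
 moreover have "((\<lambda>t. lor (V t) (W t)) has_vector_derivative 0) (at t)"
  by (rule has_vector_derivative_transform_within_open[OF has_vector_derivative_const[of c] I_open t]) (simp add: c)
 ultimately have "lor (V t) (D W t) + lor (D V t) (W t) = 0" by (rule vector_derivative_unique_at)
 thus ?thesis by simp
qed

lemma g0: assumes t: "t \<in> I"
 shows "lor (Y0 t) (Y0 t) = 0" (is ?g1) "lor (Yh0 t) (Yh0 t) = 0" (is ?g2) "lor (Y0 t) (Yh0 t) = -1" (is ?g3) "lor (Yh0 t) (Y0 t) = -1" (is ?g4) "fst (Y0 t) > 0" "fst (Yh0 t) > 0"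
  "lor (Y0 t) (D Y0 t) = 0" (is ?g5) "lor (D Y0 t) (Y0 t) = 0" (is ?g6) "lor (Yh0 t) (D Yh0 t) = 0" (is ?g7) "lor (D Yh0 t) (Yh0 t) = 0" (is ?g8) "lor (Y0 t) (D Yh0 t) = - lor (D Y0 t) (Yh0 t)" (is ?g9)
  "lor (D Y0 t) (D Y0 t) = 1" (is ?g10)
proof -
 note c = cone[unfolded in_cone_def]
 show ?g1 ?g2 ?g3 ?g4 "fst (Y0 t) > 0" "fst (Yh0 t) > 0"
  ?g10
  using c prod arclength t by (auto simp: lor_commute[of "Yh0 t" "Y0 t"])
 show ?g5 ?g6
  using lor_const_deriv[OF t hol_Y(1)[OF t] hol_Y(1)[OF t], of 0] c by (auto simp: lor_commute)
 show ?g7 ?g8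
  using lor_const_deriv[OF t hol_Y(2)[OF t] hol_Y(2)[OF t], of 0] c by (auto simp: lor_commute)
 show ?g9
  using lor_const_deriv[OF t hol_Y(1)[OF t] hol_Y(2)[OF t], of "-1"] prod by simp
qed

text \<open>The values that Re mu and Pu are forced to have on the axis, by \<open>Re_m\<close> and
  the definition of \<open>Pu\<close>.\<close>

definition m1 :: "real => real" where "m1 t = lor (D Y0 t) (Yh0 t)"
definition P1 :: "real => 'n mink" where "P1 t = D Y0 t + m1 t *\<^sub>R Y0 t"

lemma gP1: assumes t: "t \<in> I"
 shows "lor (Y0 t) (P1 t) = 0" "lor (P1 t) (Y0 t) = 0" "lor (Yh0 t) (P1 t) = 0" "lor (P1 t) (Yh0 t) = 0" "lor (P1 t) (P1 t) = 1"
 using g0[OF t] by (simp_all add: P1_def lor_simps) (simp_all add: m1_def lor_commute)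

text \<open>x completes Y0, P1, Yh0 to a positively oriented frame of the prescribed plane; it will
  be the value of \<open>Pv\<close>.\<close>

definition adapted :: "real => 'n mink => bool" where
 "adapted t x \<longleftrightarrow> lor_frame (Y0 t) (P1 t) x (Yh0 t) \<and> fr (Y0 t) (P1 t) x (Yh0 t) \<in> \<Phi>0 t"

lemma \<Phi>0_eq: "t \<in> I ==> b \<in> \<Phi>0 t ==> is_frame b \<and> \<Phi>0 t = or_class b"
 using \<Phi>0_plane[of t] or_class_eqI by (auto simp: oriented_lorentzian_4plane_def or_class_def)

lemma adapted_unique: "t \<in> I ==> adapted t x ==> adapted t x' ==> x' = x"
 using \<Phi>0_eq[of t "fr (Y0 t) (P1 t) x (Yh0 t)"] by (auto simp: adapted_def intro: oriented_normal_unique)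

lemma adapted_frame:
 "t \<in> I ==> lor_frame (Y0 t) (P1 t) x (Yh0 t) \<longleftrightarrow> lor x (Y0 t) = 0 \<and> lor x (Yh0 t) = 0 \<and> lor x (P1 t) = 0 \<and> lor x x = 1"
 using g0[of t] gP1[of t] by (auto simp: lor_frame_def)

lemma P1_in_plane:
 assumes t: "t \<in> I" and b: "b \<in> \<Phi>0 t"
 shows "Y0 t \<in> frame_span b" (is ?g1) "Yh0 t \<in> frame_span b" (is ?g2) "P1 t \<in> frame_span b" (is ?g3) "D Yh0 t \<in> frame_span b" (is ?g4)
proof -
 have pl: "plane_of (\<Phi>0 t) = frame_span b" using \<Phi>0_eq[OF t b] plane_of_or_class by auto
 show ?g1 ?g2 ?g4 using env[OF t] pl by auto
 thus ?g3 unfolding P1_def using env[OF t] pl by (auto simp: frame_span_def intro!: span_add span_scale)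
qed

text \<open>The frame consists of four independent vectors in a span of dimension four, so it spans;
  the coefficients come from the dual frame.\<close>

lemma adapted_spans:
 assumes t: "t \<in> I" and b: "b \<in> \<Phi>0 t" and x: "lor_frame (Y0 t) (P1 t) x (Yh0 t)" "x \<in> frame_span b"
  and v: "v \<in> frame_span b"
 shows "v = (\<Sum>i\<in>UNIV. lor v (fr (- Yh0 t) (P1 t) x (- Y0 t) $ i) *\<^sub>R fr (Y0 t) (P1 t) x (Yh0 t) $ i)"
proof (rule span_dual_frame[OF lor_frame_dual[OF x(1)]])
 let ?f = "fr (Y0 t) (P1 t) x (Yh0 t)"
 have f: "is_frame ?f" by (rule is_frame_fr[OF x(1)])
 have fb: "is_frame b" using \<Phi>0_eq[OF t b] by simp
 have "\<forall>i. ?f $ i \<in> frame_span b" unfolding forall_4 using P1_in_plane[OF t b] x(2) by simp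
 hence "range (\<lambda>i. ?f $ i) \<subseteq> frame_span b" by auto
 moreover have "dim (frame_span b) \<le> card (range (\<lambda>i. ?f $ i))"
  unfolding frame_span_def using dim_eq_card_independent[OF frame_dim(1)[OF fb]] frame_dim(2)[OF fb] frame_dim(2)[OF f] by simp
 ultimately show "v \<in> span (range (\<lambda>i. ?f $ i))"
  using card_ge_dim_independent[OF _ frame_dim(1)[OF f]] v by blast
qed

text \<open>An analytic local frame of the plane is projected off Y0, Yh0 and P1. Some projected
  vector is nonzero at u because three vectors cannot span the plane; being orthogonal to both null
  vectors it has positive norm, so it can be normalized analytically, and a constant sign adjusts
  the orientation.\<close>

lemma local_adapted:
 assumes u: "u \<in> I"
 shows "\<exists>d>0. \<exists>p. hol_vec p u \<and> (\<forall>t. \<bar>t - u\<bar> < d \<longrightarrow> t \<in> I \<and> adapted t (p t))"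
proof -
 obtain e and b :: "real => 'n mink ^ 4" where eb: "e > 0" "\<And>i. real_analytic_on (\<lambda>t. b t $ i) (I \<inter> ball u e)" "\<And>t. t \<in> I \<inter> ball u e ==> b t \<in> \<Phi>0 t"
  using \<Phi>0_analytic u unfolding analytic_plane_curve_def by blast
 have oI: "open (I \<inter> ball u e)" and uI: "u \<in> I \<inter> ball u e" using I_open u eb(1) by auto
 have hb: "hol_vec (\<lambda>t. b t $ i) u" for i
  unfolding hol_vec_def using real_analytic_hol_ext[OF eb(2) uI oI] by blast
 have hm: "hol_ext (\<lambda>t. complex_of_real (m1 t)) u"
  unfolding m1_def by (intro hol_ext_lor hol_vec_deriv hol_Y u)
 have hP1: "hol_vec P1 u" unfolding P1_def[abs_def] by (intro hol_vec_add hol_vec_scaleR hm hol_vec_deriv hol_Y u)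
 define pr where "pr t v = v + lor v (Yh0 t) *\<^sub>R Y0 t + lor v (Y0 t) *\<^sub>R Yh0 t - lor v (P1 t) *\<^sub>R P1 t" for t v
 have pro: "lor (pr t v) (Y0 t) = 0" "lor (pr t v) (Yh0 t) = 0" "lor (pr t v) (P1 t) = 0" if "t \<in> I" for t v
  using g0[OF that] gP1[OF that] by (simp_all add: pr_def lor_simps)
 have prV: "pr t v \<in> frame_span (b t)" if "t \<in> I \<inter> ball u e" "v \<in> frame_span (b t)" for t v
  using P1_in_plane[OF _ eb(3)[OF that(1)]] that unfolding pr_def frame_span_def by (intro span_add span_diff span_scale) auto
 have fr: "is_frame (b t)" if "t \<in> I \<inter> ball u e" for t using \<Phi>0_eq[OF _ eb(3)[OF that]] that by simp
 \<comment> \<open>Otherwise all four independent frame vectors would lie in the span of Y0, Yh0 and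
   P1.\<close>
 have "\<exists>k. pr u (b u $ k) \<noteq> 0"
 proof (rule ccontr)
  assume "\<not> ?thesis"
  hence 0: "pr u (b u $ k) = 0" for k by simp
  have "b u $ k = - (lor (b u $ k) (Yh0 u)) *\<^sub>R Y0 u - lor (b u $ k) (Y0 u) *\<^sub>R Yh0 u + lor (b u $ k) (P1 u) *\<^sub>R P1 u" for k
   using 0[of k] by (simp add: pr_def algebra_simps)
  hence "b u $ k \<in> span {Y0 u, Yh0 u, P1 u}" for k
   by (metis insertI1 insertI2 span_add span_base span_diff span_scale)
  hence "range (\<lambda>k. b u $ k) \<subseteq> span {Y0 u, Yh0 u, P1 u}" by auto
  from independent_span_bound[OF _ frame_dim(1)[OF fr[OF uI]] this]
  have "card (range (\<lambda>k. b u $ k)) \<le> card {Y0 u, Yh0 u, P1 u}" by simp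
  thus False using frame_dim(2)[OF fr[OF uI]] by (simp add: card_insert_if split: if_splits)
 qed
 then obtain k where k: "pr u (b u $ k) \<noteq> 0" by auto
 define w where "w t = pr t (b t $ k)" for t
 have hw: "hol_vec w u" unfolding w_def pr_def by (intro hol_vec_add hol_vec_diff hol_vec_scaleR hol_ext_lor hb hP1 hol_Y u)
 have wpos: "lor (w u) (w u) > 0"
 proof -
  have "fst (Y0 u) \<noteq> 0" "lor (Y0 u) (Yh0 u) \<noteq> 0" using g0[OF u] by simp_all
  note l = lor_spacelike[OF g0(1)[OF u] this pro(1,2)[OF u], of "b u $ k"]
  show ?thesis using l k unfolding w_def by (metis order_le_less)
 qed
 have hww: "hol_ext (\<lambda>t. complex_of_real (lor (w t) (w t))) u" by (rule hol_ext_lor[OF hw hw])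
 have contr: "isCont f u" if "hol_ext (\<lambda>t. complex_of_real (f t)) u" for f
  using continuous_Re[OF hol_ext_continuous[OF that]] by simp
 have evpos: "\<exists>d>0. \<forall>t. \<bar>t - u\<bar> < d \<longrightarrow> f t > 0" if f: "isCont f u" "f u > 0" for f :: "real => real"
 proof -
  have "eventually (\<lambda>t. f t > 0) (nhds u)"
   using f order_tendstoD(1)[of f "f u" "at u" 0] by (simp add: isCont_def eventually_nhds_conv_at)
  thus ?thesis unfolding eventually_nhds_metric dist_real_def by blast
 qed
 obtain d1 where d1: "d1 > 0" "\<And>t. \<bar>t - u\<bar> < d1 ==> lor (w t) (w t) > 0"
  using evpos[OF contr[OF hww] wpos] by blast
 define q where "q t = (1 / sqrt (lor (w t) (w t))) *\<^sub>R w t" for t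
 have hq: "hol_vec q u" unfolding q_def by (intro hol_vec_scaleR hol_ext_inverse_sqrt hww hw wpos)
 define B where "B t = (\<chi> j i. lor (b t $ j) (fr (- Yh0 t) (P1 t) (q t) (- Y0 t) $ i))" for t
 obtain d2 where d2: "d2 > 0" "\<And>t. \<bar>t - u\<bar> < d2 ==> t \<in> I \<inter> ball u e"
  using oI uI by (metis (no_types, lifting) open_real_def dist_real_def open_dist)
 have qprop: "lor_frame (Y0 t) (P1 t) (q t) (Yh0 t)" (is ?h1) "q t \<in> frame_span (b t)" if t: "\<bar>t - u\<bar> < min d1 d2" for t
 proof -
  have tI: "t \<in> I \<inter> ball u e" and p: "lor (w t) (w t) > 0" using d1 d2 t by auto
  show ?h1
   using pro[of t "b t $ k"] tI p by (simp add: adapted_frame q_def w_def lor_simps)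
  show "q t \<in> frame_span (b t)"
  proof -
   have "b t $ k \<in> frame_span (b t)" by (simp add: frame_span_def span_base)
   from prV[OF tI this] show ?thesis unfolding q_def w_def frame_span_def by (rule span_scale)
  qed
 qed
 have Bf: "b t $ j = (\<Sum>i\<in>UNIV. B t $ j $ i *\<^sub>R fr (Y0 t) (P1 t) (q t) (Yh0 t) $ i)" if t: "\<bar>t - u\<bar> < min d1 d2" for t j
  unfolding B_def using adapted_spans[OF _ eb(3) qprop[OF t], of "b t $ j"] d2(2)[of t] t
  by (simp add: frame_span_def span_base)
 have Bnz: "det (B t) \<noteq> 0" if t: "\<bar>t - u\<bar> < min d1 d2" for t
 proof
  assume "det (B t) = 0"
  hence "\<not> invertible (transpose (B t))" by (simp add: invertible_det_nz)
  then obtain c where c: "transpose (B t) *v c = 0" "c \<noteq> 0"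
   unfolding invertible_def using matrix_left_invertible_ker[of "transpose (B t)"] matrix_left_right_inverse by metis
  have "(\<Sum>j\<in>UNIV. c $ j *\<^sub>R b t $ j) = (\<Sum>i\<in>UNIV. (transpose (B t) *v c) $ i *\<^sub>R fr (Y0 t) (P1 t) (q t) (Yh0 t) $ i)"
   unfolding Bf[OF t] scaleR_sum_right by (subst sum.swap) (simp add: matrix_vector_mult_def transpose_def scaleR_sum_left mult.commute)
  hence "c = 0" using c(1) fr[OF d2(2)[of t]] t by (simp add: is_frame_def)
  thus False using c(2) by simp
 qed
 have Bc: "isCont (\<lambda>t. det (B t)) u"
 proof -
  have Bij: "isCont (\<lambda>t. B t $ j $ i) u" for j i
  proof -
   have n: "hol_vec (\<lambda>t. - F t) u" if "hol_vec F u" for F :: "real => 'n mink"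
    using hol_vec_scaleR[OF hol_ext_const[of "of_real (-1)"] that] by simp
   have "\<forall>i. hol_vec (\<lambda>t. fr (- Yh0 t) (P1 t) (q t) (- Y0 t) $ i) u"
    unfolding forall_4 by (simp add: n hol_Y u hP1 hq)
   thus ?thesis unfolding B_def by (simp add: contr[OF hol_ext_lor[OF hb]])
  qed
  show ?thesis unfolding det_def by (intro continuous_sum continuous_mult continuous_const continuous_prod Bij)
 qed
 \<comment> \<open>det B is continuous at u and nonzero, so its sign near u is that at u, and
   multiplying by one constant s keeps p analytic.\<close>
 define s where "s = sgn (det (B u))"
 have s: "s * s = 1" "s * det (B u) > 0"
  using Bnz[of u] d1(1) d2(1) by (auto simp: s_def sgn_if)
 obtain d3 where d3: "d3 > 0" "\<And>t. \<bar>t - u\<bar> < d3 ==> s * det (B t) > 0"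
  using evpos[of "\<lambda>t. s * det (B t)"] s(2) continuous_mult[OF continuous_const Bc] by blast
 define p where "p t = s *\<^sub>R q t" for t
 have "hol_vec p u" unfolding p_def by (intro hol_vec_scaleR hol_ext_const hq)
 moreover have "t \<in> I \<and> adapted t (p t)" if t: "\<bar>t - u\<bar> < min (min d1 d2) d3" for t
 proof -
  have t': "\<bar>t - u\<bar> < min d1 d2" and tI: "t \<in> I" using t d2(2)[of t] by auto
  note Q = qprop[OF t']
  \<comment> \<open>The change from the frame with p to the one with q; q = s p because s^2 = 1.
    Composition with B has determinant s det B > 0.\<close>
  define E :: "real ^ 4 ^ 4" where "E = (\<chi> i j. if i = j then (if i = 3 then s else 1) else 0)"
  have "det E = (\<Prod>i\<in>UNIV. E $ i $ i)" by (rule det_diagonal) (simp add: E_def)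
  also have "\<dots> = s"  by (simp add: E_def)
  finally have dE: "det E = s" .
  have "\<forall>i. fr (Y0 t) (P1 t) (q t) (Yh0 t) $ i = (\<Sum>j\<in>UNIV. E $ i $ j *\<^sub>R fr (Y0 t) (P1 t) (p t) (Yh0 t) $ j)"
   unfolding forall_4 using s(1) by (simp add: sum_4 E_def p_def)
  hence "fr (Y0 t) (P1 t) (q t) (Yh0 t) $ i = (\<Sum>j\<in>UNIV. E $ i $ j *\<^sub>R fr (Y0 t) (P1 t) (p t) (Yh0 t) $ j)" for i by simp
  from frame_change_mult[OF this Bf[OF t']]
  have "b t $ i = (\<Sum>j\<in>UNIV. (B t ** E) $ i $ j *\<^sub>R fr (Y0 t) (P1 t) (p t) (Yh0 t) $ j)" for i .
  moreover have "det (B t ** E) > 0" using d3(2)[of t] t by (simp add: det_mul dE mult.commute)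
  ultimately have so: "same_orientation (fr (Y0 t) (P1 t) (p t) (Yh0 t)) (b t)" unfolding same_orientation_def by blast
  have "fr (Y0 t) (P1 t) (p t) (Yh0 t) \<in> \<Phi>0 t"
   using \<Phi>0_eq[OF tI eb(3)[OF d2(2)]] t same_orientation_sym[OF so] is_frame_orientation[OF _ same_orientation_sym[OF so]] by (auto simp: or_class_def)
  thus ?thesis using tI Q s(1) unfolding adapted_def by (simp add: adapted_frame p_def lor_simps flip: mult.assoc)
 qed
 ultimately show ?thesis using d1(1) d2(1) d3(1) by (intro exI[of _ "min (min d1 d2) d3"]) auto
qed

end

section \<open>Initial data on the axis and the solution they determine\<close>

lemma has_vector_derivative_cf:
 assumes "hol_vec V x"
 shows "(cf V a has_vector_derivative cf (\<lambda>t. vector_derivative V (at t)) a x) (at x)"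
 using bounded_linear.has_vector_derivative[OF bounded_linear_of_real bounded_linear.has_vector_derivative[OF bounded_linear_mc hol_vec_deriv(1)[OF assms]]]
 unfolding cf_def[abs_def] .

context congruence_curve
begin

text \<open>By \<open>adapted_unique\<close> this choice coincides with every local analytic one, so
  it is analytic and no gluing is required.\<close>

definition P2 :: "real => 'n mink" where "P2 t = (SOME x. adapted t x)"

lemma P2: assumes t: "t \<in> I" shows "adapted t (P2 t)" "hol_vec P2 t"
proof -
 obtain d p where p: "d > 0" "hol_vec p t" "\<And>s. \<bar>s - t\<bar> < d ==> s \<in> I \<and> adapted s (p s)" using local_adapted[OF t] by blast
 have e: "adapted s (P2 s) \<and> P2 s = p s" if "\<bar>s - t\<bar> < d" for s
 proof -
  have "adapted s (P2 s)" unfolding P2_def using p(3)[OF that] by (metis someI_ex)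
  thus ?thesis using adapted_unique p(3)[OF that] by blast
 qed
 show "adapted t (P2 t)" using e[of t] p(1) by auto
 show "hol_vec P2 t" by (rule hol_vec_cong[OF p(2,1)]) (use e in blast)
qed

lemma hol_m1: "t \<in> I ==> hol_ext (\<lambda>t. complex_of_real (m1 t)) t"
 unfolding m1_def by (intro hol_ext_lor hol_vec_deriv hol_Y)

lemma hol_P1: "t \<in> I ==> hol_vec P1 t"
 unfolding P1_def[abs_def] by (intro hol_vec_add hol_vec_scaleR hol_m1 hol_vec_deriv hol_Y)

text \<open>\<open>P_u\<close> read backwards: with P = (P1 - i P2) / 2 the product of P_u with cnj
  P is i m2 / 2 and that with Yh is - (r1 - i r2) / 2. \<open>K0\<close> is the equation for P_u
  solved for kappa.\<close>

definition m2 :: "real => real" where "m2 t = lor (D P1 t) (P2 t)"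
definition r1 :: "real => real" where "r1 t = lor (D Yh0 t) (P1 t)"
definition r2 :: "real => real" where "r2 t = lor (D Yh0 t) (P2 t)"
definition m0 :: "real => complex" where "m0 t = of_real (m1 t) + \<i> * of_real (m2 t)"
definition r0 :: "real => complex" where "r0 t = of_real (r1 t) + \<i> * of_real (r2 t)"
definition P0 :: "'n option => real => complex" where "P0 a t = (cf P1 a t - \<i> * cf P2 a t) / 2"
definition K0 :: "'n option => real => complex" where
 "K0 a t = (cf (D P1) a t - \<i> * cf (D P2) a t) / 2 - \<i> * of_real (m2 t) * P0 a t - cf Yh0 a t / 2 - (of_real (r1 t) - \<i> * of_real (r2 t)) / 2 * cf Y0 a t"

lemma hol_vec_cf: "hol_vec V u ==> hol_ext (cf V a) u"
 by (simp add: hol_vec_def)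

definition extends :: "(complex => 'n mink) => (complex => complex) => bool" where
 "extends y m \<longleftrightarrow> (\<forall>u\<in>I. canon_lift y (of_real u) = Y0 u \<and> dual_lift y m (of_real u) = Yh0 u \<and> conformal_gauss_map y (of_real u) = \<Phi>0 u)"

lemma gP2: assumes t: "t \<in> I"
 shows "lor (P2 t) (Y0 t) = 0" "lor (P2 t) (Yh0 t) = 0" "lor (P2 t) (P1 t) = 0" "lor (P2 t) (P2 t) = 1" "lor (Y0 t) (P2 t) = 0" "lor (Yh0 t) (P2 t) = 0" "lor (P1 t) (P2 t) = 0"
 using P2(1)[OF t] by (simp_all add: adapted_def lor_frame_def lor_commute)

lemma DY0: "D Y0 t = P1 t - m1 t *\<^sub>R Y0 t"
 by (simp add: P1_def)

text \<open>The enveloping condition on Yh0 enters here: its derivative lies in the plane, so it has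
  no normal part and its expansion in the adapted frame is complete.\<close>

lemma DYh0: assumes t: "t \<in> I" shows "D Yh0 t = m1 t *\<^sub>R Yh0 t + r1 t *\<^sub>R P1 t + r2 t *\<^sub>R P2 t"
proof -
 note a = P2(1)[OF t, unfolded adapted_def]
 have "P2 t \<in> frame_span (fr (Y0 t) (P1 t) (P2 t) (Yh0 t))"
  unfolding frame_span_def by (rule span_base) (metis (no_types) rangeI vector_4(3))
 from adapted_spans[OF t conjunct2[OF a] conjunct1[OF a] this P1_in_plane(4)[OF t conjunct2[OF a]]]
 have "D Yh0 t = - lor (D Yh0 t) (Yh0 t) *\<^sub>R Y0 t + r1 t *\<^sub>R P1 t + r2 t *\<^sub>R P2 t - lor (D Yh0 t) (Y0 t) *\<^sub>R Yh0 t"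
  by (simp add: sum_4 lor_simps r1_def r2_def)
 thus ?thesis using g0(10,11)[OF t] by (simp add: m1_def lor_commute)
qed

lemma gD: assumes t: "t \<in> I"
 shows "lor (D P1 t) (Y0 t) = -1" (is ?g1) "lor (D P1 t) (Yh0 t) = - r1 t" (is ?g2) "lor (D P1 t) (P1 t) = 0" (is ?g3) "lor (D P1 t) (P2 t) = m2 t" (is ?g4)
  "lor (D P2 t) (Y0 t) = 0" (is ?g5) "lor (D P2 t) (Yh0 t) = - r2 t" (is ?g6) "lor (D P2 t) (P1 t) = - m2 t" (is ?g7) "lor (D P2 t) (P2 t) = 0" (is ?g8)
proof -
 note h = hol_P1[OF t] P2(2)[OF t] hol_Y[OF t]
 have c: "lor (D V t) (W t) = - lor (V t) (D W t)" if "hol_vec V t" "hol_vec W t" "\<And>t. t \<in> I ==> lor (V t) (W t) = c" for V W c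
  by (rule lor_const_deriv[OF t that])
 show ?g1 using c[OF h(1,3) gP1(2)] gP1[OF t] by (simp add: DY0 lor_simps)
 show ?g2 using c[OF h(1,4) gP1(4)] by (simp add: r1_def lor_commute)
 show ?g3 using c[OF h(1,1) gP1(5)] by (simp add: lor_commute)
 show ?g4 by (simp add: m2_def)
 show ?g5 using c[OF h(2,3) gP2(1)] gP2[OF t] by (simp add: DY0 lor_simps)
 show ?g6 using c[OF h(2,4) gP2(2)] by (simp add: r2_def lor_commute)
 show ?g7 using c[OF h(2,1) gP2(3)] by (simp add: m2_def lor_commute)
 show ?g8 using c[OF h(2,2) gP2(4)] by (simp add: lor_commute)
qed

lemma ip_P0: "ip P0 f x = (ip (cf P1) f x - \<i> * ip (cf P2) f x) / 2"
 "ip (bar P0) f x = (ip (cf P1) f x + \<i> * ip (cf P2) f x) / 2"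
 by (simp_all add: ip_def bar_def P0_def cf_def sum_distrib_left sum_subtractf[symmetric] sum.distrib[symmetric] sum_divide_distrib algebra_simps)

lemma ip_P0': "ip f P0 x = (ip (cf P1) f x - \<i> * ip (cf P2) f x) / 2"
 "ip f (bar P0) x = (ip (cf P1) f x + \<i> * ip (cf P2) f x) / 2"
 by (simp_all add: ip_commute[of f] ip_P0)

lemma ip_K0: "ip K0 f x = (ip (cf (D P1)) f x - \<i> * ip (cf (D P2)) f x) / 2 - \<i> * of_real (m2 x) * ip P0 f x - ip (cf Yh0) f x / 2
  - (of_real (r1 x) - \<i> * of_real (r2 x)) / 2 * ip (cf Y0) f x"
 unfolding ip_def K0_def
 by (simp add: sum_distrib_left sum_subtractf sum.distrib sum_divide_distrib algebra_simps diff_divide_distrib)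

lemma solution_exists:
 "\<exists>S y m. complex_of_real ` I \<subseteq> S \<and> dual_surface S y m \<and> (\<forall>z\<in>S. fst (canon_lift y z) > 0 \<and> fst (dual_lift y m z) > 0) \<and> extends y m"
proof -
 have re: "Re (m0 x) = m1 x" "Im (m0 x) = m2 x" "cnj (r0 x) = of_real (r1 x) - \<i> * of_real (r2 x)" for x by (simp_all add: m0_def r0_def)
 have "\<exists>S y m. complex_of_real ` I \<subseteq> S \<and> dual_surface S y m \<and> (\<forall>z\<in>S. fst (canon_lift y z) > 0 \<and> fst (dual_lift y m z) > 0) \<and>
   (\<forall>x\<in>I. \<forall>a. cf (canon_lift y) a (of_real x) = cf Y0 a x \<and> cf (dual_lift y m) a (of_real x) = cf Yh0 a x \<and>
    swillmore_lift.P (cf (canon_lift y)) m a (of_real x) = P0 a x)"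
 proof (rule willmore_system_solvable[where ?m0.0=m0 and ?r0.0=r0 and ?K0.0=K0])
  show "open I" by (rule I_open)
  fix x a assume x: "x \<in> I"
  have hm2: "hol_ext (\<lambda>t. complex_of_real (m2 t)) x" and hr: "hol_ext (\<lambda>t. complex_of_real (r1 t)) x" "hol_ext (\<lambda>t. complex_of_real (r2 t)) x"
   unfolding m2_def r1_def r2_def by (intro hol_ext_lor hol_vec_deriv hol_Y hol_P1 P2 x)+
  note hI = hol_ext_add hol_ext_diff hol_ext_mult hol_ext_divide_const hol_ext_const hol_vec_cf hol_vec_deriv hol_Y hol_P1 P2 x hol_m1 hm2 hr
  have hP0: "hol_ext (P0 a) x" unfolding P0_def[abs_def] by (intro hI)
  have "hol_ext (K0 a) x" unfolding K0_def[abs_def] by (intro hI hP0)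
  thus "hol_ext (cf Y0 a) x \<and> hol_ext (cf Yh0 a) x \<and> hol_ext (P0 a) x \<and> hol_ext (K0 a) x" using hP0 by (simp add: hol_vec_cf hol_Y x)
  show "hol_ext m0 x \<and> hol_ext r0 x" unfolding m0_def[abs_def] r0_def[abs_def] by (intro conjI hI)
  show "cnj (cf Y0 a x) = cf Y0 a x" "cnj (cf Yh0 a x) = cf Yh0 a x" by (simp_all add: cf_def)
  show "Re (cf Y0 None x) > 0" "Re (cf Yh0 None x) > 0" using g0(5,6)[OF x] by (simp_all add: cf_def mc_def)
  show "(cf Y0 a has_vector_derivative P0 a x + cnj (P0 a x) - of_real (Re (m0 x)) * cf Y0 a x) (at x)"
  proof -
   have "cf (D Y0) a x = P0 a x + cnj (P0 a x) - of_real (Re (m0 x)) * cf Y0 a x"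
    unfolding re by (simp add: DY0 P0_def) (simp add: cf_def complex_eq_iff)
   thus ?thesis using has_vector_derivative_cf[OF hol_Y(1)[OF x], of a] by simp
  qed
  show "(cf Yh0 a has_vector_derivative of_real (Re (m0 x)) * cf Yh0 a x + r0 x * P0 a x + cnj (r0 x * P0 a x)) (at x)"
  proof -
   have "cf (D Yh0) a x = of_real (Re (m0 x)) * cf Yh0 a x + r0 x * P0 a x + cnj (r0 x * P0 a x)"
    unfolding re r0_def cf_def[of "D Yh0"] DYh0[OF x] P0_def by (simp add: cf_def field_simps)
   thus ?thesis using has_vector_derivative_cf[OF hol_Y(2)[OF x], of a] by simp
  qed
  show "(P0 a has_vector_derivative \<i> * of_real (Im (m0 x)) * P0 a x + K0 a x + cf Yh0 a x / 2 + cnj (r0 x) / 2 * cf Y0 a x) (at x)"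
  proof -
   have "((\<lambda>t. (cf P1 a t - \<i> * cf P2 a t) / 2) has_vector_derivative (cf (D P1) a x - \<i> * cf (D P2) a x) / 2) (at x)"
    by (intro has_vector_derivative_divide has_vector_derivative_diff has_vector_derivative_mult_right has_vector_derivative_cf hol_P1 P2 x)
   moreover have "\<i> * of_real (Im (m0 x)) * P0 a x + K0 a x + cf Yh0 a x / 2 + cnj (r0 x) / 2 * cf Y0 a x = (cf (D P1) a x - \<i> * cf (D P2) a x) / 2"
    unfolding re K0_def by simp
   ultimately show ?thesis by (simp only: P0_def[abs_def])
  qed
  note gs = g0(1-4)[OF x] gP1[OF x] gP2[OF x] gD[OF x]
  show "gram_rel (cf Y0) (cf Yh0) P0 K0 x"
   unfolding gram_rel_def ip_K0 by (simp add: ip_P0 ip_P0' of_real_lor[symmetric] gs lor_commute[of "P1 x" "D _ x"] lor_commute[of "P2 x" "D _ x"] field_simps)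
 qed
 then obtain S y m where s: "complex_of_real ` I \<subseteq> S" "dual_surface S y m" "\<forall>z\<in>S. fst (canon_lift y z) > 0 \<and> fst (dual_lift y m z) > 0"
   "\<And>x a. x \<in> I ==> cf (canon_lift y) a (of_real x) = cf Y0 a x \<and> cf (dual_lift y m) a (of_real x) = cf Yh0 a x \<and>
    swillmore_lift.P (cf (canon_lift y)) m a (of_real x) = P0 a x" by auto
 interpret ds: dual_surface S y m by (rule s(2))
 have "canon_lift y (of_real u) = Y0 u \<and> dual_lift y m (of_real u) = Yh0 u \<and> conformal_gauss_map y (of_real u) = \<Phi>0 u" if u: "u \<in> I" for u
 proof -
  have uS: "of_real u \<in> S" using s(1) u by auto
  have L: "canon_lift y (of_real u) = Y0 u" "dual_lift y m (of_real u) = Yh0 u"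
   by (rule mink_eqI; use s(4)[OF u] in \<open>simp add: cf_def\<close>)+
  have "cf ds.Pu a (of_real u) = cf P1 a u" "cf ds.Pv a (of_real u) = cf P2 a u" for a
   using s(4)[OF u, of a] by (simp_all add: ds.cf_Pu[OF uS] ds.cf_Pv[OF uS] P0_def) (simp_all add: cf_def complex_eq_iff)
  hence "ds.Pu (of_real u) = P1 u" "ds.Pv (of_real u) = P2 u" by (auto intro!: mink_eqI simp: cf_def)
  hence "conformal_gauss_map y (of_real u) = or_class (fr (Y0 u) (P1 u) (P2 u) (Yh0 u))"
   unfolding ds.gauss_map_eq L by simp
  also have "\<dots> = \<Phi>0 u" using \<Phi>0_eq[OF u] P2(1)[OF u] by (auto simp: adapted_def)
  finally show ?thesis using L by simp
 qed
 thus ?thesis using s(1-3) unfolding extends_def by blast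
qed

text \<open>The lifts in the theorem are arbitrary, but on the axis they are canonical. Y0 is a
  positive multiple of y, and a unit tangent vector fixes the factor as that of the canonical lift;
  then the product -1 fixes the scale of the dual lift.\<close>

lemma solution_normalized:
 assumes IS: "complex_of_real ` I \<subseteq> S" and pair: "dual_s_willmore_pair S y yh"
  and lift: "is_lift S y Y" "is_lift S yh Yh" "\<forall>u\<in>I. Y (of_real u) = Y0 u \<and> Yh (of_real u) = Yh0 u"
  and gm: "\<forall>u\<in>I. conformal_gauss_map y (of_real u) = \<Phi>0 u"
 shows "\<exists>m. dual_surface S y m \<and> (\<forall>z\<in>S. yh z = (1 / fst (dual_lift y m z)) *\<^sub>R dual_lift y m z) \<and> extends y m"
proof -
 obtain m where m: "s_willmore_with S y m" "\<And>z. z \<in> S ==> yh z = (1 / fst (dual_lift y m z)) *\<^sub>R dual_lift y m z"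
  using pair by (auto simp: dual_s_willmore_pair_def)
 interpret ds: dual_surface S y m
  using m(1) by unfold_locales (auto simp: s_willmore_with_def willmore_def)
 have uS: "complex_of_real u \<in> S" if "u \<in> I" for u using that IS by auto
 have Yy: "Y0 u = fst (Y0 u) *\<^sub>R y (of_real u)" if u: "u \<in> I" for u
  using lift(1,3) u uS[OF u] unfolding is_lift_def by metis
 have L: "canon_lift y (of_real u) = Y0 u" if u: "u \<in> I" for u
 proof -
  have d: "((\<lambda>t. fst (Y0 t)) has_real_derivative fst (D Y0 u)) (at u)"
   using bounded_linear.has_vector_derivative[OF bounded_linear_fst hol_vec_deriv(1)[OF hol_Y(1)[OF u]]]
   by (simp add: has_real_derivative_iff_has_vector_derivative)
  have "((\<lambda>t. fst (Y0 t) *\<^sub>R y (of_real t)) has_vector_derivative fst (Y0 u) *\<^sub>R pd y 1 (of_real u) + fst (D Y0 u) *\<^sub>R y (of_real u)) (at u)"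
   by (rule has_vector_derivative_scaleR[OF d has_vector_derivative_of_real[OF ds.Sy(1) uS[OF u] ds.Sy(2)]])
  hence "(Y0 has_vector_derivative fst (Y0 u) *\<^sub>R pd y 1 (of_real u) + fst (D Y0 u) *\<^sub>R y (of_real u)) (at u)"
   by (rule has_vector_derivative_transform_within_open[OF _ I_open u]) (use Yy in metis)
  hence D: "D Y0 u = fst (Y0 u) *\<^sub>R pd y 1 (of_real u) + fst (D Y0 u) *\<^sub>R y (of_real u)" by (rule vector_derivative_at)
  have "1 = lor (fst (Y0 u) *\<^sub>R pd y 1 (of_real u) + fst (D Y0 u) *\<^sub>R y (of_real u)) (fst (Y0 u) *\<^sub>R pd y 1 (of_real u) + fst (D Y0 u) *\<^sub>R y (of_real u))"
   using g0(12)[OF u] unfolding D[symmetric] by simp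
  also have "\<dots> = (fst (Y0 u))^2 * ds.lam (of_real u)"
   using ds.yyv[OF uS[OF u], of 1] ds.Sy(4)[OF uS[OF u]]
   by (simp add: lor_simps lor_commute[of "pd y 1 _" "y _"] ds.lam_def power2_eq_square)
  finally have e: "(fst (Y0 u))^2 * ds.lam (of_real u) = 1" by simp
  have "(ds.sig (of_real u))^2 * ds.lam (of_real u) = 1" using ds.sig(2)[OF uS[OF u]] by (simp add: power2_eq_square)
  hence "(ds.sig (of_real u))^2 = (fst (Y0 u))^2" using e ds.Sy(7)[OF uS[OF u]] by (metis less_irrefl mult_right_cancel)
  hence "ds.sig (of_real u) = fst (Y0 u)" using ds.sig(1)[OF uS[OF u]] g0(5)[OF u] by (metis less_imp_le power2_eq_imp_eq)
  thus ?thesis using Yy[OF u] by (simp add: ds.L_eq)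
 qed
 have "dual_lift y m (of_real u) = Yh0 u" if u: "u \<in> I" for u
 proof -
  let ?d = "dual_lift y m (of_real u)"
  have "Yh0 u = fst (Yh0 u) *\<^sub>R yh (of_real u)" using lift(2,3) u uS[OF u] unfolding is_lift_def by metis
  also have "yh (of_real u) = (1 / fst ?d) *\<^sub>R ?d" by (rule m(2)[OF uS[OF u]])
  finally have Yh: "Yh0 u = (fst (Yh0 u) / fst ?d) *\<^sub>R ?d" by simp
  have "-1 = (fst (Yh0 u) / fst ?d) * lor (Y0 u) ?d" using g0(3)[OF u] by (subst (asm) Yh) (simp add: lor_simps)
  also have "lor (Y0 u) ?d = -1" using ds.dual_frame[OF uS[OF u]] by (simp add: lor_frame_def L[OF u])
  finally have "fst (Yh0 u) / fst ?d = 1" by simp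
  thus ?thesis using Yh by simp
 qed
 thus ?thesis using ds.dual_surface_axioms m(2) L gm unfolding extends_def by blast
qed

text \<open>Nonconstancy of the congruence gives kappa \<noteq> 0 somewhere, hence theta = 0 for
  both surfaces, which is the hypothesis under which the states satisfy the closed system.\<close>

lemma solutions_agree:
 assumes int: "is_interval I" and nonconst: "u1 \<in> I" "u2 \<in> I" "\<Phi>0 u1 \<noteq> \<Phi>0 u2"
  and ds: "dual_surface S1 y1 m1'" "dual_surface S2 y2 m2'" and IS: "complex_of_real ` I \<subseteq> S1" "complex_of_real ` I \<subseteq> S2"
  and ini: "extends y1 m1'" "extends y2 m2'"
 shows "\<exists>U. open U \<and> complex_of_real ` I \<subseteq> U \<and> U \<subseteq> S1 \<inter> S2 \<and>
  (\<forall>z\<in>U. canon_lift y1 z = canon_lift y2 z \<and> dual_lift y1 m1' z = dual_lift y2 m2' z)"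
proof -
 interpret A: dual_surface S1 y1 m1' by fact
 interpret B: dual_surface S2 y2 m2' by fact
 \<comment> \<open>Restricting to real parts in I keeps other real points of the common domain out,
   where the surfaces carry no prescribed data.\<close>
 define T where "T = S1 \<inter> S2 \<inter> Re -` I"
 have oT: "open T" unfolding T_def using A.Sy(1) B.Sy(1) I_open by (intro open_Int open_vimage continuous_intros) auto
 have IT: "complex_of_real ` I \<subseteq> T" using IS by (auto simp: T_def)
 \<comment> \<open>Unique continuation needs a connected domain; I is connected, so one component
   contains all of it.\<close>
 define U where "U = connected_component_set T (of_real u1)"
 have U: "open U" "connected U" "U \<subseteq> T" unfolding U_def using oT by (auto simp: open_connected_component connected_component_subset)
 have "connected (complex_of_real ` I)"
  by (intro connected_continuous_image continuous_intros is_interval_connected int)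
 hence IU: "complex_of_real ` I \<subseteq> U"
  unfolding U_def using nonconst(1) IT by (intro connected_component_maximal) auto
 have US: "U \<subseteq> S1" "U \<subseteq> S2" using U(3) by (auto simp: T_def)
 have realU: "x \<in> I" if "complex_of_real x \<in> U" for x using that U(3) by (auto simp: T_def)
 have th: "swillmore_lift.th (cf (canon_lift y)) m z = 0"
  if d: "dual_surface S y m" and S: "U \<subseteq> S" and gm: "extends y m" and z: "z \<in> U" for S y m z
 proof -
  interpret dual_surface S y m by (rule d)
  have "\<exists>z0\<in>U. \<exists>a. lift.K a z0 \<noteq> 0"
  proof (rule ccontr)
   assume "\<not> ?thesis"
   hence "conformal_gauss_map y (of_real u1) = conformal_gauss_map y (of_real u2)"
    by (intro gauss_map_constant[OF U(1,2) S _ int IU nonconst(1,2)]) blast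
   thus False using gm nonconst by (simp add: extends_def)
  qed
  thus ?thesis using th_eq_0[OF U(1,2) S _ _ z] by blast
 qed
 have "canon_lift y1 z = canon_lift y2 z \<and> dual_lift y1 m1' z = dual_lift y2 m2' z" if z: "z \<in> U" for z
 proof -
  have u1U: "complex_of_real u1 \<in> U" using nonconst(1) IU by blast
  have e: "canon_lift y1 (of_real x) = canon_lift y2 (of_real x)" "dual_lift y1 m1' (of_real x) = dual_lift y2 m2' (of_real x)"
   "conformal_gauss_map y1 (of_real x) = conformal_gauss_map y2 (of_real x)" if "complex_of_real x \<in> U" for x
   using ini realU[OF that] by (auto simp: extends_def)
  have t: "swillmore_lift.th (cf (canon_lift y1)) m1' w = 0" "swillmore_lift.th (cf (canon_lift y2)) m2' w = 0" if "w \<in> U" for w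
   using th[OF ds(1) US(1) ini(1) that] th[OF ds(2) US(2) ini(2) that] by auto
  show ?thesis
   using dual_surfaces_agree[OF ds U(1,2) US u1U e t z] by simp
 qed
 thus ?thesis using U(1) IU US by blast
qed

end

theorem mainTheorem14:
  fixes I :: "real set"
    and \<Phi>0 :: "real \<Rightarrow> ('n::finite mink ^ 4) set"
    and Y0 Yh0 :: "real \<Rightarrow> 'n mink"
  assumes I_open: "open I" and I_int: "is_interval I" and I_ne: "I \<noteq> {}"
    and \<Phi>0_plane: "\<forall>u\<in>I. oriented_lorentzian_4plane (\<Phi>0 u)"
    and \<Phi>0_analytic: "analytic_plane_curve \<Phi>0 I"
    and \<Phi>0_nonconst: "\<exists>u1\<in>I. \<exists>u2\<in>I. \<Phi>0 u1 \<noteq> \<Phi>0 u2"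
    and Y0_an: "real_analytic_on Y0 I" and Yh0_an: "real_analytic_on Yh0 I"
    and Y0_cone: "\<forall>u\<in>I. in_cone (Y0 u)" and Yh0_cone: "\<forall>u\<in>I. in_cone (Yh0 u)"
    and prod: "\<forall>u\<in>I. lor (Y0 u) (Yh0 u) = -1"
    and arclength: "\<forall>u\<in>I. lor (vector_derivative Y0 (at u)) (vector_derivative Y0 (at u)) = 1"
    and env_Y0: "\<forall>u\<in>I. Y0 u \<in> plane_of (\<Phi>0 u) \<and> vector_derivative Y0 (at u) \<in> plane_of (\<Phi>0 u)"
    and env_Yh0: "\<forall>u\<in>I. Yh0 u \<in> plane_of (\<Phi>0 u) \<and> vector_derivative Yh0 (at u) \<in> plane_of (\<Phi>0 u)"
  shows "(\<exists>\<Sigma> y yh. open \<Sigma> \<and> complex_of_real ` I \<subseteq> \<Sigma> \<and> dual_s_willmore_pair \<Sigma> y yh \<and>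
            (\<exists>Y Yh. is_lift \<Sigma> y Y \<and> is_lift \<Sigma> yh Yh \<and>
                    (\<forall>u\<in>I. Y (complex_of_real u) = Y0 u \<and> Yh (complex_of_real u) = Yh0 u)) \<and>
            (\<forall>u\<in>I. conformal_gauss_map y (complex_of_real u) = \<Phi>0 u))
       \<and> (\<forall>\<Sigma>1 y1 yh1 \<Sigma>2 y2 yh2.
            (open \<Sigma>1 \<and> complex_of_real ` I \<subseteq> \<Sigma>1 \<and> dual_s_willmore_pair \<Sigma>1 y1 yh1 \<and>
             (\<exists>Y Yh. is_lift \<Sigma>1 y1 Y \<and> is_lift \<Sigma>1 yh1 Yh \<and>
                    (\<forall>u\<in>I. Y (complex_of_real u) = Y0 u \<and> Yh (complex_of_real u) = Yh0 u)) \<and>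
             (\<forall>u\<in>I. conformal_gauss_map y1 (complex_of_real u) = \<Phi>0 u)) \<and>
            (open \<Sigma>2 \<and> complex_of_real ` I \<subseteq> \<Sigma>2 \<and> dual_s_willmore_pair \<Sigma>2 y2 yh2 \<and>
             (\<exists>Y Yh. is_lift \<Sigma>2 y2 Y \<and> is_lift \<Sigma>2 yh2 Yh \<and>
                    (\<forall>u\<in>I. Y (complex_of_real u) = Y0 u \<and> Yh (complex_of_real u) = Yh0 u)) \<and>
             (\<forall>u\<in>I. conformal_gauss_map y2 (complex_of_real u) = \<Phi>0 u))
            \<longrightarrow> (\<exists>U. open U \<and> complex_of_real ` I \<subseteq> U \<and> U \<subseteq> \<Sigma>1 \<inter> \<Sigma>2 \<and>
                      (\<forall>z\<in>U. y1 z = y2 z \<and> yh1 z = yh2 z)))"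
proof -
 interpret congruence_curve I \<Phi>0 Y0 Yh0
  by unfold_locales (use assms in \<open>simp_all\<close>)
 define sol where "sol \<Sigma> y yh \<longleftrightarrow> open \<Sigma> \<and> complex_of_real ` I \<subseteq> \<Sigma> \<and> dual_s_willmore_pair \<Sigma> y yh \<and>
   (\<exists>Y Yh. is_lift \<Sigma> y Y \<and> is_lift \<Sigma> yh Yh \<and> (\<forall>u\<in>I. Y (complex_of_real u) = Y0 u \<and> Yh (complex_of_real u) = Yh0 u)) \<and>
   (\<forall>u\<in>I. conformal_gauss_map y (complex_of_real u) = \<Phi>0 u)" for \<Sigma> and y yh :: "complex => 'n mink"
 have existence: "\<exists>\<Sigma> y yh. sol \<Sigma> y yh"
 proof -
  obtain S y m where s: "complex_of_real ` I \<subseteq> S" "dual_surface S y m" "\<forall>z\<in>S. fst (canon_lift y z) > 0 \<and> fst (dual_lift y m z) > 0"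
   "extends y m"
   using solution_exists by blast
  interpret ds: dual_surface S y m by (rule s(2))
  define yh where "yh z = (1 / fst (dual_lift y m z)) *\<^sub>R dual_lift y m z" for z
  have "dual_s_willmore_pair S y yh" unfolding dual_s_willmore_pair_def using ds.sws by (auto simp: yh_def)
  moreover have "is_lift S y (canon_lift y)"
   using s(3) ds.Sy(3) by (simp add: is_lift_def ds.L_eq)
  moreover have "is_lift S yh (dual_lift y m)"
   using s(3) by (auto simp: is_lift_def yh_def)
  ultimately show ?thesis using ds.Sy(1) s(1,4) unfolding sol_def extends_def by blast
 qed
 have uniqueness: "\<exists>U. open U \<and> complex_of_real ` I \<subseteq> U \<and> U \<subseteq> \<Sigma>1 \<inter> \<Sigma>2 \<and> (\<forall>z\<in>U. y1 z = y2 z \<and> yh1 z = yh2 z)"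
  if "sol \<Sigma>1 y1 yh1" "sol \<Sigma>2 y2 yh2" for \<Sigma>1 y1 yh1 \<Sigma>2 y2 yh2
 proof -
  have m: "\<exists>m. dual_surface \<Sigma> y m \<and> (\<forall>z\<in>\<Sigma>. yh z = (1 / fst (dual_lift y m z)) *\<^sub>R dual_lift y m z) \<and> extends y m" if "sol \<Sigma> y yh" for \<Sigma> y yh
   using that unfolding sol_def by (elim conjE exE) (rule solution_normalized)
  from m[OF that(1)] obtain m1 where m1: "dual_surface \<Sigma>1 y1 m1" "\<forall>z\<in>\<Sigma>1. yh1 z = (1 / fst (dual_lift y1 m1 z)) *\<^sub>R dual_lift y1 m1 z" "extends y1 m1"
   by blast
  from m[OF that(2)] obtain m2 where m2: "dual_surface \<Sigma>2 y2 m2" "\<forall>z\<in>\<Sigma>2. yh2 z = (1 / fst (dual_lift y2 m2 z)) *\<^sub>R dual_lift y2 m2 z" "extends y2 m2"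
   by blast
  interpret A: dual_surface \<Sigma>1 y1 m1 by (rule m1(1))
  interpret B: dual_surface \<Sigma>2 y2 m2 by (rule m2(1))
  obtain u1 u2 where u: "u1 \<in> I" "u2 \<in> I" "\<Phi>0 u1 \<noteq> \<Phi>0 u2" using \<Phi>0_nonconst by blast
  have "\<exists>U. open U \<and> complex_of_real ` I \<subseteq> U \<and> U \<subseteq> \<Sigma>1 \<inter> \<Sigma>2 \<and>
    (\<forall>z\<in>U. canon_lift y1 z = canon_lift y2 z \<and> dual_lift y1 m1 z = dual_lift y2 m2 z)"
   by (rule solutions_agree[OF I_int u m1(1) m2(1) _ _ m1(3) m2(3)]) (use that in \<open>simp_all add: sol_def\<close>)
  then obtain U where U: "open U" "complex_of_real ` I \<subseteq> U" "U \<subseteq> \<Sigma>1 \<inter> \<Sigma>2"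
   "\<And>z. z \<in> U ==> canon_lift y1 z = canon_lift y2 z" "\<And>z. z \<in> U ==> dual_lift y1 m1 z = dual_lift y2 m2 z" by blast
  have "y1 z = y2 z \<and> yh1 z = yh2 z" if z: "z \<in> U" for z
  proof -
   have S: "z \<in> \<Sigma>1" "z \<in> \<Sigma>2" using z U(3) by auto
   \<comment> \<open>The points have first coordinate 1, so equality of the canonical lifts gives
     equality of the scales and then of the points.\<close>
   have "A.sig z *\<^sub>R y1 z = B.sig z *\<^sub>R y2 z" using U(4)[OF z] by (simp add: A.L_eq B.L_eq)
   moreover from this have "A.sig z = B.sig z" using A.Sy(3)[OF S(1)] B.Sy(3)[OF S(2)] by (metis fst_scaleR mult.right_neutral real_scaleR_def)
   ultimately have "y1 z = y2 z" using A.sig(1)[OF S(1)] by simp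
   thus ?thesis using m1(2) m2(2) S U(5)[OF z] by simp
  qed
  thus ?thesis using U(1-3) by blast
 qed
 show ?thesis unfolding sol_def[symmetric] by (rule conjI[OF existence], intro allI impI, erule conjE, rule uniqueness)
qed

end
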